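(* A big tt-category $\mathscr{F}$ is a tt-field if and only if $\mathscr{F}\neq0$ and the internal hom functor $\mathsf{hom}(-,X)\colon\mathscr{F}^{\mathrm{op}}\to\mathscr{F}$ is faithful for every non-zero object $X\in\mathscr{F}$.
   Context: A big tt-category is a rigidly-compactly generated tensor-triangulated category $\mathscr{F}$: a triangulated category with all small coproducts and a closed symmetric monoidal structure $\otimes$ (unit $1$, internal hom $\mathsf{hom}$), exact and coproduct-preserving in each variable of $\otimes$, such that the compact objects and the rigid (i.e. strongly dualizable) objects coincide, and the full subcategory $\mathscr{F}^c$ of compact-rigid objects is essentially small and generates $\mathscr{F}$ as a localizing subcategory. A tt-field is a non-zero big tt-category $\mathscr{F}$ such that every object of $\mathscr{F}$ is a coproduct of compact-rigid objects of $\mathscr{F}^c$ and every non-zero object $X$ of $\mathscr{F}$ is $\otimes$-faithful, meaning that $X\otimes-\colon\mathscr{F}\to\mathscr{F}$ is faithful. *)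

theory Defs
  imports "HOL-Algebra.Free_Abelian_Groups" "HOL-Library.Equipollence"
begin

section \<open>Universes and smallness\<close>

text \<open>
  A set is small if its cardinality is below that of a fixed universe \<open>U\<close>, which has
  strongly inaccessible cardinality. This plays the role of the set/class distinction;
  families are indexed by small subsets of the type of \<open>U\<close>, which loses nothing because
  every small set is equipollent to one of these.
\<close>

definition small :: "'u set \<Rightarrow> 'a set \<Rightarrow> bool" where
  "small U A \<longleftrightarrow> A \<prec> U"

definition universe :: "'u set \<Rightarrow> bool" where
  "universe U \<longleftrightarrow>
     small U (UNIV :: nat set) \<and>
     (\<forall>A :: 'u set. small U A \<longrightarrow> small U (Pow A)) \<and>
     (\<forall>(A :: 'u set) (B :: 'u \<Rightarrow> 'u set).
        small U A \<longrightarrow> (\<forall>a\<in>A. small U (B a)) \<longrightarrow> small U (\<Union>a\<in>A. B a))"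


section \<open>Categories\<close>

record ('o, 'm) category_data =
  Obj :: "'o set"
  Arr :: "'m set"
  Dom :: "'m \<Rightarrow> 'o"
  Cod :: "'m \<Rightarrow> 'o"
  Id :: "'o \<Rightarrow> 'm"
  Comp :: "'m \<Rightarrow> 'm \<Rightarrow> 'm"  (infixl \<open>\<cdot>\<index>\<close> 65)

definition Hom :: "('o, 'm, 'x) category_data_scheme \<Rightarrow> 'o \<Rightarrow> 'o \<Rightarrow> 'm set" where
  "Hom C A B = {f \<in> Arr C. Dom C f = A \<and> Cod C f = B}"

locale category =
  fixes C :: "('o, 'm, 'x) category_data_scheme" (structure)
  assumes Dom_in_Obj: "f \<in> Arr C \<Longrightarrow> Dom C f \<in> Obj C"
    and Cod_in_Obj: "f \<in> Arr C \<Longrightarrow> Cod C f \<in> Obj C"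
    and Id_in_Hom: "A \<in> Obj C \<Longrightarrow> Id C A \<in> Hom C A A"
    and Comp_in_Hom: "\<lbrakk>f \<in> Hom C A B; g \<in> Hom C B D\<rbrakk> \<Longrightarrow> g \<cdot> f \<in> Hom C A D"
    and Comp_Id: "f \<in> Hom C A B \<Longrightarrow> f \<cdot> Id C A = f"
    and Id_Comp: "f \<in> Hom C A B \<Longrightarrow> Id C B \<cdot> f = f"
    and Comp_assoc: "\<lbrakk>f \<in> Hom C A B; g \<in> Hom C B D; h \<in> Hom C D E\<rbrakk>
                      \<Longrightarrow> (h \<cdot> g) \<cdot> f = h \<cdot> (g \<cdot> f)"

definition locally_small :: "'u set \<Rightarrow> ('o, 'm, 'x) category_data_scheme \<Rightarrow> bool" where
  "locally_small U C \<longleftrightarrow> (\<forall>A\<in>Obj C. \<forall>B\<in>Obj C. small U (Hom C A B))"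

definition opposite :: "('o, 'm, 'x) category_data_scheme \<Rightarrow> ('o, 'm) category_data" where
  "opposite C = \<lparr>Obj = Obj C, Arr = Arr C, Dom = Cod C, Cod = Dom C, Id = Id C,
                 Comp = (\<lambda>g f. f \<cdot>\<^bsub>C\<^esub> g)\<rparr>"

definition isomorphism ::
    "('o, 'm, 'x) category_data_scheme \<Rightarrow> 'o \<Rightarrow> 'o \<Rightarrow> 'm \<Rightarrow> bool" where
  "isomorphism C A B f \<longleftrightarrow>
     f \<in> Hom C A B \<and> (\<exists>g\<in>Hom C B A. g \<cdot>\<^bsub>C\<^esub> f = Id C A \<and> f \<cdot>\<^bsub>C\<^esub> g = Id C B)"

definition inverse_arr :: "('o, 'm, 'x) category_data_scheme \<Rightarrow> 'm \<Rightarrow> 'm" where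
  "inverse_arr C f = (THE g. g \<in> Hom C (Cod C f) (Dom C f) \<and>
                        g \<cdot>\<^bsub>C\<^esub> f = Id C (Dom C f) \<and> f \<cdot>\<^bsub>C\<^esub> g = Id C (Cod C f))"

definition isomorphic :: "('o, 'm, 'x) category_data_scheme \<Rightarrow> 'o \<Rightarrow> 'o \<Rightarrow> bool" where
  "isomorphic C A B \<longleftrightarrow> (\<exists>f. isomorphism C A B f)"

definition zero_object :: "('o, 'm, 'x) category_data_scheme \<Rightarrow> 'o \<Rightarrow> bool" where
  "zero_object C Z \<longleftrightarrow>
     Z \<in> Obj C \<and> (\<forall>A\<in>Obj C. (\<exists>!f. f \<in> Hom C A Z) \<and> (\<exists>!f. f \<in> Hom C Z A))"

definition is_coproduct ::
    "('o, 'm, 'x) category_data_scheme \<Rightarrow> 'i set \<Rightarrow> ('i \<Rightarrow> 'o) \<Rightarrow> 'o \<Rightarrow> ('i \<Rightarrow> 'm) \<Rightarrow> bool" where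
  "is_coproduct C I X Y \<iota> \<longleftrightarrow>
     Y \<in> Obj C \<and> (\<forall>i\<in>I. X i \<in> Obj C \<and> \<iota> i \<in> Hom C (X i) Y) \<and>
     (\<forall>A\<in>Obj C. \<forall>f. (\<forall>i\<in>I. f i \<in> Hom C (X i) A) \<longrightarrow>
        (\<exists>!h. h \<in> Hom C Y A \<and> (\<forall>i\<in>I. h \<cdot>\<^bsub>C\<^esub> \<iota> i = f i)))"

definition has_small_coproducts :: "'u set \<Rightarrow> ('o, 'm, 'x) category_data_scheme \<Rightarrow> bool" where
  "has_small_coproducts U C \<longleftrightarrow>
     (\<forall>(I :: 'u set) X. small U I \<longrightarrow> (\<forall>i\<in>I. X i \<in> Obj C) \<longrightarrow> (\<exists>Y \<iota>. is_coproduct C I X Y \<iota>))"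

text \<open>The full subcategory on the objects \<open>S\<close> of a locally small category is essentially small.\<close>

definition essentially_small ::
    "'u set \<Rightarrow> ('o, 'm, 'x) category_data_scheme \<Rightarrow> 'o set \<Rightarrow> bool" where
  "essentially_small U C S \<longleftrightarrow> (\<exists>T\<subseteq>S. small U T \<and> (\<forall>X\<in>S. \<exists>Y\<in>T. isomorphic C X Y))"


section \<open>Functors\<close>

text \<open>A functor is given by its object part \<open>G\<close> and its arrow part \<open>Gm\<close>.\<close>

locale category_functor =
  source: category C + target: category D
  for C :: "('o, 'm, 'x) category_data_scheme"
    and D :: "('p, 'n, 'y) category_data_scheme"
    and G :: "'o \<Rightarrow> 'p" and Gm :: "'m \<Rightarrow> 'n" +
  assumes G_Obj: "A \<in> Obj C \<Longrightarrow> G A \<in> Obj D"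
    and Gm_Hom: "f \<in> Hom C A B \<Longrightarrow> Gm f \<in> Hom D (G A) (G B)"
    and Gm_Id: "A \<in> Obj C \<Longrightarrow> Gm (Id C A) = Id D (G A)"
    and Gm_Comp: "\<lbrakk>f \<in> Hom C A B; g \<in> Hom C B E\<rbrakk>
                    \<Longrightarrow> Gm (g \<cdot>\<^bsub>C\<^esub> f) = Gm g \<cdot>\<^bsub>D\<^esub> Gm f"

definition faithful ::
    "('o, 'm, 'x) category_data_scheme \<Rightarrow> ('p, 'n, 'y) category_data_scheme \<Rightarrow>
     ('o \<Rightarrow> 'p) \<Rightarrow> ('m \<Rightarrow> 'n) \<Rightarrow> bool" where
  "faithful C D G Gm \<longleftrightarrow>
     category_functor C D G Gm \<and> (\<forall>A\<in>Obj C. \<forall>B\<in>Obj C. inj_on Gm (Hom C A B))"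

definition equivalence_functor ::
    "('o, 'm, 'x) category_data_scheme \<Rightarrow> ('p, 'n, 'y) category_data_scheme \<Rightarrow>
     ('o \<Rightarrow> 'p) \<Rightarrow> ('m \<Rightarrow> 'n) \<Rightarrow> bool" where
  "equivalence_functor C D G Gm \<longleftrightarrow>
     category_functor C D G Gm \<and>
     (\<forall>A\<in>Obj C. \<forall>B\<in>Obj C. bij_betw Gm (Hom C A B) (Hom D (G A) (G B))) \<and>
     (\<forall>Y\<in>Obj D. \<exists>A\<in>Obj C. isomorphic D (G A) Y)"

definition natural_iso ::
    "('o, 'm, 'x) category_data_scheme \<Rightarrow> ('p, 'n, 'y) category_data_scheme \<Rightarrow>
     ('o \<Rightarrow> 'p) \<Rightarrow> ('m \<Rightarrow> 'n) \<Rightarrow> ('o \<Rightarrow> 'p) \<Rightarrow> ('m \<Rightarrow> 'n) \<Rightarrow> ('o \<Rightarrow> 'n) \<Rightarrow> bool" where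
  "natural_iso C D G Gm H Hm \<phi> \<longleftrightarrow>
     (\<forall>A\<in>Obj C. isomorphism D (G A) (H A) (\<phi> A)) \<and>
     (\<forall>A\<in>Obj C. \<forall>B\<in>Obj C. \<forall>f\<in>Hom C A B. \<phi> B \<cdot>\<^bsub>D\<^esub> Gm f = Hm f \<cdot>\<^bsub>D\<^esub> \<phi> A)"

definition preserves_small_coproducts ::
    "'u set \<Rightarrow> ('o, 'm, 'x) category_data_scheme \<Rightarrow> ('p, 'n, 'y) category_data_scheme \<Rightarrow>
     ('o \<Rightarrow> 'p) \<Rightarrow> ('m \<Rightarrow> 'n) \<Rightarrow> bool" where
  "preserves_small_coproducts U C D G Gm \<longleftrightarrow>
     (\<forall>(I :: 'u set) X Y \<iota>. small U I \<longrightarrow> is_coproduct C I X Y \<iota> \<longrightarrow>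
        is_coproduct D I (G \<circ> X) (G Y) (Gm \<circ> \<iota>))"


section \<open>Additive categories\<close>

record ('o, 'm) preadditive_data = "('o, 'm) category_data" +
  Add :: "'m \<Rightarrow> 'm \<Rightarrow> 'm"
  Zero :: "'o \<Rightarrow> 'o \<Rightarrow> 'm"

definition hom_group :: "('o, 'm, 'x) preadditive_data_scheme \<Rightarrow> 'o \<Rightarrow> 'o \<Rightarrow> 'm monoid" where
  "hom_group C A B = \<lparr>carrier = Hom C A B, mult = Add C, one = Zero C A B\<rparr>"

locale additive_category = category C
  for C :: "('o, 'm, 'x) preadditive_data_scheme" (structure) +
  assumes hom_comm_group: "\<lbrakk>A \<in> Obj C; B \<in> Obj C\<rbrakk> \<Longrightarrow> comm_group (hom_group C A B)"
    and Comp_Add_left: "\<lbrakk>f \<in> Hom C A B; g \<in> Hom C B D; g' \<in> Hom C B D\<rbrakk>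
                          \<Longrightarrow> Add C g g' \<cdot> f = Add C (g \<cdot> f) (g' \<cdot> f)"
    and Comp_Add_right: "\<lbrakk>f \<in> Hom C A B; f' \<in> Hom C A B; g \<in> Hom C B D\<rbrakk>
                          \<Longrightarrow> g \<cdot> Add C f f' = Add C (g \<cdot> f) (g \<cdot> f')"
    and ex_zero_object: "\<exists>Z. zero_object C Z"
    and ex_binary_coproduct: "\<lbrakk>A \<in> Obj C; B \<in> Obj C\<rbrakk>
          \<Longrightarrow> \<exists>Y \<iota>. is_coproduct C UNIV (\<lambda>b. if b then A else B) Y \<iota>"

definition additive_functor ::
    "('o, 'm, 'x) preadditive_data_scheme \<Rightarrow> ('p, 'n, 'y) preadditive_data_scheme \<Rightarrow>
     ('o \<Rightarrow> 'p) \<Rightarrow> ('m \<Rightarrow> 'n) \<Rightarrow> bool" where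
  "additive_functor C D G Gm \<longleftrightarrow>
     category_functor C D G Gm \<and>
     (\<forall>A\<in>Obj C. \<forall>B\<in>Obj C. Gm \<in> hom (hom_group C A B) (hom_group D (G A) (G B)))"

text \<open>
  \<open>A\<close> is compact if the canonical homomorphism from the direct sum of the groups
  \<open>Hom(A, X i)\<close> to \<open>Hom(A, Y)\<close>, where \<open>Y\<close> is the coproduct of the \<open>X i\<close>, is bijective.
  HOL-Algebra writes these groups multiplicatively, so \<^const>\<open>gfinprod\<close> is the
  sum of the finitely many non-zero terms.
\<close>

definition compact_object ::
    "'u set \<Rightarrow> ('o, 'm, 'x) preadditive_data_scheme \<Rightarrow> 'o \<Rightarrow> bool" where
  "compact_object U C A \<longleftrightarrow>
     A \<in> Obj C \<and>
     (\<forall>(I :: 'u set) X Y \<iota>. small U I \<longrightarrow> is_coproduct C I X Y \<iota> \<longrightarrow>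
        (\<lambda>f. gfinprod (hom_group C A Y) (\<lambda>i. \<iota> i \<cdot>\<^bsub>C\<^esub> f i) I)
          \<in> iso (sum_group I (\<lambda>i. hom_group C A (X i))) (hom_group C A Y))"


section \<open>Triangulated categories\<close>

text \<open>
  \<open>Susp\<close> and \<open>Susp_arr\<close> are the suspension functor \<open>\<Sigma>\<close>; \<open>Tri\<close> is the set of
  distinguished triangles \<open>A \<rightarrow> B \<rightarrow> C \<rightarrow> \<Sigma>A\<close>, each given by its three arrows.
\<close>

record ('o, 'm) triangulated_data = "('o, 'm) preadditive_data" +
  Susp :: "'o \<Rightarrow> 'o"
  Susp_arr :: "'m \<Rightarrow> 'm"
  Tri :: "('m \<times> 'm \<times> 'm) set"

definition triangle_shape ::
    "('o, 'm, 'x) triangulated_data_scheme \<Rightarrow> 'o \<Rightarrow> 'o \<Rightarrow> 'o \<Rightarrow> 'm \<Rightarrow> 'm \<Rightarrow> 'm \<Rightarrow> bool" where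
  "triangle_shape T A B C f g h \<longleftrightarrow>
     f \<in> Hom T A B \<and> g \<in> Hom T B C \<and> h \<in> Hom T C (Susp T A)"

definition triangle ::
    "('o, 'm, 'x) triangulated_data_scheme \<Rightarrow> 'o \<Rightarrow> 'o \<Rightarrow> 'o \<Rightarrow> 'm \<Rightarrow> 'm \<Rightarrow> 'm \<Rightarrow> bool" where
  "triangle T A B C f g h \<longleftrightarrow> triangle_shape T A B C f g h \<and> (f, g, h) \<in> Tri T"

locale triangulated_category = additive_category T
  for T :: "('o, 'm, 'x) triangulated_data_scheme" (structure) +
  assumes Susp_additive: "additive_functor T T (Susp T) (Susp_arr T)"
    and Susp_equivalence: "equivalence_functor T T (Susp T) (Susp_arr T)"
    and Tri_shape: "(f, g, h) \<in> Tri T \<Longrightarrow> \<exists>A B C. triangle_shape T A B C f g h"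
    and Tri_iso:
      "\<lbrakk>triangle T A B C f g h; triangle_shape T A' B' C' f' g' h';
        isomorphism T A A' a; isomorphism T B B' b; isomorphism T C C' c;
        b \<cdot> f = f' \<cdot> a; c \<cdot> g = g' \<cdot> b; Susp_arr T a \<cdot> h = h' \<cdot> c\<rbrakk>
       \<Longrightarrow> triangle T A' B' C' f' g' h'"
    and TR1_Id:
      "\<lbrakk>A \<in> Obj T; zero_object T Z\<rbrakk>
       \<Longrightarrow> triangle T A A Z (Id T A) (Zero T A Z) (Zero T Z (Susp T A))"
    and TR1_cone: "f \<in> Hom T A B \<Longrightarrow> \<exists>C g h. triangle T A B C f g h"
    and TR2_rotate:
      "triangle_shape T A B C f g h
       \<Longrightarrow> triangle T A B C f g h \<longleftrightarrow>
           triangle T B C (Susp T A) g h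
             (inv\<^bsub>hom_group T (Susp T A) (Susp T B)\<^esub> (Susp_arr T f))"
    and TR3_morphism:
      "\<lbrakk>triangle T A B C f g h; triangle T A' B' C' f' g' h';
        a \<in> Hom T A A'; b \<in> Hom T B B'; b \<cdot> f = f' \<cdot> a\<rbrakk>
       \<Longrightarrow> \<exists>c\<in>Hom T C C'. c \<cdot> g = g' \<cdot> b \<and> Susp_arr T a \<cdot> h = h' \<cdot> c"
    and TR4_octahedral:
      "\<lbrakk>triangle T A B D f f1 f2; triangle T B C F g g1 g2; triangle T A C E (g \<cdot> f) k1 k2\<rbrakk>
       \<Longrightarrow> \<exists>u v. triangle T D E F u v (Susp_arr T f1 \<cdot> g2) \<and>
             u \<cdot> f1 = k1 \<cdot> g \<and> k2 \<cdot> u = f2 \<and>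
             v \<cdot> k1 = g1 \<and> g2 \<cdot> v = Susp_arr T f \<cdot> k2"

definition exact_functor ::
    "('o, 'm, 'x) triangulated_data_scheme \<Rightarrow> ('p, 'n, 'y) triangulated_data_scheme \<Rightarrow>
     ('o \<Rightarrow> 'p) \<Rightarrow> ('m \<Rightarrow> 'n) \<Rightarrow> bool" where
  "exact_functor S T G Gm \<longleftrightarrow>
     additive_functor S T G Gm \<and>
     (\<exists>\<phi>. natural_iso S T (G \<circ> Susp S) (Gm \<circ> Susp_arr S) (Susp T \<circ> G) (Susp_arr T \<circ> Gm) \<phi> \<and>
        (\<forall>A B C f g h. triangle S A B C f g h \<longrightarrow>
           triangle T (G A) (G B) (G C) (Gm f) (Gm g) (\<phi> A \<cdot>\<^bsub>T\<^esub> Gm h)))"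

text \<open>Full triangulated subcategories closed under small coproducts, given by their objects.\<close>

definition localizing_subcategory ::
    "'u set \<Rightarrow> ('o, 'm, 'x) triangulated_data_scheme \<Rightarrow> 'o set \<Rightarrow> bool" where
  "localizing_subcategory U T S \<longleftrightarrow>
     S \<subseteq> Obj T \<and>
     (\<forall>Z. zero_object T Z \<longrightarrow> Z \<in> S) \<and>
     (\<forall>A B. isomorphic T A B \<longrightarrow> A \<in> S \<longrightarrow> B \<in> S) \<and>
     (\<forall>A\<in>Obj T. Susp T A \<in> S \<longleftrightarrow> A \<in> S) \<and>
     (\<forall>A B C f g h. triangle T A B C f g h \<longrightarrow> A \<in> S \<longrightarrow> B \<in> S \<longrightarrow> C \<in> S) \<and>
     (\<forall>(I :: 'u set) X Y \<iota>. small U I \<longrightarrow> is_coproduct T I X Y \<iota> \<longrightarrow> (\<forall>i\<in>I. X i \<in> S) \<longrightarrow> Y \<in> S)"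

definition generates_localizing ::
    "'u set \<Rightarrow> ('o, 'm, 'x) triangulated_data_scheme \<Rightarrow> 'o set \<Rightarrow> bool" where
  "generates_localizing U T K \<longleftrightarrow>
     (\<forall>S. localizing_subcategory U T S \<longrightarrow> K \<subseteq> S \<longrightarrow> S = Obj T)"


section \<open>Closed symmetric monoidal structures\<close>

text \<open>
  \<open>Ihom X Y\<close> is the internal hom \<open>hom(X, Y)\<close>, and \<open>Eval X Y\<close> is the evaluation
  \<open>hom(X, Y) \<otimes> X \<rightarrow> Y\<close>, i.e. the counit of the adjunction between \<open>- \<otimes> X\<close> and \<open>hom(X, -)\<close>.
\<close>

record ('o, 'm) tt_data = "('o, 'm) triangulated_data" +
  Tensor :: "'o \<Rightarrow> 'o \<Rightarrow> 'o"  (infixl \<open>\<otimes>\<^sub>o\<index>\<close> 70)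
  Tensor_arr :: "'m \<Rightarrow> 'm \<Rightarrow> 'm"  (infixl \<open>\<otimes>\<^sub>a\<index>\<close> 70)
  Unit :: "'o"
  Associator :: "'o \<Rightarrow> 'o \<Rightarrow> 'o \<Rightarrow> 'm"
  Left_unitor :: "'o \<Rightarrow> 'm"
  Right_unitor :: "'o \<Rightarrow> 'm"
  Symmetry :: "'o \<Rightarrow> 'o \<Rightarrow> 'm"
  Ihom :: "'o \<Rightarrow> 'o \<Rightarrow> 'o"
  Eval :: "'o \<Rightarrow> 'o \<Rightarrow> 'm"

locale closed_symmetric_monoidal = category M
  for M :: "('o, 'm, 'x) tt_data_scheme" (structure) +
  assumes Tensor_Obj: "\<lbrakk>A \<in> Obj M; B \<in> Obj M\<rbrakk> \<Longrightarrow> A \<otimes>\<^sub>o B \<in> Obj M"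
    and Tensor_arr_Hom: "\<lbrakk>f \<in> Hom M A B; g \<in> Hom M C D\<rbrakk>
                           \<Longrightarrow> f \<otimes>\<^sub>a g \<in> Hom M (A \<otimes>\<^sub>o C) (B \<otimes>\<^sub>o D)"
    and Tensor_Id: "\<lbrakk>A \<in> Obj M; B \<in> Obj M\<rbrakk> \<Longrightarrow> Id M A \<otimes>\<^sub>a Id M B = Id M (A \<otimes>\<^sub>o B)"
    and Tensor_Comp:
      "\<lbrakk>f \<in> Hom M A B; f' \<in> Hom M B C; g \<in> Hom M D E; g' \<in> Hom M E F\<rbrakk>
       \<Longrightarrow> (f' \<cdot> f) \<otimes>\<^sub>a (g' \<cdot> g) = (f' \<otimes>\<^sub>a g') \<cdot> (f \<otimes>\<^sub>a g)"
    and Unit_Obj: "Unit M \<in> Obj M"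
    and Associator_iso:
      "\<lbrakk>A \<in> Obj M; B \<in> Obj M; C \<in> Obj M\<rbrakk>
       \<Longrightarrow> isomorphism M ((A \<otimes>\<^sub>o B) \<otimes>\<^sub>o C) (A \<otimes>\<^sub>o (B \<otimes>\<^sub>o C)) (Associator M A B C)"
    and Associator_natural:
      "\<lbrakk>f \<in> Hom M A A'; g \<in> Hom M B B'; h \<in> Hom M C C'\<rbrakk>
       \<Longrightarrow> Associator M A' B' C' \<cdot> ((f \<otimes>\<^sub>a g) \<otimes>\<^sub>a h)
           = (f \<otimes>\<^sub>a (g \<otimes>\<^sub>a h)) \<cdot> Associator M A B C"
    and Left_unitor_iso: "A \<in> Obj M \<Longrightarrow> isomorphism M (Unit M \<otimes>\<^sub>o A) A (Left_unitor M A)"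
    and Left_unitor_natural:
      "f \<in> Hom M A B \<Longrightarrow> Left_unitor M B \<cdot> (Id M (Unit M) \<otimes>\<^sub>a f) = f \<cdot> Left_unitor M A"
    and Right_unitor_iso: "A \<in> Obj M \<Longrightarrow> isomorphism M (A \<otimes>\<^sub>o Unit M) A (Right_unitor M A)"
    and Right_unitor_natural:
      "f \<in> Hom M A B \<Longrightarrow> Right_unitor M B \<cdot> (f \<otimes>\<^sub>a Id M (Unit M)) = f \<cdot> Right_unitor M A"
    and Symmetry_Hom:
      "\<lbrakk>A \<in> Obj M; B \<in> Obj M\<rbrakk> \<Longrightarrow> Symmetry M A B \<in> Hom M (A \<otimes>\<^sub>o B) (B \<otimes>\<^sub>o A)"
    and Symmetry_natural:
      "\<lbrakk>f \<in> Hom M A A'; g \<in> Hom M B B'\<rbrakk>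
       \<Longrightarrow> Symmetry M A' B' \<cdot> (f \<otimes>\<^sub>a g) = (g \<otimes>\<^sub>a f) \<cdot> Symmetry M A B"
    and Symmetry_involutive:
      "\<lbrakk>A \<in> Obj M; B \<in> Obj M\<rbrakk> \<Longrightarrow> Symmetry M B A \<cdot> Symmetry M A B = Id M (A \<otimes>\<^sub>o B)"
    and pentagon:
      "\<lbrakk>A \<in> Obj M; B \<in> Obj M; C \<in> Obj M; D \<in> Obj M\<rbrakk>
       \<Longrightarrow> Associator M A B (C \<otimes>\<^sub>o D) \<cdot> Associator M (A \<otimes>\<^sub>o B) C D
           = (Id M A \<otimes>\<^sub>a Associator M B C D) \<cdot> Associator M A (B \<otimes>\<^sub>o C) D
               \<cdot> (Associator M A B C \<otimes>\<^sub>a Id M D)"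
    and unit_triangle:
      "\<lbrakk>A \<in> Obj M; B \<in> Obj M\<rbrakk>
       \<Longrightarrow> (Id M A \<otimes>\<^sub>a Left_unitor M B) \<cdot> Associator M A (Unit M) B
           = Right_unitor M A \<otimes>\<^sub>a Id M B"
    and hexagon:
      "\<lbrakk>A \<in> Obj M; B \<in> Obj M; C \<in> Obj M\<rbrakk>
       \<Longrightarrow> Associator M B C A \<cdot> Symmetry M A (B \<otimes>\<^sub>o C) \<cdot> Associator M A B C
           = (Id M B \<otimes>\<^sub>a Symmetry M A C) \<cdot> Associator M B A C
               \<cdot> (Symmetry M A B \<otimes>\<^sub>a Id M C)"
    and Ihom_Obj: "\<lbrakk>X \<in> Obj M; Y \<in> Obj M\<rbrakk> \<Longrightarrow> Ihom M X Y \<in> Obj M"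
    and Eval_Hom: "\<lbrakk>X \<in> Obj M; Y \<in> Obj M\<rbrakk> \<Longrightarrow> Eval M X Y \<in> Hom M (Ihom M X Y \<otimes>\<^sub>o X) Y"
    and Eval_universal:
      "\<lbrakk>A \<in> Obj M; X \<in> Obj M; Y \<in> Obj M; f \<in> Hom M (A \<otimes>\<^sub>o X) Y\<rbrakk>
       \<Longrightarrow> \<exists>!g. g \<in> Hom M A (Ihom M X Y) \<and> Eval M X Y \<cdot> (g \<otimes>\<^sub>a Id M X) = f"

text \<open>The adjoint \<open>A \<rightarrow> hom(X, Y)\<close> of an arrow \<open>f: A \<otimes> X \<rightarrow> Y\<close>.\<close>

definition transpose_arr ::
    "('o, 'm, 'x) tt_data_scheme \<Rightarrow> 'o \<Rightarrow> 'o \<Rightarrow> 'o \<Rightarrow> 'm \<Rightarrow> 'm" where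
  "transpose_arr M A X Y f =
     (THE g. g \<in> Hom M A (Ihom M X Y) \<and> Eval M X Y \<cdot>\<^bsub>M\<^esub> (g \<otimes>\<^sub>a\<^bsub>M\<^esub> Id M X) = f)"

text \<open>
  The action of \<open>hom(-, X)\<close> on \<open>f: A \<rightarrow> B\<close>, an arrow \<open>hom(B, X) \<rightarrow> hom(A, X)\<close>: the
  adjoint of \<open>hom(B, X) \<otimes> A \<rightarrow> hom(B, X) \<otimes> B \<rightarrow> X\<close>.
\<close>

definition Ihom_contra :: "('o, 'm, 'x) tt_data_scheme \<Rightarrow> 'o \<Rightarrow> 'm \<Rightarrow> 'm" where
  "Ihom_contra M X f =
     (let A = Dom M f; B = Cod M f in
      transpose_arr M (Ihom M B X) A X
        (Eval M B X \<cdot>\<^bsub>M\<^esub> (Id M (Ihom M B X) \<otimes>\<^sub>a\<^bsub>M\<^esub> f)))"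

text \<open>
  The canonical arrow \<open>hom(X, 1) \<otimes> Y \<rightarrow> hom(X, Y)\<close>: the adjoint of
  \<open>(hom(X, 1) \<otimes> Y) \<otimes> X \<cong> (hom(X, 1) \<otimes> X) \<otimes> Y \<rightarrow> 1 \<otimes> Y \<cong> Y\<close>.
\<close>

definition dual_tensor_to_Ihom :: "('o, 'm, 'x) tt_data_scheme \<Rightarrow> 'o \<Rightarrow> 'o \<Rightarrow> 'm" where
  "dual_tensor_to_Ihom M X Y =
     (let DX = Ihom M X (Unit M) in
      transpose_arr M (DX \<otimes>\<^sub>o\<^bsub>M\<^esub> Y) X Y
        (Left_unitor M Y \<cdot>\<^bsub>M\<^esub> (Eval M X (Unit M) \<otimes>\<^sub>a\<^bsub>M\<^esub> Id M Y)
          \<cdot>\<^bsub>M\<^esub> inverse_arr M (Associator M DX X Y)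
          \<cdot>\<^bsub>M\<^esub> (Id M DX \<otimes>\<^sub>a\<^bsub>M\<^esub> Symmetry M Y X)
          \<cdot>\<^bsub>M\<^esub> Associator M DX Y X))"

definition rigid_object :: "('o, 'm, 'x) tt_data_scheme \<Rightarrow> 'o \<Rightarrow> bool" where
  "rigid_object M X \<longleftrightarrow>
     X \<in> Obj M \<and>
     (\<forall>Y\<in>Obj M. isomorphism M (Ihom M X (Unit M) \<otimes>\<^sub>o\<^bsub>M\<^esub> Y) (Ihom M X Y)
                   (dual_tensor_to_Ihom M X Y))"


section \<open>Big tt-categories and tt-fields\<close>

definition compact_objects :: "'u set \<Rightarrow> ('o, 'm, 'x) preadditive_data_scheme \<Rightarrow> 'o set" where
  "compact_objects U C = {X. compact_object U C X}"

locale big_tt_category =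
  triangulated_category F + closed_symmetric_monoidal F
  for U :: "'u set" and F :: "('o, 'm, 'x) tt_data_scheme" (structure) +
  assumes universe_U: "universe U"
    and locally_small_F: "locally_small U F"
    and small_coproducts: "has_small_coproducts U F"
    and tensor_left_exact:
      "X \<in> Obj F \<Longrightarrow> exact_functor F F (\<lambda>Y. X \<otimes>\<^sub>o Y) (\<lambda>f. Id F X \<otimes>\<^sub>a f)"
    and tensor_right_exact:
      "X \<in> Obj F \<Longrightarrow> exact_functor F F (\<lambda>Y. Y \<otimes>\<^sub>o X) (\<lambda>f. f \<otimes>\<^sub>a Id F X)"
    and tensor_left_coproducts:
      "X \<in> Obj F \<Longrightarrow> preserves_small_coproducts U F F (\<lambda>Y. X \<otimes>\<^sub>o Y) (\<lambda>f. Id F X \<otimes>\<^sub>a f)"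
    and tensor_right_coproducts:
      "X \<in> Obj F \<Longrightarrow> preserves_small_coproducts U F F (\<lambda>Y. Y \<otimes>\<^sub>o X) (\<lambda>f. f \<otimes>\<^sub>a Id F X)"
    and compact_iff_rigid: "X \<in> Obj F \<Longrightarrow> compact_object U F X \<longleftrightarrow> rigid_object F X"
    and compact_essentially_small: "essentially_small U F (compact_objects U F)"
    and compact_generates: "generates_localizing U F (compact_objects U F)"

definition nonzero_category :: "('o, 'm, 'x) category_data_scheme \<Rightarrow> bool" where
  "nonzero_category C \<longleftrightarrow> (\<exists>X\<in>Obj C. \<not> zero_object C X)"

definition tensor_faithful :: "('o, 'm, 'x) tt_data_scheme \<Rightarrow> 'o \<Rightarrow> bool" where
  "tensor_faithful F X \<longleftrightarrow>
     faithful F F (\<lambda>Y. X \<otimes>\<^sub>o\<^bsub>F\<^esub> Y) (\<lambda>f. Id F X \<otimes>\<^sub>a\<^bsub>F\<^esub> f)"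

locale tt_field = big_tt_category U F
  for U :: "'u set" and F :: "('o, 'm, 'x) tt_data_scheme" (structure) +
  assumes nonzero: "nonzero_category F"
    and coproduct_of_compacts:
      "Y \<in> Obj F \<Longrightarrow> \<exists>(I :: 'u set) X \<iota>. small U I \<and> (\<forall>i\<in>I. X i \<in> compact_objects U F) \<and>
                        is_coproduct F I X Y \<iota>"
    and nonzero_tensor_faithful:
      "\<lbrakk>X \<in> Obj F; \<not> zero_object F X\<rbrakk> \<Longrightarrow> tensor_faithful F X"

end

theory Submission
  imports Defs Complex_Main "HOL-Algebra.Ring"
begin

text \<open>
  If \<open>F\<close> is a tt-field and \<open>hom(d, X) = 0\<close> with \<open>X \<noteq> 0\<close>, then every arrow \<open>Z \<otimes> B \<rightarrow> X\<close> vanishes on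
  \<open>Z \<otimes> d\<close>; for \<open>Z = X \<otimes> hom(B, 1)\<close> faithfulness of \<open>X \<otimes> -\<close> gives \<open>hom(d, 1) = 0\<close>, and \<open>d = 0\<close> follows
  componentwise because the summands of \<open>B\<close> are rigid.

  Conversely, let the functors \<open>hom(-, X)\<close> be faithful. Faithfulness of \<open>X \<otimes> -\<close> follows from
  \<open>hom(X \<otimes> -, X) = hom(-, hom(X, X))\<close>. Brown's construction gives a non-zero pure-injective
  object \<open>E\<close>. If \<open>Z \<otimes> f\<close> is phantom for every \<open>Z\<close>, then \<open>hom(f, E) = 0\<close>, hence \<open>f = 0\<close>. So
  telescopes of compact objects split, which is a descending chain condition on compact objects;
  as in Bass's theory of perfect rings it forces every non-zero retract of a coproduct of compact
  objects to have a non-zero compact summand. By Zorn's lemma such a retract is itself a coproduct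
  of compact objects. The absence of phantoms also shows that the coproducts of compact objects
  are closed under cones, so they form a localizing subcategory, which is everything.
\<close>

section \<open>Small sets\<close>

text \<open>A single object \<open>E\<close> suffices because the adjoint of
  \<open>hom(f, E)\<close> is \<open>hom(B, E) \<otimes> f\<close> followed by evaluation into
  \<open>E\<close>. This is why vanishing, injectivity and surjectivity on compact sources are
  always tested after tensoring with an arbitrary \<open>Z\<close>. For the shift \<open>s\<close>
  on the coproduct of a sequence, \<open>1 - s\<close> is injective in this sense, so the connecting
  arrow of its triangle is zero and \<open>1 - s\<close> has a left inverse \<open>r\<close>. A
  compact source sees only finitely many components of \<open>r\<close>, and an index outside this
  finite support yields a relation that recovers one composite of the sequence from the next. That
  is the chain condition. It is used twice on a retract \<open>X\<close> of a coproduct: once to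
  find an endomorphism of a compact object that factors through \<open>X\<close> and is not
  nilpotent, once to turn it into an idempotent, whose image is the compact summand. The group Q/Z
  enters as an injective cogenerator; as roots of unity it is written multiplicatively, like the
  groups of HOL-Algebra.\<close>

lemma small_lepoll: "A \<lesssim> B \<Longrightarrow> small U B \<Longrightarrow> small U A"
  unfolding small_def by (rule lesspoll_trans1)

lemma small_subset: "A \<subseteq> B \<Longrightarrow> small U B \<Longrightarrow> small U A"
  by (blast intro: small_lepoll subset_imp_lepoll)

lemma small_image: "small U A \<Longrightarrow> small U (f ` A)"
  by (rule small_lepoll[OF image_lepoll])

text \<open>The definitions quantify only over index sets of type \<open>'u\<close>. Moving a small
  set there lets later constructions be indexed by arrows, pairs or numbers.\<close>

lemma small_eqpoll_obtain:
  assumes "small (U :: 'u set) A"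
  obtains A' :: "'u set" and g where "bij_betw g A' A" "small U A'"
proof -
  from assms have "A \<lesssim> U" by (simp add: small_def lesspoll_imp_lepoll)
  then obtain f where f: "inj_on f A" "f ` A \<subseteq> U" by (auto simp: lepoll_def)
  then have "bij_betw (the_inv_into A f) (f ` A) A"
    by (simp add: bij_betw_the_inv_into inj_on_imp_bij_betw)
  then show ?thesis using that small_image[OF assms] by blast
qed

lemma small_nat: "universe U \<Longrightarrow> small U (A :: nat set)"
  unfolding universe_def by (elim conjE small_subset[OF subset_UNIV])

lemma small_countable: "universe U \<Longrightarrow> countable A \<Longrightarrow> small U A"
  by (meson countable_def lepoll_def small_lepoll small_nat subset_UNIV)

lemma small_finite: "universe U \<Longrightarrow> finite A \<Longrightarrow> small U A"
  by (blast intro: small_countable countable_finite)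

lemma small_Pow:
  fixes U :: "'u set"
  assumes U: "universe U" and A: "small U A"
  shows "small U (Pow A)"
proof -
  obtain A' :: "'u set" and g where g: "bij_betw g A' A" and A': "small U A'"
    using small_eqpoll_obtain[OF A] .
  have "Pow A = image g ` Pow A'"
    using g by (metis bij_betw_def image_Pow_surj)
  then show ?thesis using U A' by (simp add: universe_def small_image)
qed

text \<open>The universe axiom speaks only of families of sets inside \<open>'u\<close>, so the
  index set and all members are first copied into \<open>'u\<close>. The copies may overlap, hence a
  point of the union is reached from a pair: an index and a point of the copy belonging to
  it.\<close>

lemma small_UN:
  fixes U :: "'u set"
  assumes U: "universe U" and A: "small U A" and B: "\<And>a. a \<in> A \<Longrightarrow> small U (B a)"
  shows "small U (\<Union>a\<in>A. B a)"
proof -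
  obtain A' :: "'u set" and g where g: "bij_betw g A' A" and A': "small U A'"
    using small_eqpoll_obtain[OF A] .
  have "\<forall>a\<in>A. \<exists>(C :: 'u set) h. bij_betw h C (B a) \<and> small U C"
    using B small_eqpoll_obtain by metis
  then obtain C :: "_ \<Rightarrow> 'u set" and h where C: "\<And>a. a \<in> A \<Longrightarrow> bij_betw (h a) (C a) (B a) \<and> small U (C a)"
    by metis
  have univ_UN: "small U (\<Union>a\<in>D. E a)" if "small U D" "\<And>a. a \<in> D \<Longrightarrow> small U (E a)"
    for D :: "'u set" and E :: "'u \<Rightarrow> 'u set"
    using U that unfolding universe_def by blast
  let ?V = "\<Union>a\<in>A'. C (g a)"
  have "small U ?V"
    using univ_UN[OF A', of "\<lambda>a. C (g a)"] C bij_betwE[OF g] by blast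
  have "small U (Pow (Pow (A' \<union> ?V)))"
  proof -
    have "A' \<union> ?V = (\<Union>b\<in>{True, False}. if b then A' else ?V)" by auto
    \<comment> \<open>Only indexed unions are available, so the binary union is indexed by a copy of
      a two-element set in \<open>'u\<close>.\<close>
    obtain D :: "'u set" and k where k: "bij_betw k D {True, False}" and D: "small U D"
      by (rule small_eqpoll_obtain[OF small_finite[OF U, of "{True, False}"]]) auto
    have "A' \<union> ?V = (\<Union>d\<in>D. if k d then A' else ?V)"
    proof -
      have "(\<Union>d\<in>D. if k d then A' else ?V) = (\<Union>b\<in>k ` D. if b then A' else ?V)" by blast
      then show ?thesis using k by (auto simp: bij_betw_def)
    qed
    moreover have "small U (\<Union>d\<in>D. if k d then A' else ?V)"
      by (rule univ_UN[OF D]) (use A' \<open>small U ?V\<close> in auto)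
    ultimately have "small U (A' \<union> ?V)" by simp
    then show ?thesis using U by (intro small_Pow)
  qed
  \<comment> \<open>The pair (a, c) is coded as the Kuratowski pair \<open>{{a}, {a, c}}\<close>, a
    point of the double power set, as no pairing on \<open>'u\<close> is at hand. \<open>?w\<close>
    decodes it: the singleton yields a, the other member yields c, and c = a if there is no other
    member.\<close>
  let ?w = "\<lambda>S. let a = (THE a. {a} \<in> S) in h (g a) (if \<exists>b. b \<noteq> a \<and> {a, b} \<in> S then (THE b. b \<noteq> a \<and>
    {a, b} \<in> S) else a)"
  have "(\<Union>a\<in>A. B a) \<subseteq> ?w ` Pow (Pow (A' \<union> ?V))"
  proof
    fix y assume "y \<in> (\<Union>a\<in>A. B a)"
    then obtain a' where a': "a' \<in> A'" "y \<in> B (g a')" using g unfolding bij_betw_def by auto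
    then have "g a' \<in> A" using g bij_betwE by blast
    then have "bij_betw (h (g a')) (C (g a')) (B (g a'))" using C by blast
    then have "y \<in> h (g a') ` C (g a')" using a' by (simp add: bij_betw_def)
    then obtain c where c: "c \<in> C (g a')" "h (g a') c = y" by blast
    let ?S = "{{a'}, {a', c}}"
    have S: "?S \<in> Pow (Pow (A' \<union> ?V))" using a' c by auto
    have "?w ?S = y"
    proof (cases "c = a'")
      case True
      have t: "(THE a. {a} \<in> ?S) = a'" by (rule the_equality) (use True in auto)
      have "\<not> (\<exists>b. b \<noteq> a' \<and> {a', b} \<in> ?S)" using True by (simp add: doubleton_eq_iff)
      then show ?thesis using True c(2) unfolding Let_def t by (simp only: if_False simp_thms)
    next
      case False
      have t: "(THE a. {a} \<in> ?S) = a'" by (rule the_equality) (use False in auto)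
      have t2: "(THE b. b \<noteq> a' \<and> {a', b} \<in> ?S) = c" 
        by (rule the_equality) (use False in \<open>auto simp: doubleton_eq_iff\<close>)
      have "\<exists>b. b \<noteq> a' \<and> {a', b} \<in> ?S" using False by blast
      then show ?thesis using c(2) unfolding Let_def t t2 by (simp only: if_True simp_thms)
    qed
    then show "y \<in> ?w ` Pow (Pow (A' \<union> ?V))" using S by blast
  qed
  then show ?thesis
    using \<open>small U (Pow (Pow _))\<close> by (blast intro: small_subset small_image)
qed

lemma small_Sigma:
  assumes U: "universe U" and "small U A" and "\<And>a. a \<in> A \<Longrightarrow> small U (B a)"
  shows "small U (Sigma A B)"
proof -
  have "Sigma A B = (\<Union>a\<in>A. Pair a ` B a)" by auto
  then show ?thesis using assms by (simp add: small_UN small_image)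
qed

lemma small_Un:
  assumes U: "universe U" and "small U A" "small U B"
  shows "small U (A \<union> B)"
proof -
  have "A \<union> B = (\<Union>b\<in>{True, False}. if b then A else B)" by auto
  moreover have "small U (\<Union>b\<in>{True, False}. if b then A else B)"
    by (rule small_UN) (use assms in \<open>auto intro: small_finite\<close>)
  ultimately show ?thesis by simp
qed

text \<open>A function is determined by its graph, so the function set injects into a power
  set.\<close>

lemma small_PiE:
  assumes U: "universe U" and "small U A" and "small U B"
  shows "small U (A \<rightarrow>\<^sub>E B)"
proof -
  have "inj_on (\<lambda>f. {p \<in> A \<times> B. f (fst p) = snd p}) (A \<rightarrow>\<^sub>E B)"
  proof (rule inj_onI)
    fix f f' assume f: "f \<in> A \<rightarrow>\<^sub>E B" "f' \<in> A \<rightarrow>\<^sub>E B"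
      and eq: "{p \<in> A \<times> B. f (fst p) = snd p} = {p \<in> A \<times> B. f' (fst p) = snd p}"
    show "f = f'"
    proof (rule PiE_ext[OF f])
      fix a assume "a \<in> A"
      then have "(a, f a) \<in> {p \<in> A \<times> B. f (fst p) = snd p}" using f by auto
      then show "f a = f' a" using eq by auto
    qed
  qed
  then have "A \<rightarrow>\<^sub>E B \<lesssim> Pow (A \<times> B)" unfolding lepoll_def by blast
  then show ?thesis using assms by (blast intro: small_lepoll small_Pow small_Sigma)
qed

section \<open>Categories\<close>

lemma isomorphismE:
  assumes "isomorphism C A B f"
  obtains g where "f \<in> Hom C A B" "g \<in> Hom C B A" "g \<cdot>\<^bsub>C\<^esub> f = Id C A" "f \<cdot>\<^bsub>C\<^esub> g = Id C B"
  using assms unfolding isomorphism_def by blast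

lemma isomorphismI:
  "\<lbrakk>f \<in> Hom C A B; g \<in> Hom C B A; g \<cdot>\<^bsub>C\<^esub> f = Id C A; f \<cdot>\<^bsub>C\<^esub> g = Id C B\<rbrakk> \<Longrightarrow> isomorphism C A B f"
  unfolding isomorphism_def by blast

context category
begin

lemma Hom_Obj: "f \<in> Hom C A B \<Longrightarrow> A \<in> Obj C" "f \<in> Hom C A B \<Longrightarrow> B \<in> Obj C"
  using Dom_in_Obj Cod_in_Obj by (auto simp: Hom_def)

lemma Hom_arr: "f \<in> Arr C \<Longrightarrow> f \<in> Hom C (Dom C f) (Cod C f)"
  by (simp add: Hom_def)

text \<open>The axioms in terms of \<open>Hom\<close> mention a middle object that rewriting cannot
  guess. Restated with \<open>Dom\<close> and \<open>Cod\<close>, all side conditions can be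
  computed, which is the purpose of the collection \<open>cat\<close>.\<close>

lemma arr_comp: "\<lbrakk>f \<in> Arr C; g \<in> Arr C; Cod C f = Dom C g\<rbrakk> \<Longrightarrow> g \<cdot> f \<in> Arr C"
  using Comp_in_Hom[of f "Dom C f" "Cod C f" g "Cod C g"] by (simp add: Hom_def)

lemma dom_comp: "\<lbrakk>f \<in> Arr C; g \<in> Arr C; Cod C f = Dom C g\<rbrakk> \<Longrightarrow> Dom C (g \<cdot> f) = Dom C f"
  using Comp_in_Hom[of f "Dom C f" "Cod C f" g "Cod C g"] by (simp add: Hom_def)

lemma cod_comp: "\<lbrakk>f \<in> Arr C; g \<in> Arr C; Cod C f = Dom C g\<rbrakk> \<Longrightarrow> Cod C (g \<cdot> f) = Cod C g"
  using Comp_in_Hom[of f "Dom C f" "Cod C f" g "Cod C g"] by (simp add: Hom_def)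

lemma comp_assoc:
  "\<lbrakk>f \<in> Arr C; g \<in> Arr C; h \<in> Arr C; Cod C f = Dom C g; Cod C g = Dom C h\<rbrakk>
   \<Longrightarrow> (h \<cdot> g) \<cdot> f = h \<cdot> (g \<cdot> f)"
  by (rule Comp_assoc[of f "Dom C f" "Cod C f" g "Cod C g" h "Cod C h"]) (simp_all add: Hom_def)

lemma arr_id: "A \<in> Obj C \<Longrightarrow> Id C A \<in> Arr C" "A \<in> Obj C \<Longrightarrow> Dom C (Id C A) = A"
  "A \<in> Obj C \<Longrightarrow> Cod C (Id C A) = A"
  using Id_in_Hom by (auto simp: Hom_def)

lemma comp_id: "\<lbrakk>f \<in> Arr C; Dom C f = A\<rbrakk> \<Longrightarrow> f \<cdot> Id C A = f"
  "\<lbrakk>f \<in> Arr C; Cod C f = B\<rbrakk> \<Longrightarrow> Id C B \<cdot> f = f"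
  using Comp_Id Id_Comp by (auto simp: Hom_def)

lemmas cat = Hom_def arr_comp dom_comp cod_comp comp_assoc arr_id comp_id Dom_in_Obj Cod_in_Obj

text \<open>Composites are normalized to the right, where a known value of
  \<open>g \<cdot> f\<close> no longer occurs as a subterm of
  \<open>g \<cdot> (f \<cdot> y)\<close>; this form restores the rewrite.\<close>

lemma reduce:
  "\<lbrakk>g \<cdot> f = k; y \<in> Arr C; f \<in> Arr C; g \<in> Arr C; Cod C y = Dom C f; Cod C f = Dom C g\<rbrakk>
   \<Longrightarrow> g \<cdot> (f \<cdot> y) = k \<cdot> y"
  by (simp add: comp_assoc[symmetric])

lemma inverse_arr:
  assumes "isomorphism C A B f"
  shows "inverse_arr C f \<in> Hom C B A" "inverse_arr C f \<cdot> f = Id C A" "f \<cdot> inverse_arr C f = Id C B"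
proof -
  obtain g where g: "f \<in> Hom C A B" "g \<in> Hom C B A" "g \<cdot> f = Id C A" "f \<cdot> g = Id C B"
    using assms by (rule isomorphismE)
  have o: "A \<in> Obj C" "B \<in> Obj C" using Hom_Obj g(1) by blast+
  have "inverse_arr C f = g"
    unfolding inverse_arr_def
  proof (rule the_equality)
    fix h assume "h \<in> Hom C (Cod C f) (Dom C f) \<and> h \<cdot> f = Id C (Dom C f) \<and> f \<cdot> h = Id C (Cod C f)"
    then have h: "h \<in> Hom C B A" "h \<cdot> f = Id C A" using g(1) by (auto simp: Hom_def)
    have "h = (h \<cdot> f) \<cdot> g" using h(1) g(1,2,4) o by (simp add: cat)
    then show "h = g" unfolding h(2) using g(2) by (simp add: cat)
  qed (use g in \<open>auto simp: Hom_def\<close>)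
  then show "inverse_arr C f \<in> Hom C B A" "inverse_arr C f \<cdot> f = Id C A" "f \<cdot> inverse_arr C f = Id C B"
    using g by auto
qed

lemma isomorphic_sym: "isomorphic C A B \<Longrightarrow> isomorphic C B A"
  unfolding isomorphic_def isomorphism_def by blast

lemma zero_object_eq:
  assumes "zero_object C Z" "f \<in> Hom C A Z" "g \<in> Hom C A Z"
  shows "f = g"
  using assms Hom_Obj(1)[OF assms(2)] unfolding zero_object_def by blast

lemma zero_object_eq':
  assumes "zero_object C Z" "f \<in> Hom C Z A" "g \<in> Hom C Z A"
  shows "f = g"
  using assms Hom_Obj(2)[OF assms(2)] unfolding zero_object_def by blast

lemma zero_object_iso:
  assumes "isomorphic C Z Z'" "zero_object C Z"
  shows "zero_object C Z'"
proof -
  obtain u v where u: "u \<in> Hom C Z Z'" "v \<in> Hom C Z' Z" "v \<cdot> u = Id C Z" "u \<cdot> v = Id C Z'"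
    using assms(1) unfolding isomorphic_def isomorphism_def by blast
  note o = Hom_Obj[OF u(1)]
  have "(\<exists>!f. f \<in> Hom C A Z') \<and> (\<exists>!f. f \<in> Hom C Z' A)" if A: "A \<in> Obj C" for A
  proof -
    obtain f g where f: "f \<in> Hom C A Z" and g: "g \<in> Hom C Z A"
      using assms(2) A unfolding zero_object_def by blast
    have 1: "u \<cdot> f \<in> Hom C A Z'" "g \<cdot> v \<in> Hom C Z' A" using u f g by (simp_all add: cat)
    have 2: "k = u \<cdot> f" if k: "k \<in> Hom C A Z'" for k
    proof -
      have "v \<cdot> k = f" by (rule zero_object_eq[OF assms(2) _ f]) (use u k in \<open>simp add: cat\<close>)
      then have "u \<cdot> (v \<cdot> k) = u \<cdot> f" by simp
      then show ?thesis using u k o by (simp add: cat comp_assoc[symmetric])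
    qed
    have 3: "k = g \<cdot> v" if k: "k \<in> Hom C Z' A" for k
    proof -
      have "k \<cdot> u = g" by (rule zero_object_eq'[OF assms(2) _ g]) (use u k in \<open>simp add: cat\<close>)
      then have "(k \<cdot> u) \<cdot> v = g \<cdot> v" by simp
      then show ?thesis using u k o by (simp add: cat)
    qed
    show ?thesis using 1 2 3 by blast
  qed
  then show ?thesis using o unfolding zero_object_def by blast
qed

subsection \<open>Coproducts\<close>

lemma coproduct_Obj: "is_coproduct C I X Y \<iota> \<Longrightarrow> Y \<in> Obj C"
  and coproduct_incl: "is_coproduct C I X Y \<iota> \<Longrightarrow> i \<in> I \<Longrightarrow> \<iota> i \<in> Hom C (X i) Y"
  and coproduct_summand: "is_coproduct C I X Y \<iota> \<Longrightarrow> i \<in> I \<Longrightarrow> X i \<in> Obj C"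
  unfolding is_coproduct_def by blast+

lemma coproduct_copair:
  assumes "is_coproduct C I X Y \<iota>" "A \<in> Obj C" "\<And>i. i \<in> I \<Longrightarrow> f i \<in> Hom C (X i) A"
  shows "\<exists>h. h \<in> Hom C Y A \<and> (\<forall>i\<in>I. h \<cdot> \<iota> i = f i)"
  using assms unfolding is_coproduct_def by blast

lemma coproduct_ext:
  assumes c: "is_coproduct C I X Y \<iota>" and h: "h \<in> Hom C Y A" "h' \<in> Hom C Y A"
    and eq: "\<And>i. i \<in> I \<Longrightarrow> h \<cdot> \<iota> i = h' \<cdot> \<iota> i"
  shows "h = h'"
proof -
  have *: "\<forall>i\<in>I. h \<cdot> \<iota> i \<in> Hom C (X i) A"
    using h coproduct_incl[OF c] by (auto simp: cat)
  have "\<exists>!k. k \<in> Hom C Y A \<and> (\<forall>i\<in>I. k \<cdot> \<iota> i = h \<cdot> \<iota> i)"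
    using c[unfolded is_coproduct_def, THEN conjunct2, THEN conjunct2, rule_format,
        OF Hom_Obj(2)[OF h(1)], of "\<lambda>i. h \<cdot> \<iota> i"] * by simp
  moreover have "h \<in> Hom C Y A \<and> (\<forall>i\<in>I. h \<cdot> \<iota> i = h \<cdot> \<iota> i)" using h by simp
  moreover have "h' \<in> Hom C Y A \<and> (\<forall>i\<in>I. h' \<cdot> \<iota> i = h \<cdot> \<iota> i)" using h eq by simp
  ultimately show ?thesis by blast
qed

lemma coproductI:
  assumes "Y \<in> Obj C" "\<And>i. i \<in> I \<Longrightarrow> \<iota> i \<in> Hom C (X i) Y"
    and ex: "\<And>A f. A \<in> Obj C \<Longrightarrow> (\<And>i. i \<in> I \<Longrightarrow> f i \<in> Hom C (X i) A)
               \<Longrightarrow> \<exists>h\<in>Hom C Y A. \<forall>i\<in>I. h \<cdot> \<iota> i = f i"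
    and uniq: "\<And>A h h'. \<lbrakk>h \<in> Hom C Y A; h' \<in> Hom C Y A; \<And>i. i \<in> I \<Longrightarrow> h \<cdot> \<iota> i = h' \<cdot> \<iota> i\<rbrakk> \<Longrightarrow> h = h'"
  shows "is_coproduct C I X Y \<iota>"
  unfolding is_coproduct_def
proof (intro conjI ballI allI impI)
  fix A f assume A: "A \<in> Obj C" "\<forall>i\<in>I. f i \<in> Hom C (X i) A"
  then obtain h where "h \<in> Hom C Y A" "\<forall>i\<in>I. h \<cdot> \<iota> i = f i" using ex[of A f] by blast
  then show "\<exists>!h. h \<in> Hom C Y A \<and> (\<forall>i\<in>I. h \<cdot> \<iota> i = f i)"
    by (intro ex1I[of _ h] conjI) (simp, simp, rule uniq, simp_all)
next
  show "X i \<in> Obj C" if "i \<in> I" for i using assms(2)[OF that] Hom_Obj(1) by blast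
qed (fact assms(1), fact assms(2))

lemma coproduct_reindex:
  assumes c: "is_coproduct C I X Y \<iota>" and g: "bij_betw g J I"
  shows "is_coproduct C J (\<lambda>j. X (g j)) Y (\<lambda>j. \<iota> (g j))"
proof (rule coproductI)
  show "Y \<in> Obj C" using coproduct_Obj[OF c] .
  have gI: "g j \<in> I" if "j \<in> J" for j using g that by (auto simp: bij_betw_def)
  let ?k = "the_inv_into J g"
  have k: "?k i \<in> J" "g (?k i) = i" if "i \<in> I" for i
    using g that by (auto simp: bij_betw_def f_the_inv_into_f the_inv_into_into)
  have kg: "?k (g j) = j" if "j \<in> J" for j
    using g that by (simp add: bij_betw_def the_inv_into_f_f)
  show "\<iota> (g j) \<in> Hom C (X (g j)) Y" if "j \<in> J" for j using coproduct_incl[OF c gI[OF that]] .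
  show "\<exists>h\<in>Hom C Y A. \<forall>i\<in>J. h \<cdot> \<iota> (g i) = f i"
    if A: "A \<in> Obj C" "\<And>i. i \<in> J \<Longrightarrow> f i \<in> Hom C (X (g i)) A" for A f
  proof -
    have "f (?k i) \<in> Hom C (X i) A" if "i \<in> I" for i using A(2)[of "?k i"] k[OF that] by simp
    then obtain h where "h \<in> Hom C Y A" "\<And>i. i \<in> I \<Longrightarrow> h \<cdot> \<iota> i = f (?k i)"
      using coproduct_copair[OF c A(1), where f = "\<lambda>i. f (?k i)"] by blast
    then show ?thesis by (intro bexI[of _ h]) (simp_all add: gI kg)
  qed
  show "h = h'" if "h \<in> Hom C Y A" "h' \<in> Hom C Y A" "\<And>i. i \<in> J \<Longrightarrow> h \<cdot> \<iota> (g i) = h' \<cdot> \<iota> (g i)" for A h h'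
    by (rule coproduct_ext[OF c that(1,2)]) (use that(3) k in metis)
qed

lemma coproduct_cong:
  assumes "is_coproduct C I X Y \<iota>" "\<And>i. i \<in> I \<Longrightarrow> X i = X' i" "\<And>i. i \<in> I \<Longrightarrow> \<iota> i = \<iota>' i"
  shows "is_coproduct C I X' Y \<iota>'"
  using assms unfolding is_coproduct_def by simp

lemma coproduct_reindex_inv:
  assumes c: "is_coproduct C J (\<lambda>j. X (g j)) Y \<iota>" and g: "bij_betw g J I"
  shows "is_coproduct C I X Y (\<lambda>i. \<iota> (the_inv_into J g i))"
proof -
  have k: "bij_betw (the_inv_into J g) I J" by (rule bij_betw_the_inv_into[OF g])
  show ?thesis
    by (rule coproduct_cong[OF coproduct_reindex[OF c k]])
      (use g in \<open>auto simp: bij_betw_def f_the_inv_into_f\<close>)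
qed

lemma coproduct_iso:
  assumes c: "is_coproduct C I X Y \<iota>" and u: "isomorphism C Y Y' u"
    and v: "\<And>i. i \<in> I \<Longrightarrow> isomorphism C (X' i) (X i) (v i)"
  shows "is_coproduct C I X' Y' (\<lambda>i. u \<cdot> \<iota> i \<cdot> v i)"
proof -
  obtain u' where u': "u \<in> Hom C Y Y'" "u' \<in> Hom C Y' Y" "u' \<cdot> u = Id C Y" "u \<cdot> u' = Id C Y'"
    using u by (rule isomorphismE)
  have "\<forall>i\<in>I. \<exists>v'. v i \<in> Hom C (X' i) (X i) \<and> v' \<in> Hom C (X i) (X' i) \<and> v' \<cdot> v i = Id C (X' i) \<and>
      v i \<cdot> v' = Id C (X i)"
    using v unfolding isomorphism_def by blast
  then obtain v' where v': "\<And>i. i \<in> I \<Longrightarrow> v i \<in> Hom C (X' i) (X i)"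
    "\<And>i. i \<in> I \<Longrightarrow> v' i \<in> Hom C (X i) (X' i)"
    "\<And>i. i \<in> I \<Longrightarrow> v' i \<cdot> v i = Id C (X' i)" "\<And>i. i \<in> I \<Longrightarrow> v i \<cdot> v' i = Id C (X i)"
    by metis
  note inc = coproduct_incl[OF c] and ob = coproduct_summand[OF c] and oY = Hom_Obj[OF u'(1)]
  show ?thesis
  proof (rule coproductI)
    show "Y' \<in> Obj C" using oY by simp
    show "u \<cdot> \<iota> i \<cdot> v i \<in> Hom C (X' i) Y'" if "i \<in> I" for i
      using u'(1) inc[OF that] v'(1)[OF that] by (simp add: cat)
    show "\<exists>h\<in>Hom C Y' A. \<forall>i\<in>I. h \<cdot> (u \<cdot> \<iota> i \<cdot> v i) = f i"
      if A: "A \<in> Obj C" "\<And>i. i \<in> I \<Longrightarrow> f i \<in> Hom C (X' i) A" for A f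
    proof -
      have "f i \<cdot> v' i \<in> Hom C (X i) A" if "i \<in> I" for i
        using A(2)[OF that] v'(2)[OF that] by (simp add: cat)
      then obtain h where h: "h \<in> Hom C Y A" "\<And>i. i \<in> I \<Longrightarrow> h \<cdot> \<iota> i = f i \<cdot> v' i"
        using coproduct_copair[OF c A(1), where f = "\<lambda>i. f i \<cdot> v' i"] by blast
      have "(h \<cdot> u') \<cdot> (u \<cdot> \<iota> i \<cdot> v i) = f i" if i: "i \<in> I" for i
      proof -
        note t = h(1) u'(1,2) inc[OF i] v'(1,2)[OF i] A(2)[OF i] ob[OF i] oY
        have "(h \<cdot> u') \<cdot> (u \<cdot> \<iota> i \<cdot> v i) = (h \<cdot> \<iota> i) \<cdot> v i"
          using t by (simp add: cat reduce[OF u'(3)])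
        also have "\<dots> = f i \<cdot> (v' i \<cdot> v i)" unfolding h(2)[OF i] using t by (simp add: cat)
        also have "\<dots> = f i" unfolding v'(3)[OF i] using t by (simp add: cat)
        finally show ?thesis .
      qed
      moreover have "h \<cdot> u' \<in> Hom C Y' A" using h(1) u'(2) by (simp add: cat)
      ultimately show ?thesis by blast
    qed
    show "h = h'" if h: "h \<in> Hom C Y' A" "h' \<in> Hom C Y' A"
      and eq: "\<And>i. i \<in> I \<Longrightarrow> h \<cdot> (u \<cdot> \<iota> i \<cdot> v i) = h' \<cdot> (u \<cdot> \<iota> i \<cdot> v i)" for A h h'
    proof -
      have "h \<cdot> u = h' \<cdot> u"
      proof (rule coproduct_ext[OF c])
        fix i assume i: "i \<in> I"
        note t = h u'(1,2) inc[OF i] v'(1,2)[OF i] ob[OF i] oY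
        have "(h \<cdot> (u \<cdot> \<iota> i \<cdot> v i)) \<cdot> v' i = (h' \<cdot> (u \<cdot> \<iota> i \<cdot> v i)) \<cdot> v' i" using eq[OF i] by simp
        then show "(h \<cdot> u) \<cdot> \<iota> i = (h' \<cdot> u) \<cdot> \<iota> i" using t by (simp add: cat v'(4)[OF i])
      qed (use h u' in \<open>simp_all add: cat\<close>)
      then have "(h \<cdot> u) \<cdot> u' = (h' \<cdot> u) \<cdot> u'" by simp
      then show ?thesis using h u' oY by (simp add: cat)
    qed
  qed
qed

lemma coproduct_iso_Obj:
  assumes c: "is_coproduct C I X Y \<iota>" and "isomorphic C Y Y'"
  shows "\<exists>\<iota>'. is_coproduct C I X Y' \<iota>'"
proof -
  have "isomorphism C (X i) (X i) (Id C (X i))" if "i \<in> I" for i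
    using coproduct_summand[OF c that] by (auto intro!: isomorphismI[of _ _ _ _ "Id C (X i)"] simp: cat)
  moreover obtain u where "isomorphism C Y Y' u" using assms(2) unfolding isomorphic_def by blast
  ultimately show ?thesis using coproduct_iso[OF c, where X' = X and v = "\<lambda>i. Id C (X i)"] by blast
qed

lemma coproduct_iso_summands:
  assumes c: "is_coproduct C I X Y \<iota>" and X: "\<And>i. i \<in> I \<Longrightarrow> isomorphic C (X' i) (X i)"
  shows "\<exists>\<iota>'. is_coproduct C I X' Y \<iota>'"
proof -
  have "isomorphism C Y Y (Id C Y)"
    using coproduct_Obj[OF c] by (auto intro!: isomorphismI[of _ _ _ _ "Id C Y"] simp: cat)
  moreover obtain v where "\<And>i. i \<in> I \<Longrightarrow> isomorphism C (X' i) (X i) (v i)"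
    using X unfolding isomorphic_def by metis
  ultimately show ?thesis using coproduct_iso[OF c, where X' = X' and v = v] by blast
qed

lemma coproduct_unique_arrow:
  assumes c: "is_coproduct C I X Y \<iota>" and c': "is_coproduct C I X Y' \<iota>'"
  obtains u v where "u \<in> Hom C Y Y'" "v \<in> Hom C Y' Y" "v \<cdot> u = Id C Y" "u \<cdot> v = Id C Y'"
    "\<And>i. i \<in> I \<Longrightarrow> u \<cdot> \<iota> i = \<iota>' i" "\<And>i. i \<in> I \<Longrightarrow> v \<cdot> \<iota>' i = \<iota> i"
proof -
  obtain u where u: "u \<in> Hom C Y Y'" "\<And>i. i \<in> I \<Longrightarrow> u \<cdot> \<iota> i = \<iota>' i"
    using coproduct_copair[OF c coproduct_Obj[OF c'] coproduct_incl[OF c']] by blast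
  obtain v where v: "v \<in> Hom C Y' Y" "\<And>i. i \<in> I \<Longrightarrow> v \<cdot> \<iota>' i = \<iota> i"
    using coproduct_copair[OF c' coproduct_Obj[OF c] coproduct_incl[OF c]] by blast
  note o = Hom_Obj[OF u(1)]
  have "v \<cdot> u = Id C Y"
  proof (rule coproduct_ext[OF c])
    fix i assume i: "i \<in> I"
    show "(v \<cdot> u) \<cdot> \<iota> i = Id C Y \<cdot> \<iota> i"
      using u(1) v(1) coproduct_incl[OF c i] o by (simp add: cat u(2)[OF i] v(2)[OF i])
  qed (use u v o in \<open>simp_all add: cat\<close>)
  moreover have "u \<cdot> v = Id C Y'"
  proof (rule coproduct_ext[OF c'])
    fix i assume i: "i \<in> I"
    show "(u \<cdot> v) \<cdot> \<iota>' i = Id C Y' \<cdot> \<iota>' i"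
      using u(1) v(1) coproduct_incl[OF c' i] o by (simp add: cat u(2)[OF i] v(2)[OF i])
  qed (use u v o in \<open>simp_all add: cat\<close>)
  ultimately show ?thesis using that u v by blast
qed

lemma coproduct_unique:
  assumes "is_coproduct C I X Y \<iota>" "is_coproduct C I X Y' \<iota>'"
  shows "isomorphic C Y Y'"
  unfolding isomorphic_def isomorphism_def using coproduct_unique_arrow[OF assms] by metis

lemma coproduct_Sigma:
  assumes c: "is_coproduct C I X Y \<iota>" and d: "\<And>i. i \<in> I \<Longrightarrow> is_coproduct C (J i) (W i) (X i) (\<kappa> i)"
  shows "is_coproduct C (Sigma I J) (\<lambda>p. W (fst p) (snd p)) Y (\<lambda>p. \<iota> (fst p) \<cdot> \<kappa> (fst p) (snd p))"
proof (rule coproductI)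
  note inc = coproduct_incl[OF c] and inc' = coproduct_incl[OF d] and oX = coproduct_summand[OF c]
  show "Y \<in> Obj C" using coproduct_Obj[OF c] .
  show "\<iota> (fst p) \<cdot> \<kappa> (fst p) (snd p) \<in> Hom C (W (fst p) (snd p)) Y" if "p \<in> Sigma I J" for p
    using that inc[of "fst p"] inc'[of "fst p" "snd p"] by (auto simp: cat)
  show "\<exists>h\<in>Hom C Y A. \<forall>p\<in>Sigma I J. h \<cdot> (\<iota> (fst p) \<cdot> \<kappa> (fst p) (snd p)) = f p"
    if A: "A \<in> Obj C" "\<And>p. p \<in> Sigma I J \<Longrightarrow> f p \<in> Hom C (W (fst p) (snd p)) A" for A f
  proof -
    have "\<exists>k. k \<in> Hom C (X i) A \<and> (\<forall>j\<in>J i. k \<cdot> \<kappa> i j = f (i, j))" if i: "i \<in> I" for i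
      using coproduct_copair[OF d[OF i] A(1), where f = "\<lambda>j. f (i, j)"] A(2) i by force
    then obtain k where k: "\<And>i. i \<in> I \<Longrightarrow> k i \<in> Hom C (X i) A"
      "\<And>i j. i \<in> I \<Longrightarrow> j \<in> J i \<Longrightarrow> k i \<cdot> \<kappa> i j = f (i, j)" by metis
    obtain h where h: "h \<in> Hom C Y A" "\<And>i. i \<in> I \<Longrightarrow> h \<cdot> \<iota> i = k i"
      using coproduct_copair[OF c A(1), of k] k(1) by blast
    have "h \<cdot> (\<iota> i \<cdot> \<kappa> i j) = f (i, j)" if "i \<in> I" "j \<in> J i" for i j
      using h(1) inc[OF that(1)] inc'[OF that] k(2)[OF that] h(2)[OF that(1)]
      by (simp add: cat reduce[OF h(2)[OF that(1)]])
    then show ?thesis using h(1) by auto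
  qed
  show "h = h'" if h: "h \<in> Hom C Y A" "h' \<in> Hom C Y A"
    and eq: "\<And>p. p \<in> Sigma I J \<Longrightarrow> h \<cdot> (\<iota> (fst p) \<cdot> \<kappa> (fst p) (snd p)) = h' \<cdot> (\<iota> (fst p) \<cdot> \<kappa> (fst p) (snd p))"
    for A h h'
  proof (rule coproduct_ext[OF c h])
    fix i assume i: "i \<in> I"
    show "h \<cdot> \<iota> i = h' \<cdot> \<iota> i"
    proof (rule coproduct_ext[OF d[OF i]])
      fix j assume j: "j \<in> J i"
      show "(h \<cdot> \<iota> i) \<cdot> \<kappa> i j = (h' \<cdot> \<iota> i) \<cdot> \<kappa> i j"
        using eq[of "(i, j)"] i j h inc[OF i] inc'[OF i j] by (simp add: cat)
    qed (use h inc[OF i] in \<open>simp_all add: cat\<close>)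
  qed
qed

lemma ex_small_coproduct:
  assumes "has_small_coproducts (U :: 'u set) C" "small U I" "\<And>i. i \<in> I \<Longrightarrow> X i \<in> Obj C"
  obtains Y \<iota> where "is_coproduct C I X Y \<iota>"
proof -
  obtain J :: "'u set" and g where g: "bij_betw g J I" "small U J"
    using small_eqpoll_obtain[OF assms(2)] .
  have "\<forall>j\<in>J. X (g j) \<in> Obj C" using assms(3) g by (auto simp: bij_betw_def)
  then obtain Y \<iota> where "is_coproduct C J (\<lambda>j. X (g j)) Y \<iota>"
    using assms(1) g(2) unfolding has_small_coproducts_def by meson
  then show ?thesis using coproduct_reindex_inv[OF _ g(1)] that by blast
qed

end

subsection \<open>Functors\<close>

lemma Hom_opposite: "Hom (opposite C) A B = Hom C B A"
  unfolding Hom_def opposite_def by auto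

lemma category_opposite:
  assumes "category C"
  shows "category (opposite C)"
proof -
  interpret category C by fact
  show ?thesis
    by (rule category.intro; (unfold Hom_opposite)?; simp add: opposite_def)
      (auto intro: Dom_in_Obj Cod_in_Obj Id_in_Hom Comp_in_Hom Comp_Id Id_Comp Comp_assoc[symmetric])
qed

lemma preserves_coproduct:
  assumes p: "preserves_small_coproducts (U :: 'u set) C D G Gm" and "category C" "category D"
    and s: "small U I" and c: "is_coproduct C I X Y \<iota>"
  shows "is_coproduct D I (\<lambda>i. G (X i)) (G Y) (\<lambda>i. Gm (\<iota> i))"
proof -
  interpret C: category C by fact
  interpret D: category D by fact
  obtain J :: "'u set" and g where g: "bij_betw g J I" "small U J"
    using small_eqpoll_obtain[OF s] .
  have "is_coproduct C J (\<lambda>j. X (g j)) Y (\<lambda>j. \<iota> (g j))" by (rule C.coproduct_reindex[OF c g(1)])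
  then have "is_coproduct D J (G \<circ> (\<lambda>j. X (g j))) (G Y) (Gm \<circ> (\<lambda>j. \<iota> (g j)))"
    using p g(2) unfolding preserves_small_coproducts_def by blast
  then have "is_coproduct D J (\<lambda>j. G (X (g j))) (G Y) (\<lambda>j. Gm (\<iota> (g j)))" by (simp add: comp_def)
  then have "is_coproduct D I (\<lambda>i. G (X i)) (G Y) (\<lambda>i. Gm (\<iota> (g (the_inv_into J g i))))"
    using D.coproduct_reindex_inv[OF _ g(1), where X = "\<lambda>i. G (X i)"] by blast
  then show ?thesis
    by (rule D.coproduct_cong) (use g(1) in \<open>auto simp: bij_betw_def f_the_inv_into_f\<close>)
qed

text \<open>Every test object of \<open>D\<close> is isomorphic to some \<open>G A\<close>; after
  this replacement, full faithfulness reduces the universal property to the one in \<open>C\<close>.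
  It serves for the suspension, which is given without an inverse functor.\<close>

lemma equivalence_preserves_coproduct:
  assumes e: "equivalence_functor C D G Gm" and c: "is_coproduct C I X Y \<iota>"
  shows "is_coproduct D I (\<lambda>i. G (X i)) (G Y) (\<lambda>i. Gm (\<iota> i))"
proof -
  interpret category_functor C D G Gm using e by (simp add: equivalence_functor_def)
  have full: "\<exists>f\<in>Hom C A B. Gm f = k" if "k \<in> Hom D (G A) (G B)" "A \<in> Obj C" "B \<in> Obj C" for A B k
    using e that unfolding equivalence_functor_def bij_betw_def by (metis imageE)
  have faith: "f = f'" if "Gm f = Gm f'" "f \<in> Hom C A B" "f' \<in> Hom C A B" for f f' A B
    using e that source.Hom_Obj[OF that(2)] unfolding equivalence_functor_def bij_betw_def
      inj_on_def by blast
  have target: "\<exists>A u u'. A \<in> Obj C \<and> u \<in> Hom D (G A) B \<and> u' \<in> Hom D B (G A) \<and> u' \<cdot>\<^bsub>D\<^esub> u =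
      Id D (G A) \<and> u \<cdot>\<^bsub>D\<^esub> u' = Id D B"
    if "B \<in> Obj D" for B
    using e that unfolding equivalence_functor_def isomorphic_def isomorphism_def by metis
  note inc = source.coproduct_incl[OF c] and oX = source.coproduct_summand[OF c]
    and oY = source.coproduct_Obj[OF c]
  show ?thesis
  proof (rule target.coproductI)
    show "G Y \<in> Obj D" using G_Obj[OF oY] .
    show "Gm (\<iota> i) \<in> Hom D (G (X i)) (G Y)" if "i \<in> I" for i using Gm_Hom[OF inc[OF that]] .
    show "\<exists>h\<in>Hom D (G Y) B. \<forall>i\<in>I. h \<cdot>\<^bsub>D\<^esub> Gm (\<iota> i) = f i"
      if B: "B \<in> Obj D" "\<And>i. i \<in> I \<Longrightarrow> f i \<in> Hom D (G (X i)) B" for B f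
    proof -
      obtain A u u' where A: "A \<in> Obj C" "u \<in> Hom D (G A) B" "u' \<in> Hom D B (G A)"
        "u' \<cdot>\<^bsub>D\<^esub> u = Id D (G A)" "u \<cdot>\<^bsub>D\<^esub> u' = Id D B" using target[OF B(1)] by blast
      have "\<exists>k. k \<in> Hom C (X i) A \<and> Gm k = u' \<cdot>\<^bsub>D\<^esub> f i" if i: "i \<in> I" for i
      proof -
        have "u' \<cdot>\<^bsub>D\<^esub> f i \<in> Hom D (G (X i)) (G A)" using A(3) B(2)[OF i] by (simp add: target.cat)
        then show ?thesis using full oX[OF i] A(1) by blast
      qed
      then obtain k where k: "\<And>i. i \<in> I \<Longrightarrow> k i \<in> Hom C (X i) A" "\<And>i. i \<in> I \<Longrightarrow> Gm (k i) = u' \<cdot>\<^bsub>D\<^esub> f i"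
        by metis
      obtain h where h: "h \<in> Hom C Y A" "\<And>i. i \<in> I \<Longrightarrow> h \<cdot>\<^bsub>C\<^esub> \<iota> i = k i"
        using source.coproduct_copair[OF c A(1), of k] k(1) by blast
      have "(u \<cdot>\<^bsub>D\<^esub> Gm h) \<cdot>\<^bsub>D\<^esub> Gm (\<iota> i) = f i" if i: "i \<in> I" for i
      proof -
        have "Gm h \<cdot>\<^bsub>D\<^esub> Gm (\<iota> i) = u' \<cdot>\<^bsub>D\<^esub> f i"
          using Gm_Comp[OF inc[OF i] h(1)] h(2)[OF i] k(2)[OF i] by simp
        then show ?thesis
          using A(2,3) B(2)[OF i] Gm_Hom[OF inc[OF i]] Gm_Hom[OF h(1)] B(1)
          by (simp add: target.cat target.reduce[OF A(5)])
      qed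
      moreover have "u \<cdot>\<^bsub>D\<^esub> Gm h \<in> Hom D (G Y) B" using A(2) Gm_Hom[OF h(1)] by (simp add: target.cat)
      ultimately show ?thesis by blast
    qed
    show "h = h'" if h: "h \<in> Hom D (G Y) B" "h' \<in> Hom D (G Y) B"
      and eq: "\<And>i. i \<in> I \<Longrightarrow> h \<cdot>\<^bsub>D\<^esub> Gm (\<iota> i) = h' \<cdot>\<^bsub>D\<^esub> Gm (\<iota> i)" for B h h'
    proof -
      have oB: "B \<in> Obj D" using target.Hom_Obj(2)[OF h(1)] .
      obtain A u u' where A: "A \<in> Obj C" "u \<in> Hom D (G A) B" "u' \<in> Hom D B (G A)"
        "u' \<cdot>\<^bsub>D\<^esub> u = Id D (G A)" "u \<cdot>\<^bsub>D\<^esub> u' = Id D B" using target[OF oB] by blast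
      have "u' \<cdot>\<^bsub>D\<^esub> h \<in> Hom D (G Y) (G A)" "u' \<cdot>\<^bsub>D\<^esub> h' \<in> Hom D (G Y) (G A)"
        using A(3) h by (simp_all add: target.cat)
      then obtain k k' where k: "k \<in> Hom C Y A" "Gm k = u' \<cdot>\<^bsub>D\<^esub> h" "k' \<in> Hom C Y A" "Gm k' = u' \<cdot>\<^bsub>D\<^esub> h'"
        using full A(1) oY by meson
      have "k = k'"
      proof (rule source.coproduct_ext[OF c k(1,3)], rule faith)
        fix i assume i: "i \<in> I"
        show "Gm (k \<cdot>\<^bsub>C\<^esub> \<iota> i) = Gm (k' \<cdot>\<^bsub>C\<^esub> \<iota> i)"
          using eq[OF i] h A(3) Gm_Hom[OF inc[OF i]]
          by (simp add: Gm_Comp[OF inc[OF i] k(1)] Gm_Comp[OF inc[OF i] k(3)] k(2,4) target.cat)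
        show "k \<cdot>\<^bsub>C\<^esub> \<iota> i \<in> Hom C (X i) A" "k' \<cdot>\<^bsub>C\<^esub> \<iota> i \<in> Hom C (X i) A"
          using k inc[OF i] by (simp_all add: source.cat)
      qed
      then have "u \<cdot>\<^bsub>D\<^esub> (u' \<cdot>\<^bsub>D\<^esub> h) = u \<cdot>\<^bsub>D\<^esub> (u' \<cdot>\<^bsub>D\<^esub> h')" using k by simp
      then show ?thesis using A h oB by (simp add: target.cat target.reduce[OF A(5)])
    qed
  qed
qed

section \<open>Additive categories\<close>

context additive_category
begin

abbreviation add (infixl "\<boxplus>" 60) where "f \<boxplus> g \<equiv> Add C f g"

lemma hom_group_simps:
  "carrier (hom_group C A B) = Hom C A B" "mult (hom_group C A B) = Add C" "one (hom_group C A B) =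
    Zero C A B"
  by (simp_all add: hom_group_def)

definition neg where "neg f = inv\<^bsub>hom_group C (Dom C f) (Cod C f)\<^esub> f"

definition sub (infixl "\<boxminus>" 60) where "f \<boxminus> g = f \<boxplus> neg g"

lemma add_Hom: "\<lbrakk>f \<in> Hom C A B; g \<in> Hom C A B\<rbrakk> \<Longrightarrow> f \<boxplus> g \<in> Hom C A B"
  using comm_group.axioms(2)[OF hom_comm_group[OF Hom_Obj[of f A B]]] Hom_Obj[of f A B]
    monoid.m_closed[of "hom_group C A B" f g] by (simp add: hom_group_def group_def)

lemma zero_Hom: "\<lbrakk>A \<in> Obj C; B \<in> Obj C\<rbrakk> \<Longrightarrow> Zero C A B \<in> Hom C A B"
  using comm_group.axioms(2)[OF hom_comm_group[of A B]] monoid.one_closed[of "hom_group C A B"]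
  by (simp add: hom_group_def group_def)

lemma neg_Hom: "f \<in> Hom C A B \<Longrightarrow> neg f \<in> Hom C A B"
  using comm_group.axioms(2)[OF hom_comm_group[OF Hom_Obj[of f A B]]]
    group.inv_closed[of "hom_group C A B" f] unfolding neg_def hom_group_def by (simp add: Hom_def)

lemma add_assoc: "\<lbrakk>f \<in> Hom C A B; g \<in> Hom C A B; h \<in> Hom C A B\<rbrakk> \<Longrightarrow> f \<boxplus> g \<boxplus> h = f \<boxplus> (g \<boxplus> h)"
  using comm_group.axioms(2)[OF hom_comm_group[OF Hom_Obj[of f A B]]]
    monoid.m_assoc[of "hom_group C A B" f g h] by (simp add: hom_group_def group_def)

lemma add_comm: "\<lbrakk>f \<in> Hom C A B; g \<in> Hom C A B\<rbrakk> \<Longrightarrow> f \<boxplus> g = g \<boxplus> f"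
  using comm_group.axioms(1)[OF hom_comm_group[OF Hom_Obj[of f A B]]]
    comm_monoid.m_comm[of "hom_group C A B" f g] by (simp add: hom_group_def)

lemma add_zero: "f \<in> Hom C A B \<Longrightarrow> f \<boxplus> Zero C A B = f" "f \<in> Hom C A B \<Longrightarrow> Zero C A B \<boxplus> f = f"
  using comm_group.axioms(2)[OF hom_comm_group[OF Hom_Obj[of f A B]]]
    monoid.r_one[of "hom_group C A B" f] monoid.l_one[of "hom_group C A B" f]
  by (simp_all add: hom_group_def group_def)

lemma add_neg: "f \<in> Hom C A B \<Longrightarrow> f \<boxplus> neg f = Zero C A B" "f \<in> Hom C A B \<Longrightarrow> neg f \<boxplus> f = Zero C A B"
  using comm_group.axioms(2)[OF hom_comm_group[OF Hom_Obj[of f A B]]]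
    group.r_inv[of "hom_group C A B" f] group.l_inv[of "hom_group C A B" f]
  unfolding neg_def by (simp_all add: hom_group_def Hom_def)

lemma add_cancel: 
  assumes "f \<in> Hom C A B" "g \<in> Hom C A B" "h \<in> Hom C A B" "f \<boxplus> g = f \<boxplus> h"
  shows "g = h"
proof -
  have eq: "neg f \<boxplus> (f \<boxplus> k) = k" if "k \<in> Hom C A B" for k
    using add_assoc[OF neg_Hom[OF assms(1)] assms(1) that] add_neg(2)[OF assms(1)]
      add_zero(2)[OF that] by simp
  have "neg f \<boxplus> (f \<boxplus> g) = neg f \<boxplus> (f \<boxplus> h)" using assms by simp
  then show ?thesis using eq assms by metis
qed

lemma arr_add: "\<lbrakk>f \<in> Arr C; g \<in> Arr C; Dom C f = Dom C g; Cod C f = Cod C g\<rbrakk> \<Longrightarrow> f \<boxplus> g \<in> Arr C"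
  "\<lbrakk>f \<in> Arr C; g \<in> Arr C; Dom C f = Dom C g; Cod C f = Cod C g\<rbrakk> \<Longrightarrow> Dom C (f \<boxplus> g) = Dom C g"
  "\<lbrakk>f \<in> Arr C; g \<in> Arr C; Dom C f = Dom C g; Cod C f = Cod C g\<rbrakk> \<Longrightarrow> Cod C (f \<boxplus> g) = Cod C g"
  using add_Hom[of f "Dom C f" "Cod C f" g] by (auto simp: Hom_def)

lemma arr_neg: "f \<in> Arr C \<Longrightarrow> neg f \<in> Arr C"
  "f \<in> Arr C \<Longrightarrow> Dom C (neg f) = Dom C f" "f \<in> Arr C \<Longrightarrow> Cod C (neg f) = Cod C f"
  using neg_Hom[of f "Dom C f" "Cod C f"] by (auto simp: Hom_def)

lemma arr_zero: "\<lbrakk>A \<in> Obj C; B \<in> Obj C\<rbrakk> \<Longrightarrow> Zero C A B \<in> Arr C"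
  "\<lbrakk>A \<in> Obj C; B \<in> Obj C\<rbrakk> \<Longrightarrow> Dom C (Zero C A B) = A" "\<lbrakk>A \<in> Obj C; B \<in> Obj C\<rbrakk> \<Longrightarrow> Cod C (Zero C A B) = B"
  using zero_Hom by (auto simp: Hom_def)

lemma sub_Hom: "\<lbrakk>f \<in> Hom C A B; g \<in> Hom C A B\<rbrakk> \<Longrightarrow> f \<boxminus> g \<in> Hom C A B"
  unfolding sub_def by (intro add_Hom neg_Hom)

lemma arr_sub: "\<lbrakk>f \<in> Arr C; g \<in> Arr C; Dom C f = Dom C g; Cod C f = Cod C g\<rbrakk> \<Longrightarrow> f \<boxminus> g \<in> Arr C"
  "\<lbrakk>f \<in> Arr C; g \<in> Arr C; Dom C f = Dom C g; Cod C f = Cod C g\<rbrakk> \<Longrightarrow> Dom C (f \<boxminus> g) = Dom C g"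
  "\<lbrakk>f \<in> Arr C; g \<in> Arr C; Dom C f = Dom C g; Cod C f = Cod C g\<rbrakk> \<Longrightarrow> Cod C (f \<boxminus> g) = Cod C g"
  using sub_Hom[of f "Dom C f" "Cod C f" g] by (auto simp: Hom_def)

lemma comp_add: 
  "\<lbrakk>f \<in> Arr C; g \<in> Arr C; g' \<in> Arr C; Dom C g = Cod C f; Dom C g' = Cod C f; Cod C g = Cod C g'\<rbrakk>
     \<Longrightarrow> (g \<boxplus> g') \<cdot> f = g \<cdot> f \<boxplus> g' \<cdot> f"
  "\<lbrakk>f \<in> Arr C; f' \<in> Arr C; g \<in> Arr C; Cod C f = Dom C g; Cod C f' = Dom C g; Dom C f = Dom C f'\<rbrakk>
     \<Longrightarrow> g \<cdot> (f \<boxplus> f') = g \<cdot> f \<boxplus> g \<cdot> f'"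
  by (rule Comp_Add_left[of f "Dom C f" "Cod C f" g "Cod C g" g'],
      simp_all add: Hom_def,
      rule Comp_Add_right[of f "Dom C f" "Cod C f" f' g "Cod C g"], simp_all add: Hom_def)

lemma zero_unique: "\<lbrakk>f \<in> Hom C A B; f \<boxplus> f = f\<rbrakk> \<Longrightarrow> f = Zero C A B"
  using add_cancel[of f A B f "Zero C A B"] zero_Hom[OF Hom_Obj[of f A B]] by (simp add: add_zero)

lemma zero_comp: "\<lbrakk>f \<in> Arr C; Cod C f = A; B \<in> Obj C\<rbrakk> \<Longrightarrow> Zero C A B \<cdot> f = Zero C (Dom C f) B"
proof (rule zero_unique)
  assume a: "f \<in> Arr C" "Cod C f = A" "B \<in> Obj C"
  then have A: "A \<in> Obj C" by (auto simp: cat)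
  show "Zero C A B \<cdot> f \<in> Hom C (Dom C f) B" using a A by (simp add: cat arr_zero)
  have "Zero C A B \<boxplus> Zero C A B = Zero C A B" by (rule add_zero(1)[OF zero_Hom[OF A a(3)]])
  then show "Zero C A B \<cdot> f \<boxplus> Zero C A B \<cdot> f = Zero C A B \<cdot> f"
    using a A by (simp add: comp_add(1)[symmetric] arr_zero)
qed

lemma comp_zero: "\<lbrakk>f \<in> Arr C; Dom C f = B; A \<in> Obj C\<rbrakk> \<Longrightarrow> f \<cdot> Zero C A B = Zero C A (Cod C f)"
proof (rule zero_unique)
  assume a: "f \<in> Arr C" "Dom C f = B" "A \<in> Obj C"
  then have B: "B \<in> Obj C" by (auto simp: cat)
  show "f \<cdot> Zero C A B \<in> Hom C A (Cod C f)" using a B by (simp add: cat arr_zero)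
  have "Zero C A B \<boxplus> Zero C A B = Zero C A B" by (rule add_zero(1)[OF zero_Hom[OF a(3) B]])
  then show "f \<cdot> Zero C A B \<boxplus> f \<cdot> Zero C A B = f \<cdot> Zero C A B"
    using a B by (simp add: comp_add(2)[symmetric] arr_zero)
qed

lemma neg_unique: "\<lbrakk>f \<in> Hom C A B; g \<in> Hom C A B; f \<boxplus> g = Zero C A B\<rbrakk> \<Longrightarrow> g = neg f"
  by (rule add_cancel[of f A B]) (simp_all add: neg_Hom add_neg)

lemma neg_comp: "\<lbrakk>f \<in> Arr C; g \<in> Arr C; Cod C f = Dom C g\<rbrakk> \<Longrightarrow> neg g \<cdot> f = neg (g \<cdot> f)"
  by (rule neg_unique[of _ "Dom C f" "Cod C g"])
    (simp_all add: cat arr_neg comp_add(1)[symmetric] add_neg[OF Hom_arr] zero_comp)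

lemma comp_neg: "\<lbrakk>f \<in> Arr C; g \<in> Arr C; Cod C f = Dom C g\<rbrakk> \<Longrightarrow> g \<cdot> neg f = neg (g \<cdot> f)"
  by (rule neg_unique[of _ "Dom C f" "Cod C g"])
    (simp_all add: cat arr_neg comp_add(2)[symmetric] add_neg[OF Hom_arr] comp_zero)

lemma neg_neg: "f \<in> Arr C \<Longrightarrow> neg (neg f) = f"
  by (rule neg_unique[symmetric, of _ "Dom C f" "Cod C f"]) (simp_all add: cat arr_neg add_neg[OF Hom_arr])

lemma neg_Zero: "A \<in> Obj C \<Longrightarrow> B \<in> Obj C \<Longrightarrow> neg (Zero C A B) = Zero C A B"
  by (rule neg_unique[symmetric, OF zero_Hom zero_Hom]) (auto intro: add_zero zero_Hom)

lemma comp_sub: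
  "\<lbrakk>f \<in> Arr C; g \<in> Arr C; g' \<in> Arr C; Dom C g = Cod C f; Dom C g' = Cod C f; Cod C g = Cod C g'\<rbrakk>
     \<Longrightarrow> (g \<boxminus> g') \<cdot> f = g \<cdot> f \<boxminus> g' \<cdot> f"
  "\<lbrakk>f \<in> Arr C; f' \<in> Arr C; g \<in> Arr C; Cod C f = Dom C g; Cod C f' = Dom C g; Dom C f = Dom C f'\<rbrakk>
     \<Longrightarrow> g \<cdot> (f \<boxminus> f') = g \<cdot> f \<boxminus> g \<cdot> f'"
  unfolding sub_def by (simp_all add: comp_add arr_neg neg_comp comp_neg)

lemma sub_eq_zero_iff:
  assumes "f \<in> Hom C A B" "g \<in> Hom C A B"
  shows "f \<boxminus> g = Zero C A B \<longleftrightarrow> f = g"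
proof
  assume "f \<boxminus> g = Zero C A B"
  then have "neg g \<boxplus> f = Zero C A B" using assms unfolding sub_def by (metis add_comm neg_Hom)
  then have "f = neg (neg g)" using assms by (intro neg_unique[of _ A B] neg_Hom)
  then show "f = g" using assms by (simp add: neg_neg Hom_def)
qed (use assms in \<open>simp add: sub_def add_neg\<close>)

lemma add_sub_cancel: "\<lbrakk>f \<in> Hom C A B; g \<in> Hom C A B\<rbrakk> \<Longrightarrow> f \<boxminus> g \<boxplus> g = f"
  unfolding sub_def by (simp add: add_assoc[of _ A B] neg_Hom add_neg add_zero)

lemma sub_zero: "f \<in> Hom C A B \<Longrightarrow> f \<boxminus> Zero C A B = f"
  using add_sub_cancel[of f A B "Zero C A B"] zero_Hom[OF Hom_Obj[of f A B]] sub_Hom[of f A B]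
  by (simp add: add_zero)

lemma zero_object_zero: "\<lbrakk>zero_object C Z; f \<in> Hom C A Z\<rbrakk> \<Longrightarrow> f = Zero C A Z"
  "\<lbrakk>zero_object C Z; g \<in> Hom C Z A\<rbrakk> \<Longrightarrow> g = Zero C Z A"
  using zero_object_eq[of Z f A] zero_object_eq'[of Z g A] zero_Hom[OF Hom_Obj[of f A Z]]
    zero_Hom[OF Hom_Obj[of g Z A]]
  by blast+

lemma zero_object_iff_Id: "A \<in> Obj C \<Longrightarrow> zero_object C A \<longleftrightarrow> Id C A = Zero C A A"
proof
  assume A: "A \<in> Obj C" and eq: "Id C A = Zero C A A"
  have 1: "f = Zero C B A" if "f \<in> Hom C B A" for f B
  proof -
    have "f = Id C A \<cdot> f" using that by (simp add: cat)
    also have "\<dots> = Zero C B A" unfolding eq using that A by (simp add: zero_comp Hom_def)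
    finally show ?thesis .
  qed
  have 2: "f = Zero C A B" if "f \<in> Hom C A B" for f B
  proof -
    have "f = f \<cdot> Id C A" using that by (simp add: cat)
    also have "\<dots> = Zero C A B" unfolding eq using that A by (simp add: comp_zero Hom_def)
    finally show ?thesis .
  qed
  show "zero_object C A" unfolding zero_object_def using A 1 2 zero_Hom by blast
qed (use Id_in_Hom zero_object_zero in blast)

lemmas addcat = cat arr_add arr_neg arr_zero arr_sub

subsection \<open>Projections and supports\<close>

lemma coproduct_proj:
  assumes c: "is_coproduct C I X Y \<iota>" and j: "j \<in> I"
  obtains p where "p \<in> Hom C Y (X j)" "p \<cdot> \<iota> j = Id C (X j)"
    "\<And>i. i \<in> I \<Longrightarrow> i \<noteq> j \<Longrightarrow> p \<cdot> \<iota> i = Zero C (X i) (X j)"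
proof -
  let ?f = "\<lambda>i. if i = j then Id C (X j) else Zero C (X i) (X j)"
  have "?f i \<in> Hom C (X i) (X j)" if "i \<in> I" for i
    using coproduct_summand[OF c that] coproduct_summand[OF c j] by (auto simp: addcat)
  then obtain p where "p \<in> Hom C Y (X j)" "\<And>i. i \<in> I \<Longrightarrow> p \<cdot> \<iota> i = ?f i"
    using coproduct_copair[OF c coproduct_summand[OF c j], of ?f] by blast
  then show ?thesis using that j by simp
qed

lemma coproduct_projs:
  assumes c: "is_coproduct C I X Y \<iota>"
  shows "\<exists>p. \<forall>j\<in>I. p j \<in> Hom C Y (X j) \<and> p j \<cdot> \<iota> j = Id C (X j) \<and>
    (\<forall>i\<in>I. i \<noteq> j \<longrightarrow> p j \<cdot> \<iota> i = Zero C (X i) (X j))"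
  by (rule bchoice) (use coproduct_proj[OF c] in metis)

text \<open>\<open>e\<close> is the idempotent of \<open>Y\<close> that projects to the summands in
  \<open>J\<close>. It is the standard test endomorphism for \<open>supported\<close>.\<close>

lemma coproduct_trunc:
  assumes c: "is_coproduct C I X Y \<iota>"
  obtains e where "e \<in> Hom C Y Y" "\<And>j. j \<in> I \<Longrightarrow> j \<in> J \<Longrightarrow> e \<cdot> \<iota> j = \<iota> j"
    "\<And>i. i \<in> I \<Longrightarrow> i \<notin> J \<Longrightarrow> e \<cdot> \<iota> i = Zero C (X i) Y"
proof -
  let ?f = "\<lambda>i. if i \<in> J then \<iota> i else Zero C (X i) Y"
  have "?f i \<in> Hom C (X i) Y" if "i \<in> I" for i
    using coproduct_summand[OF c that] coproduct_incl[OF c that] coproduct_Obj[OF c] by (auto simp: addcat)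
  then obtain e where "e \<in> Hom C Y Y" "\<And>i. i \<in> I \<Longrightarrow> e \<cdot> \<iota> i = ?f i"
    using coproduct_copair[OF c coproduct_Obj[OF c], of ?f] by blast
  then show ?thesis using that by simp
qed

text \<open>
  The arrow \<open>y: A \<rightarrow> Y\<close> into a coproduct factors through the sub-coproduct indexed by \<open>J\<close>. Phrased
  in terms of endomorphisms of \<open>Y\<close>, this needs neither finite sums nor the sub-coproduct.
\<close>

definition supported :: "'i set \<Rightarrow> ('i \<Rightarrow> 'm) \<Rightarrow> 'm \<Rightarrow> bool" where
  "supported J \<iota> y \<longleftrightarrow>
     (\<forall>e\<in>Hom C (Cod C y) (Cod C y). (\<forall>j\<in>J. e \<cdot> \<iota> j = \<iota> j) \<longrightarrow> e \<cdot> y = y)"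

lemma supportedD:
  "\<lbrakk>supported J \<iota> y; y \<in> Hom C A Y; e \<in> Hom C Y Y; \<And>j. j \<in> J \<Longrightarrow> e \<cdot> \<iota> j = \<iota> j\<rbrakk> \<Longrightarrow> e \<cdot> y = y"
  unfolding supported_def by (auto simp: Hom_def)

text \<open>\<open>k\<close> and \<open>k'\<close> agree after truncation to \<open>J\<close>, and
  truncation fixes \<open>y\<close>.\<close>

lemma supported_eq:
  assumes c: "is_coproduct C I X Y \<iota>" and s: "supported J \<iota> y" and J: "J \<subseteq> I"
    and y: "y \<in> Hom C A Y" and k: "k \<in> Hom C Y B" "k' \<in> Hom C Y B"
    and eq: "\<And>j. j \<in> J \<Longrightarrow> k \<cdot> \<iota> j = k' \<cdot> \<iota> j"
  shows "k \<cdot> y = k' \<cdot> y"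
proof -
  obtain e where e: "e \<in> Hom C Y Y" "\<And>j. j \<in> I \<Longrightarrow> j \<in> J \<Longrightarrow> e \<cdot> \<iota> j = \<iota> j"
    "\<And>i. i \<in> I \<Longrightarrow> i \<notin> J \<Longrightarrow> e \<cdot> \<iota> i = Zero C (X i) Y" using coproduct_trunc[OF c, where J = J] by blast
  have "k \<cdot> e = k' \<cdot> e"
  proof (rule coproduct_ext[OF c])
    fix i assume i: "i \<in> I"
    show "(k \<cdot> e) \<cdot> \<iota> i = (k' \<cdot> e) \<cdot> \<iota> i"
      using e(1) e(2,3)[OF i] k coproduct_incl[OF c i] coproduct_summand[OF c i] eq[of i] 
      by (cases "i \<in> J") (simp_all add: cat comp_zero)
  qed (use e k in \<open>simp_all add: cat\<close>)
  moreover have "e \<cdot> y = y" using supportedD[OF s y e(1)] e(2) J by blast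
  ultimately show ?thesis using k e(1) y by (metis Comp_assoc)
qed

text \<open>This replaces writing \<open>y\<close> as the finite sum of its components. The
  truncation to a subset K of \<open>J\<close> grows by \<open>\<iota> j \<cdot> p\<close> when j is
  added to K, starting from zero for the empty set, and the truncation to \<open>J\<close> fixes
  \<open>y\<close>.\<close>

lemma supported_induct:
  assumes c: "is_coproduct C I X Y \<iota>" and s: "supported J \<iota> y" and J: "J \<subseteq> I" and fin: "finite J"
    and y: "y \<in> Hom C A Y" and zero: "P (Zero C A Y)"
    and step: "\<And>j p a. \<lbrakk>j \<in> J; p \<in> Hom C Y (X j); p \<cdot> \<iota> j = Id C (X j);
        \<And>i. i \<in> I \<Longrightarrow> i \<noteq> j \<Longrightarrow> p \<cdot> \<iota> i = Zero C (X i) (X j); a \<in> Hom C A Y; P a\<rbrakk>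
      \<Longrightarrow> P (a \<boxplus> \<iota> j \<cdot> (p \<cdot> y))"
  shows "P y"
proof -
  have oA: "A \<in> Obj C" "Y \<in> Obj C" using Hom_Obj[OF y] .
  have "\<forall>e. e \<in> Hom C Y Y \<longrightarrow> (\<forall>j\<in>I. e \<cdot> \<iota> j = (if j \<in> K then \<iota> j else Zero C (X j) Y)) \<longrightarrow> P (e \<cdot> y)"
    if "K \<subseteq> J" for K
    using finite_subset[OF that fin] that
  proof (induction K rule: finite_induct)
    case empty
    show ?case
    proof (intro allI impI)
      fix e assume e: "e \<in> Hom C Y Y" "\<forall>j\<in>I. e \<cdot> \<iota> j = (if j \<in> {} then \<iota> j else Zero C (X j) Y)"
      have "e = Zero C Y Y"
        by (rule coproduct_ext[OF c e(1) zero_Hom])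
          (use e coproduct_incl[OF c] oA in \<open>auto simp: addcat zero_comp\<close>)
      then show "P (e \<cdot> y)" using y oA zero by (simp add: cat zero_comp)
    qed
  next
    case (insert j K)
    show ?case
    proof (intro allI impI)
      fix e assume e: "e \<in> Hom C Y Y" "\<forall>i\<in>I. e \<cdot> \<iota> i = (if i \<in> insert j K then \<iota> i else Zero C (X i) Y)"
      have jI: "j \<in> I" using insert J by blast
      obtain p where p: "p \<in> Hom C Y (X j)" "p \<cdot> \<iota> j = Id C (X j)"
        "\<And>i. i \<in> I \<Longrightarrow> i \<noteq> j \<Longrightarrow> p \<cdot> \<iota> i = Zero C (X i) (X j)" using coproduct_proj[OF c jI] by blast
      obtain e' where e': "e' \<in> Hom C Y Y" "\<And>i. i \<in> I \<Longrightarrow> i \<in> K \<Longrightarrow> e' \<cdot> \<iota> i = \<iota> i"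
        "\<And>i. i \<in> I \<Longrightarrow> i \<notin> K \<Longrightarrow> e' \<cdot> \<iota> i = Zero C (X i) Y" using coproduct_trunc[OF c, where J = K] by blast
      have P: "P (e' \<cdot> y)" using insert e' by auto
      note ij = coproduct_incl[OF c jI] and oj = coproduct_summand[OF c jI]
      have "e = e' \<boxplus> \<iota> j \<cdot> p"
      proof (rule coproduct_ext[OF c e(1)])
        show "e' \<boxplus> \<iota> j \<cdot> p \<in> Hom C Y Y" using e' p ij by (simp add: addcat)
        fix i assume i: "i \<in> I"
        note ii = coproduct_incl[OF c i] and oi = coproduct_summand[OF c i]
        have 1: "(e' \<boxplus> \<iota> j \<cdot> p) \<cdot> \<iota> i = e' \<cdot> \<iota> i \<boxplus> \<iota> j \<cdot> (p \<cdot> \<iota> i)"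
          using e' p(1) ij ii by (simp add: addcat comp_add)
        show "e \<cdot> \<iota> i = (e' \<boxplus> \<iota> j \<cdot> p) \<cdot> \<iota> i"
        proof (cases "i = j")
          case True
          then show ?thesis unfolding 1 using insert e'(3)[OF i] e(2) i ij oj p(2) oA
            by (simp add: cat add_zero[of _ "X j" Y])
        next
          case False
          then have "e \<cdot> \<iota> i = e' \<cdot> \<iota> i" using e(2) e'(2,3)[OF i] i by auto
          moreover have "\<iota> j \<cdot> (p \<cdot> \<iota> i) = Zero C (X i) Y" using p(3)[OF i False] ij oi oj
              by (simp add: cat comp_zero)
          moreover have "e' \<cdot> \<iota> i \<in> Hom C (X i) Y" using e' ii by (simp add: cat)
          ultimately show ?thesis unfolding 1 by (simp add: add_zero)
        qed
      qed
      then have "e \<cdot> y = e' \<cdot> y \<boxplus> \<iota> j \<cdot> (p \<cdot> y)" using e'(1) p(1) ij y by (simp add: addcat comp_add)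
      moreover have "e' \<cdot> y \<in> Hom C A Y" using e'(1) y by (simp add: cat)
      ultimately show "P (e \<cdot> y)" using step[OF _ p _ P] insert(4) by simp
    qed
  qed
  moreover obtain e where e: "e \<in> Hom C Y Y" "\<And>j. j \<in> I \<Longrightarrow> j \<in> J \<Longrightarrow> e \<cdot> \<iota> j = \<iota> j"
    "\<And>i. i \<in> I \<Longrightarrow> i \<notin> J \<Longrightarrow> e \<cdot> \<iota> i = Zero C (X i) Y" using coproduct_trunc[OF c, where J = J] by blast
  ultimately have "P (e \<cdot> y)" using subset_refl[of J] by (metis (full_types))
  moreover have "e \<cdot> y = y" using supportedD[OF s y e(1)] e(2) J by blast
  ultimately show ?thesis by simp
qed

lemma supported_zero:
  assumes c: "is_coproduct C I X Y \<iota>" and s: "supported J \<iota> y" and J: "J \<subseteq> I" and fin: "finite J"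
    and y: "y \<in> Hom C A Y"
    and p: "\<And>j. j \<in> J \<Longrightarrow> \<exists>p\<in>Hom C Y (X j). p \<cdot> \<iota> j = Id C (X j) \<and> (\<forall>i\<in>I. i \<noteq> j \<longrightarrow> p \<cdot> \<iota> i =
      Zero C (X i) (X j)) \<and> p \<cdot> y = Zero C A (X j)"
  shows "y = Zero C A Y"
proof (rule supported_induct[OF c s J fin y])
  fix j p a assume j: "j \<in> J" and q: "p \<in> Hom C Y (X j)" "p \<cdot> \<iota> j = Id C (X j)"
    "\<And>i. i \<in> I \<Longrightarrow> i \<noteq> j \<Longrightarrow> p \<cdot> \<iota> i = Zero C (X i) (X j)" and a: "a = Zero C A Y"
  have jI: "j \<in> I" using j J by blast
  obtain p' where p': "p' \<in> Hom C Y (X j)" "p' \<cdot> \<iota> j = Id C (X j)" "\<forall>i\<in>I. i \<noteq> j \<longrightarrow> p' \<cdot> \<iota> i =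
      Zero C (X i) (X j)"
    "p' \<cdot> y = Zero C A (X j)" using assms(6)[OF j] by blast
  have "p = p'" by (rule coproduct_ext[OF c q(1) p'(1)]) (use q p' in metis)
  then show "a \<boxplus> \<iota> j \<cdot> (p \<cdot> y) = Zero C A Y" unfolding a using p'(4) coproduct_incl[OF c jI] Hom_Obj[OF y]
    by (simp add: comp_zero Hom_def add_zero[OF zero_Hom])
qed simp

text \<open>The sub-coproduct over \<open>J\<close> is a retract of \<open>Y\<close>, and arrows
  supported on \<open>J\<close> pass through it. With \<open>J\<close> finite and compact summands
  this is how a compact object takes the place of \<open>Y\<close>.\<close>

lemma coproduct_finite_part:
  assumes c: "is_coproduct C I X Y \<iota>" and d: "is_coproduct C J X W \<kappa>" and J: "J \<subseteq> I"
  obtains l p where "l \<in> Hom C W Y" "p \<in> Hom C Y W" "p \<cdot> l = Id C W"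
    "\<And>j. j \<in> J \<Longrightarrow> l \<cdot> \<kappa> j = \<iota> j" "\<And>j. j \<in> J \<Longrightarrow> p \<cdot> \<iota> j = \<kappa> j"
    "\<And>A y. y \<in> Hom C A Y \<Longrightarrow> supported J \<iota> y \<Longrightarrow> l \<cdot> (p \<cdot> y) = y"
proof -
  have "\<iota> j \<in> Hom C (X j) Y" if "j \<in> J" for j using coproduct_incl[OF c] that J by blast
  then obtain l where l: "l \<in> Hom C W Y" "\<And>j. j \<in> J \<Longrightarrow> l \<cdot> \<kappa> j = \<iota> j"
    using coproduct_copair[OF d coproduct_Obj[OF c], of \<iota>] by blast
  let ?f = "\<lambda>i. if i \<in> J then \<kappa> i else Zero C (X i) W"
  have "?f i \<in> Hom C (X i) W" if "i \<in> I" for i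
    using coproduct_incl[OF d] coproduct_Obj[OF d] coproduct_summand[OF c that] by (auto simp: addcat)
  then obtain p where p: "p \<in> Hom C Y W" "\<And>i. i \<in> I \<Longrightarrow> p \<cdot> \<iota> i = ?f i"
    using coproduct_copair[OF c coproduct_Obj[OF d], of ?f] by blast
  have pj: "p \<cdot> \<iota> j = \<kappa> j" if "j \<in> J" for j using p(2)[of j] that J by auto
  have "p \<cdot> l = Id C W"
  proof (rule coproduct_ext[OF d])
    fix j assume j: "j \<in> J"
    show "(p \<cdot> l) \<cdot> \<kappa> j = Id C W \<cdot> \<kappa> j"
      using p(1) l(1) coproduct_incl[OF d j] coproduct_Obj[OF d] by (simp add: cat l(2)[OF j] pj[OF j])
  qed (use p l coproduct_Obj[OF d] in \<open>simp_all add: cat\<close>)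
  moreover have "l \<cdot> (p \<cdot> y) = y" if y: "y \<in> Hom C A Y" "supported J \<iota> y" for A y
  proof -
    have "(l \<cdot> p) \<cdot> y = y"
    proof (rule supportedD[OF y(2,1)])
      fix j assume j: "j \<in> J"
      have "\<iota> j \<in> Hom C (X j) Y" using coproduct_incl[OF c] j J by blast
      then show "(l \<cdot> p) \<cdot> \<iota> j = \<iota> j" using p(1) l(1) by (simp add: cat pj[OF j] l(2)[OF j])
    qed (use p l in \<open>simp add: cat\<close>)
    then show ?thesis using p l y by (simp add: cat)
  qed
  ultimately show ?thesis using that l p(1) pj by blast
qed

subsection \<open>Compact objects\<close>

lemma comp_finprod:
  assumes "finite S" "\<And>i. i \<in> S \<Longrightarrow> f i \<in> Hom C A Y" "k \<in> Hom C Y B" "A \<in> Obj C"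
  shows "finprod (hom_group C A Y) f S \<in> Hom C A Y \<and>
    k \<cdot> finprod (hom_group C A Y) f S = finprod (hom_group C A B) (\<lambda>i. k \<cdot> f i) S"
  using assms(1,2)
proof (induction S rule: finite_induct)
  case empty
  note o = Hom_Obj[OF assms(3)]
  interpret Y: comm_group "hom_group C A Y" using hom_comm_group assms(4) o by blast
  interpret B: comm_group "hom_group C A B" using hom_comm_group assms(4) o by blast
  show ?case unfolding Y.finprod_empty B.finprod_empty hom_group_simps
    using assms(3,4) o by (simp add: comp_zero zero_Hom arr_zero Hom_def)
next
  case (insert i S)
  note o = Hom_Obj[OF assms(3)]
  interpret Y: comm_group "hom_group C A Y" using hom_comm_group assms(4) o by blast
  interpret B: comm_group "hom_group C A B" using hom_comm_group assms(4) o by blast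
  have i: "f i \<in> Hom C A Y" "k \<cdot> f i \<in> Hom C A B" "\<And>j. j \<in> S \<Longrightarrow> k \<cdot> f j \<in> Hom C A B"
    using insert(4) assms(3) by (auto simp: cat)
  have 1: "finprod (hom_group C A Y) f (insert i S) = f i \<boxplus> finprod (hom_group C A Y) f S"
    using Y.finprod_insert[OF insert(1,2), of f] insert i by (auto simp: hom_group_simps)
  have 2: "finprod (hom_group C A B) (\<lambda>i. k \<cdot> f i) (insert i S) = k \<cdot> f i \<boxplus> finprod (hom_group C A
      B) (\<lambda>i. k \<cdot> f i) S"
    using B.finprod_insert[OF insert(1,2), of "\<lambda>i. k \<cdot> f i"] i by (auto simp: hom_group_simps)
  have IH: "finprod (hom_group C A Y) f S \<in> Hom C A Y"
    "finprod (hom_group C A B) (\<lambda>i. k \<cdot> f i) S = k \<cdot> finprod (hom_group C A Y) f S"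
    using insert.IH insert.prems by auto
  show ?case unfolding 1 2 IH(2) using i(1) IH(1) assms(3) by (simp add: addcat comp_add)
qed

lemma gfinprod_eq:
  assumes "finite S" "S \<subseteq> I" "\<And>i. i \<in> I \<Longrightarrow> f i \<in> Hom C A Y" "\<And>i. i \<in> I \<Longrightarrow> i \<notin> S \<Longrightarrow> f i = Zero C A Y"
    "A \<in> Obj C" "Y \<in> Obj C"
  shows "gfinprod (hom_group C A Y) f I = finprod (hom_group C A Y) f S"
proof -
  interpret Y: comm_group "hom_group C A Y" using hom_comm_group assms by blast
  have "{i \<in> I. f i \<noteq> \<one>\<^bsub>hom_group C A Y\<^esub>} \<subseteq> S" using assms(4) by (auto simp: hom_group_def)
  then have "finite {i \<in> I. f i \<noteq> \<one>\<^bsub>hom_group C A Y\<^esub>}" using assms(1) finite_subset by blast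
  then have "gfinprod (hom_group C A Y) f I = finprod (hom_group C A Y) f {i \<in> I. f i \<noteq> \<one>\<^bsub>hom_group C A Y\<^esub>}"
    by (simp add: gfinprod_def)
  also have "\<dots> = finprod (hom_group C A Y) f S"
    by (rule Y.finprod_mono_neutral_cong_left)
      (use assms in \<open>auto simp: hom_group_simps\<close>)
  finally show ?thesis .
qed

text \<open>The bridge from the definition of compactness to supports. For every \<open>A\<close>
  the map \<Phi> is an injective homomorphism, since projections recover the components of a family.
  So bijectivity is a matter of surjectivity, that is, of finite supports.\<close>

lemma compact_object_supported_aux:
  assumes c: "is_coproduct C I X Y \<iota>" and A: "A \<in> Obj C"
  defines "\<Phi> \<equiv> \<lambda>f. gfinprod (hom_group C A Y) (\<lambda>i. \<iota> i \<cdot> f i) I"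
  shows "\<Phi> \<in> iso (sum_group I (\<lambda>i. hom_group C A (X i))) (hom_group C A Y) \<longleftrightarrow>
    (\<forall>y\<in>Hom C A Y. \<exists>J. finite J \<and> J \<subseteq> I \<and> supported J \<iota> y)"
proof -
  note inc = coproduct_incl[OF c] and oX = coproduct_summand[OF c] and oY = coproduct_Obj[OF c]
  interpret Y: comm_group "hom_group C A Y" using hom_comm_group A oY by blast
  have grp: "group (hom_group C A (X i))" if "i \<in> I" for i
    using hom_comm_group[OF A oX[OF that]] comm_group.axioms(2) by blast
  let ?S = "sum_group I (\<lambda>i. hom_group C A (X i))"
  have mem: "f \<in> carrier ?S \<longleftrightarrow> f \<in> (\<Pi>\<^sub>E i\<in>I. Hom C A (X i)) \<and> finite {i \<in> I. f i \<noteq> Zero C A (X i)}" for f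
    using carrier_sum_group[of I "\<lambda>i. hom_group C A (X i)"] grp by (simp add: hom_group_simps)
  have hom: "\<iota> i \<cdot> f i \<in> Hom C A Y" if "f \<in> carrier ?S" "i \<in> I" for f i
    using that inc[of i] by (auto simp: mem cat dest!: PiE_mem)
  have fin: "finite {i \<in> I. \<iota> i \<cdot> f i \<noteq> Zero C A Y}" if "f \<in> carrier ?S" for f
  proof (rule finite_subset)
    show "{i \<in> I. \<iota> i \<cdot> f i \<noteq> Zero C A Y} \<subseteq> {i \<in> I. f i \<noteq> Zero C A (X i)}"
      using inc A by (auto simp: comp_zero Hom_def)
  qed (use that mem in blast)
  have eq: "\<Phi> f = finprod (hom_group C A Y) (\<lambda>i. \<iota> i \<cdot> f i) S"
    if f: "f \<in> carrier ?S" and S: "finite S" "S \<subseteq> I" "\<And>i. i \<in> I \<Longrightarrow> i \<notin> S \<Longrightarrow> f i = Zero C A (X i)" for f S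
    unfolding \<Phi>_def
    by (rule gfinprod_eq[OF S(1,2) hom[OF f] _ A oY]) (use S(3) inc A in \<open>auto simp: comp_zero Hom_def\<close>)
  have in_Hom: "\<Phi> f \<in> Hom C A Y" if "f \<in> carrier ?S" for f
    using Y.gfinprod_closed[of "\<lambda>i. \<iota> i \<cdot> f i" I] hom[OF that] by (auto simp: hom_group_simps \<Phi>_def)
  have sup: "supported S \<iota> (\<Phi> f)"
    if f: "f \<in> carrier ?S" and S: "finite S" "S \<subseteq> I" "\<And>i. i \<in> I \<Longrightarrow> i \<notin> S \<Longrightarrow> f i = Zero C A (X i)" for f S
    unfolding supported_def
  proof (intro ballI impI)
    fix e assume "e \<in> Hom C (Cod C (\<Phi> f)) (Cod C (\<Phi> f))" and ej: "\<forall>j\<in>S. e \<cdot> \<iota> j = \<iota> j"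
    then have e: "e \<in> Hom C Y Y" using in_Hom[OF f] by (simp add: Hom_def)
    have eqS: "\<Phi> f = finprod (hom_group C A Y) (\<lambda>i. \<iota> i \<cdot> f i) S" by (rule eq[OF f S(1,2)]) (rule S(3))
    have h: "\<iota> i \<cdot> f i \<in> Hom C A Y" if "i \<in> S" for i using hom[OF f] S(2) that by blast
    have "e \<cdot> \<Phi> f = finprod (hom_group C A Y) (\<lambda>i. e \<cdot> (\<iota> i \<cdot> f i)) S"
      unfolding eqS by (rule comp_finprod[OF S(1) h e A, THEN conjunct2])
    also have "\<dots> = finprod (hom_group C A Y) (\<lambda>i. \<iota> i \<cdot> f i) S"
    proof (rule Y.finprod_cong')
      fix i assume i: "i \<in> S"
      then have "i \<in> I" "f i \<in> Hom C A (X i)" using f S(2) mem by auto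
      then show "e \<cdot> (\<iota> i \<cdot> f i) = \<iota> i \<cdot> f i" using e inc[of i] ej i
          by (simp add: Hom_def comp_assoc[symmetric])
    qed (use hom[OF f] S(2) in \<open>auto simp: hom_group_simps\<close>)
    finally show "e \<cdot> \<Phi> f = \<Phi> f" unfolding eqS .
  qed
  have proj: "p \<cdot> \<Phi> f = f j"
    if f: "f \<in> carrier ?S" and j: "j \<in> I" and p: "p \<in> Hom C Y (X j)" "p \<cdot> \<iota> j = Id C (X j)"
      "\<And>i. i \<in> I \<Longrightarrow> i \<noteq> j \<Longrightarrow> p \<cdot> \<iota> i = Zero C (X i) (X j)" for f j p
  proof -
    let ?T = "insert j {i \<in> I. f i \<noteq> Zero C A (X i)}"
    have T: "finite ?T" "?T \<subseteq> I" using f mem j by auto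
    have fj: "f i \<in> Hom C A (X i)" if "i \<in> I" for i using f mem that by auto
    interpret Xj: comm_group "hom_group C A (X j)" using hom_comm_group A oX j by blast
    have "p \<cdot> \<Phi> f = finprod (hom_group C A (X j)) (\<lambda>i. p \<cdot> (\<iota> i \<cdot> f i)) ?T"
      by (subst eq[OF f T], simp, rule comp_finprod[OF T(1) _ p(1) A, THEN conjunct2])
        (use hom[OF f] T(2) in blast)
    also have "\<dots> = finprod (hom_group C A (X j)) (\<lambda>i. if j = i then f j else \<one>\<^bsub>hom_group C A (X j)\<^esub>) ?T"
    proof (rule Xj.finprod_cong')
      fix i assume "i \<in> ?T"
      then have i: "i \<in> I" using T(2) by blast
      have "p \<cdot> (\<iota> i \<cdot> f i) = (p \<cdot> \<iota> i) \<cdot> f i" using p(1) inc[OF i] fj[OF i]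
          by (simp add: Hom_def comp_assoc)
      then show "p \<cdot> (\<iota> i \<cdot> f i) = (if j = i then f j else \<one>\<^bsub>hom_group C A (X j)\<^esub>)"
        using p(2) p(3)[OF i] fj[OF i] oX[OF j] by (auto simp: hom_group_simps cat zero_comp)
    qed (use fj j A oX in \<open>auto simp: hom_group_simps zero_Hom\<close>)
    also have "\<dots> = f j" by (rule Xj.finprod_singleton[of j ?T "\<lambda>_. f j"]) (use T fj j in \<open>auto simp:
        hom_group_simps\<close>)
    finally show ?thesis .
  qed
  show ?thesis
  proof
    assume "\<Phi> \<in> iso ?S (hom_group C A Y)"
    then have im: "\<Phi> ` carrier ?S = Hom C A Y" unfolding iso_def bij_betw_def hom_group_simps by blast
    show "\<forall>y\<in>Hom C A Y. \<exists>J. finite J \<and> J \<subseteq> I \<and> supported J \<iota> y"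
    proof
      fix y assume "y \<in> Hom C A Y"
      then obtain f where f: "f \<in> carrier ?S" "y = \<Phi> f" using im by blast
      have "supported {i \<in> I. f i \<noteq> Zero C A (X i)} \<iota> y"
        unfolding f(2) by (rule sup[OF f(1)]) (use f mem in auto)
      then show "\<exists>J. finite J \<and> J \<subseteq> I \<and> supported J \<iota> y"
        using f mem by (intro exI[of _ "{i \<in> I. f i \<noteq> Zero C A (X i)}"]) auto
    qed
  next
    assume s: "\<forall>y\<in>Hom C A Y. \<exists>J. finite J \<and> J \<subseteq> I \<and> supported J \<iota> y"
    obtain p where p: "\<And>j. j \<in> I \<Longrightarrow> p j \<in> Hom C Y (X j)" "\<And>j. j \<in> I \<Longrightarrow> p j \<cdot> \<iota> j = Id C (X j)"
      "\<And>j i. j \<in> I \<Longrightarrow> i \<in> I \<Longrightarrow> i \<noteq> j \<Longrightarrow> p j \<cdot> \<iota> i = Zero C (X i) (X j)"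
      using coproduct_projs[OF c] by blast
    have "\<Phi> \<in> hom ?S (hom_group C A Y)"
    proof (rule homI)
      fix f g assume fg: "f \<in> carrier ?S" "g \<in> carrier ?S"
      have m: "f i \<in> Hom C A (X i)" "g i \<in> Hom C A (X i)" if "i \<in> I" for i using fg mem that by auto
      have "\<Phi> (f \<otimes>\<^bsub>?S\<^esub> g) = gfinprod (hom_group C A Y) (\<lambda>i. \<iota> i \<cdot> f i \<boxplus> \<iota> i \<cdot> g i) I"
        unfolding \<Phi>_def
      proof (rule Y.gfinprod_cong)
        show "(\<lambda>i. \<iota> i \<cdot> (f \<otimes>\<^bsub>?S\<^esub> g) i) \<in> I \<rightarrow> carrier (hom_group C A Y)"
        proof
          fix i assume i: "i \<in> I"
          then show "\<iota> i \<cdot> (f \<otimes>\<^bsub>?S\<^esub> g) i \<in> carrier (hom_group C A Y)"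
            using Comp_in_Hom[OF add_Hom[OF m[OF i]] inc[OF i]] by (simp add: hom_group_simps)
        qed
        show "i \<in> I =simp=> \<iota> i \<cdot> (f \<otimes>\<^bsub>?S\<^esub> g) i = \<iota> i \<cdot> f i \<boxplus> \<iota> i \<cdot> g i" for i
          using m[of i] inc[of i] by (auto simp: simp_implies_def hom_group_simps comp_add Hom_def)
      qed simp
      also have "\<dots> = \<Phi> f \<boxplus> \<Phi> g"
        using Y.gfinprod_distrib[of I "\<lambda>i. \<iota> i \<cdot> f i" "\<lambda>i. \<iota> i \<cdot> g i"] fin fg hom
        unfolding \<Phi>_def by (auto simp: hom_group_simps)
      finally show "\<Phi> (f \<otimes>\<^bsub>?S\<^esub> g) = \<Phi> f \<otimes>\<^bsub>hom_group C A Y\<^esub> \<Phi> g" by (simp add: hom_group_simps)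
    qed (simp add: in_Hom hom_group_simps)
    moreover have "inj_on \<Phi> (carrier ?S)"
    proof (rule inj_onI)
      fix f g assume fg: "f \<in> carrier ?S" "g \<in> carrier ?S" "\<Phi> f = \<Phi> g"
      have "f \<in> (\<Pi>\<^sub>E i\<in>I. Hom C A (X i))" "g \<in> (\<Pi>\<^sub>E i\<in>I. Hom C A (X i))" using fg mem by auto
      then show "f = g"
      proof (rule PiE_ext)
        fix j assume j: "j \<in> I"
        then show "f j = g j"
          using proj[OF fg(1) j, of "p j"] proj[OF fg(2) j, of "p j"] p fg(3) by simp
      qed
    qed
    moreover have "\<Phi> ` carrier ?S = Hom C A Y"
    proof (intro equalityI subsetI)
      fix y assume y: "y \<in> Hom C A Y"
      then obtain J where J: "finite J" "J \<subseteq> I" "supported J \<iota> y" using s by blast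
      let ?f = "\<lambda>i\<in>I. if i \<in> J then p i \<cdot> y else Zero C A (X i)"
      have "{i \<in> I. ?f i \<noteq> Zero C A (X i)} \<subseteq> J" by auto
      then have f: "?f \<in> carrier ?S"
        unfolding mem using p(1) y A oX J(1) by (auto simp: addcat intro: finite_subset)
      have supf: "supported J \<iota> (\<Phi> ?f)" by (rule sup[OF f J(1,2)]) simp
      \<comment> \<open>\<open>?f\<close> collects the components of \<open>y\<close> on
        \<open>J\<close>. The difference is still supported on \<open>J\<close> and all its
        projections there vanish, so it is zero.\<close>
      have "supported J \<iota> (y \<boxminus> \<Phi> ?f)"
        unfolding supported_def
      proof (intro ballI impI)
        fix e assume e: "e \<in> Hom C (Cod C (y \<boxminus> \<Phi> ?f)) (Cod C (y \<boxminus> \<Phi> ?f))" "\<forall>j\<in>J. e \<cdot> \<iota> j = \<iota> j"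
        note H = y in_Hom[OF f]
        have eY: "e \<in> Hom C Y Y" using e(1) sub_Hom[OF H] by (simp add: Hom_def)
        have "e \<cdot> y = y" "e \<cdot> \<Phi> ?f = \<Phi> ?f"
          using supportedD[OF J(3) y eY] supportedD[OF supf in_Hom[OF f] eY] e(2) by blast+
        then show "e \<cdot> (y \<boxminus> \<Phi> ?f) = y \<boxminus> \<Phi> ?f" using H eY by (simp add: comp_sub Hom_def)
      qed
      then have "y \<boxminus> \<Phi> ?f = Zero C A Y"
      proof (rule supported_zero[OF c _ J(2,1) sub_Hom[OF y in_Hom[OF f]]])
        fix j assume j: "j \<in> J"
        then have jI: "j \<in> I" using J by blast
        have "p j \<cdot> \<Phi> ?f = p j \<cdot> y" using proj[OF f jI p(1)[OF jI] p(2)[OF jI] p(3)[OF jI]] j jI by simp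
        then have "p j \<cdot> (y \<boxminus> \<Phi> ?f) = p j \<cdot> y \<boxminus> p j \<cdot> y"
          using y in_Hom[OF f] p(1)[OF jI] by (simp add: comp_sub Hom_def)
        also have "\<dots> = Zero C A (X j)" using sub_eq_zero_iff[of "p j \<cdot> y" A "X j" "p j \<cdot> y"] y
            p(1)[OF jI] by (simp add: cat)
        finally show "\<exists>q\<in>Hom C Y (X j). q \<cdot> \<iota> j = Id C (X j) \<and> (\<forall>i\<in>I. i \<noteq> j \<longrightarrow> q \<cdot> \<iota> i =
            Zero C (X i) (X j)) \<and>
            q \<cdot> (y \<boxminus> \<Phi> ?f) = Zero C A (X j)" using p jI by blast
      qed
      then have "y = \<Phi> ?f" using sub_eq_zero_iff[OF y in_Hom[OF f]] by blast
      then show "y \<in> \<Phi> ` carrier ?S" using f by blast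
    qed (use in_Hom in blast)
    ultimately show "\<Phi> \<in> iso ?S (hom_group C A Y)"
      by (simp add: iso_def bij_betw_def hom_group_simps)
  qed
qed

lemma compact_object_supported:
  fixes U :: "'u set"
  assumes "compact_object U C A" and s: "small U I" and c: "is_coproduct C I X Y \<iota>" and y: "y \<in> Hom C A Y"
  obtains J where "finite J" "J \<subseteq> I" "supported J \<iota> y"
proof -
  obtain I' :: "'u set" and g where g: "bij_betw g I' I" "small U I'"
    using small_eqpoll_obtain[OF s] .
  have c': "is_coproduct C I' (\<lambda>j. X (g j)) Y (\<lambda>j. \<iota> (g j))" by (rule coproduct_reindex[OF c g(1)])
  have A: "A \<in> Obj C" using Hom_Obj(1)[OF y] .
  have "(\<lambda>f. gfinprod (hom_group C A Y) (\<lambda>i. \<iota> (g i) \<cdot> f i) I')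
    \<in> iso (sum_group I' (\<lambda>i. hom_group C A (X (g i)))) (hom_group C A Y)"
    using assms(1) g(2) c' unfolding compact_object_def by blast
  then obtain J where J: "finite J" "J \<subseteq> I'" "supported J (\<lambda>j. \<iota> (g j)) y"
    using compact_object_supported_aux[OF c' A] y by blast
  have "supported (g ` J) \<iota> y" using J(3) unfolding supported_def by simp
  moreover have "g ` J \<subseteq> I" using J(2) g(1) by (auto simp: bij_betw_def)
  ultimately show ?thesis using that J(1) by blast
qed

lemma compact_objectI:
  fixes U :: "'u set"
  assumes A: "A \<in> Obj C"
    and "\<And>(I :: 'u set) X Y \<iota> y. \<lbrakk>small U I; is_coproduct C I X Y \<iota>; y \<in> Hom C A Y\<rbrakk>
           \<Longrightarrow> \<exists>J. finite J \<and> J \<subseteq> I \<and> supported J \<iota> y"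
  shows "compact_object U C A"
  unfolding compact_object_def
proof (intro conjI allI impI A)
  fix I :: "'u set" and X Y \<iota>
  assume I: "small U I" and c: "is_coproduct C I X Y \<iota>"
  show "(\<lambda>f. gfinprod (hom_group C A Y) (\<lambda>i. \<iota> i \<cdot> f i) I)
    \<in> iso (sum_group I (\<lambda>i. hom_group C A (X i))) (hom_group C A Y)"
    unfolding compact_object_supported_aux[OF c A] using assms(2)[OF I c] by (rule ballI)
qed

end

section \<open>Triangulated categories\<close>

context
  fixes S T G Gm
  assumes S: "additive_category S" and T: "additive_category T" and add: "additive_functor S T G Gm"
begin

interpretation S: additive_category S by (fact S)
interpretation T: additive_category T by (fact T)
interpretation category_functor S T G Gm using add by (simp add: additive_functor_def)

lemma additive_functor_add:
  "f \<in> Hom S A B \<Longrightarrow> g \<in> Hom S A B \<Longrightarrow> Gm (Add S f g) = Add T (Gm f) (Gm g)"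
  using add S.Hom_Obj[of f A B] unfolding additive_functor_def hom_def by (simp add: hom_group_def)

lemma additive_functor_zero:
  assumes "A \<in> Obj S" "B \<in> Obj S"
  shows "Gm (Zero S A B) = Zero T (G A) (G B)"
proof (rule T.zero_unique)
  show "Gm (Zero S A B) \<in> Hom T (G A) (G B)" by (rule Gm_Hom[OF S.zero_Hom[OF assms]])
  show "Add T (Gm (Zero S A B)) (Gm (Zero S A B)) = Gm (Zero S A B)"
    using S.zero_Hom[OF assms] by (simp add: additive_functor_add[symmetric] S.add_zero)
qed

lemma additive_functor_neg:
  assumes f: "f \<in> Hom S A B"
  shows "Gm (S.neg f) = T.neg (Gm f)"
proof (rule T.neg_unique)
  show "Gm f \<in> Hom T (G A) (G B)" "Gm (S.neg f) \<in> Hom T (G A) (G B)" using Gm_Hom f S.neg_Hom by blast+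
  show "Add T (Gm f) (Gm (S.neg f)) = Zero T (G A) (G B)"
    using f S.Hom_Obj[OF f] S.neg_Hom[OF f]
    by (simp add: additive_functor_add[OF f S.neg_Hom[OF f], symmetric] S.add_neg additive_functor_zero)
qed

lemma additive_functor_sub:
  assumes "f \<in> Hom S A B" "g \<in> Hom S A B"
  shows "Gm (S.sub f g) = T.sub (Gm f) (Gm g)"
  unfolding S.sub_def T.sub_def
  using assms by (simp add: additive_functor_add[of f A B] S.neg_Hom additive_functor_neg[of g A B])

end

context triangulated_category
begin

notation add (infixl "\<boxplus>" 60)
notation sub (infixl "\<boxminus>" 60)

abbreviation SA where "SA \<equiv> Susp T"
abbreviation SM where "SM \<equiv> Susp_arr T"

lemma Susp_functor: "category_functor T T SA SM"
  using Susp_equivalence by (simp add: equivalence_functor_def)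

lemma SA_Obj: "A \<in> Obj T \<Longrightarrow> SA A \<in> Obj T"
  and SM_Hom: "f \<in> Hom T A B \<Longrightarrow> SM f \<in> Hom T (SA A) (SA B)"
  and SM_Id: "A \<in> Obj T \<Longrightarrow> SM (Id T A) = Id T (SA A)"
  and SM_Comp: "f \<in> Hom T A B \<Longrightarrow> g \<in> Hom T B D \<Longrightarrow> SM (g \<cdot> f) = SM g \<cdot> SM f"
  using category_functor.G_Obj[OF Susp_functor] category_functor.Gm_Hom[OF Susp_functor]
    category_functor.Gm_Id[OF Susp_functor] category_functor.Gm_Comp[OF Susp_functor] by blast+

lemma SM_arr: "f \<in> Arr T \<Longrightarrow> SM f \<in> Arr T" "f \<in> Arr T \<Longrightarrow> Dom T (SM f) = SA (Dom T f)"
  "f \<in> Arr T \<Longrightarrow> Cod T (SM f) = SA (Cod T f)"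
  using SM_Hom[OF Hom_arr] by (auto simp: Hom_def)

lemma SM_zero: "A \<in> Obj T \<Longrightarrow> B \<in> Obj T \<Longrightarrow> SM (Zero T A B) = Zero T (SA A) (SA B)"
  using additive_functor_zero[OF additive_category_axioms additive_category_axioms Susp_additive] .

lemma SM_sub: "f \<in> Hom T A B \<Longrightarrow> g \<in> Hom T A B \<Longrightarrow> SM (f \<boxminus> g) = SM f \<boxminus> SM g"
  using additive_functor_sub[OF additive_category_axioms additive_category_axioms Susp_additive] .

lemma SM_faithful: "\<lbrakk>SM f = SM g; f \<in> Hom T A B; g \<in> Hom T A B\<rbrakk> \<Longrightarrow> f = g"
  using Susp_equivalence Hom_Obj[of f A B] unfolding equivalence_functor_def bij_betw_def inj_on_def
    by blast

lemma SM_full: "\<lbrakk>k \<in> Hom T (SA A) (SA B); A \<in> Obj T; B \<in> Obj T\<rbrakk> \<Longrightarrow> \<exists>f\<in>Hom T A B. SM f = k"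
  using Susp_equivalence unfolding equivalence_functor_def bij_betw_def by (metis imageE)

lemma SA_ess: "B \<in> Obj T \<Longrightarrow> \<exists>A\<in>Obj T. isomorphic T (SA A) B"
  using Susp_equivalence unfolding equivalence_functor_def by blast

lemma SA_isomorphic_reflect:
  assumes "isomorphic T (SA A) (SA B)" "A \<in> Obj T" "B \<in> Obj T"
  shows "isomorphic T A B"
proof -
  obtain u v where u: "u \<in> Hom T (SA A) (SA B)" "v \<in> Hom T (SA B) (SA A)" "v \<cdot> u = Id T (SA A)"
      "u \<cdot> v = Id T (SA B)"
    using assms(1) unfolding isomorphic_def isomorphism_def by blast
  obtain f g where f: "f \<in> Hom T A B" "SM f = u" and g: "g \<in> Hom T B A" "SM g = v"
    using SM_full u(1,2) assms(2,3) by meson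
  have "SM (g \<cdot> f) = SM (Id T A)" "SM (f \<cdot> g) = SM (Id T B)"
    using f g u assms SM_Comp[OF f(1) g(1)] SM_Comp[OF g(1) f(1)] by (simp_all add: SM_Id)
  then have "g \<cdot> f = Id T A" "f \<cdot> g = Id T B"
    using SM_faithful[OF _ Comp_in_Hom[OF f(1) g(1)] Id_in_Hom[OF assms(2)]]
      SM_faithful[OF _ Comp_in_Hom[OF g(1) f(1)] Id_in_Hom[OF assms(3)]] by blast+
  then show ?thesis unfolding isomorphic_def using isomorphismI[OF f(1) g(1)] by blast
qed

lemma SA_zero_object: "zero_object T Z \<Longrightarrow> zero_object T (SA Z)"
  using zero_object_iff_Id SA_Obj SM_Id SM_zero by (metis zero_object_def)

lemma SA_coproduct: "is_coproduct T I X Y \<iota> \<Longrightarrow> is_coproduct T I (\<lambda>i. SA (X i)) (SA Y) (\<lambda>i. SM (\<iota> i))"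
  by (rule equivalence_preserves_coproduct[OF Susp_equivalence])

subsection \<open>Exact sequences\<close>

lemma triangleD: "triangle T A B C f g h \<Longrightarrow> f \<in> Hom T A B" "triangle T A B C f g h \<Longrightarrow> g \<in> Hom T B C"
  "triangle T A B C f g h \<Longrightarrow> h \<in> Hom T C (SA A)"
  unfolding triangle_def triangle_shape_def by blast+

lemma rotate:
  assumes "triangle T A B C f g h"
  shows "triangle T B C (SA A) g h (neg (SM f))"
proof -
  have "SM f \<in> Hom T (SA A) (SA B)" by (rule SM_Hom[OF triangleD(1)[OF assms]])
  then have "inv\<^bsub>hom_group T (SA A) (SA B)\<^esub> (SM f) = neg (SM f)" by (simp add: neg_def Hom_def)
  then show ?thesis using TR2_rotate[of A B C f g h] assms by (simp add: triangle_def)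
qed

text \<open>By TR3 the trivial triangle on \<open>A\<close> maps to the given one, and its third
  corner is a zero object through which \<open>g \<cdot> f\<close> then factors.\<close>

lemma triangle_comp:
  assumes t: "triangle T A B C f g h"
  shows "g \<cdot> f = Zero T A C"
proof -
  obtain Z where Z: "zero_object T Z" using ex_zero_object by blast
  note o = Hom_Obj[OF triangleD(1)[OF t]] Hom_Obj[OF triangleD(3)[OF t]]
  have "triangle T A A Z (Id T A) (Zero T A Z) (Zero T Z (SA A))" using TR1_Id[OF o(1) Z] .
  from TR3_morphism[OF this t Id_in_Hom[OF o(1)] triangleD(1)[OF t]] obtain c
    where "c \<in> Hom T Z C" "c \<cdot> Zero T A Z = g \<cdot> f" by blast
  then show ?thesis using o(1) by (simp add: comp_zero Hom_def)
qed

lemma triangle_comp_Susp: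
  assumes t: "triangle T A B C f g h"
  shows "SM f \<cdot> h = Zero T C (SA B)"
proof -
  note th = triangleD[OF t]
  have o: "C \<in> Obj T" "SA B \<in> Obj T" using Hom_Obj th SA_Obj by blast+
  have "neg (SM f) \<cdot> h = Zero T C (SA B)" by (rule triangle_comp[OF rotate[OF rotate[OF t]]])
  then have "neg (neg (SM f \<cdot> h)) = neg (Zero T C (SA B))" using th by (simp add: neg_comp SM_arr Hom_def)
  then show ?thesis using neg_neg[of "SM f \<cdot> h"] th neg_Zero[OF o] by (simp add: SM_arr cat)
qed

text \<open>TR3 only supplies the third arrow of a morphism of triangles, so the wanted
  \<open>x\<close> has to be moved there: the trivial triangle on \<open>D\<close> and the given one
  are both rotated, TR3 yields an arrow between suspensions, and full faithfulness desuspends it.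
  The signs from the two rotations cancel.\<close>

lemma exact1:
  assumes t: "triangle T A B C f g h" and y: "y \<in> Hom T D B" "g \<cdot> y = Zero T D C"
  shows "\<exists>x\<in>Hom T D A. f \<cdot> x = y"
proof -
  obtain Z where Z: "zero_object T Z" using ex_zero_object by blast
  then have oZ: "Z \<in> Obj T" by (simp add: zero_object_def)
  note o = Hom_Obj[OF triangleD(1)[OF t]] Hom_Obj[OF triangleD(3)[OF t]] Hom_Obj(1)[OF y(1)]
  note th = triangleD[OF t]
  have t1: "triangle T D Z (SA D) (Zero T D Z) (Zero T Z (SA D)) (neg (SM (Id T D)))"
    using rotate[OF TR1_Id[OF o(5) Z]] .
  have "Zero T Z C \<cdot> Zero T D Z = g \<cdot> y" using y(2) o oZ by (simp add: zero_comp arr_zero)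
  from TR3_morphism[OF t1 rotate[OF t] y(1) zero_Hom[OF oZ o(3)] this] obtain c
    where c: "c \<in> Hom T (SA D) (SA A)" "SM y \<cdot> neg (SM (Id T D)) = neg (SM f) \<cdot> c" by blast
  obtain x where x: "x \<in> Hom T D A" "SM x = c" using SM_full[OF c(1) o(5,1)] by blast
  have "SM y \<cdot> neg (SM (Id T D)) = neg (SM y)"
    using y(1) o SA_Obj[OF o(5)] by (simp add: SM_Id comp_neg cat SM_arr)
  moreover have "neg (SM f) \<cdot> c = neg (SM f \<cdot> c)"
    using c(1) th(1) by (simp add: neg_comp SM_arr Hom_def)
  ultimately have "neg (SM y) = neg (SM f \<cdot> c)" using c(2) by simp
  then have "SM y = SM f \<cdot> c"
  proof -
    assume e: "neg (SM y) = neg (SM f \<cdot> c)"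
    have "SM y \<in> Arr T" "SM f \<cdot> c \<in> Arr T" using c(1) y(1) th(1) by (simp_all add: SM_arr cat)
    then show ?thesis using e neg_neg by metis
  qed
  then have "SM (f \<cdot> x) = SM y" using SM_Comp[OF x(1) th(1)] x(2) by simp
  then have "f \<cdot> x = y" by (rule SM_faithful[OF _ Comp_in_Hom[OF x(1) th(1)] y(1)])
  then show ?thesis using x(1) by blast
qed

text \<open>The comparison is with the triangle from 0 to \<open>D\<close> to \<open>D\<close>,
  which is the trivial triangle on \<open>D\<close> rotated backwards. For the backward rotation the
  zero object of the trivial triangle must itself be a suspension, namely
  \<open>SA Z\<close>.\<close>

lemma exact2:
  assumes t: "triangle T A B C f g h" and y: "y \<in> Hom T B D" "y \<cdot> f = Zero T A D"
  shows "\<exists>x\<in>Hom T C D. x \<cdot> g = y"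
proof -
  obtain Z where Z: "zero_object T Z" using ex_zero_object by blast
  then have oZ: "Z \<in> Obj T" by (simp add: zero_object_def)
  note o = Hom_Obj[OF triangleD(1)[OF t]] Hom_Obj[OF triangleD(3)[OF t]] Hom_Obj(2)[OF y(1)]
  note th = triangleD[OF t]
  have "Zero T (SA Z) (SA D) = inv\<^bsub>hom_group T (SA Z) (SA D)\<^esub> (SM (Zero T Z D))"
    using zero_object_zero(2)[OF SA_zero_object[OF Z] neg_Hom[OF SM_Hom[OF zero_Hom[OF oZ o(5)]]]]
    using SM_Hom[OF zero_Hom[OF oZ o(5)]] by (simp add: neg_def Hom_def)
  then have "triangle T Z D D (Zero T Z D) (Id T D) (Zero T D (SA Z))"
    using TR2_rotate[of Z D D "Zero T Z D" "Id T D" "Zero T D (SA Z)"] TR1_Id[OF o(5) SA_zero_object[OF Z]]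
      zero_Hom Id_in_Hom oZ o(5) SA_Obj[OF oZ] by (simp add: triangle_shape_def)
  moreover have "y \<cdot> f = Zero T Z D \<cdot> Zero T A Z" using y(2) oZ o by (simp add: zero_comp arr_zero)
  ultimately obtain c where "c \<in> Hom T C D" "c \<cdot> g = Id T D \<cdot> y"
    using TR3_morphism[OF t _ zero_Hom[OF o(1) oZ] y(1)] by blast
  then show ?thesis using y(1) by (auto simp: cat)
qed

text \<open>The identity of \<open>SA A\<close> annihilates \<open>h\<close>, so it factors through
  the next arrow \<open>neg (SM f)\<close>; the factor, up to sign, desuspends to the
  retraction.\<close>

lemma split_mono_of_zero:
  assumes t: "triangle T A B C f g h" and h: "h = Zero T C (SA A)"
  shows "\<exists>r\<in>Hom T B A. r \<cdot> f = Id T A"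
proof -
  note th = triangleD[OF t]
  have o: "A \<in> Obj T" "B \<in> Obj T" "C \<in> Obj T" "SA A \<in> Obj T" "SA B \<in> Obj T"
    using Hom_Obj th SA_Obj by blast+
  have "Id T (SA A) \<cdot> h = Zero T C (SA A)" using h o by (simp add: addcat)
  then obtain x where x: "x \<in> Hom T (SA B) (SA A)" "x \<cdot> neg (SM f) = Id T (SA A)"
    using exact2[OF rotate[OF rotate[OF t]] Id_in_Hom[OF o(4)]] by blast
  then obtain r where r: "r \<in> Hom T B A" "SM r = neg x" using SM_full[OF neg_Hom o(2,1)] by blast
  have "SM (r \<cdot> f) = Id T (SA A)"
    using SM_Comp[OF th(1) r(1)] r(2) x th by (simp add: neg_comp comp_neg SM_arr Hom_def)
  then have "r \<cdot> f = Id T A"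
    by (intro SM_faithful[OF _ Comp_in_Hom[OF th(1) r(1)] Id_in_Hom[OF o(1)]]) (simp add: SM_Id o)
  then show ?thesis using r(1) by blast
qed

lemma split_epi_of_zero:
  assumes t: "triangle T A B C f g h" and h: "h = Zero T C (SA A)"
  shows "\<exists>s\<in>Hom T C B. g \<cdot> s = Id T C"
proof -
  have o: "C \<in> Obj T" "SA A \<in> Obj T" using Hom_Obj triangleD[OF t] by blast+
  have "h \<cdot> Id T C = Zero T C (SA A)" using h o by (simp add: addcat)
  then show ?thesis using exact1[OF rotate[OF t] Id_in_Hom[OF o(1)]] by blast
qed

lemma iso_of_zero_cone:
  assumes t: "triangle T A B C f g h" and Z: "zero_object T C"
  shows "isomorphism T A B f"
proof -
  note th = triangleD[OF t]
  have o: "A \<in> Obj T" "B \<in> Obj T" "C \<in> Obj T" "SA A \<in> Obj T" using Hom_Obj th by blast+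
  obtain r where r: "r \<in> Hom T B A" "r \<cdot> f = Id T A"
    using split_mono_of_zero[OF t] zero_object_zero(2)[OF Z th(3)] by blast
  have "g \<cdot> Id T B = Zero T B C" using zero_object_zero(1)[OF Z th(2)] o by (simp add: addcat)
  then obtain s where s: "s \<in> Hom T B A" "f \<cdot> s = Id T B" using exact1[OF t Id_in_Hom[OF o(2)]] by blast
  have "r = s" using reduce[OF r(2), of s] r s th o by (simp add: cat)
  then show ?thesis using isomorphismI[OF th(1) r(1)] r s by blast
qed

end

section \<open>Compact objects of a big tt-category\<close>

context big_tt_category
begin

notation add (infixl "\<boxplus>" 60)
notation sub (infixl "\<boxminus>" 60)

abbreviation compact :: "'o \<Rightarrow> bool" where "compact \<equiv> compact_object U F"

abbreviation TL where "TL Z f \<equiv> Id F Z \<otimes>\<^sub>a f"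

lemma ex_coproduct:
  assumes "small U I" "\<And>i. i \<in> I \<Longrightarrow> X i \<in> Obj F"
  shows "\<exists>Y \<iota>. is_coproduct F I X Y \<iota>"
  using ex_small_coproduct[OF small_coproducts assms(1), of X] assms(2) by blast

lemma compact_Obj: "compact A \<Longrightarrow> A \<in> Obj F"
  by (simp add: compact_object_def)

lemma compact_supported:
  assumes "compact A" "small U I" "is_coproduct F I X Y \<iota>" "y \<in> Hom F A Y"
  obtains J where "finite J" "J \<subseteq> I" "supported J \<iota> y"
  using compact_object_supported[OF assms] by blast

text \<open>A support of \<open>y \<cdot> u\<close> also supports \<open>y\<close>, as
  \<open>y\<close> is recovered from it by composing with \<open>t\<close>.\<close>

lemma compact_retract:
  assumes A: "compact A" and t: "t \<in> Hom F T A" "u \<in> Hom F A T" "u \<cdot> t = Id F T"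
  shows "compact T"
proof (rule compact_objectI)
  show "T \<in> Obj F" using Hom_Obj t(1) by blast
  fix I :: "'u set" and X Y \<iota> y
  assume I: "small U I" and c: "is_coproduct F I X Y \<iota>" and y: "y \<in> Hom F T Y"
  have yu: "y \<cdot> u \<in> Hom F A Y" using y t by (simp add: cat)
  obtain J where J: "finite J" "J \<subseteq> I" "supported J \<iota> (y \<cdot> u)"
    using compact_supported[OF A I c yu] .
  have "supported J \<iota> y"
    unfolding supported_def
  proof (intro ballI impI)
    fix e assume "e \<in> Hom F (Cod F y) (Cod F y)" and e: "\<forall>j\<in>J. e \<cdot> \<iota> j = \<iota> j"
    then have eY: "e \<in> Hom F Y Y" using y by (simp add: Hom_def)
    have "e \<cdot> (y \<cdot> u) = y \<cdot> u" using supportedD[OF J(3) yu eY] e by blast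
    then have "(e \<cdot> (y \<cdot> u)) \<cdot> t = (y \<cdot> u) \<cdot> t" by simp
    then show "e \<cdot> y = y" using eY y t by (simp add: cat)
  qed
  then show "\<exists>J. finite J \<and> J \<subseteq> I \<and> supported J \<iota> y" using J by blast
qed

lemma compact_isomorphic:
  assumes "isomorphic F A B" "compact A"
  shows "compact B"
proof -
  obtain u v where "u \<in> Hom F A B" "v \<in> Hom F B A" "u \<cdot> v = Id F B"
    using assms(1) unfolding isomorphic_def isomorphism_def by blast
  then show ?thesis using compact_retract[OF assms(2)] by blast
qed

lemma supported_Susp:
  assumes c: "is_coproduct F I X Y \<iota>" and J: "J \<subseteq> I" and y: "y \<in> Hom F A Y"
  shows "supported J (\<lambda>i. SM (\<iota> i)) (SM y) \<longleftrightarrow> supported J \<iota> y"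
proof -
  note inc = coproduct_incl[OF c] and oY = coproduct_Obj[OF c]
  have eq: "SM e \<cdot> SM z = SM z \<longleftrightarrow> e \<cdot> z = z" if "e \<in> Hom F Y Y" "z \<in> Hom F B Y" for e z B
    using SM_Comp[OF that(2,1)] SM_faithful[of "e \<cdot> z" z, OF _ Comp_in_Hom[OF that(2,1)] that(2)] by metis
  have eq': "(\<forall>j\<in>J. SM e \<cdot> SM (\<iota> j) = SM (\<iota> j)) \<longleftrightarrow> (\<forall>j\<in>J. e \<cdot> \<iota> j = \<iota> j)" if e: "e \<in> Hom F Y Y" for e
    using eq[OF e inc] J by blast
  have cod: "Cod F (SM y) = SA Y" "Cod F y = Y" using y SM_Hom[OF y] by (auto simp: Hom_def)
  show ?thesis
  proof
    assume s: "supported J (\<lambda>i. SM (\<iota> i)) (SM y)"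
    show "supported J \<iota> y" unfolding supported_def cod
      using s[unfolded supported_def cod] eq[OF _ y] eq' SM_Hom by blast
  next
    assume s: "supported J \<iota> y"
    show "supported J (\<lambda>i. SM (\<iota> i)) (SM y)" unfolding supported_def cod
    proof (intro ballI impI)
      fix e assume e: "e \<in> Hom F (SA Y) (SA Y)" "\<forall>j\<in>J. e \<cdot> SM (\<iota> j) = SM (\<iota> j)"
      obtain k where k: "k \<in> Hom F Y Y" "SM k = e" using SM_full[OF e(1) oY oY] by blast
      have "k \<cdot> y = y" using s[unfolded supported_def cod] k eq' e(2) by blast
      then show "e \<cdot> SM y = SM y" using eq[OF k(1) y] k(2) by simp
    qed
  qed
qed

lemma compact_desuspend:
  assumes A: "A \<in> Obj F" and c: "compact (SA A)"
  shows "compact A"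
proof (rule compact_objectI[OF A])
  fix I :: "'u set" and X Y \<iota> y
  assume I: "small U I" and c': "is_coproduct F I X Y \<iota>" and y: "y \<in> Hom F A Y"
  obtain J where "finite J" "J \<subseteq> I" "supported J (\<lambda>i. SM (\<iota> i)) (SM y)"
    using compact_supported[OF c I SA_coproduct[OF c'] SM_Hom[OF y]] .
  then show "\<exists>J. finite J \<and> J \<subseteq> I \<and> supported J \<iota> y" using supported_Susp[OF c' _ y] by blast
qed

text \<open>The suspension is only essentially surjective, so a coproduct of arbitrary
  \<open>X i\<close> is first replaced by the suspension of a coproduct of desuspensions. There the
  arrow desuspends, and its finite support is carried back.\<close>

lemma compact_Susp:
  assumes A: "compact A"
  shows "compact (SA A)"
proof (rule compact_objectI)
  have oA: "A \<in> Obj F" using A compact_Obj by blast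
  show "SA A \<in> Obj F" using SA_Obj[OF oA] .
  fix I :: "'u set" and X Y \<iota> y
  assume I: "small U I" and c: "is_coproduct F I X Y \<iota>" and y: "y \<in> Hom F (SA A) Y"
  have "\<forall>i\<in>I. \<exists>B. B \<in> Obj F \<and> isomorphic F (SA B) (X i)" using SA_ess coproduct_summand[OF c] by blast
  then obtain X' where X': "\<And>i. i \<in> I \<Longrightarrow> X' i \<in> Obj F" "\<And>i. i \<in> I \<Longrightarrow> isomorphic F (SA (X' i)) (X i)"
    by metis
  then have "\<forall>i\<in>I. \<exists>v. isomorphism F (X i) (SA (X' i)) v" using isomorphic_sym
      unfolding isomorphic_def by blast
  then obtain v where v: "\<And>i. i \<in> I \<Longrightarrow> isomorphism F (X i) (SA (X' i)) (v i)" by metis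
  obtain Y' \<iota>' where Y': "is_coproduct F I X' Y' \<iota>'" using ex_coproduct[OF I, of X'] X'(1) by blast
  note oY' = coproduct_Obj[OF Y'] and inc' = coproduct_incl[OF Y']
  have "isomorphism F (SA Y') (SA Y') (Id F (SA Y'))"
    using SA_Obj[OF oY'] by (auto intro!: isomorphismI[of _ _ _ _ "Id F (SA Y')"] simp: cat)
  then have c2: "is_coproduct F I X (SA Y') (\<lambda>i. Id F (SA Y') \<cdot> SM (\<iota>' i) \<cdot> v i)"
    using coproduct_iso[OF SA_coproduct[OF Y'] _ v] by blast
  obtain w w' where w: "w \<in> Hom F Y (SA Y')" "w' \<in> Hom F (SA Y') Y" "w' \<cdot> w = Id F Y"
      "w \<cdot> w' = Id F (SA Y')"
    "\<And>i. i \<in> I \<Longrightarrow> w \<cdot> \<iota> i = Id F (SA Y') \<cdot> SM (\<iota>' i) \<cdot> v i"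
    "\<And>i. i \<in> I \<Longrightarrow> w' \<cdot> (Id F (SA Y') \<cdot> SM (\<iota>' i) \<cdot> v i) = \<iota> i"
    using coproduct_unique_arrow[OF c c2] by blast
  have wy: "w \<cdot> y \<in> Hom F (SA A) (SA Y')" using w y by (simp add: cat)
  obtain z where z: "z \<in> Hom F A Y'" "SM z = w \<cdot> y" using SM_full[OF wy oA oY'] by blast
  obtain J where J: "finite J" "J \<subseteq> I" "supported J \<iota>' z" using compact_supported[OF A I Y' z(1)] .
  have s: "supported J (\<lambda>i. SM (\<iota>' i)) (w \<cdot> y)" using supported_Susp[OF Y' J(2) z(1)] J(3) z(2) by simp
  have "supported J \<iota> y"
    unfolding supported_def
  proof (intro ballI impI)
    fix e assume "e \<in> Hom F (Cod F y) (Cod F y)" and e: "\<forall>j\<in>J. e \<cdot> \<iota> j = \<iota> j"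
    then have eY: "e \<in> Hom F Y Y" using y by (simp add: Hom_def)
    \<comment> \<open>The support is known for the copy \<open>SA Y'\<close> of \<open>Y\<close>, so
      the test endomorphism \<open>e\<close> is conjugated by the isomorphism
      \<open>w\<close>.\<close>
    have "(w \<cdot> e \<cdot> w') \<cdot> (w \<cdot> y) = w \<cdot> y"
    proof (rule supportedD[OF s wy])
      show "w \<cdot> e \<cdot> w' \<in> Hom F (SA Y') (SA Y')" using w eY by (simp add: cat)
      fix j assume j: "j \<in> J"
      then have jI: "j \<in> I" using J by blast
      obtain v' where v': "v j \<in> Hom F (X j) (SA (X' j))" "v' \<in> Hom F (SA (X' j)) (X j)" "v j \<cdot> v' =
          Id F (SA (X' j))"
        using v[OF jI] by (rule isomorphismE)
      have i: "SM (\<iota>' j) \<in> Hom F (SA (X' j)) (SA Y')" by (rule SM_Hom[OF inc'[OF jI]])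
      note ij = coproduct_incl[OF c jI]
      have k: "SM (\<iota>' j) = w \<cdot> (\<iota> j \<cdot> v')"
      proof -
        have "(w \<cdot> \<iota> j) \<cdot> v' = SM (\<iota>' j) \<cdot> (v j \<cdot> v')" unfolding w(5)[OF jI]
          using i v' Hom_Obj[OF i] by (simp add: cat)
        then show ?thesis using i v' Hom_Obj[OF i] w ij by (simp add: cat)
      qed
      show "(w \<cdot> e \<cdot> w') \<cdot> SM (\<iota>' j) = SM (\<iota>' j)"
        unfolding k using w(1,2) eY ij v'(2) e j by (simp add: cat reduce[OF w(3)] reduce[of e "\<iota> j" "\<iota> j"])
    qed
    then have "w' \<cdot> ((w \<cdot> e \<cdot> w') \<cdot> (w \<cdot> y)) = w' \<cdot> (w \<cdot> y)" by simp
    then show "e \<cdot> y = y" using w(1,2) eY y Hom_Obj[OF y] by (simp add: cat reduce[OF w(3)])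
  qed
  then show "\<exists>J. finite J \<and> J \<subseteq> I \<and> supported J \<iota> y" using J by blast
qed

text \<open>Finite support is used twice. Truncating \<open>y\<close> to a support of
  \<open>y \<cdot> g\<close> does not change it on \<open>B\<close>; the remaining difference
  therefore factors through \<open>SA A\<close>, which is compact as well, and has a finite support
  of its own.\<close>

lemma compact_cone:
  assumes t: "triangle F A B D f g h" and A: "compact A" and B: "compact B"
  shows "compact D"
proof (rule compact_objectI)
  note th = triangleD[OF t]
  show oD: "D \<in> Obj F" using Hom_Obj th by blast
  fix I :: "'u set" and X Y \<iota> y
  assume I: "small U I" and c: "is_coproduct F I X Y \<iota>" and y: "y \<in> Hom F D Y"
  have yg: "y \<cdot> g \<in> Hom F B Y" using y th by (simp add: cat)
  obtain J where J: "finite J" "J \<subseteq> I" "supported J \<iota> (y \<cdot> g)" using compact_supported[OF B I c yg] .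
  obtain e where e: "e \<in> Hom F Y Y" "\<And>j. j \<in> I \<Longrightarrow> j \<in> J \<Longrightarrow> e \<cdot> \<iota> j = \<iota> j"
    "\<And>i. i \<in> I \<Longrightarrow> i \<notin> J \<Longrightarrow> e \<cdot> \<iota> i = Zero F (X i) Y" using coproduct_trunc[OF c, where J = J] by blast
  have eyg: "e \<cdot> (y \<cdot> g) = y \<cdot> g" using supportedD[OF J(3) yg e(1)] e(2) J(2) by blast
  have ey: "e \<cdot> y \<in> Hom F D Y" using e y by (simp add: cat)
  have "(y \<boxminus> e \<cdot> y) \<cdot> g = y \<cdot> g \<boxminus> e \<cdot> (y \<cdot> g)" using y e(1) th by (simp add: cat comp_sub)
  also have "\<dots> = Zero F B Y" unfolding eyg using sub_eq_zero_iff[OF yg yg] by simp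
  finally obtain z where z: "z \<in> Hom F (SA A) Y" "z \<cdot> h = y \<boxminus> e \<cdot> y"
    using exact2[OF rotate[OF t] sub_Hom[OF y ey]] by blast
  obtain J' where J': "finite J'" "J' \<subseteq> I" "supported J' \<iota> z"
      using compact_supported[OF compact_Susp[OF A] I c z(1)] .
  have "supported (J \<union> J') \<iota> y"
    unfolding supported_def
  proof (intro ballI impI)
    fix k assume "k \<in> Hom F (Cod F y) (Cod F y)" and k: "\<forall>j\<in>J \<union> J'. k \<cdot> \<iota> j = \<iota> j"
    then have kY: "k \<in> Hom F Y Y" using y by (simp add: Hom_def)
    have "k \<cdot> e = e"
    proof (rule coproduct_ext[OF c _ e(1)])
      fix i assume i: "i \<in> I"
      show "(k \<cdot> e) \<cdot> \<iota> i = e \<cdot> \<iota> i"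
        using e(1) e(2,3)[OF i] kY k coproduct_incl[OF c i] coproduct_summand[OF c i]
        by (cases "i \<in> J") (simp_all add: cat comp_zero)
    qed (use kY e(1) in \<open>simp add: cat\<close>)
    moreover have "k \<cdot> z = z" using supportedD[OF J'(3) z(1) kY] k by blast
    ultimately have "k \<cdot> (z \<cdot> h) = z \<cdot> h" "k \<cdot> (e \<cdot> y) = e \<cdot> y"
      using kY z(1) th e(1) y by (metis Comp_assoc)+
    then have "k \<cdot> y \<boxminus> e \<cdot> y = y \<boxminus> e \<cdot> y"
      using kY y ey comp_sub(2)[of y "e \<cdot> y" k] unfolding z(2) by (simp add: Hom_def)
    then have "(k \<cdot> y \<boxminus> e \<cdot> y) \<boxplus> e \<cdot> y = (y \<boxminus> e \<cdot> y) \<boxplus> e \<cdot> y" by simp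
    then show "k \<cdot> y = y" using add_sub_cancel[OF _ ey, of "k \<cdot> y"] add_sub_cancel[OF y ey] kY y
        by (simp add: cat)
  qed
  then show "\<exists>J. finite J \<and> J \<subseteq> I \<and> supported J \<iota> y" using J J' by (intro exI[of _ "J \<union> J'"]) auto
qed

lemma compact_finite_coproduct:
  assumes K: "finite K" and d: "is_coproduct F K W D \<kappa>" and W: "\<And>k. k \<in> K \<Longrightarrow> compact (W k)"
  shows "compact D"
proof (rule compact_objectI)
  show "D \<in> Obj F" using coproduct_Obj[OF d] .
  fix I :: "'u set" and X Y \<iota> y
  assume I: "small U I" and c: "is_coproduct F I X Y \<iota>" and y: "y \<in> Hom F D Y"
  have yk: "y \<cdot> \<kappa> k \<in> Hom F (W k) Y" if "k \<in> K" for k using y coproduct_incl[OF d that] by (simp add: cat)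
  have "\<forall>k\<in>K. \<exists>J. finite J \<and> J \<subseteq> I \<and> supported J \<iota> (y \<cdot> \<kappa> k)"
    using compact_supported[OF W I c yk] by metis
  then obtain J where J: "\<And>k. k \<in> K \<Longrightarrow> finite (J k) \<and> J k \<subseteq> I \<and> supported (J k) \<iota> (y \<cdot> \<kappa> k)" by metis
  have "supported (\<Union>k\<in>K. J k) \<iota> y"
    unfolding supported_def
  proof (intro ballI impI)
    fix e assume "e \<in> Hom F (Cod F y) (Cod F y)" and e: "\<forall>j\<in>(\<Union>k\<in>K. J k). e \<cdot> \<iota> j = \<iota> j"
    then have eY: "e \<in> Hom F Y Y" using y by (simp add: Hom_def)
    show "e \<cdot> y = y"
    proof (rule coproduct_ext[OF d _ y])
      fix k assume k: "k \<in> K"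
      have "e \<cdot> (y \<cdot> \<kappa> k) = y \<cdot> \<kappa> k" by (rule supportedD[OF _ yk[OF k] eY, of "J k" \<iota>]) (use J k e in auto)
      then show "(e \<cdot> y) \<cdot> \<kappa> k = y \<cdot> \<kappa> k" using eY y coproduct_incl[OF d k] by (simp add: cat)
    qed (use eY y in \<open>simp add: cat\<close>)
  qed
  moreover have "finite (\<Union>k\<in>K. J k)" "(\<Union>k\<in>K. J k) \<subseteq> I" using J K by auto
  ultimately show "\<exists>J. finite J \<and> J \<subseteq> I \<and> supported J \<iota> y" by blast
qed

section \<open>Desuspension of compact objects and detection of zero\<close>

lemma compact_desuspension:
  assumes "compact A"
  obtains B where "compact B" "isomorphic F (SA B) A"
  using SA_ess[OF compact_Obj[OF assms]] compact_desuspend compact_isomorphic isomorphic_sym assms by blast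

lemma compact_skeleton:
  obtains S where "S \<subseteq> {X. compact X}" "small U S" "\<And>X. compact X \<Longrightarrow> \<exists>Y\<in>S. isomorphic F X Y"
  using compact_essentially_small unfolding essentially_small_def compact_objects_def by auto

text \<open>Connecting arrows end in suspensions, whereas injectivity is known for \<open>f\<close>
  itself. It passes to \<open>SM f\<close> because a compact source is, up to isomorphism, the
  suspension of a compact object.\<close>

lemma zero_via_desuspension:
  assumes d: "compact d" and w: "w \<in> Hom F d (SA V)" and V: "V \<in> Obj F" and f: "f \<in> Hom F V V'"
    and fw: "SM f \<cdot> w = Zero F d (SA V')"
    and inj: "\<And>d y. compact d \<Longrightarrow> y \<in> Hom F d V \<Longrightarrow> f \<cdot> y = Zero F d V' \<Longrightarrow> y = Zero F d V"
  shows "w = Zero F d (SA V)"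
proof -
  obtain d' where d': "compact d'" "isomorphic F (SA d') d" using compact_desuspension[OF d] .
  obtain u v where u: "u \<in> Hom F (SA d') d" "v \<in> Hom F d (SA d')" "u \<cdot> v = Id F d"
    using d'(2) unfolding isomorphic_def isomorphism_def by blast
  note od' = compact_Obj[OF d'(1)] and oV' = Hom_Obj(2)[OF f]
  have wu: "w \<cdot> u \<in> Hom F (SA d') (SA V)" using w u by (simp add: cat)
  obtain x where x: "x \<in> Hom F d' V" "SM x = w \<cdot> u" using SM_full[OF wu od' V] by blast
  have "SM (f \<cdot> x) = SM f \<cdot> (w \<cdot> u)" using SM_Comp[OF x(1) f] x(2) by simp
  also have "\<dots> = SM (Zero F d' V')"
    using reduce[OF fw, of u] w u SA_Obj[OF oV'] SM_zero[OF od' oV'] SM_Hom[OF f]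
      by (simp add: zero_comp Hom_def)
  finally have "f \<cdot> x = Zero F d' V'"
      by (rule SM_faithful[OF _ Comp_in_Hom[OF x(1) f] zero_Hom[OF od' oV']])
  then have "x = Zero F d' V" using inj[OF d'(1) x(1)] by blast
  then have "w \<cdot> u = Zero F (SA d') (SA V)" using x(2) SM_zero[OF od' V] by simp
  then have "(w \<cdot> u) \<cdot> v = Zero F d (SA V)" using u SA_Obj[OF V] by (simp add: zero_comp Hom_def)
  then show ?thesis using w u by (simp add: cat)
qed

lemma compacts_detect_Susp:
  assumes W: "W \<in> Obj F" and z: "\<And>d y. compact d \<Longrightarrow> y \<in> Hom F d W \<Longrightarrow> y = Zero F d W"
    and d: "compact d" and y: "y \<in> Hom F d (SA W)"
  shows "y = Zero F d (SA W)"
proof -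
  obtain d' where d': "compact d'" "isomorphic F (SA d') d" using compact_desuspension[OF d] .
  obtain u v where u: "u \<in> Hom F (SA d') d" "v \<in> Hom F d (SA d')" "u \<cdot> v = Id F d"
    using d'(2) unfolding isomorphic_def isomorphism_def by blast
  note o = compact_Obj[OF d] compact_Obj[OF d'(1)] SA_Obj[OF W]
  have "y \<cdot> u \<in> Hom F (SA d') (SA W)" using y u by (simp add: cat)
  then obtain x where x: "x \<in> Hom F d' W" "SM x = y \<cdot> u" using SM_full o W by blast
  have "y \<cdot> u = Zero F (SA d') (SA W)" using z[OF d'(1) x(1)] x(2) SM_zero[OF o(2) W] by simp
  then have "(y \<cdot> u) \<cdot> v = Zero F d (SA W)" using u o by (simp add: zero_comp Hom_def)
  then show ?thesis using y u by (simp add: cat)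
qed

text \<open>The objects without non-zero arrows to the objects of \<open>?W\<close> form a
  localizing subcategory that contains the compact objects, so \<open>W\<close> itself belongs to it
  and its identity is zero. The whole class \<open>?W\<close> is tested because closure under
  suspension and desuspension needs a class of targets that is stable under both.\<close>

lemma compacts_detect_zero:
  assumes W: "W \<in> Obj F" and z: "\<And>d y. compact d \<Longrightarrow> y \<in> Hom F d W \<Longrightarrow> y = Zero F d W"
  shows "zero_object F W"
proof -
  let ?W = "{W \<in> Obj F. \<forall>d y. compact d \<longrightarrow> y \<in> Hom F d W \<longrightarrow> y = Zero F d W}"
  let ?S = "{A \<in> Obj F. \<forall>W\<in>?W. \<forall>y\<in>Hom F A W. y = Zero F A W}"
  have W1: "SA V \<in> ?W" if "V \<in> ?W" for V
    using compacts_detect_Susp[of V] that SA_Obj[of V] by blast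
  have W2: "\<exists>V'\<in>?W. isomorphic F (SA V') V" if V: "V \<in> ?W" for V
  proof -
    obtain V' where V': "V' \<in> Obj F" "isomorphic F (SA V') V" using SA_ess V by blast
    obtain u v where u: "u \<in> Hom F (SA V') V" "v \<in> Hom F V (SA V')" "v \<cdot> u = Id F (SA V')"
      using V'(2) unfolding isomorphic_def isomorphism_def by blast
    have "y = Zero F d V'" if d: "compact d" and y: "y \<in> Hom F d V'" for d y
    proof -
      note o = compact_Obj[OF d] V'(1) SA_Obj[OF V'(1)] SA_Obj[OF compact_Obj[OF d]]
      have "u \<cdot> SM y \<in> Hom F (SA d) V" using u SM_Hom[OF y] by (simp add: cat)
      then have "u \<cdot> SM y = Zero F (SA d) V" using V compact_Susp[OF d] by blast
      then have "v \<cdot> (u \<cdot> SM y) = Zero F (SA d) (SA V')" using u o by (simp add: comp_zero Hom_def)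
      then have "SM y = SM (Zero F d V')"
        using u SM_Hom[OF y] o by (simp add: cat reduce[OF u(3)] SM_zero)
      then show ?thesis using SM_faithful y zero_Hom o by blast
    qed
    then show ?thesis using V' by blast
  qed
  have iso: "B \<in> ?S" if ab: "isomorphic F A B" and A: "A \<in> ?S" for A B
  proof -
    obtain u v where u: "u \<in> Hom F A B" "v \<in> Hom F B A" "u \<cdot> v = Id F B"
      using ab unfolding isomorphic_def isomorphism_def by blast
    have "y = Zero F B V" if V: "V \<in> ?W" and y: "y \<in> Hom F B V" for V y
    proof -
      have "y \<cdot> u \<in> Hom F A V" using y u by (simp add: cat)
      then have "y \<cdot> u = Zero F A V" using A V by blast
      then have "(y \<cdot> u) \<cdot> v = Zero F B V" using u V by (simp add: zero_comp Hom_def)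
      then show ?thesis using y u by (simp add: cat)
    qed
    then show ?thesis using Hom_Obj(2)[OF u(1)] by blast
  qed
  have "localizing_subcategory U F ?S"
    unfolding localizing_subcategory_def
  proof (intro conjI allI impI ballI)
    show "Z \<in> ?S" if "zero_object F Z" for Z using that zero_object_zero(2)
        unfolding zero_object_def by blast
    show "B \<in> ?S" if "isomorphic F A B" "A \<in> ?S" for A B using iso that by blast
    show "SA A \<in> ?S \<longleftrightarrow> A \<in> ?S" if A: "A \<in> Obj F" for A
    proof
      assume S: "SA A \<in> ?S"
      have "y = Zero F A V" if V: "V \<in> ?W" and y: "y \<in> Hom F A V" for V y
      proof -
        have "SM y = Zero F (SA A) (SA V)" using S W1[OF V] SM_Hom[OF y] by blast
        then show ?thesis using SM_faithful[OF _ y zero_Hom] SM_zero A V by auto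
      qed
      then show "A \<in> ?S" using A by blast
    next
      assume S: "A \<in> ?S"
      have "y = Zero F (SA A) V" if V: "V \<in> ?W" and y: "y \<in> Hom F (SA A) V" for V y
      proof -
        obtain V' where V': "V' \<in> ?W" "isomorphic F (SA V') V" using W2[OF V] by blast
        obtain u v where u: "u \<in> Hom F (SA V') V" "v \<in> Hom F V (SA V')" "u \<cdot> v = Id F V"
          using V'(2) unfolding isomorphic_def isomorphism_def by blast
        have vy: "v \<cdot> y \<in> Hom F (SA A) (SA V')" using y u by (simp add: cat)
        have oV: "V' \<in> Obj F" using V' by blast
        obtain x where x: "x \<in> Hom F A V'" "SM x = v \<cdot> y" using SM_full[OF vy A oV] by blast
        have "x = Zero F A V'" using S V'(1) x(1) by blast
        then have "v \<cdot> y = Zero F (SA A) (SA V')" using x(2) SM_zero[OF A oV] by simp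
        then have "u \<cdot> (v \<cdot> y) = Zero F (SA A) V" using u SA_Obj[OF A] by (simp add: comp_zero Hom_def)
        then show ?thesis using u y V by (simp add: cat reduce[OF u(3)])
      qed
      then show "SA A \<in> ?S" using SA_Obj[OF A] by blast
    qed
    show "D \<in> ?S" if t: "triangle F A B D f g h" and A: "A \<in> ?S" and B: "B \<in> ?S" for A B D f g h
    proof -
      note th = triangleD[OF t]
      have SA: "SA A \<in> ?S" (is "_ \<in> ?R")
        using A \<open>\<And>A. A \<in> Obj F \<Longrightarrow> (SA A \<in> ?R) = (A \<in> ?R)\<close> by blast
      have "y = Zero F D V" if V: "V \<in> ?W" and y: "y \<in> Hom F D V" for V y
      proof -
        have "y \<cdot> g \<in> Hom F B V" using y th by (simp add: cat)
        then have "y \<cdot> g = Zero F B V" using B V by blast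
        then obtain x where x: "x \<in> Hom F (SA A) V" "x \<cdot> h = y" using exact2[OF rotate[OF t] y] by blast
        have "x = Zero F (SA A) V" using SA V x(1) by blast
        then show ?thesis using x(2) th V by (simp add: zero_comp Hom_def)
      qed
      then show ?thesis using Hom_Obj th by blast
    qed
    show "Y \<in> ?S" if "small U I" and c: "is_coproduct F I X Y \<iota>" and X: "\<forall>i\<in>I. X i \<in> ?S"
        for I :: "'u set" and X Y \<iota>
    proof -
      have "y = Zero F Y V" if V: "V \<in> ?W" and y: "y \<in> Hom F Y V" for V y
      proof (rule coproduct_ext[OF c y])
        note oY = coproduct_Obj[OF c]
        show "Zero F Y V \<in> Hom F Y V" using zero_Hom oY V by blast
        fix i assume i: "i \<in> I"
        have "y \<cdot> \<iota> i \<in> Hom F (X i) V" using y coproduct_incl[OF c i] by (simp add: cat)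
        then have "y \<cdot> \<iota> i = Zero F (X i) V" using X i V by blast
        then show "y \<cdot> \<iota> i = Zero F Y V \<cdot> \<iota> i" using coproduct_incl[OF c i] V
            by (simp add: zero_comp Hom_def)
      qed
      then show ?thesis using coproduct_Obj[OF c] by blast
    qed
  qed blast
  moreover have "compact_objects U F \<subseteq> ?S" unfolding compact_objects_def using compact_Obj by blast
  ultimately have "?S = Obj F" using compact_generates unfolding generates_localizing_def by blast
  then have "W \<in> ?S" using W by blast
  moreover have "W \<in> ?W" using W z by blast
  ultimately have "Id F W = Zero F W W" using Id_in_Hom[OF W] by blast
  then show ?thesis using zero_object_iff_Id[OF W] by blast
qed

subsection \<open>Telescopes\<close>

text \<open>Nothing is shifted into position 0, so that component of \<open>y\<close> vanishes; the
  component at \<open>Suc n\<close> is \<open>k n\<close> applied to the one at \<open>n\<close>.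
  Hence all components are zero, and the finite support makes \<open>y\<close> zero.\<close>

lemma shift_fixed_zero:
  fixes X :: "nat \<Rightarrow> 'o"
  assumes c: "is_coproduct F UNIV X P \<iota>" and k: "\<And>n. k n \<in> Hom F (X n) (X (Suc n))"
    and s: "s \<in> Hom F P P" "\<And>n. s \<cdot> \<iota> n = \<iota> (Suc n) \<cdot> k n"
    and d: "compact d" and y: "y \<in> Hom F d P" "s \<cdot> y = y"
  shows "y = Zero F d P"
proof -
  note inc = coproduct_incl[OF c UNIV_I] and oX = coproduct_summand[OF c UNIV_I]
  have od: "d \<in> Obj F" using compact_Obj[OF d] .
  obtain J where J: "finite J" "J \<subseteq> UNIV" "supported J \<iota> y"
    using compact_supported[OF d small_nat[OF universe_U] c y(1)] .
  obtain p where p: "\<And>j. p j \<in> Hom F P (X j)" "\<And>j. p j \<cdot> \<iota> j = Id F (X j)"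
    "\<And>i j. i \<noteq> j \<Longrightarrow> p j \<cdot> \<iota> i = Zero F (X i) (X j)" using coproduct_projs[OF c] by blast
  have p0: "p 0 \<cdot> s = Zero F P (X 0)"
  proof (rule coproduct_ext[OF c _ zero_Hom])
    show "p 0 \<cdot> s \<in> Hom F P (X 0)" using p(1)[of 0] s by (simp add: cat)
    fix n :: nat
    show "(p 0 \<cdot> s) \<cdot> \<iota> n = Zero F P (X 0) \<cdot> \<iota> n"
      using p(1)[of 0] s(1) inc[of n] inc[of "Suc n"] k[of n] oX
      by (simp add: cat s(2) zero_comp reduce[OF p(3)[of "Suc n" 0]])
  qed (use coproduct_Obj[OF c] oX in auto)
  have pS: "p (Suc n) \<cdot> s = k n \<cdot> p n" for n
  proof (rule coproduct_ext[OF c])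
    show "p (Suc n) \<cdot> s \<in> Hom F P (X (Suc n))" using p(1)[of "Suc n"] s by (simp add: cat)
    show "k n \<cdot> p n \<in> Hom F P (X (Suc n))" using p(1)[of n] k[of n] by (simp add: cat)
    fix m :: nat
    have 1: "(p (Suc n) \<cdot> s) \<cdot> \<iota> m = (p (Suc n) \<cdot> \<iota> (Suc m)) \<cdot> k m"
      using p(1)[of "Suc n"] s(1) inc[of m] inc[of "Suc m"] k[of m] by (simp add: cat s(2))
    have 2: "(k n \<cdot> p n) \<cdot> \<iota> m = k n \<cdot> (p n \<cdot> \<iota> m)"
      using p(1)[of n] inc[of m] k[of n] by (simp add: cat)
    show "(p (Suc n) \<cdot> s) \<cdot> \<iota> m = (k n \<cdot> p n) \<cdot> \<iota> m"
      unfolding 1 2 using k[of n] k[of m] oX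
      by (cases "m = n") (simp_all add: p(2) p(3) cat zero_comp comp_zero)
  qed
  have py: "p n \<cdot> y = Zero F d (X n)" for n
  proof (induction n)
    case 0
    have "p 0 \<cdot> y = (p 0 \<cdot> s) \<cdot> y" using p(1)[of 0] s(1) y by (simp add: cat)
    then show ?case unfolding p0 using y(1) oX by (simp add: zero_comp Hom_def)
  next
    case (Suc n)
    have "p (Suc n) \<cdot> y = (p (Suc n) \<cdot> s) \<cdot> y" using p(1)[of "Suc n"] s(1) y by (simp add: cat)
    also have "\<dots> = k n \<cdot> (p n \<cdot> y)" unfolding pS using k[of n] p(1)[of n] y(1) by (simp add: cat)
    finally show ?case unfolding Suc using k[of n] od by (simp add: comp_zero Hom_def)
  qed
  show ?thesis
    by (rule supported_zero[OF c J(3,2,1) y(1)]) (use p py in blast)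
qed

lemma one_minus_shift_injective:
  fixes X :: "nat \<Rightarrow> 'o"
  assumes c: "is_coproduct F UNIV X P \<iota>" and k: "\<And>n. k n \<in> Hom F (X n) (X (Suc n))"
    and s: "s \<in> Hom F P P" "\<And>n. s \<cdot> \<iota> n = \<iota> (Suc n) \<cdot> k n"
    and d: "compact d" and y: "y \<in> Hom F d P" "(Id F P \<boxminus> s) \<cdot> y = Zero F d P"
  shows "y = Zero F d P"
proof (rule shift_fixed_zero[OF c k s d y(1)])
  have "y \<boxminus> s \<cdot> y = Zero F d P" using y s(1) coproduct_Obj[OF c] by (simp add: comp_sub cat)
  then show "s \<cdot> y = y" using sub_eq_zero_iff[OF y(1), of "s \<cdot> y"] y(1) s(1) by (simp add: cat)
qed

text \<open>\<open>s\<close> moves each summand to the next one along \<open>k\<close>. The cone of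
  \<open>Id F P \<boxminus> s\<close> is Milnor's telescope, the homotopy colimit of the
  sequence.\<close>

lemma ex_shift:
  fixes X :: "nat \<Rightarrow> 'o"
  assumes k: "\<And>n. k n \<in> Hom F (X n) (X (Suc n))"
  obtains P \<iota> s where "is_coproduct F UNIV X P \<iota>" "s \<in> Hom F P P" "\<And>n. s \<cdot> \<iota> n = \<iota> (Suc n) \<cdot> k n"
    "Id F P \<boxminus> s \<in> Hom F P P"
proof -
  obtain P \<iota> where c: "is_coproduct F UNIV X P \<iota>"
    using ex_coproduct[of "UNIV :: nat set" X] small_nat[OF universe_U] Hom_Obj(1)[OF k] by blast
  have "\<iota> (Suc n) \<cdot> k n \<in> Hom F (X n) P" for n
    using k[of n] coproduct_incl[OF c UNIV_I, of "Suc n"] by (simp add: cat)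
  then obtain s where s: "s \<in> Hom F P P" "\<And>n. s \<cdot> \<iota> n = \<iota> (Suc n) \<cdot> k n"
    using coproduct_copair[OF c coproduct_Obj[OF c], where f = "\<lambda>n. \<iota> (Suc n) \<cdot> k n"] by blast
  show ?thesis using that[OF c s sub_Hom[OF Id_in_Hom[OF coproduct_Obj[OF c]] s(1)]] .
qed

lemma telescope_incl:
  fixes X :: "nat \<Rightarrow> 'o"
  assumes c: "is_coproduct F UNIV X P \<iota>" and k: "\<And>n. k n \<in> Hom F (X n) (X (Suc n))"
    and s: "s \<in> Hom F P P" "\<And>n. s \<cdot> \<iota> n = \<iota> (Suc n) \<cdot> k n"
    and t: "triangle F P P T (Id F P \<boxminus> s) q h"
  shows "q \<cdot> s = q" "q \<cdot> \<iota> (Suc n) \<cdot> k n = q \<cdot> \<iota> n"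
proof -
  note q = triangleD(2)[OF t] and oP = coproduct_Obj[OF c] and inc = coproduct_incl[OF c UNIV_I]
  have "q \<cdot> (Id F P \<boxminus> s) = Zero F P T" by (rule triangle_comp[OF t])
  then have "q \<boxminus> q \<cdot> s = Zero F P T" using q s(1) oP by (simp add: comp_sub cat)
  then show qs: "q \<cdot> s = q" using sub_eq_zero_iff[OF q, of "q \<cdot> s"] q s(1) by (simp add: cat)
  have "(q \<cdot> s) \<cdot> \<iota> n = q \<cdot> (\<iota> (Suc n) \<cdot> k n)" using q s(1) inc[of n] inc[of "Suc n"] k[of n]
      by (simp add: cat s(2))
  then show "q \<cdot> \<iota> (Suc n) \<cdot> k n = q \<cdot> \<iota> n" unfolding qs using q inc[of "Suc n"] k[of n] by (simp add: cat)
qed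

text \<open>Compact objects see the telescope as a direct limit. The suspended sequence has an
  injective \<open>1 - SM s\<close> on compact sources, so \<open>h \<cdot> g\<close> vanishes and
  \<open>g\<close> lifts to the coproduct. The lift has finite support, and the arrows of the
  sequence collect it at one stage.\<close>

lemma telescope_factor:
  fixes X :: "nat \<Rightarrow> 'o"
  assumes c: "is_coproduct F UNIV X P \<iota>" and k: "\<And>n. k n \<in> Hom F (X n) (X (Suc n))"
    and s: "s \<in> Hom F P P" "\<And>n. s \<cdot> \<iota> n = \<iota> (Suc n) \<cdot> k n"
    and t: "triangle F P P T (Id F P \<boxminus> s) q h"
    and d: "compact d" and g: "g \<in> Hom F d T"
  shows "\<exists>n. \<exists>g'\<in>Hom F d (X n). g = q \<cdot> \<iota> n \<cdot> g'"
proof -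
  note th = triangleD[OF t] and oP = coproduct_Obj[OF c] and inc = coproduct_incl[OF c UNIV_I]
    and oX = coproduct_summand[OF c UNIV_I] and u = telescope_incl(2)[OF c k s t]
  have od: "d \<in> Obj F" using compact_Obj[OF d] .
  have "h \<cdot> g = Zero F d (SA P)"
  proof (rule one_minus_shift_injective[OF SA_coproduct[OF c] SM_Hom[OF k] SM_Hom[OF s(1)] _ d])
    show "SM s \<cdot> SM (\<iota> n) = SM (\<iota> (Suc n)) \<cdot> SM (k n)" for n
      using SM_Comp[OF inc[of n] s(1)] SM_Comp[OF k[of n] inc[of "Suc n"]] s(2)[of n] by simp
    show "h \<cdot> g \<in> Hom F d (SA P)" using g th by (simp add: cat)
    have "SM (Id F P \<boxminus> s) \<cdot> h \<cdot> g = Zero F d (SA P)"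
      unfolding triangle_comp_Susp[OF t] using g Hom_Obj[OF th(3)] by (simp add: zero_comp Hom_def)
    moreover have "SM (Id F P \<boxminus> s) = Id F (SA P) \<boxminus> SM s"
      using SM_sub[OF Id_in_Hom[OF oP] s(1)] SM_Id[OF oP] by simp
    ultimately show "(Id F (SA P) \<boxminus> SM s) \<cdot> (h \<cdot> g) = Zero F d (SA P)"
      using g th SM_Hom[OF th(1)] by (simp add: cat)
  qed
  then obtain g1 where g1: "g1 \<in> Hom F d P" "q \<cdot> g1 = g" using exact1[OF rotate[OF t] g] by blast
  obtain J where J: "finite J" "J \<subseteq> UNIV" "supported J \<iota> g1"
    using compact_supported[OF d small_nat[OF universe_U] c g1(1)] .
  obtain N where N: "\<And>j. j \<in> J \<Longrightarrow> j \<le> N" using J(1) unfolding finite_nat_set_iff_bounded_le by blast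
  \<comment> \<open>\<open>w\<close> is the composite of the sequence from stage n to stage N, built
    downwards from N.\<close>
  have "\<forall>n\<le>N. \<exists>w. w \<in> Hom F (X n) (X N) \<and> q \<cdot> \<iota> N \<cdot> w = q \<cdot> \<iota> n"
  proof (intro allI impI)
    fix n assume "n \<le> N"
    then show "\<exists>w. w \<in> Hom F (X n) (X N) \<and> q \<cdot> \<iota> N \<cdot> w = q \<cdot> \<iota> n"
    proof (induction n rule: inc_induct)
      case base
      show ?case using Id_in_Hom[OF oX[of N]] oX[of N] th(2) inc[of N]
          by (intro exI[of _ "Id F (X N)"]) (simp add: cat)
    next
      case (step n)
      then obtain w where w: "w \<in> Hom F (X (Suc n)) (X N)" "q \<cdot> \<iota> N \<cdot> w = q \<cdot> \<iota> (Suc n)" by blast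
      have "(q \<cdot> \<iota> N \<cdot> w) \<cdot> k n = q \<cdot> \<iota> n" unfolding w(2) using u by simp
      then show ?case using w(1) k[of n] th(2) inc[of N] by (intro exI[of _ "w \<cdot> k n"]) (simp add: cat)
    qed
  qed
  then obtain w where w: "\<And>n. n \<le> N \<Longrightarrow> w n \<in> Hom F (X n) (X N)" "\<And>n. n \<le> N \<Longrightarrow> q \<cdot> \<iota> N \<cdot> w n = q \<cdot> \<iota> n"
    by metis
  \<comment> \<open>The support of \<open>g1\<close> ends at N, so the zero beyond it has no
    effect.\<close>
  let ?f = "\<lambda>n. if n \<le> N then w n else Zero F (X n) (X N)"
  have "?f n \<in> Hom F (X n) (X N)" for n using w(1) zero_Hom[OF oX oX] by auto
  then obtain W where W: "W \<in> Hom F P (X N)" "\<And>n. W \<cdot> \<iota> n = ?f n"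
    using coproduct_copair[OF c oX, of ?f] by blast
  have "(q \<cdot> \<iota> N \<cdot> W) \<cdot> g1 = q \<cdot> g1"
  proof (rule supported_eq[OF c J(3,2) g1(1)])
    fix j assume j: "j \<in> J"
    show "(q \<cdot> \<iota> N \<cdot> W) \<cdot> \<iota> j = q \<cdot> \<iota> j"
      using w(2)[OF N[OF j]] W(2)[of j] N[OF j] W(1) th(2) inc[of N] inc[of j] w(1)[OF N[OF j]]
        by (simp add: cat)
  qed (use W(1) th(2) inc[of N] in \<open>simp_all add: cat\<close>)
  then have "g = q \<cdot> \<iota> N \<cdot> (W \<cdot> g1)" using g1 W(1) th(2) inc[of N] by (simp add: cat)
  moreover have "W \<cdot> g1 \<in> Hom F d (X N)" using W(1) g1(1) by (simp add: cat)
  ultimately show ?thesis by blast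
qed

end

section \<open>Characters\<close>

text \<open>The group \<open>\<rat>/\<int>\<close>, as the group of complex roots of unity.\<close>

definition unity_roots :: "complex set" where
  "unity_roots = range (\<lambda>q :: rat. cis (2 * pi * of_rat q))"

lemma unity_roots_one: "1 \<in> unity_roots"
  unfolding unity_roots_def by (rule range_eqI[of _ _ 0]) simp

lemma unity_roots_mult: "z \<in> unity_roots \<Longrightarrow> w \<in> unity_roots \<Longrightarrow> z * w \<in> unity_roots"
proof -
  assume "z \<in> unity_roots" "w \<in> unity_roots"
  then obtain p q where "z = cis (2 * pi * of_rat p)" "w = cis (2 * pi * of_rat q)"
    unfolding unity_roots_def by auto
  then have "z * w = cis (2 * pi * of_rat (p + q))" by (simp add: cis_mult of_rat_add distrib_left)
  then show ?thesis unfolding unity_roots_def by blast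
qed

lemma unity_roots_inverse: "z \<in> unity_roots \<Longrightarrow> inverse z \<in> unity_roots"
proof -
  assume "z \<in> unity_roots"
  then obtain q where "z = cis (2 * pi * of_rat q)" unfolding unity_roots_def by auto
  then have "inverse z = cis (2 * pi * of_rat (- q))" by (simp add: of_rat_minus)
  then show ?thesis unfolding unity_roots_def by blast
qed

lemma unity_roots_nonzero: "z \<in> unity_roots \<Longrightarrow> z \<noteq> 0"
  unfolding unity_roots_def by auto

lemma unity_roots_power_int: "z \<in> unity_roots \<Longrightarrow> z powi k \<in> unity_roots"
proof -
  assume z: "z \<in> unity_roots"
  have "z ^ n \<in> unity_roots" for n
    by (induction n) (use z in \<open>auto intro: unity_roots_one unity_roots_mult\<close>)
  then show ?thesis by (auto simp: power_int_def power_inverse intro: unity_roots_inverse)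
qed

text \<open>Divisibility is what makes Q/Z injective.\<close>

lemma unity_roots_divisible:
  assumes "z \<in> unity_roots" "n > 0"
  obtains w where "w \<in> unity_roots" "w ^ n = z"
proof -
  obtain q where q: "z = cis (2 * pi * of_rat q)" using assms(1) unfolding unity_roots_def by auto
  have "cis (2 * pi * of_rat (q / of_nat n)) ^ n = z"
    using assms(2) unfolding Complex.DeMoivre q by (simp add: of_rat_divide field_simps)
  then show ?thesis using that unfolding unity_roots_def by blast
qed

lemma unity_roots_primitive:
  assumes "n \<ge> 2"
  obtains w where "w \<in> unity_roots" "w ^ n = 1" "w \<noteq> 1"
proof -
  let ?w = "cis (2 * pi * of_rat (1 / of_nat n))"
  have "?w ^ n = 1" using assms unfolding Complex.DeMoivre by (simp add: of_rat_divide)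
  moreover have "?w \<noteq> 1"
  proof
    assume "?w = 1"
    then have "cos (2 * pi / n) = 1" by (simp add: complex_eq_iff of_rat_divide)
    \<comment> \<open>For n at least 2 the angle lies in the half-open interval from 0 (excluded) to
      pi, where the cosine is strictly below its value at 0.\<close>
    moreover have "cos (2 * pi / n) < cos 0"
      by (rule cos_monotone_0_pi) (use assms in \<open>auto simp: field_simps\<close>)
    ultimately show False by simp
  qed
  ultimately show ?thesis using that unfolding unity_roots_def by blast
qed

text \<open>This makes the sets of characters in the later construction small.\<close>

lemma countable_unity_roots: "countable unity_roots"
  unfolding unity_roots_def by simp

text \<open>Homomorphisms from subgroups of \<open>G\<close> to \<open>\<rat>/\<int>\<close>, represented by their graphs.\<close>

definition partial_character :: "('a, 'b) monoid_scheme \<Rightarrow> ('a \<times> complex) set \<Rightarrow> bool" where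
  "partial_character G R \<longleftrightarrow>
     R \<subseteq> carrier G \<times> unity_roots \<and> (\<one>\<^bsub>G\<^esub>, 1) \<in> R \<and>
     (\<forall>x z y w. (x, z) \<in> R \<longrightarrow> (y, w) \<in> R \<longrightarrow> (x \<otimes>\<^bsub>G\<^esub> y, z * w) \<in> R) \<and>
     (\<forall>x z. (x, z) \<in> R \<longrightarrow> (inv\<^bsub>G\<^esub> x, inverse z) \<in> R) \<and>
     (\<forall>z. (\<one>\<^bsub>G\<^esub>, z) \<in> R \<longrightarrow> z = 1)"

section \<open>Extension and existence of characters\<close>

context comm_group
begin

lemma partial_characterD:
  assumes "partial_character G R"
  shows "(x, z) \<in> R \<Longrightarrow> x \<in> carrier G" "(x, z) \<in> R \<Longrightarrow> z \<in> unity_roots" "(\<one>, 1) \<in> R"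
    "(x, z) \<in> R \<Longrightarrow> (y, w) \<in> R \<Longrightarrow> (x \<otimes> y, z * w) \<in> R"
    "(x, z) \<in> R \<Longrightarrow> (inv x, inverse z) \<in> R" "(\<one>, z) \<in> R \<Longrightarrow> z = 1"
  using assms unfolding partial_character_def by blast+

lemma partial_character_unique:
  assumes R: "partial_character G R" and "(x, z) \<in> R" "(x, w) \<in> R"
  shows "z = w"
proof -
  note D = partial_characterD[OF R]
  have "(x \<otimes> inv x, z * inverse w) \<in> R" using D(4)[OF assms(2) D(5)[OF assms(3)]] .
  then have "z * inverse w = 1" using D(6) D(1)[OF assms(2)] by simp
  then show ?thesis using unity_roots_nonzero[OF D(2)[OF assms(3)]] by (simp add: field_simps)
qed

lemma partial_character_power:
  assumes R: "partial_character G R" and x: "(x, z) \<in> R"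
  shows "(x [^] (k :: int), z powi k) \<in> R"
proof -
  note D = partial_characterD[OF R]
  have n: "(x [^] n, z ^ n) \<in> R" for n :: nat
    by (induction n) (use D(3) D(4)[OF _ x] in \<open>auto simp: power_Suc2 simp del: power_Suc\<close>)
  show ?thesis
  proof (cases "k \<ge> 0")
    case True
    then show ?thesis using n[of "nat k"] D(1)[OF x] by (simp add: power_int_def flip: int_pow_int)
  next
    case False
    then have "x [^] k = inv (x [^] nat (- k))" using D(1)[OF x] 
      by (metis int_pow_int int_pow_neg minus_minus nat_0_le neg_0_le_iff_le linear)
    then show ?thesis using D(5)[OF n[of "nat (- k)"]] False by (simp add: power_int_def power_inverse)
  qed
qed

text \<open>The value \<open>w\<close> at \<open>x\<close> must agree with the old values wherever a
  power of \<open>x\<close> already lies in the domain. This is exactly what forces the value 1 at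
  the unit, and hence makes the new relation single-valued.\<close>

lemma partial_character_adjoin:
  assumes R: "partial_character G R" and x: "x \<in> carrier G" and w: "w \<in> unity_roots"
    and comp: "\<And>k z. (x [^] (k :: int), z) \<in> R \<Longrightarrow> w powi k = z"
  shows "partial_character G {(r \<otimes> x [^] k, z * w powi k) | r z k. (r, z) \<in> R}"
    (is "partial_character G ?R")
proof -
  note D = partial_characterD[OF R]
  have w0: "w \<noteq> 0" using unity_roots_nonzero[OF w] .
  have mult: "(a \<otimes> b, y * y') \<in> ?R" if "(a, y) \<in> ?R" "(b, y') \<in> ?R" for a b y y'
  proof -
    obtain r z k r' z' k' where 1: "a = r \<otimes> x [^] (k :: int)" "y = z * w powi k" "(r, z) \<in> R"
      "b = r' \<otimes> x [^] (k' :: int)" "y' = z' * w powi k'" "(r', z') \<in> R" using \<open>(a, y) \<in> ?R\<close> \<open>(b, y')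
        \<in> ?R\<close> by blast
    have "a \<otimes> b = (r \<otimes> r') \<otimes> x [^] (k + k')"
      using D(1)[OF 1(3)] D(1)[OF 1(6)] x unfolding 1 by (simp add: int_pow_mult m_ac)
    moreover have "y * y' = (z * z') * w powi (k + k')" unfolding 1 using w0 by (simp add: power_int_add)
    ultimately show ?thesis using D(4)[OF 1(3,6)] by blast
  qed
  have "(inv a, inverse y) \<in> ?R" if ay: "(a, y) \<in> ?R" for a y
  proof -
    obtain r z k where 1: "a = r \<otimes> x [^] (k :: int)" "y = z * w powi k" "(r, z) \<in> R" using ay by blast
    have "inv a = inv r \<otimes> x [^] (- k)" using D(1)[OF 1(3)] x unfolding 1 by (simp add: inv_mult int_pow_neg)
    moreover have "inverse y = inverse z * w powi (- k)" unfolding 1 by (simp add: power_int_minus)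
    ultimately show ?thesis using D(5)[OF 1(3)] by blast
  qed
  moreover have "y = 1" if y: "(\<one>, y) \<in> ?R" for y
  proof -
    obtain r z k where 1: "\<one> = r \<otimes> x [^] (k :: int)" "y = z * w powi k" "(r, z) \<in> R" using y by blast
    have "x [^] k = inv r" using 1(1) D(1)[OF 1(3)] x by (metis inv_equality int_pow_closed m_comm)
    then have "w powi k = inverse z" using comp D(5)[OF 1(3)] by metis
    then show ?thesis using 1(2) unity_roots_nonzero[OF D(2)[OF 1(3)]] by simp
  qed
  moreover have "(\<one>, 1) \<in> ?R"
  proof -
    have "\<one> = \<one> \<otimes> x [^] (0 :: int)" "(1 :: complex) = 1 * w powi 0" by simp_all
    then show ?thesis using D(3) by blast
  qed
  moreover have "?R \<subseteq> carrier G \<times> unity_roots"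
    using D(1,2) x w by (auto intro: unity_roots_mult unity_roots_power_int)
  ultimately show ?thesis unfolding partial_character_def using mult by blast
qed

text \<open>The exponents k with \<open>x [^] k\<close> in the domain are the multiples of the least
  positive one, \<open>n\<close>, by division with remainder. So consistency at \<open>n\<close> is
  consistency everywhere.\<close>

lemma partial_character_compatible:
  assumes R: "partial_character G R" and x: "x \<in> carrier G" and n: "n > 0"
    and z0: "(x [^] n, z0) \<in> R" and min: "\<And>m. 0 < m \<Longrightarrow> m < n \<Longrightarrow> x [^] m \<notin> Domain R"
    and w: "w \<in> unity_roots" "w ^ n = z0" and k: "(x [^] (k :: int), z) \<in> R"
  shows "w powi k = z"
proof -
  note D = partial_characterD[OF R]
  have xn: "(x [^] (int n * m), z0 powi m) \<in> R" for m
    using partial_character_power[OF R z0, of m] x by (simp add: int_pow_pow flip: int_pow_int)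
  have "x [^] (k mod int n) = x [^] k \<otimes> inv (x [^] (int n * (k div int n)))"
    using x by (simp add: int_pow_diff[symmetric] minus_mult_div_eq_mod)
  then have "x [^] (k mod int n) \<in> Domain R" using D(4)[OF k D(5)[OF xn]] by auto
  moreover have "x [^] (k mod int n) = x [^] nat (k mod int n)" using n by (simp flip: int_pow_int)
  ultimately have "\<not> (0 < nat (k mod int n) \<and> nat (k mod int n) < n)" using min by metis
  then have "k mod int n = 0" using n
    using pos_mod_bound[of "int n" k] pos_mod_sign[of "int n" k] by linarith
  then obtain m where m: "k = int n * m" by auto
  have "z = z0 powi m" using partial_character_unique[OF R] xn[of m] k unfolding m by blast
  then show ?thesis using w(2) unfolding m by (simp add: power_int_mult)
qed

text \<open>Injectivity of Q/Z in Baer's manner: a maximal extension exists by Zorn's lemma, the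
  union of a chain of graphs being a graph, and it is total because any missing element could still
  be adjoined.\<close>

lemma partial_character_extend:
  assumes R: "partial_character G R"
  obtains \<chi> where "\<And>x. x \<in> carrier G \<Longrightarrow> \<chi> x \<in> unity_roots"
    "\<And>x y. x \<in> carrier G \<Longrightarrow> y \<in> carrier G \<Longrightarrow> \<chi> (x \<otimes> y) = \<chi> x * \<chi> y"
    "\<And>x z. (x, z) \<in> R \<Longrightarrow> \<chi> x = z"
proof -
  let ?A = "{S. partial_character G S \<and> R \<subseteq> S}"
  have "\<exists>M\<in>?A. \<forall>S\<in>?A. M \<subseteq> S \<longrightarrow> S = M"
  proof (rule subset_Zorn)
    fix C assume C: "subset.chain ?A C"
    then have CA: "C \<subseteq> ?A" and lin: "\<And>S S'. S \<in> C \<Longrightarrow> S' \<in> C \<Longrightarrow> S \<subseteq> S' \<or> S' \<subseteq> S"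
      unfolding subset.chain_def by blast+
    show "\<exists>M\<in>?A. \<forall>S\<in>C. S \<subseteq> M"
    proof (cases "C = {}")
      case True
      then show ?thesis using R by blast
    next
      case False
      have "partial_character G (\<Union>C)"
        unfolding partial_character_def
      proof (intro conjI allI impI)
        show "\<Union>C \<subseteq> carrier G \<times> unity_roots" "(\<one>, 1) \<in> \<Union>C"
          using CA False unfolding partial_character_def by blast+
        show "(x \<otimes> y, z * w) \<in> \<Union>C" if xz: "(x, z) \<in> \<Union>C" and yw: "(y, w) \<in> \<Union>C" for x y z w
        proof -
          obtain S S' where S: "S \<in> C" "(x, z) \<in> S" "S' \<in> C" "(y, w) \<in> S'" using xz yw by blast
          then obtain S'' where S'': "S'' \<in> C" "(x, z) \<in> S''" "(y, w) \<in> S''" using lin[OF S(1,3)] by blast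
          then have "partial_character G S''" using CA by blast
          then show ?thesis using partial_characterD(4)[OF _ S''(2,3)] S''(1) by blast
        qed
        show "(inv x, inverse z) \<in> \<Union>C" if xz: "(x, z) \<in> \<Union>C" for x z
        proof -
          obtain S where S: "S \<in> C" "(x, z) \<in> S" using xz by blast
          then have "partial_character G S" using CA by blast
          then show ?thesis using partial_characterD(5)[OF _ S(2)] S(1) by blast
        qed
        show "z = 1" if z: "(\<one>, z) \<in> \<Union>C" for z
        proof -
          obtain S where S: "S \<in> C" "(\<one>, z) \<in> S" using z by blast
          then have "partial_character G S" using CA by blast
          then show ?thesis using partial_characterD(6)[OF _ S(2)] by blast
        qed
      qed
      then show ?thesis using CA False by blast
    qed
  qed
  then obtain M where M0: "M \<in> ?A" and M': "\<forall>S\<in>?A. M \<subseteq> S \<longrightarrow> S = M" by (rule bexE)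
  then have M: "partial_character G M" "R \<subseteq> M" by simp_all
  have max: "S = M" if "partial_character G S" "M \<subseteq> S" for S
    using M' M(2) that by (metis (mono_tags, lifting) mem_Collect_eq order_trans)
  note D = partial_characterD[OF M(1)]
  have "x \<in> Domain M" if x: "x \<in> carrier G" for x
  proof -
    \<comment> \<open>If some positive power of x lies in the domain, w is a root of the value at
      the least such power. Otherwise only the exponent 0 imposes a condition and w = 1 will
      do.\<close>
    obtain w where w: "w \<in> unity_roots" "\<And>k z. (x [^] (k :: int), z) \<in> M \<Longrightarrow> w powi k = z"
    proof (cases "\<exists>n > 0. x [^] (n :: nat) \<in> Domain M")
      case True
      define n where "n = (LEAST n. n > 0 \<and> x [^] (n :: nat) \<in> Domain M)"
      have n: "n > 0" "x [^] n \<in> Domain M" using LeastI_ex[OF True] unfolding n_def by blast+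
      have min: "x [^] m \<notin> Domain M" if "0 < m" "m < n" for m
      proof
        assume "x [^] m \<in> Domain M"
        then have "n \<le> m" unfolding n_def using that(1) by (intro Least_le) simp
        then show False using that(2) by simp
      qed
      obtain z0 where z0: "(x [^] n, z0) \<in> M" using n by blast
      obtain w where w: "w \<in> unity_roots" "w ^ n = z0" using unity_roots_divisible[OF D(2)[OF z0] n(1)] .
      show thesis using that[OF w(1) partial_character_compatible[OF M(1) x n(1) z0 min w]] by blast
    next
      case False
      have "1 powi k = z" if k: "(x [^] k, z) \<in> M" for k :: int and z
      proof -
        have "\<not> k > 0" using False k by (metis Domain.intros int_pow_int pos_int_cases)
        moreover have "\<not> k < 0"
        proof
          assume "k < 0"
          moreover have "(x [^] (- k), inverse z) \<in> M" using D(5)[OF k] x by (simp add: int_pow_neg)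
          ultimately show False using False by (metis Domain.intros int_pow_int neg_0_less_iff_less
              pos_int_cases)
        qed
        ultimately have "k = 0" by simp
        then show ?thesis using k D(6) by auto
      qed
      then show thesis using that unity_roots_one by blast
    qed
    let ?M' = "{(r \<otimes> x [^] (k :: int), z * w powi k) | r z k. (r, z) \<in> M}"
    have "M \<subseteq> ?M'"
    proof
      fix p assume p: "p \<in> M"
      obtain r z where rz: "p = (r, z)" by (cases p)
      have "r = r \<otimes> x [^] (0 :: int)" "z = z * w powi 0" using D(1) p rz by auto
      then show "p \<in> ?M'" using p rz by blast
    qed
    moreover have "partial_character G ?M'" using partial_character_adjoin[OF M(1) x w] by blast
    ultimately have "?M' = M" using max by blast
    moreover have "x = \<one> \<otimes> x [^] (1 :: int)" using x by simp
    ultimately show ?thesis using D(3) by blast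
  qed
  then have ex: "\<exists>z. (x, z) \<in> M" if "x \<in> carrier G" for x using that by blast
  define \<chi> where "\<chi> x = (SOME z. (x, z) \<in> M)" for x
  have chi: "(x, \<chi> x) \<in> M" if "x \<in> carrier G" for x using someI_ex[OF ex[OF that]] unfolding \<chi>_def .
  show ?thesis
  proof (rule that)
    show "\<chi> x \<in> unity_roots" if "x \<in> carrier G" for x using D(2)[OF chi[OF that]] .
    show "\<chi> (x \<otimes> y) = \<chi> x * \<chi> y" if "x \<in> carrier G" "y \<in> carrier G" for x y
      using partial_character_unique[OF M(1) chi D(4)[OF chi[OF that(1)] chi[OF that(2)]]] that by simp
    show "\<chi> x = z" if "(x, z) \<in> R" for x z
      using partial_character_unique[OF M(1) chi] D(1) M(2) that by blast
  qed
qed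

text \<open>Q/Z is a cogenerator: the character of the trivial subgroup is extended to the cyclic
  group of \<open>x\<close> with a value other than 1 at \<open>x\<close>, and then to all of
  \<open>G\<close>.\<close>

lemma ex_nontrivial_character:
  assumes x: "x \<in> carrier G" "x \<noteq> \<one>"
  obtains \<chi> where "\<And>x. x \<in> carrier G \<Longrightarrow> \<chi> x \<in> unity_roots"
    "\<And>x y. x \<in> carrier G \<Longrightarrow> y \<in> carrier G \<Longrightarrow> \<chi> (x \<otimes> y) = \<chi> x * \<chi> y" "\<chi> x \<noteq> 1"
proof -
  let ?R = "{(\<one>, 1 :: complex)}"
  have R: "partial_character G ?R" unfolding partial_character_def by (simp add: unity_roots_one)
  obtain w where w: "w \<in> unity_roots" "w \<noteq> 1" "\<And>k z. (x [^] (k :: int), z) \<in> ?R \<Longrightarrow> w powi k = z"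
  proof (cases "\<exists>n > 0. x [^] (n :: nat) = \<one>")
    case True
    define n where "n = (LEAST n. n > 0 \<and> x [^] (n :: nat) = \<one>)"
    have n: "n > 0" "x [^] n = \<one>" using LeastI_ex[OF True] unfolding n_def by blast+
    have min: "x [^] m \<noteq> \<one>" if "0 < m" "m < n" for m
    proof
      assume "x [^] m = \<one>"
      then have "n \<le> m" unfolding n_def using that(1) by (intro Least_le) simp
      then show False using that(2) by simp
    qed
    have "n \<noteq> 1" using n(2) x by auto
    then have "n \<ge> 2" using n(1) by simp
    then obtain w where w: "w \<in> unity_roots" "w ^ n = 1" "w \<noteq> 1" by (rule unity_roots_primitive)
    have "w powi k = z" if "(x [^] k, z) \<in> ?R" for k :: int and z
      using partial_character_compatible[OF R x(1) n(1) _ _ w(1,2) that] n(2) min by auto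
    then show thesis using that w by blast
  next
    case False
    \<comment> \<open>Here x has infinite order and every value is consistent; a square root of 1
      other than 1 is a convenient choice.\<close>
    obtain w where w: "w \<in> unity_roots" "w ^ 2 = 1" "w \<noteq> 1" by (rule unity_roots_primitive[of 2]) auto
    have "w powi k = z" if k: "(x [^] k, z) \<in> ?R" for k :: int and z
    proof -
      have xk: "x [^] k = \<one>" "z = 1" using k by auto
      have "\<not> k > 0" using False xk by (metis int_pow_int pos_int_cases)
      moreover have "\<not> k < 0"
      proof
        assume "k < 0"
        moreover have "x [^] (- k) = \<one>" using xk x by (simp add: int_pow_neg)
        ultimately show False using False by (metis int_pow_int neg_0_less_iff_less pos_int_cases)
      qed
      ultimately show ?thesis using xk by simp
    qed
    then show thesis using that w by blast
  qed
  obtain \<chi> where chi: "\<And>x. x \<in> carrier G \<Longrightarrow> \<chi> x \<in> unity_roots"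
    "\<And>x y. x \<in> carrier G \<Longrightarrow> y \<in> carrier G \<Longrightarrow> \<chi> (x \<otimes> y) = \<chi> x * \<chi> y"
    "\<And>y z. (y, z) \<in> {(r \<otimes> x [^] (k :: int), z * w powi k) | r z k. (r, z) \<in> ?R} \<Longrightarrow> \<chi> y = z"
    using partial_character_extend[OF partial_character_adjoin[OF R x(1) w(1,3)]] by blast
  have "\<chi> x = 1 * w powi 1"
    by (rule chi(3)) (use x in \<open>auto intro!: exI[of _ \<one>] exI[of _ "1 :: int"]\<close>)
  then show ?thesis using that[OF chi(1,2)] w(2) by auto
qed

end

section \<open>Pure-injective objects\<close>

context big_tt_category
begin

text \<open>\<open>\<chi>\<close> is an element of the Q/Z-dual of \<open>Hom(c, A)\<close>. As
  \<open>A\<close> varies, these duals form a contravariant functor; an object with a universal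
  \<open>\<chi>\<close> represents it.\<close>

definition chr :: "'o \<Rightarrow> 'o \<Rightarrow> ('m \<Rightarrow> complex) \<Rightarrow> bool" where
  "chr c A \<chi> \<longleftrightarrow> (\<forall>y\<in>Hom F c A. \<chi> y \<in> unity_roots) \<and>
     (\<forall>y\<in>Hom F c A. \<forall>y'\<in>Hom F c A. \<chi> (y \<boxplus> y') = \<chi> y * \<chi> y')"

lemma chrD:
  assumes "chr c A \<chi>"
  shows "y \<in> Hom F c A \<Longrightarrow> \<chi> y \<in> unity_roots" "y \<in> Hom F c A \<Longrightarrow> \<chi> y \<noteq> 0"
    "y \<in> Hom F c A \<Longrightarrow> y' \<in> Hom F c A \<Longrightarrow> \<chi> (y \<boxplus> y') = \<chi> y * \<chi> y'"
  using assms unity_roots_nonzero unfolding chr_def by blast+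

lemma chr_zero: "chr c A \<chi> \<Longrightarrow> c \<in> Obj F \<Longrightarrow> A \<in> Obj F \<Longrightarrow> \<chi> (Zero F c A) = 1"
  using chrD(2)[of c A \<chi> "Zero F c A"] chrD(3)[of c A \<chi> "Zero F c A" "Zero F c A"] zero_Hom[of c A]
  by (simp add: add_zero)

lemma chr_neg: "chr c A \<chi> \<Longrightarrow> y \<in> Hom F c A \<Longrightarrow> \<chi> (neg y) = inverse (\<chi> y)"
proof -
  assume a: "chr c A \<chi>" "y \<in> Hom F c A"
  have "\<chi> y * \<chi> (neg y) = 1"
    using chrD(3)[OF a(1) a(2) neg_Hom[OF a(2)]] chr_zero[OF a(1)] Hom_Obj[OF a(2)]
      add_neg(1)[OF a(2)] by simp
  then show ?thesis using chrD(2)[OF a] by (simp add: field_simps)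
qed

lemma chr_sub: "chr c A \<chi> \<Longrightarrow> y \<in> Hom F c A \<Longrightarrow> y' \<in> Hom F c A \<Longrightarrow> \<chi> (y \<boxminus> y') = \<chi> y / \<chi> y'"
  unfolding sub_def by (simp add: chrD(3) neg_Hom chr_neg divide_inverse)

lemma chr_comp: "chr c B \<chi> \<Longrightarrow> f \<in> Hom F A B \<Longrightarrow> chr c A (\<lambda>y. \<chi> (f \<cdot> y))"
  unfolding chr_def by (simp add: Comp_in_Hom Hom_def comp_add cat)

text \<open>The dual functor is exact at the middle of a triangle. By exactness at \<open>B\<close>,
  a character that is trivial on the image of \<open>Hom(c, A)\<close> is well defined on the image
  of \<open>Hom(c, B)\<close> in \<open>Hom(c, D)\<close>, and injectivity of Q/Z extends it from
  there.\<close>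

lemma chr_triangle_extend:
  assumes t: "triangle F A B D f g h" and chi: "chr c B \<chi>" and triv: "\<And>y. y \<in> Hom F c A \<Longrightarrow> \<chi> (f \<cdot> y) = 1"
    and oc: "c \<in> Obj F"
  obtains \<chi>' where "chr c D \<chi>'" "\<And>y. y \<in> Hom F c B \<Longrightarrow> \<chi>' (g \<cdot> y) = \<chi> y"
proof -
  note th = triangleD[OF t]
  have oD: "D \<in> Obj F" "A \<in> Obj F" "B \<in> Obj F" using Hom_Obj th by blast+
  interpret G: comm_group "hom_group F c D" using hom_comm_group[OF oc oD(1)] .
  let ?R = "{(g \<cdot> y, \<chi> y) | y. y \<in> Hom F c B}"
  have gy: "g \<cdot> y \<in> Hom F c D" if "y \<in> Hom F c B" for y using that th by (simp add: cat)
  have inv: "inv\<^bsub>hom_group F c D\<^esub> x = neg x" if "x \<in> Hom F c D" for x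
    using that by (simp add: neg_def Hom_def)
  have "partial_character (hom_group F c D) ?R"
    unfolding partial_character_def hom_group_simps
  proof (intro conjI allI impI)
    show "?R \<subseteq> Hom F c D \<times> unity_roots" using gy chrD(1)[OF chi] by auto
    have "Zero F c D = g \<cdot> Zero F c B" using th oc by (simp add: comp_zero Hom_def)
    moreover have "1 = \<chi> (Zero F c B)" using chr_zero[OF chi oc oD(3)] by simp
    ultimately show "(Zero F c D, 1) \<in> ?R" using zero_Hom[OF oc oD(3)] by blast
    show "(x \<boxplus> y, z * w) \<in> ?R" if p: "(x, z) \<in> ?R" "(y, w) \<in> ?R" for x z y w
    proof -
      obtain a b where ab: "a \<in> Hom F c B" "b \<in> Hom F c B" "x = g \<cdot> a" "y = g \<cdot> b" "z = \<chi> a" "w = \<chi> b"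
        using p by blast
      have "x \<boxplus> y = g \<cdot> (a \<boxplus> b)" "z * w = \<chi> (a \<boxplus> b)"
        using ab th chrD(3)[OF chi] by (simp_all add: comp_add Hom_def)
      then show ?thesis using add_Hom[OF ab(1,2)] by blast
    qed
    show "(inv\<^bsub>hom_group F c D\<^esub> x, inverse z) \<in> ?R" if p: "(x, z) \<in> ?R" for x z
    proof -
      obtain a where a: "a \<in> Hom F c B" "x = g \<cdot> a" "z = \<chi> a" using p by blast
      have "inv\<^bsub>hom_group F c D\<^esub> x = g \<cdot> neg a" "inverse z = \<chi> (neg a)"
        using inv[OF gy[OF a(1)]] a th chr_neg[OF chi a(1)] by (simp_all add: comp_neg Hom_def)
      then show ?thesis using neg_Hom[OF a(1)] by blast
    qed
    show "z = 1" if p: "(Zero F c D, z) \<in> ?R" for z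
    proof -
      obtain a where a: "a \<in> Hom F c B" "Zero F c D = g \<cdot> a" "z = \<chi> a" using p by blast
      obtain x where "x \<in> Hom F c A" "f \<cdot> x = a" using exact1[OF t a(1) a(2)[symmetric]] by blast
      then show ?thesis using triv a(3) by blast
    qed
  qed
  then obtain \<chi>' where chi': "\<And>x. x \<in> Hom F c D \<Longrightarrow> \<chi>' x \<in> unity_roots"
    "\<And>x y. x \<in> Hom F c D \<Longrightarrow> y \<in> Hom F c D \<Longrightarrow> \<chi>' (x \<boxplus> y) = \<chi>' x * \<chi>' y"
    "\<And>x z. (x, z) \<in> ?R \<Longrightarrow> \<chi>' x = z"
    using G.partial_character_extend[of ?R] unfolding hom_group_simps by blast
  have "chr c D \<chi>'" unfolding chr_def using chi'(1,2) by blast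
  moreover have "\<chi>' (g \<cdot> y) = \<chi> y" if "y \<in> Hom F c B" for y using chi'(3) that by blast
  ultimately show ?thesis using that by blast
qed

lemma chr_coproduct_trivial:
  assumes c: "compact c" and s: "small U I" and d: "is_coproduct F I X Y \<iota>" and chi: "chr c Y \<chi>"
    and triv: "\<And>i y. i \<in> I \<Longrightarrow> y \<in> Hom F c (X i) \<Longrightarrow> \<chi> (\<iota> i \<cdot> y) = 1" and y: "y \<in> Hom F c Y"
  shows "\<chi> y = 1"
proof -
  obtain J where J: "finite J" "J \<subseteq> I" "supported J \<iota> y" using compact_supported[OF c s d y] .
  show ?thesis
  proof (rule supported_induct[OF d J(3,2,1) y])
    show "\<chi> (Zero F c Y) = 1" using chr_zero[OF chi] Hom_Obj[OF y] by blast
    fix j p a assume j: "j \<in> J" and p: "p \<in> Hom F Y (X j)" and a: "a \<in> Hom F c Y" "\<chi> a = 1"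
    have jI: "j \<in> I" using j J by blast
    have "p \<cdot> y \<in> Hom F c (X j)" using p y by (simp add: cat)
    moreover from this have "\<iota> j \<cdot> (p \<cdot> y) \<in> Hom F c Y" using coproduct_incl[OF d jI] by (simp add: cat)
    ultimately show "\<chi> (a \<boxplus> \<iota> j \<cdot> (p \<cdot> y)) = 1" using chrD(3)[OF chi a(1)] a(2) triv[OF jI] by simp
  qed
qed

text \<open>The dual functor turns coproducts into products: since \<open>c\<close> is compact, an
  arrow into \<open>Y\<close> has only finitely many non-zero components, and \<psi> multiplies the
  values on them.\<close>

lemma chr_coproduct:
  assumes c: "compact c" and s: "small U I" and d: "is_coproduct F I X Y \<iota>"
    and chi: "\<And>i. i \<in> I \<Longrightarrow> chr c (X i) (\<chi> i)"
  shows "\<exists>\<psi>. chr c Y \<psi> \<and> (\<forall>i\<in>I. \<forall>y\<in>Hom F c (X i). \<psi> (\<iota> i \<cdot> y) = \<chi> i y)"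
proof -
  note inc = coproduct_incl[OF d] and oX = coproduct_summand[OF d] and oY = coproduct_Obj[OF d]
  have oc: "c \<in> Obj F" using compact_Obj[OF c] .
  obtain p where p: "\<And>j. j \<in> I \<Longrightarrow> p j \<in> Hom F Y (X j)" "\<And>j. j \<in> I \<Longrightarrow> p j \<cdot> \<iota> j = Id F (X j)"
    "\<And>i j. j \<in> I \<Longrightarrow> i \<in> I \<Longrightarrow> i \<noteq> j \<Longrightarrow> p j \<cdot> \<iota> i = Zero F (X i) (X j)"
    using coproduct_projs[OF d] by blast
  have py: "p i \<cdot> y \<in> Hom F c (X i)" if "i \<in> I" "y \<in> Hom F c Y" for i y using p(1) that by (simp add: cat)
  let ?S = "\<lambda>y. {i \<in> I. p i \<cdot> y \<noteq> Zero F c (X i)}"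
  have fin: "finite (?S y)" if y: "y \<in> Hom F c Y" for y
  proof -
    obtain J where J: "finite J" "J \<subseteq> I" "supported J \<iota> y" using compact_supported[OF c s d y] .
    have "p i \<cdot> y = Zero F c (X i)" if i: "i \<in> I" "i \<notin> J" for i
    proof -
      have "p i \<cdot> y = Zero F Y (X i) \<cdot> y"
      proof (rule supported_eq[OF d J(3,2) y p(1)[OF i(1)] zero_Hom[OF oY oX[OF i(1)]]])
        fix j assume j: "j \<in> J"
        then have "p i \<cdot> \<iota> j = Zero F (X j) (X i)" using p(3)[OF i(1)] i J(2) by blast
        then show "p i \<cdot> \<iota> j = Zero F Y (X i) \<cdot> \<iota> j" using inc[of j] j J(2) oX[OF i(1)]
          by (auto simp: zero_comp Hom_def)
      qed
      then show ?thesis using y oX[OF i(1)] by (simp add: zero_comp Hom_def)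
    qed
    then have "?S y \<subseteq> J" by blast
    then show ?thesis using J(1) finite_subset by blast
  qed
  define \<psi> where "\<psi> y = (\<Prod>i\<in>?S y. \<chi> i (p i \<cdot> y))" for y
  \<comment> \<open>Zero components contribute the factor 1, so the index set may be enlarged. This
    allows a common set for two arrows and their sum.\<close>
  have eq: "\<psi> y = (\<Prod>i\<in>K. \<chi> i (p i \<cdot> y))" if "finite K" "?S y \<subseteq> K" "K \<subseteq> I" for y K
    unfolding \<psi>_def
    by (rule prod.mono_neutral_left) (use that chr_zero[OF chi oc oX] in auto)
  have "chr c Y \<psi>"
    unfolding chr_def
  proof (intro conjI ballI)
    fix y assume y: "y \<in> Hom F c Y"
    have "(\<Prod>i\<in>K. \<chi> i (p i \<cdot> y)) \<in> unity_roots" if "finite K" "K \<subseteq> I" for K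
      using that by (induction K rule: finite_induct)
        (use chrD(1)[OF chi py] y in \<open>auto intro: unity_roots_one unity_roots_mult\<close>)
    then show "\<psi> y \<in> unity_roots" unfolding \<psi>_def using fin[OF y] by blast
    fix y' assume y': "y' \<in> Hom F c Y"
    let ?K = "?S y \<union> ?S y'"
    have add: "p i \<cdot> (y \<boxplus> y') = p i \<cdot> y \<boxplus> p i \<cdot> y'" if "i \<in> I" for i
      using p(1)[OF that] y y' by (simp add: comp_add Hom_def)
    have "?S (y \<boxplus> y') \<subseteq> ?K"
      using add add_zero(1)[OF zero_Hom[OF oc oX]] by auto
    then have "\<psi> (y \<boxplus> y') = (\<Prod>i\<in>?K. \<chi> i (p i \<cdot> (y \<boxplus> y')))" using eq fin y y' by simp
    also have "\<dots> = (\<Prod>i\<in>?K. \<chi> i (p i \<cdot> y) * \<chi> i (p i \<cdot> y'))"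
      by (rule prod.cong) (use chrD(3)[OF chi py py] add y y' in auto)
    also have "\<dots> = (\<Prod>i\<in>?K. \<chi> i (p i \<cdot> y)) * (\<Prod>i\<in>?K. \<chi> i (p i \<cdot> y'))" by (rule prod.distrib)
    also have "\<dots> = \<psi> y * \<psi> y'" using eq[of ?K y] eq[of ?K y'] fin y y' by auto
    finally show "\<psi> (y \<boxplus> y') = \<psi> y * \<psi> y'" .
  qed
  moreover have "\<psi> (\<iota> j \<cdot> y) = \<chi> j y" if j: "j \<in> I" and y: "y \<in> Hom F c (X j)" for j y
  proof -
    have 1: "p i \<cdot> (\<iota> j \<cdot> y) = (p i \<cdot> \<iota> j) \<cdot> y" if "i \<in> I" for i
      using p(1)[OF that] inc[OF j] y by (simp add: cat)
    have 2: "p i \<cdot> (\<iota> j \<cdot> y) = Zero F c (X i)" if "i \<in> I" "i \<noteq> j" for i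
      using 1[OF that(1)] p(3)[OF that(1) j] that y oX by (simp add: zero_comp Hom_def)
    have "\<psi> (\<iota> j \<cdot> y) = (\<Prod>i\<in>{j}. \<chi> i (p i \<cdot> (\<iota> j \<cdot> y)))" by (rule eq) (use 2 j in auto)
    then show ?thesis using 1[OF j] p(2)[OF j] y by (simp add: cat)
  qed
  ultimately show ?thesis by blast
qed

text \<open>Compatibility of the \<open>\<chi> n\<close> says that the character they define on the
  coproduct is trivial on the image of \<open>Id F P \<boxminus> s\<close>; so it extends to the
  cone.\<close>

lemma chr_telescope:
  fixes X :: "nat \<Rightarrow> 'o"
  assumes cc: "compact cc" and c: "is_coproduct F UNIV X P \<iota>" and k: "\<And>n. k n \<in> Hom F (X n) (X (Suc n))"
    and s: "s \<in> Hom F P P" "\<And>n. s \<cdot> \<iota> n = \<iota> (Suc n) \<cdot> k n"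
    and t: "triangle F P P T (Id F P \<boxminus> s) q h"
    and chi: "\<And>n. chr cc (X n) (\<chi> n)" and comp: "\<And>n y. y \<in> Hom F cc (X n) \<Longrightarrow> \<chi> (Suc n) (k n \<cdot> y) = \<chi> n y"
  obtains \<psi> where "chr cc T \<psi>" "\<And>n y. y \<in> Hom F cc (X n) \<Longrightarrow> \<psi> (q \<cdot> \<iota> n \<cdot> y) = \<chi> n y"
proof -
  note inc = coproduct_incl[OF c UNIV_I] and oP = coproduct_Obj[OF c]
  have sm: "small U (UNIV :: nat set)" by (rule small_nat[OF universe_U])
  obtain \<theta> where th: "chr cc P \<theta>" "\<And>n y. y \<in> Hom F cc (X n) \<Longrightarrow> \<theta> (\<iota> n \<cdot> y) = \<chi> n y"
    using chr_coproduct[OF cc sm c, of \<chi>] chi by (meson UNIV_I)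
  have f: "Id F P \<boxminus> s \<in> Hom F P P" using triangleD(1)[OF t] .
  have "\<theta> ((Id F P \<boxminus> s) \<cdot> y) = 1" if y: "y \<in> Hom F cc P" for y
  proof (rule chr_coproduct_trivial[OF cc sm c chr_comp[OF th(1) f] _ y])
    fix n y assume y: "y \<in> Hom F cc (X n)"
    have i: "\<iota> n \<cdot> y \<in> Hom F cc P" "k n \<cdot> y \<in> Hom F cc (X (Suc n))" "\<iota> (Suc n) \<cdot> (k n \<cdot> y) \<in> Hom F cc P"
      using inc[of n] inc[of "Suc n"] k[of n] y by (simp_all add: cat)
    have "s \<cdot> (\<iota> n \<cdot> y) = (s \<cdot> \<iota> n) \<cdot> y" using s(1) inc[of n] y by (simp add: cat)
    also have "\<dots> = \<iota> (Suc n) \<cdot> (k n \<cdot> y)" unfolding s(2) using inc[of "Suc n"] k[of n] y by (simp add: cat)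
    finally have sy: "s \<cdot> (\<iota> n \<cdot> y) = \<iota> (Suc n) \<cdot> (k n \<cdot> y)" .
    have "(Id F P \<boxminus> s) \<cdot> (\<iota> n \<cdot> y) = \<iota> n \<cdot> y \<boxminus> s \<cdot> (\<iota> n \<cdot> y)"
      using s(1) i(1) oP by (simp add: comp_sub arr_id comp_id Hom_def)
    then have "\<theta> ((Id F P \<boxminus> s) \<cdot> (\<iota> n \<cdot> y)) = \<theta> (\<iota> n \<cdot> y) / \<theta> (\<iota> (Suc n) \<cdot> (k n \<cdot> y))"
      unfolding sy using chr_sub[OF th(1) i(1,3)] by simp
    also have "\<dots> = 1" using th(2)[OF y] th(2)[OF i(2)] comp[OF y] chrD(2)[OF chi y] by simp
    finally show "\<theta> ((Id F P \<boxminus> s) \<cdot> (\<iota> n \<cdot> y)) = 1" .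
  qed
  then obtain \<psi> where psi: "chr cc T \<psi>" "\<And>y. y \<in> Hom F cc P \<Longrightarrow> \<psi> (q \<cdot> y) = \<theta> y"
    using chr_triangle_extend[OF t th(1) _ compact_Obj[OF cc]] by blast
  have "\<psi> (q \<cdot> \<iota> n \<cdot> y) = \<chi> n y" if y: "y \<in> Hom F cc (X n)" for n y
    using psi(2)[of "\<iota> n \<cdot> y"] th(2)[OF y] y inc[of n] triangleD(2)[OF t] by (simp add: cat)
  then show ?thesis using that psi(1) by blast
qed

section \<open>Brown's construction for the dual of Hom(c, -)\<close>

lemma small_Hom: "A \<in> Obj F \<Longrightarrow> B \<in> Obj F \<Longrightarrow> small U (Hom F A B)"
  using locally_small_F unfolding locally_small_def by blast

definition chr_extension :: "'o \<Rightarrow> 'o \<Rightarrow> ('m \<Rightarrow> complex) \<Rightarrow> 'o \<Rightarrow> ('m \<Rightarrow> complex) \<Rightarrow> 'm \<Rightarrow> bool" where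
  "chr_extension c X \<chi> X' \<chi>' k \<longleftrightarrow>
     k \<in> Hom F X X' \<and> chr c X' \<chi>' \<and> (\<forall>y\<in>Hom F c X. \<chi>' (k \<cdot> y) = \<chi> y)"

text \<open>\<open>g\<close> lies in the kernel of the Yoneda map from \<open>Hom(d, X)\<close> to
  the dual of \<open>Hom(c, d)\<close> that belongs to \<open>\<chi>\<close>.\<close>

definition chr_trivial :: "'o \<Rightarrow> 'o \<Rightarrow> ('m \<Rightarrow> complex) \<Rightarrow> 'm \<Rightarrow> bool" where
  "chr_trivial c d \<chi> g \<longleftrightarrow> (\<forall>y\<in>Hom F c d. \<chi> (g \<cdot> y) = 1)"

lemma chr_extension_trans:
  assumes "chr_extension c X \<chi> X' \<chi>' k" "chr_extension c X' \<chi>' X'' \<chi>'' k'"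
  shows "chr_extension c X \<chi> X'' \<chi>'' (k' \<cdot> k)"
proof -
  have "\<chi>'' ((k' \<cdot> k) \<cdot> y) = \<chi> y" if "y \<in> Hom F c X" for y
    using assms Comp_assoc[of y c X k X' k' X''] Comp_in_Hom[of y c X k X'] that
      unfolding chr_extension_def by auto
  then show ?thesis using assms Comp_in_Hom unfolding chr_extension_def by blast
qed

text \<open>One stage of attaching cells: \<open>X'\<close> is the cone of the arrow from the
  coproduct of the sources of all trivial arrows. The character is trivial on that coproduct and
  therefore extends over the cone. Restricting the sources to \<open>S\<close> keeps the coproduct
  small.\<close>

lemma chr_kill:
  assumes c: "compact c" and S: "S \<subseteq> {X. compact X}" "small U S" and X: "X \<in> Obj F" "chr c X \<chi>"
  shows "\<exists>X' \<chi>' k. X' \<in> Obj F \<and> chr_extension c X \<chi> X' \<chi>' k \<and>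
    (\<forall>d\<in>S. \<forall>g\<in>Hom F d X. chr_trivial c d \<chi> g \<longrightarrow> k \<cdot> g = Zero F d X')"
proof -
  have oc: "c \<in> Obj F" using compact_Obj[OF c] .
  let ?I = "{g \<in> Arr F. Dom F g \<in> S \<and> Cod F g = X \<and> chr_trivial c (Dom F g) \<chi> g}"
  have oS: "d \<in> Obj F" if "d \<in> S" for d using S(1) compact_Obj that by blast
  have "small U (\<Union>d\<in>S. Hom F d X)" by (rule small_UN[OF universe_U S(2)]) (use small_Hom oS X in blast)
  moreover have "?I \<subseteq> (\<Union>d\<in>S. Hom F d X)" by (auto simp: Hom_def)
  ultimately have I: "small U ?I" by (rule small_subset[rotated])
  obtain Q \<iota> where Q: "is_coproduct F ?I (Dom F) Q \<iota>" using ex_coproduct[OF I, of "Dom F"] oS by blast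
  note inc = coproduct_incl[OF Q] and oQ = coproduct_Obj[OF Q]
  have "g \<in> Hom F (Dom F g) X" if "g \<in> ?I" for g using that by (simp add: Hom_def)
  then obtain w where w: "w \<in> Hom F Q X" "\<And>g. g \<in> ?I \<Longrightarrow> w \<cdot> \<iota> g = g"
    using coproduct_copair[OF Q X(1), where f = "\<lambda>g. g"] by blast
  obtain X' k h where t: "triangle F Q X X' w k h" using TR1_cone[OF w(1)] by blast
  note th = triangleD[OF t]
  have "\<chi> (w \<cdot> y) = 1" if y: "y \<in> Hom F c Q" for y
  proof (rule chr_coproduct_trivial[OF c I Q chr_comp[OF X(2) w(1)] _ y])
    fix g y assume g: "g \<in> ?I" and y: "y \<in> Hom F c (Dom F g)"
    have "w \<cdot> (\<iota> g \<cdot> y) = g \<cdot> y" using reduce[OF w(2)[OF g]] w(1) inc[OF g] y by (simp add: Hom_def)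
    then show "\<chi> (w \<cdot> (\<iota> g \<cdot> y)) = 1" using g y unfolding chr_trivial_def by simp
  qed
  then obtain \<chi>' where chi': "chr c X' \<chi>'" "\<And>y. y \<in> Hom F c X \<Longrightarrow> \<chi>' (k \<cdot> y) = \<chi> y"
    using chr_triangle_extend[OF t X(2) _ oc] by blast
  have "k \<cdot> g = Zero F d X'" if d: "d \<in> S" and g: "g \<in> Hom F d X" "chr_trivial c d \<chi> g" for d g
  proof -
    have gI: "g \<in> ?I" using d g by (simp add: Hom_def)
    have "k \<cdot> g = (k \<cdot> w) \<cdot> \<iota> g" using th inc[OF gI] w(2)[OF gI] by (simp add: cat)
    also have "\<dots> = Zero F (Dom F g) X'" unfolding triangle_comp[OF t]
      using inc[OF gI] Hom_Obj[OF th(2)] by (simp add: zero_comp Hom_def)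
    finally show ?thesis using g(1) by (simp add: Hom_def)
  qed
  then show ?thesis using th chi' Hom_Obj(2)[OF th(2)] unfolding chr_extension_def by blast
qed

text \<open>One copy of \<open>d\<close> is added to \<open>X\<close> for each character of
  \<open>Hom(c, d)\<close>, and the inclusion of this copy realizes the character.\<close>

lemma chr_add_generators:
  assumes c: "compact c" and S: "S \<subseteq> {X. compact X}" "small U S" and X: "X \<in> Obj F" "chr c X \<chi>"
  shows "\<exists>X' \<chi>' k. X' \<in> Obj F \<and> chr_extension c X \<chi> X' \<chi>' k \<and>
    (\<forall>d\<in>S. \<forall>\<psi>. chr c d \<psi> \<longrightarrow> (\<exists>g\<in>Hom F d X'. \<forall>y\<in>Hom F c d. \<chi>' (g \<cdot> y) = \<psi> y))"
proof -
  have oc: "c \<in> Obj F" using compact_Obj[OF c] .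
  have oS: "d \<in> Obj F" if "d \<in> S" for d using S(1) compact_Obj that by blast
  \<comment> \<open>Characters are normalized outside \<open>Hom F c d\<close>; unrestricted
    functions on all arrows need not form a small set. In the index set \<open>None\<close> stands
    for the original object.\<close>
  let ?G = "SIGMA d:S. {\<psi> \<in> Hom F c d \<rightarrow>\<^sub>E unity_roots. chr c d \<psi>}"
  let ?I = "insert None (Some ` ?G)"
  let ?X = "\<lambda>i. case i of None \<Rightarrow> X | Some p \<Rightarrow> fst p"
  let ?\<chi> = "\<lambda>i. case i of None \<Rightarrow> \<chi> | Some p \<Rightarrow> snd p"
  have "small U ?G"
  proof (rule small_Sigma[OF universe_U S(2)])
    fix d assume d: "d \<in> S"
    have "small U (Hom F c d \<rightarrow>\<^sub>E unity_roots)"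
      by (intro small_PiE universe_U small_Hom oc oS d small_countable countable_unity_roots)
    then show "small U {\<psi> \<in> Hom F c d \<rightarrow>\<^sub>E unity_roots. chr c d \<psi>}" by (rule small_subset[rotated]) blast
  qed
  then have "small U ({None} \<union> Some ` ?G)"
    by (intro small_Un[OF universe_U small_finite[OF universe_U] small_image]) simp_all
  then have I: "small U ?I" by simp
  have "?X i \<in> Obj F" if "i \<in> ?I" for i using that X oS by auto
  then obtain Y \<iota> where Y: "is_coproduct F ?I ?X Y \<iota>" using ex_coproduct[OF I, of ?X] by blast
  have "chr c (?X i) (?\<chi> i)" if "i \<in> ?I" for i using that X by auto
  then obtain \<chi>' where chi': "chr c Y \<chi>'" "\<And>i y. i \<in> ?I \<Longrightarrow> y \<in> Hom F c (?X i) \<Longrightarrow> \<chi>' (\<iota> i \<cdot> y) = ?\<chi> i y"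
    using chr_coproduct[OF c I Y, of ?\<chi>] by meson
  have "\<exists>g\<in>Hom F d Y. \<forall>y\<in>Hom F c d. \<chi>' (g \<cdot> y) = \<psi> y" if d: "d \<in> S" and psi: "chr c d \<psi>" for d \<psi>
  proof -
    let ?\<psi> = "restrict \<psi> (Hom F c d)"
    have "chr c d ?\<psi>" using psi unfolding chr_def by (simp add: add_Hom)
    moreover have "?\<psi> \<in> Hom F c d \<rightarrow>\<^sub>E unity_roots" using psi unfolding chr_def by auto
    ultimately have i: "Some (d, ?\<psi>) \<in> ?I" using d by auto
    have "\<iota> (Some (d, ?\<psi>)) \<in> Hom F d Y" using coproduct_incl[OF Y i] by simp
    moreover have "\<chi>' (\<iota> (Some (d, ?\<psi>)) \<cdot> y) = \<psi> y" if "y \<in> Hom F c d" for y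
      using chi'(2)[OF i, of y] that by simp
    ultimately show ?thesis by blast
  qed
  moreover have "chr_extension c X \<chi> Y \<chi>' (\<iota> None)"
    unfolding chr_extension_def using coproduct_incl[OF Y, of None] chi'(1) chi'(2)[of None] by simp
  ultimately show ?thesis using coproduct_Obj[OF Y] by blast
qed

text \<open>Brown's construction of an object representing \<open>Hom(Hom(c, -), \<rat>/\<int>)\<close> on compact objects.\<close>

lemma chr_representable:
  assumes c: "compact c" and X: "X \<in> Obj F" "chr c X \<chi>"
  shows "\<exists>X' \<chi>' k. X' \<in> Obj F \<and> chr_extension c X \<chi> X' \<chi>' k \<and>
    (\<forall>d. compact d \<longrightarrow> (\<forall>g\<in>Hom F d X'. chr_trivial c d \<chi>' g \<longrightarrow> g = Zero F d X')) \<and>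
    (\<forall>d. compact d \<longrightarrow> (\<forall>\<psi>. chr c d \<psi> \<longrightarrow> (\<exists>g\<in>Hom F d X'. \<forall>y\<in>Hom F c d. \<chi>' (g \<cdot> y) = \<psi> y)))"
proof -
  have oc: "c \<in> Obj F" using compact_Obj[OF c] .
  obtain S where S: "S \<subseteq> {X. compact X}" "small U S" "\<And>X. compact X \<Longrightarrow> \<exists>Y\<in>S. isomorphic F X Y"
    using compact_skeleton by blast
  obtain X0 \<chi>0 k0 where X0: "X0 \<in> Obj F" "chr_extension c X \<chi> X0 \<chi>0 k0"
    "\<And>d \<psi>. d \<in> S \<Longrightarrow> chr c d \<psi> \<Longrightarrow> \<exists>g\<in>Hom F d X0. \<forall>y\<in>Hom F c d. \<chi>0 (g \<cdot> y) = \<psi> y"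
    using chr_add_generators[OF c S(1,2) X] by blast
  \<comment> \<open>Stage 0 is pinned to the object with all generators, so surjectivity is secured
    at the start and the later stages only have to kill kernels.\<close>
  let ?P = "\<lambda>(n :: nat) p. fst p \<in> Obj F \<and> chr c (fst p) (snd p) \<and> (n = 0 \<longrightarrow> p = (X0, \<chi>0))"
  let ?Q = "\<lambda>(n :: nat) p p'. \<exists>k. chr_extension c (fst p) (snd p) (fst p') (snd p') k \<and>
    (\<forall>d\<in>S. \<forall>g\<in>Hom F d (fst p). chr_trivial c d (snd p) g \<longrightarrow> k \<cdot> g = Zero F d (fst p'))"
  have "\<exists>f. \<forall>n. ?P n (f n) \<and> ?Q n (f n) (f (Suc n))"
  proof (rule dependent_nat_choice)
    show "\<exists>p. ?P 0 p" using X0(1,2) unfolding chr_extension_def by (intro exI[of _ "(X0, \<chi>0)"]) simp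
    fix p and n :: nat assume p: "?P n p"
    obtain X' \<chi>' k where "X' \<in> Obj F" "chr_extension c (fst p) (snd p) X' \<chi>' k"
      "\<forall>d\<in>S. \<forall>g\<in>Hom F d (fst p). chr_trivial c d (snd p) g \<longrightarrow> k \<cdot> g = Zero F d X'"
      using chr_kill[OF c S(1,2), of "fst p" "snd p"] p by blast
    then show "\<exists>p'. ?P (Suc n) p' \<and> ?Q n p p'"
      unfolding chr_extension_def by (intro exI[of _ "(X', \<chi>')"]) auto
  qed
  then obtain f where f: "\<And>n. ?P n (f n)" "\<And>n. ?Q n (f n) (f (Suc n))" by blast
  define V where "V n = fst (f n)" for n
  define \<xi> where "\<xi> n = snd (f n)" for n
  have V: "V n \<in> Obj F" "chr c (V n) (\<xi> n)" for n using f(1)[of n] unfolding V_def \<xi>_def by simp_all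
  have V0: "V 0 = X0" "\<xi> 0 = \<chi>0" using f(1)[of 0] unfolding V_def \<xi>_def by auto
  have "\<forall>n. \<exists>k. chr_extension c (V n) (\<xi> n) (V (Suc n)) (\<xi> (Suc n)) k \<and>
    (\<forall>d\<in>S. \<forall>g\<in>Hom F d (V n). chr_trivial c d (\<xi> n) g \<longrightarrow> k \<cdot> g = Zero F d (V (Suc n)))"
    using f(2) unfolding V_def \<xi>_def by blast
  then obtain k where k: "\<And>n. chr_extension c (V n) (\<xi> n) (V (Suc n)) (\<xi> (Suc n)) (k n)"
    "\<And>n d g. d \<in> S \<Longrightarrow> g \<in> Hom F d (V n) \<Longrightarrow> chr_trivial c d (\<xi> n) g \<Longrightarrow> k n \<cdot> g = Zero F d (V (Suc n))"
    by metis
  have kH: "k n \<in> Hom F (V n) (V (Suc n))" "\<And>y. y \<in> Hom F c (V n) \<Longrightarrow> \<xi> (Suc n) (k n \<cdot> y) = \<xi> n y" for n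
    using k(1)[of n] unfolding chr_extension_def by blast+
  obtain P \<iota> s where P: "is_coproduct F UNIV V P \<iota>" "s \<in> Hom F P P" "\<And>n. s \<cdot> \<iota> n = \<iota> (Suc n) \<cdot> k n"
    "Id F P \<boxminus> s \<in> Hom F P P" using ex_shift[where X = V and k = k, OF kH(1)] by blast
  obtain T q h where t: "triangle F P P T (Id F P \<boxminus> s) q h" using TR1_cone[OF P(4)] by blast
  note th = triangleD[OF t] and inc = coproduct_incl[OF P(1) UNIV_I]
  have oT: "T \<in> Obj F" using Hom_Obj th by blast
  obtain \<psi> where psi: "chr c T \<psi>" "\<And>n y. y \<in> Hom F c (V n) \<Longrightarrow> \<psi> (q \<cdot> \<iota> n \<cdot> y) = \<xi> n y"
    using chr_telescope[OF c P(1) kH(1) P(2,3) t V(2) kH(2)] by blast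
  have ext0: "chr_extension c X0 \<chi>0 T \<psi> (q \<cdot> \<iota> 0)"
    unfolding chr_extension_def using psi(1) psi(2)[of _ 0] V0 inc[of 0] th by (simp add: cat)
  \<comment> \<open>\<open>g\<close> factors through some stage n by compactness of d. Its factor is
    trivial for the character of that stage, so the passage to the next stage kills it.\<close>
  have injS: "g = Zero F d T" if d: "d \<in> S" and g: "g \<in> Hom F d T" "chr_trivial c d \<psi> g" for d g
  proof -
    have cd: "compact d" using d S(1) by blast
    obtain n g' where g': "g' \<in> Hom F d (V n)" "g = q \<cdot> \<iota> n \<cdot> g'"
      using telescope_factor[OF P(1) kH(1) P(2,3) t cd g(1)] by blast
    have "chr_trivial c d (\<xi> n) g'"
      unfolding chr_trivial_def
    proof
      fix y assume y: "y \<in> Hom F c d"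
      have g'y: "g' \<cdot> y \<in> Hom F c (V n)" using g'(1) y by (simp add: cat)
      have "g \<cdot> y = q \<cdot> \<iota> n \<cdot> (g' \<cdot> y)" unfolding g'(2) using g'(1) y inc[of n] th by (simp add: cat)
      then have "\<xi> n (g' \<cdot> y) = \<psi> (g \<cdot> y)" using psi(2)[OF g'y] by simp
      then show "\<xi> n (g' \<cdot> y) = 1" using g(2) y unfolding chr_trivial_def by simp
    qed
    then have kg: "k n \<cdot> g' = Zero F d (V (Suc n))" using k(2)[OF d g'(1)] by blast
    have "g = (q \<cdot> \<iota> (Suc n) \<cdot> k n) \<cdot> g'" unfolding g'(2) telescope_incl(2)[OF P(1) kH(1) P(2,3) t] ..
    also have "\<dots> = q \<cdot> \<iota> (Suc n) \<cdot> (k n \<cdot> g')" using g'(1) kH(1)[of n] inc[of "Suc n"] th by (simp add: cat)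
    also have "\<dots> = Zero F d T" unfolding kg using inc[of "Suc n"] th compact_Obj[OF cd]
        by (simp add: comp_zero cat)
    finally show ?thesis .
  qed
  have inj: "g = Zero F d T" if d: "compact d" and g: "g \<in> Hom F d T" "chr_trivial c d \<psi> g" for d g
  proof -
    obtain d' u v where d': "d' \<in> S" "u \<in> Hom F d d'" "v \<in> Hom F d' d" "v \<cdot> u = Id F d"
      using S(3)[OF d] unfolding isomorphic_def isomorphism_def by blast
    have gv: "g \<cdot> v \<in> Hom F d' T" using g d' by (simp add: cat)
    have "chr_trivial c d' \<psi> (g \<cdot> v)"
      unfolding chr_trivial_def
    proof
      fix y assume y: "y \<in> Hom F c d'"
      have "v \<cdot> y \<in> Hom F c d" "(g \<cdot> v) \<cdot> y = g \<cdot> (v \<cdot> y)" using y d' g(1) by (simp_all add: cat)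
      then show "\<psi> ((g \<cdot> v) \<cdot> y) = 1" using g(2) unfolding chr_trivial_def by simp
    qed
    then have "g \<cdot> v = Zero F d' T" using injS[OF d'(1) gv] by blast
    then have "(g \<cdot> v) \<cdot> u = Zero F d T" using d' oT by (simp add: zero_comp Hom_def)
    then show ?thesis using g(1) d' by (simp add: cat)
  qed
  \<comment> \<open>The character is realized at stage 0 after its source is moved into the
    skeleton, and the inclusion of that stage into the telescope preserves characters.\<close>
  have surj: "\<exists>g\<in>Hom F d T. \<forall>y\<in>Hom F c d. \<psi> (g \<cdot> y) = \<theta> y" if d: "compact d" and th: "chr c d \<theta>" for d \<theta>
  proof -
    obtain d' u v where d': "d' \<in> S" "u \<in> Hom F d d'" "v \<in> Hom F d' d" "v \<cdot> u = Id F d"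
      using S(3)[OF d] unfolding isomorphic_def isomorphism_def by blast
    obtain g where g: "g \<in> Hom F d' X0" "\<And>y. y \<in> Hom F c d' \<Longrightarrow> \<chi>0 (g \<cdot> y) = \<theta> (v \<cdot> y)"
      using X0(3)[OF d'(1) chr_comp[OF th d'(3)]] by blast
    have i: "q \<cdot> \<iota> 0 \<in> Hom F X0 T" using ext0 unfolding chr_extension_def by blast
    have "\<psi> ((q \<cdot> \<iota> 0 \<cdot> g \<cdot> u) \<cdot> y) = \<theta> y" if y: "y \<in> Hom F c d" for y
    proof -
      have uy: "u \<cdot> y \<in> Hom F c d'" using d' y by (simp add: cat)
      then have guy: "g \<cdot> (u \<cdot> y) \<in> Hom F c X0" using g(1) by (simp add: cat)
      have "(q \<cdot> \<iota> 0 \<cdot> g \<cdot> u) \<cdot> y = (q \<cdot> \<iota> 0) \<cdot> (g \<cdot> (u \<cdot> y))"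
        using i g(1) d'(2) y by (simp add: Hom_def arr_comp dom_comp cod_comp comp_assoc)
      then have "\<psi> ((q \<cdot> \<iota> 0 \<cdot> g \<cdot> u) \<cdot> y) = \<theta> (v \<cdot> (u \<cdot> y))"
        using ext0 guy g(2)[OF uy] unfolding chr_extension_def by simp
      then show ?thesis using reduce[OF d'(4), of y] d' y by (simp add: cat)
    qed
    moreover have "q \<cdot> \<iota> 0 \<cdot> g \<cdot> u \<in> Hom F d T" using i g(1) d'(2) by (simp add: cat)
    ultimately show ?thesis by blast
  qed
  show ?thesis using oT chr_extension_trans[OF X0(2) ext0] inj surj by blast
qed

text \<open>Bijectivity of the Yoneda map on compact sources gives injectivity on all sources. Since
  \<chi> is trivial on \<open>f\<close>, it extends over the cone of \<open>f\<close> and further to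
  a representing object \<open>X2\<close>. Both \<open>X\<close> and \<open>X2\<close> represent the
  same functor on compact objects, so the comparison arrow k is an isomorphism; but k annihilates
  \<open>f\<close>.\<close>

lemma chr_faithful:
  assumes c: "compact c" and X: "X \<in> Obj F" "chr c X \<chi>"
    and inj: "\<And>d g. compact d \<Longrightarrow> g \<in> Hom F d X \<Longrightarrow> chr_trivial c d \<chi> g \<Longrightarrow> g = Zero F d X"
    and surj: "\<And>d \<psi>. compact d \<Longrightarrow> chr c d \<psi> \<Longrightarrow> \<exists>g\<in>Hom F d X. \<forall>y\<in>Hom F c d. \<chi> (g \<cdot> y) = \<psi> y"
    and f: "f \<in> Hom F A X" "chr_trivial c A \<chi> f"
  shows "f = Zero F A X"
proof -
  have oc: "c \<in> Obj F" using compact_Obj[OF c] .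
  obtain X1 k1 h1 where t1: "triangle F A X X1 f k1 h1" using TR1_cone[OF f(1)] by blast
  note th1 = triangleD[OF t1]
  obtain \<chi>1 where chi1: "chr c X1 \<chi>1" "\<And>y. y \<in> Hom F c X \<Longrightarrow> \<chi>1 (k1 \<cdot> y) = \<chi> y"
    using chr_triangle_extend[OF t1 X(2) _ oc] f(2) unfolding chr_trivial_def by blast
  have ext1: "chr_extension c X \<chi> X1 \<chi>1 k1" unfolding chr_extension_def using th1 chi1 by blast
  obtain X2 \<chi>2 k2 where X2: "chr_extension c X1 \<chi>1 X2 \<chi>2 k2"
    "\<And>d g. compact d \<Longrightarrow> g \<in> Hom F d X2 \<Longrightarrow> chr_trivial c d \<chi>2 g \<Longrightarrow> g = Zero F d X2"
    using chr_representable[OF c Hom_Obj(2)[OF th1(2)] chi1(1)] by blast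
  define k where "k = k2 \<cdot> k1"
  have ext: "chr_extension c X \<chi> X2 \<chi>2 k" unfolding k_def by (rule chr_extension_trans[OF ext1 X2(1)])
  then have k: "k \<in> Hom F X X2" "chr c X2 \<chi>2" "\<And>y. y \<in> Hom F c X \<Longrightarrow> \<chi>2 (k \<cdot> y) = \<chi> y"
    unfolding chr_extension_def by blast+
  have oX2: "X2 \<in> Obj F" using Hom_Obj k(1) by blast
  obtain W g h where t: "triangle F X X2 W k g h" using TR1_cone[OF k(1)] by blast
  note th = triangleD[OF t]
  have oW: "W \<in> Obj F" using Hom_Obj th by blast
  have kinj: "y = Zero F d X" if d: "compact d" and y: "y \<in> Hom F d X" "k \<cdot> y = Zero F d X2" for d y
  proof (rule inj[OF d y(1)], unfold chr_trivial_def, rule ballI)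
    fix z assume z: "z \<in> Hom F c d"
    have "\<chi> (y \<cdot> z) = \<chi>2 (k \<cdot> (y \<cdot> z))" using k(3)[of "y \<cdot> z"] y z by (simp add: cat)
    also have "k \<cdot> (y \<cdot> z) = Zero F c X2" using reduce[OF y(2), of z] y(1) z k(1) oX2
        by (simp add: zero_comp Hom_def)
    finally show "\<chi> (y \<cdot> z) = 1" using chr_zero[OF k(2) oc oX2] by simp
  qed
  have "zero_object F W"
  \<comment> \<open>Injectivity of k on compact sources lifts y to \<open>y1\<close> with target
    \<open>X2\<close>, and surjectivity for \<open>X\<close> replaces \<open>y1\<close> by an arrow
    from the image of k, which g annihilates.\<close>
  proof (rule compacts_detect_zero[OF oW])
    fix d y assume d: "compact d" and y: "y \<in> Hom F d W"
    have hy: "h \<cdot> y \<in> Hom F d (SA X)" by (rule Comp_in_Hom[OF y th(3)])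
    have "SM k \<cdot> (h \<cdot> y) = Zero F d (SA X2)"
      using reduce[OF triangle_comp_Susp[OF t], of y] y th SM_Hom[OF k(1)] SA_Obj[OF oX2]
        by (simp add: zero_comp Hom_def)
    then have "h \<cdot> y = Zero F d (SA X)" using zero_via_desuspension[OF d hy X(1) k(1)] kinj by blast
    then obtain y1 where y1: "y1 \<in> Hom F d X2" "g \<cdot> y1 = y" using exact1[OF rotate[OF t] y] by blast
    obtain y2 where y2: "y2 \<in> Hom F d X" "\<And>z. z \<in> Hom F c d \<Longrightarrow> \<chi> (y2 \<cdot> z) = \<chi>2 (y1 \<cdot> z)"
      using surj[OF d chr_comp[OF k(2) y1(1)]] by blast
    have ky2: "k \<cdot> y2 \<in> Hom F d X2" using k y2 by (simp add: cat)
    \<comment> \<open>\<open>k \<cdot> y2\<close> and \<open>y1\<close> induce the same character of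
      \<open>Hom(c, d)\<close>, so injectivity of the Yoneda map for \<open>X2\<close> identifies
      them.\<close>
    have "k \<cdot> y2 \<boxminus> y1 = Zero F d X2"
    proof (rule X2(2)[OF d sub_Hom[OF ky2 y1(1)]], unfold chr_trivial_def, rule ballI)
      fix z assume z: "z \<in> Hom F c d"
      have zz: "y2 \<cdot> z \<in> Hom F c X" "k \<cdot> y2 \<cdot> z \<in> Hom F c X2" "y1 \<cdot> z \<in> Hom F c X2"
        using k(1) y1(1) y2(1) z by (simp_all add: cat)
      have "(k \<cdot> y2 \<boxminus> y1) \<cdot> z = k \<cdot> y2 \<cdot> z \<boxminus> y1 \<cdot> z" using ky2 y1(1) z by (simp add: comp_sub Hom_def)
      then have "\<chi>2 ((k \<cdot> y2 \<boxminus> y1) \<cdot> z) = \<chi>2 (k \<cdot> y2 \<cdot> z) / \<chi>2 (y1 \<cdot> z)"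
          using chr_sub[OF k(2) zz(2,3)] by simp
      also have "\<chi>2 (k \<cdot> y2 \<cdot> z) = \<chi>2 (y1 \<cdot> z)"
        using k(3)[OF zz(1)] y2(2)[OF z] k(1) y2(1) z by (simp add: cat)
      finally show "\<chi>2 ((k \<cdot> y2 \<boxminus> y1) \<cdot> z) = 1" using chrD(2)[OF k(2) zz(3)] by simp
    qed
    then have "y1 = k \<cdot> y2" using sub_eq_zero_iff[OF ky2 y1(1)] by simp
    then have "y = (g \<cdot> k) \<cdot> y2" using y1(2) y2(1) k(1) th by (simp add: cat)
    then show "y = Zero F d W" unfolding triangle_comp[OF t] using y2(1) oW by (simp add: zero_comp Hom_def)
  qed
  then have iso: "isomorphism F X X2 k" by (rule iso_of_zero_cone[OF t])
  then obtain r where r: "r \<in> Hom F X2 X" "r \<cdot> k = Id F X" by (rule isomorphismE)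
  have k2: "k2 \<in> Hom F X1 X2" using X2(1) unfolding chr_extension_def by blast
  have "f = r \<cdot> (k \<cdot> f)" using reduce[OF r(2), of f] r(1) k(1) f(1) by (simp add: cat)
  also have "k \<cdot> f = k2 \<cdot> (k1 \<cdot> f)" unfolding k_def using k2 th1 f(1) by (simp add: cat)
  also have "r \<cdot> (k2 \<cdot> (k1 \<cdot> f)) = Zero F A X"
    unfolding triangle_comp[OF t1] using r(1) k2 Hom_Obj(1)[OF f(1)] by (simp add: comp_zero Hom_def)
  finally show ?thesis .
qed

text \<open>\<open>E\<close> represents the dual of \<open>Hom(c, -)\<close> on compact objects, so
  an arrow into \<open>E\<close> is controlled by what it does to arrows from \<open>c\<close>. It
  is non-zero because the construction starts with a character of \<open>Hom(c, c)\<close> that is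
  non-trivial at the identity.\<close>

lemma ex_pure_injective:
  assumes c: "compact c" and nz: "\<not> zero_object F c"
  obtains E where "E \<in> Obj F" "\<not> zero_object F E"
    "\<And>A B f g. f \<in> Hom F A B \<Longrightarrow> g \<in> Hom F B E \<Longrightarrow> (\<And>y. y \<in> Hom F c A \<Longrightarrow> f \<cdot> y = Zero F c B)
       \<Longrightarrow> g \<cdot> f = Zero F A E"
proof -
  have oc: "c \<in> Obj F" using compact_Obj[OF c] .
  interpret G: comm_group "hom_group F c c" using hom_comm_group[OF oc oc] .
  have "Id F c \<noteq> Zero F c c" using nz zero_object_iff_Id[OF oc] by blast
  then obtain \<chi> where chi: "\<And>x. x \<in> Hom F c c \<Longrightarrow> \<chi> x \<in> unity_roots"
    "\<And>x y. x \<in> Hom F c c \<Longrightarrow> y \<in> Hom F c c \<Longrightarrow> \<chi> (x \<boxplus> y) = \<chi> x * \<chi> y" "\<chi> (Id F c) \<noteq> 1"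
    using G.ex_nontrivial_character[of "Id F c"] Id_in_Hom[OF oc] unfolding hom_group_simps by blast
  have "chr c c \<chi>" unfolding chr_def using chi by blast
  from chr_representable[OF c oc this] obtain E \<psi> k where E0: "E \<in> Obj F \<and> chr_extension c c \<chi> E \<psi> k \<and>
    (\<forall>d. compact d \<longrightarrow> (\<forall>g\<in>Hom F d E. chr_trivial c d \<psi> g \<longrightarrow> g = Zero F d E)) \<and>
    (\<forall>d. compact d \<longrightarrow> (\<forall>\<theta>. chr c d \<theta> \<longrightarrow> (\<exists>g\<in>Hom F d E. \<forall>y\<in>Hom F c d. \<psi> (g \<cdot> y) = \<theta> y)))"
    by (elim exE)
  then have E: "E \<in> Obj F" "chr_extension c c \<chi> E \<psi> k"
    "\<And>d g. compact d \<Longrightarrow> g \<in> Hom F d E \<Longrightarrow> chr_trivial c d \<psi> g \<Longrightarrow> g = Zero F d E"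
    "\<And>d \<theta>. compact d \<Longrightarrow> chr c d \<theta> \<Longrightarrow> \<exists>g\<in>Hom F d E. \<forall>y\<in>Hom F c d. \<psi> (g \<cdot> y) = \<theta> y"
    by blast+
  have psi: "chr c E \<psi>" "k \<in> Hom F c E" "\<psi> (k \<cdot> Id F c) = \<chi> (Id F c)"
    using E(2) Id_in_Hom[OF oc] unfolding chr_extension_def by blast+
  have "\<not> zero_object F E"
  proof
    assume "zero_object F E"
    then have "k \<cdot> Id F c = Zero F c E"
      by (rule zero_object_zero(1)) (use psi(2) oc in \<open>simp add: cat\<close>)
    then show False using psi(3) chi(3) chr_zero[OF psi(1) oc E(1)] by simp
  qed
  moreover have "g \<cdot> f = Zero F A E"
    if f: "f \<in> Hom F A B" and g: "g \<in> Hom F B E" and z: "\<And>y. y \<in> Hom F c A \<Longrightarrow> f \<cdot> y = Zero F c B" for A B f g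
  proof (rule chr_faithful[OF c E(1) psi(1) E(3,4)])
    show "g \<cdot> f \<in> Hom F A E" using f g by (simp add: cat)
    show "chr_trivial c A \<psi> (g \<cdot> f)"
      unfolding chr_trivial_def
    proof
      fix y assume y: "y \<in> Hom F c A"
      have "(g \<cdot> f) \<cdot> y = g \<cdot> (f \<cdot> y)" using f g y by (simp add: cat)
      also have "\<dots> = Zero F c E" unfolding z[OF y] using g oc by (simp add: comp_zero Hom_def)
      finally show "\<psi> ((g \<cdot> f) \<cdot> y) = 1" using chr_zero[OF psi(1) oc E(1)] by simp
    qed
  qed
  ultimately show ?thesis using that E(1) by blast
qed

end

section \<open>Tensor products and internal homs\<close>

context big_tt_category
begin

lemma TL_exact_functor: "Z \<in> Obj F \<Longrightarrow> exact_functor F F (\<lambda>Y. Z \<otimes>\<^sub>o Y) (TL Z)"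
  by (rule tensor_left_exact)

lemma TL_additive: "Z \<in> Obj F \<Longrightarrow> additive_functor F F (\<lambda>Y. Z \<otimes>\<^sub>o Y) (TL Z)"
  using TL_exact_functor unfolding exact_functor_def by blast

lemma TL_functor: "Z \<in> Obj F \<Longrightarrow> category_functor F F (\<lambda>Y. Z \<otimes>\<^sub>o Y) (TL Z)"
  using TL_additive unfolding additive_functor_def by blast

lemma TL_Hom: "Z \<in> Obj F \<Longrightarrow> f \<in> Hom F A B \<Longrightarrow> TL Z f \<in> Hom F (Z \<otimes>\<^sub>o A) (Z \<otimes>\<^sub>o B)"
  by (rule Tensor_arr_Hom[OF Id_in_Hom])

lemma TL_Comp: "Z \<in> Obj F \<Longrightarrow> f \<in> Hom F A B \<Longrightarrow> g \<in> Hom F B D \<Longrightarrow> TL Z (g \<cdot> f) = TL Z g \<cdot> TL Z f"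
  using category_functor.Gm_Comp[OF TL_functor] .

lemma TL_zero: "Z \<in> Obj F \<Longrightarrow> A \<in> Obj F \<Longrightarrow> B \<in> Obj F \<Longrightarrow> TL Z (Zero F A B) = Zero F (Z \<otimes>\<^sub>o A) (Z \<otimes>\<^sub>o B)"
  using additive_functor_zero[OF additive_category_axioms additive_category_axioms TL_additive] .

lemma TL_sub: "Z \<in> Obj F \<Longrightarrow> f \<in> Hom F A B \<Longrightarrow> g \<in> Hom F A B \<Longrightarrow> TL Z (f \<boxminus> g) = TL Z f \<boxminus> TL Z g"
  using additive_functor_sub[OF additive_category_axioms additive_category_axioms TL_additive] .

lemma TL_neg: "Z \<in> Obj F \<Longrightarrow> f \<in> Hom F A B \<Longrightarrow> TL Z (neg f) = neg (TL Z f)"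
  using additive_functor_neg[OF additive_category_axioms additive_category_axioms TL_additive] .

lemma TL_Id: "Z \<in> Obj F \<Longrightarrow> A \<in> Obj F \<Longrightarrow> TL Z (Id F A) = Id F (Z \<otimes>\<^sub>o A)"
  by (rule Tensor_Id)

lemma TL_coproduct:
  "Z \<in> Obj F \<Longrightarrow> small U I \<Longrightarrow> is_coproduct F I X Y \<iota>
   \<Longrightarrow> is_coproduct F I (\<lambda>i. Z \<otimes>\<^sub>o X i) (Z \<otimes>\<^sub>o Y) (\<lambda>i. TL Z (\<iota> i))"
  using preserves_coproduct[OF tensor_left_coproducts category_axioms category_axioms] .

text \<open>Exactness in the middle does not involve the third arrow of the tensored triangle, so
  the isomorphism hidden in \<open>exact_functor\<close> stays out of sight.\<close>

lemma TL_exact: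
  assumes Z: "Z \<in> Obj F" and t: "triangle F A B D f g h"
    and y: "y \<in> Hom F V (Z \<otimes>\<^sub>o B)" "TL Z g \<cdot> y = Zero F V (Z \<otimes>\<^sub>o D)"
  shows "\<exists>x\<in>Hom F V (Z \<otimes>\<^sub>o A). TL Z f \<cdot> x = y"
proof -
  obtain k where "triangle F (Z \<otimes>\<^sub>o A) (Z \<otimes>\<^sub>o B) (Z \<otimes>\<^sub>o D) (TL Z f) (TL Z g) k"
    using TL_exact_functor[OF Z] t unfolding exact_functor_def by blast
  then show ?thesis using exact1 y by blast
qed

lemma TL_triangle_comp:
  assumes Z: "Z \<in> Obj F" and t: "triangle F A B D f g h" and y: "y \<in> Hom F V (Z \<otimes>\<^sub>o A)"
  shows "TL Z g \<cdot> (TL Z f \<cdot> y) = Zero F V (Z \<otimes>\<^sub>o D)"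
proof -
  note th = triangleD[OF t]
  have o: "A \<in> Obj F" "D \<in> Obj F" using Hom_Obj th by blast+
  have "TL Z g \<cdot> (TL Z f \<cdot> y) = TL Z (g \<cdot> f) \<cdot> y"
    using TL_Comp[OF Z th(1,2)] TL_Hom[OF Z th(1)] TL_Hom[OF Z th(2)] y by (simp add: cat)
  also have "\<dots> = Zero F V (Z \<otimes>\<^sub>o D)" unfolding triangle_comp[OF t] TL_zero[OF Z o]
    using y Tensor_Obj[OF Z o(2)] by (simp add: zero_comp Hom_def)
  finally show ?thesis .
qed

lemma TL_triangle_comp_Susp:
  assumes Z: "Z \<in> Obj F" and t: "triangle F A B D f g h" and y: "y \<in> Hom F V (Z \<otimes>\<^sub>o D)"
  shows "TL Z (SM f) \<cdot> (TL Z h \<cdot> y) = Zero F V (Z \<otimes>\<^sub>o SA B)"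
proof -
  note th = triangleD[OF t] and SMf = SM_Hom[OF triangleD(1)[OF t]]
  have o: "D \<in> Obj F" "SA B \<in> Obj F" using Hom_Obj th SA_Obj by blast+
  have "TL Z (SM f) \<cdot> (TL Z h \<cdot> y) = TL Z (SM f \<cdot> h) \<cdot> y"
    unfolding TL_Comp[OF Z th(3) SMf]
      by (rule Comp_assoc[symmetric, OF y TL_Hom[OF Z th(3)] TL_Hom[OF Z SMf]])
  then show ?thesis unfolding triangle_comp_Susp[OF t] TL_zero[OF Z o]
    using y Tensor_Obj[OF Z o(2)] by (simp add: zero_comp Hom_def)
qed

subsection \<open>Transposes\<close>

lemma transpose_ex1:
  "\<lbrakk>A \<in> Obj F; X \<in> Obj F; Y \<in> Obj F; f \<in> Hom F (A \<otimes>\<^sub>o X) Y\<rbrakk>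
   \<Longrightarrow> transpose_arr F A X Y f \<in> Hom F A (Ihom F X Y) \<and> Eval F X Y \<cdot> (transpose_arr F A X Y f \<otimes>\<^sub>a Id F X) = f"
  unfolding transpose_arr_def by (rule theI'[OF Eval_universal])

lemma transpose_unique:
  assumes "g \<in> Hom F A (Ihom F X Y)" "g' \<in> Hom F A (Ihom F X Y)" "X \<in> Obj F" "Y \<in> Obj F"
    and eq: "Eval F X Y \<cdot> (g \<otimes>\<^sub>a Id F X) = Eval F X Y \<cdot> (g' \<otimes>\<^sub>a Id F X)"
  shows "g = g'"
proof -
  have A: "A \<in> Obj F" using Hom_Obj assms(1) by blast
  have "Eval F X Y \<cdot> (g \<otimes>\<^sub>a Id F X) \<in> Hom F (A \<otimes>\<^sub>o X) Y"
    using Comp_in_Hom[OF Tensor_arr_Hom[OF assms(1) Id_in_Hom[OF assms(3)]] Eval_Hom[OF assms(3,4)]] .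
  from Eval_universal[OF A assms(3,4) this] show ?thesis using assms(1,2) eq by metis
qed

lemma Ihom_contra_arg:
  assumes X: "X \<in> Obj F" and f: "f \<in> Hom F A B"
  shows "Eval F B X \<cdot> TL (Ihom F B X) f \<in> Hom F (Ihom F B X \<otimes>\<^sub>o A) X"
  using Comp_in_Hom[OF TL_Hom[OF Ihom_Obj f] Eval_Hom] X Hom_Obj[OF f] by blast

lemma Ihom_contra_Hom:
  assumes X: "X \<in> Obj F" and f: "f \<in> Hom F A B"
  shows "Ihom_contra F X f \<in> Hom F (Ihom F B X) (Ihom F A X)"
    and "Eval F A X \<cdot> (Ihom_contra F X f \<otimes>\<^sub>a Id F A) = Eval F B X \<cdot> TL (Ihom F B X) f"
proof -
  have d: "Ihom_contra F X f = transpose_arr F (Ihom F B X) A X (Eval F B X \<cdot> TL (Ihom F B X) f)"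
    using f unfolding Ihom_contra_def Let_def Hom_def by simp
  show "Ihom_contra F X f \<in> Hom F (Ihom F B X) (Ihom F A X)"
    "Eval F A X \<cdot> (Ihom_contra F X f \<otimes>\<^sub>a Id F A) = Eval F B X \<cdot> TL (Ihom F B X) f"
    using transpose_ex1[OF Ihom_Obj[OF Hom_Obj(2)[OF f] X] Hom_Obj(1)[OF f] X Ihom_contra_arg[OF X f]]
    unfolding d by blast+
qed

text \<open>An arrow into an internal hom is determined by its adjoint. In this form faithfulness
  applies without any handling of transposes.\<close>

lemma Ihom_contra_faithful_eq:
  assumes fa: "faithful (opposite F) F (\<lambda>A. Ihom F A X) (Ihom_contra F X)"
    and f: "f \<in> Hom F A B" "f' \<in> Hom F A B"
    and eq: "Eval F B X \<cdot> TL (Ihom F B X) f = Eval F B X \<cdot> TL (Ihom F B X) f'"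
  shows "f = f'"
proof -
  have "Ihom_contra F X f = Ihom_contra F X f'"
    using f eq unfolding Ihom_contra_def Let_def Hom_def by simp
  moreover have "inj_on (Ihom_contra F X) (Hom (opposite F) B A)"
    using fa Hom_Obj[OF f(1)] unfolding faithful_def by (simp add: opposite_def)
  ultimately show ?thesis using f unfolding inj_on_def Hom_opposite by blast
qed

text \<open>The left unitor of \<open>X\<close> has an adjoint with values in
  \<open>hom(X, X)\<close>. If the latter is zero, so is the unitor, hence so is the identity of
  \<open>X\<close>.\<close>

lemma Ihom_self_nonzero:
  assumes X: "X \<in> Obj F" and nz: "\<not> zero_object F X"
  shows "\<not> zero_object F (Ihom F X X)"
proof
  assume Z: "zero_object F (Ihom F X X)"
  have oU: "Unit F \<in> Obj F" "Unit F \<otimes>\<^sub>o X \<in> Obj F" using Unit_Obj Tensor_Obj X by blast+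
  obtain l where l: "Left_unitor F X \<in> Hom F (Unit F \<otimes>\<^sub>o X) X" "l \<in> Hom F X (Unit F \<otimes>\<^sub>o X)"
    "Left_unitor F X \<cdot> l = Id F X" using Left_unitor_iso[OF X] by (rule isomorphismE)
  have z: "Zero F (Unit F \<otimes>\<^sub>o X) X \<in> Hom F (Unit F \<otimes>\<^sub>o X) X" by (rule zero_Hom[OF oU(2) X])
  note t1 = transpose_ex1[OF oU(1) X X l(1)] and t2 = transpose_ex1[OF oU(1) X X z]
  have "transpose_arr F (Unit F) X X (Left_unitor F X) = transpose_arr F (Unit F) X X (Zero F (Unit
      F \<otimes>\<^sub>o X) X)"
    using zero_object_eq[OF Z] t1 t2 by blast
  then have "Left_unitor F X = Zero F (Unit F \<otimes>\<^sub>o X) X" using t1 t2 by metis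
  then have "Id F X = Zero F X X" using l X by (simp add: zero_comp Hom_def)
  then show False using nz zero_object_iff_Id[OF X] by blast
qed

lemma tensor_right_eq:
  assumes X: "X \<in> Obj F" and f: "f \<in> Hom F A B" "f' \<in> Hom F A B" and eq: "TL X f = TL X f'"
  shows "f \<otimes>\<^sub>a Id F X = f' \<otimes>\<^sub>a Id F X"
proof -
  have o: "A \<in> Obj F" "B \<in> Obj F" using Hom_Obj f by blast+
  have 1: "g \<otimes>\<^sub>a Id F X = Symmetry F X B \<cdot> (TL X g \<cdot> Symmetry F A X)" if g: "g \<in> Hom F A B" for g
  proof -
    have H: "g \<otimes>\<^sub>a Id F X \<in> Hom F (A \<otimes>\<^sub>o X) (B \<otimes>\<^sub>o X)" using Tensor_arr_Hom[OF g Id_in_Hom[OF X]] .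
    have "Symmetry F B X \<cdot> (g \<otimes>\<^sub>a Id F X) = TL X g \<cdot> Symmetry F A X"
        by (rule Symmetry_natural[OF g Id_in_Hom[OF X]])
    then have "Symmetry F X B \<cdot> (TL X g \<cdot> Symmetry F A X) = Symmetry F X B \<cdot> (Symmetry F B X \<cdot> (g
        \<otimes>\<^sub>a Id F X))" by simp
    also have "\<dots> = g \<otimes>\<^sub>a Id F X"
      using reduce[OF Symmetry_involutive[OF o(2) X]] H Symmetry_Hom[OF o(2) X] Symmetry_Hom[OF X o(2)]
        Tensor_Obj[OF o(2) X] by (simp add: cat)
    finally show ?thesis ..
  qed
  show ?thesis using 1[OF f(1)] 1[OF f(2)] eq by simp
qed

lemma tensor_assoc_eq:
  assumes W: "W \<in> Obj F" and X: "X \<in> Obj F" and f: "f \<in> Hom F A B" "f' \<in> Hom F A B"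
    and eq: "f \<otimes>\<^sub>a Id F X = f' \<otimes>\<^sub>a Id F X"
  shows "TL W f \<otimes>\<^sub>a Id F X = TL W f' \<otimes>\<^sub>a Id F X"
proof -
  have o: "A \<in> Obj F" "B \<in> Obj F" using Hom_Obj f by blast+
  obtain a where a: "Associator F W B X \<in> Hom F ((W \<otimes>\<^sub>o B) \<otimes>\<^sub>o X) (W \<otimes>\<^sub>o (B \<otimes>\<^sub>o X))"
    "a \<in> Hom F (W \<otimes>\<^sub>o (B \<otimes>\<^sub>o X)) ((W \<otimes>\<^sub>o B) \<otimes>\<^sub>o X)" "a \<cdot> Associator F W B X = Id F ((W \<otimes>\<^sub>o B) \<otimes>\<^sub>o X)"
    using Associator_iso[OF W o(2) X] by (rule isomorphismE)
  have 1: "TL W g \<otimes>\<^sub>a Id F X = a \<cdot> ((TL W (g \<otimes>\<^sub>a Id F X)) \<cdot> Associator F W A X)" if g: "g \<in> Hom F A B" for g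
  proof -
    have H: "TL W g \<otimes>\<^sub>a Id F X \<in> Hom F ((W \<otimes>\<^sub>o A) \<otimes>\<^sub>o X) ((W \<otimes>\<^sub>o B) \<otimes>\<^sub>o X)"
      using Tensor_arr_Hom[OF TL_Hom[OF W g] Id_in_Hom[OF X]] .
    have "a \<cdot> (TL W (g \<otimes>\<^sub>a Id F X) \<cdot> Associator F W A X) = a \<cdot> (Associator F W B X \<cdot> (TL W g \<otimes>\<^sub>a Id F X))"
      using Associator_natural[OF Id_in_Hom[OF W] g Id_in_Hom[OF X]] by simp
    also have "\<dots> = TL W g \<otimes>\<^sub>a Id F X"
      using reduce[OF a(3)] H a by (simp add: cat)
    finally show ?thesis ..
  qed
  show ?thesis using 1[OF f(1)] 1[OF f(2)] eq by simp
qed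

end

section \<open>The case of faithful internal homs\<close>

locale hom_faithful_category = big_tt_category U F
  for U :: "'u set" and F :: "('o, 'm, 'x) tt_data_scheme" (structure) +
  assumes hom_faithful: "\<lbrakk>X \<in> Obj F; \<not> zero_object F X\<rbrakk> \<Longrightarrow> faithful (opposite F) F (\<lambda>A.
      Ihom F A X) (Ihom_contra F X)"
    and nonzero: "nonzero_category F"
begin

notation add (infixl "\<boxplus>" 60)
notation sub (infixl "\<boxminus>" 60)

lemma nonzero_tensor_faithful:
  assumes X: "X \<in> Obj F" and nz: "\<not> zero_object F X"
  shows "tensor_faithful F X"
  unfolding tensor_faithful_def faithful_def
proof (intro conjI ballI inj_onI)
  show "category_functor F F (\<lambda>Y. X \<otimes>\<^sub>o Y) (TL X)" by (rule TL_functor[OF X])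
  fix A B f f' assume f: "f \<in> Hom F A B" "f' \<in> Hom F A B" and eq: "TL X f = TL X f'"
  let ?W = "Ihom F X X"
  let ?V = "Ihom F B ?W"
  have oW: "?W \<in> Obj F" using Ihom_Obj[OF X X] .
  have o: "A \<in> Obj F" "B \<in> Obj F" using Hom_Obj f by blast+
  have oV: "?V \<in> Obj F" using Ihom_Obj[OF o(2) oW] .
  have eq2: "TL ?V f \<otimes>\<^sub>a Id F X = TL ?V f' \<otimes>\<^sub>a Id F X"
    by (rule tensor_assoc_eq[OF oV X f tensor_right_eq[OF X f eq]])
  have split: "(Eval F B ?W \<cdot> TL ?V g) \<otimes>\<^sub>a Id F X = (Eval F B ?W \<otimes>\<^sub>a Id F X) \<cdot> (TL ?V g \<otimes>\<^sub>a Id F X)"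
    if g: "g \<in> Hom F A B" for g
    using Tensor_Comp[OF TL_Hom[OF oV g] Eval_Hom[OF o(2) oW] Id_in_Hom[OF X] Id_in_Hom[OF X]] X
      by (simp add: cat)
  \<comment> \<open>Both sides take values in \<open>hom(X, X)\<close>, so they may be compared
    after tensoring with \<open>X\<close> and evaluating; then they involve \<open>f\<close> and
    \<open>f'\<close> only through the tensor product with \<open>X\<close>.\<close>
  have "Eval F B ?W \<cdot> TL ?V f = Eval F B ?W \<cdot> TL ?V f'"
    by (rule transpose_unique[OF Ihom_contra_arg[OF oW f(1)] Ihom_contra_arg[OF oW f(2)] X X])
      (simp add: split[OF f(1)] split[OF f(2)] eq2)
  then show "f = f'"
    by (rule Ihom_contra_faithful_eq[OF hom_faithful[OF oW Ihom_self_nonzero[OF X nz]] f])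
qed

lemma phantom_zero:
  assumes f: "f \<in> Hom F A B"
    and ph: "\<And>Z d y. Z \<in> Obj F \<Longrightarrow> compact d \<Longrightarrow> y \<in> Hom F d (Z \<otimes>\<^sub>o A) \<Longrightarrow> TL Z f \<cdot> y = Zero F d (Z \<otimes>\<^sub>o B)"
  shows "f = Zero F A B"
proof -
  obtain V where V: "V \<in> Obj F" "\<not> zero_object F V" using nonzero unfolding nonzero_category_def by blast
  obtain c y where c: "compact c" "y \<in> Hom F c V" "y \<noteq> Zero F c V"
      using compacts_detect_zero[OF V(1)] V(2) by blast
  have "\<not> zero_object F c" using c(2,3) zero_object_zero(2) by blast
  then obtain E where E: "E \<in> Obj F" "\<not> zero_object F E"
    "\<And>A B f g. f \<in> Hom F A B \<Longrightarrow> g \<in> Hom F B E \<Longrightarrow> (\<And>y. y \<in> Hom F c A \<Longrightarrow> f \<cdot> y = Zero F c B)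
       \<Longrightarrow> g \<cdot> f = Zero F A E" using ex_pure_injective[OF c(1)] by blast
  have o: "A \<in> Obj F" "B \<in> Obj F" using Hom_Obj f by blast+
  \<comment> \<open>With this choice, evaluation after \<open>TL ?Z f\<close> is the adjoint of
    \<open>hom(f, E)\<close>.\<close>
  let ?Z = "Ihom F B E"
  have oZ: "?Z \<in> Obj F" using Ihom_Obj[OF o(2) E(1)] .
  note ev = Eval_Hom[OF o(2) E(1)]
  have "Eval F B E \<cdot> TL ?Z f = Zero F (?Z \<otimes>\<^sub>o A) E"
    by (rule E(3)[OF TL_Hom[OF oZ f] ev ph[OF oZ c(1)]])
  also have "\<dots> = Eval F B E \<cdot> TL ?Z (Zero F A B)"
    unfolding TL_zero[OF oZ o] using ev Tensor_Obj[OF oZ o(1)] by (simp add: comp_zero Hom_def)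
  finally show ?thesis by (rule Ihom_contra_faithful_eq[OF hom_faithful[OF E(1,2)] f zero_Hom[OF o]])
qed

text \<open>The connecting arrow \<open>h\<close> is phantom after every tensoring: an arrow in the
  image of \<open>TL Z h\<close> is annihilated by \<open>TL Z (SM i)\<close>, and the latter
  inherits injectivity on compact sources from \<open>TL Z i\<close>. Thus \<open>h\<close> is zero
  and the triangle splits; its vanishing is recorded since it also splits off the
  complement.\<close>

lemma split_mono:
  assumes i: "i \<in> Hom F P X"
    and inj: "\<And>Z d y. Z \<in> Obj F \<Longrightarrow> compact d \<Longrightarrow> y \<in> Hom F d (Z \<otimes>\<^sub>o P) \<Longrightarrow> TL Z i \<cdot> y = Zero F d (Z \<otimes>\<^sub>o X)
      \<Longrightarrow> y = Zero F d (Z \<otimes>\<^sub>o P)"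
    and t: "triangle F P X D i g h"
  shows "h = Zero F D (SA P)" "\<exists>r\<in>Hom F X P. r \<cdot> i = Id F P"
proof -
  note th = triangleD[OF t]
  have o: "P \<in> Obj F" "X \<in> Obj F" "D \<in> Obj F" "SA P \<in> Obj F" "SA X \<in> Obj F" using Hom_Obj th SA_Obj
      by blast+
  show h: "h = Zero F D (SA P)"
  proof (rule phantom_zero[OF th(3)])
    fix Z d y assume Z: "Z \<in> Obj F" and d: "compact d" and y: "y \<in> Hom F d (Z \<otimes>\<^sub>o D)"
    note SMi = SM_Hom[OF i] and TS = TL_Hom[OF Z SM_Hom[OF i]]
    note oT = Tensor_Obj[OF Z o(1)] Tensor_Obj[OF Z o(2)] and od = compact_Obj[OF d]
    let ?y = "TL Z h \<cdot> y"
    have y': "?y \<in> Hom F d (Z \<otimes>\<^sub>o SA P)" using y TL_Hom[OF Z th(3)] by (simp add: cat)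
    have TSy: "TL Z (SM i) \<cdot> ?y = Zero F d (Z \<otimes>\<^sub>o SA X)" by (rule TL_triangle_comp_Susp[OF Z t y])
    \<comment> \<open>Injectivity is available for \<open>SM (TL Z i)\<close>, not for
      \<open>TL Z (SM i)\<close>; the isomorphism \<phi> of the exact functor mediates between the
      two.\<close>
    obtain \<phi> where nat: "natural_iso F F ((\<lambda>Y. Z \<otimes>\<^sub>o Y) \<circ> SA) (TL Z \<circ> SM) (SA \<circ> (\<lambda>Y.
        Z \<otimes>\<^sub>o Y)) (SM \<circ> TL Z) \<phi>"
      using TL_exact_functor[OF Z] unfolding exact_functor_def by blast
    have phi: "isomorphism F (Z \<otimes>\<^sub>o SA A) (SA (Z \<otimes>\<^sub>o A)) (\<phi> A)" if "A \<in> Obj F" for A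
      using nat that unfolding natural_iso_def by simp
    have sq: "\<phi> X \<cdot> TL Z (SM i) = SM (TL Z i) \<cdot> \<phi> P" using nat o(1,2) i unfolding natural_iso_def by simp
    obtain \<psi> where psi: "\<phi> P \<in> Hom F (Z \<otimes>\<^sub>o SA P) (SA (Z \<otimes>\<^sub>o P))" "\<psi> \<in> Hom F (SA (Z \<otimes>\<^sub>o P)) (Z \<otimes>\<^sub>o SA P)"
      "\<psi> \<cdot> \<phi> P = Id F (Z \<otimes>\<^sub>o SA P)" using phi[OF o(1)] by (rule isomorphismE)
    have phX: "\<phi> X \<in> Hom F (Z \<otimes>\<^sub>o SA X) (SA (Z \<otimes>\<^sub>o X))" using phi[OF o(2)] by (rule isomorphismE)
    have w: "\<phi> P \<cdot> ?y \<in> Hom F d (SA (Z \<otimes>\<^sub>o P))" using psi(1) y' by (simp add: cat)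
    have "SM (TL Z i) \<cdot> (\<phi> P \<cdot> ?y) = (SM (TL Z i) \<cdot> \<phi> P) \<cdot> ?y"
      by (rule Comp_assoc[symmetric, OF y' psi(1) SM_Hom[OF TL_Hom[OF Z i]]])
    also have "\<dots> = \<phi> X \<cdot> (TL Z (SM i) \<cdot> ?y)" unfolding sq[symmetric] by (rule Comp_assoc[OF y' TS phX])
    also have "\<dots> = Zero F d (SA (Z \<otimes>\<^sub>o X))" unfolding TSy using phX od by (simp add: comp_zero Hom_def)
    finally have "\<phi> P \<cdot> ?y = Zero F d (SA (Z \<otimes>\<^sub>o P))"
      using zero_via_desuspension[OF d w oT(1) TL_Hom[OF Z i]] inj[OF Z] by blast
    then have "\<psi> \<cdot> (\<phi> P \<cdot> ?y) = Zero F d (Z \<otimes>\<^sub>o SA P)" using psi od by (simp add: comp_zero Hom_def)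
    moreover have "\<psi> \<cdot> (\<phi> P \<cdot> ?y) = ?y"
      using Comp_assoc[OF y' psi(1,2)] psi(3) Id_Comp[OF y'] by simp
    ultimately show "?y = Zero F d (Z \<otimes>\<^sub>o SA P)" by simp
  qed
  then show "\<exists>r\<in>Hom F X P. r \<cdot> i = Id F P" by (rule split_mono_of_zero[OF t])
qed

text \<open>All arrows from compact objects lift through \<open>q\<close>, also after tensoring, so
  the next arrow of the triangle is phantom and vanishes.\<close>

lemma split_epi:
  assumes q: "q \<in> Hom F P X"
    and surj: "\<And>Z d y. Z \<in> Obj F \<Longrightarrow> compact d \<Longrightarrow> y \<in> Hom F d (Z \<otimes>\<^sub>o X) \<Longrightarrow> \<exists>y'\<in>Hom F d (Z \<otimes>\<^sub>o P).
      TL Z q \<cdot> y' = y"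
  shows "\<exists>s\<in>Hom F X P. q \<cdot> s = Id F X"
proof -
  obtain D g h where t: "triangle F P X D q g h" using TR1_cone[OF q] by blast
  note th = triangleD[OF t]
  have o: "X \<in> Obj F" "D \<in> Obj F" using Hom_Obj th by blast+
  have "g = Zero F X D"
  proof (rule phantom_zero[OF th(2)])
    fix Z d y assume Z: "Z \<in> Obj F" and d: "compact d" and y: "y \<in> Hom F d (Z \<otimes>\<^sub>o X)"
    obtain y' where "y' \<in> Hom F d (Z \<otimes>\<^sub>o P)" "TL Z q \<cdot> y' = y" using surj[OF Z d y] by blast
    then show "TL Z g \<cdot> y = Zero F d (Z \<otimes>\<^sub>o D)" using TL_triangle_comp[OF Z t] by blast
  qed
  then have "g \<cdot> Id F X = Zero F X D" using o by (simp add: addcat)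
  then show ?thesis using exact1[OF t Id_in_Hom[OF o(1)]] by blast
qed

text \<open>Tensoring with \<open>Z\<close> yields the shift of another sequence, so injectivity of
  \<open>1 - s\<close> on compact sources holds after every tensoring.\<close>

lemma telescope_split:
  fixes X :: "nat \<Rightarrow> 'o"
  assumes c: "is_coproduct F UNIV X P \<iota>" and k: "\<And>n. k n \<in> Hom F (X n) (X (Suc n))"
    and s: "s \<in> Hom F P P" "\<And>n. s \<cdot> \<iota> n = \<iota> (Suc n) \<cdot> k n"
    and t: "triangle F P P T (Id F P \<boxminus> s) q h"
  shows "h = Zero F T (SA P)" "\<exists>r\<in>Hom F P P. r \<cdot> (Id F P \<boxminus> s) = Id F P"
proof -
  note oP = coproduct_Obj[OF c] and inc = coproduct_incl[OF c UNIV_I]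
  have inj: "y = Zero F d (Z \<otimes>\<^sub>o P)"
    if Z: "Z \<in> Obj F" and d: "compact d" and y: "y \<in> Hom F d (Z \<otimes>\<^sub>o P)" "TL Z (Id F P \<boxminus> s) \<cdot> y =
      Zero F d (Z \<otimes>\<^sub>o P)" for Z d y
  proof (rule one_minus_shift_injective[OF TL_coproduct[OF Z small_nat[OF universe_U] c] TL_Hom[OF Z
    k] TL_Hom[OF Z s(1)] _ d y(1)])
    show "TL Z s \<cdot> TL Z (\<iota> n) = TL Z (\<iota> (Suc n)) \<cdot> TL Z (k n)" for n
      using TL_Comp[OF Z inc[of n] s(1)] TL_Comp[OF Z k[of n] inc[of "Suc n"]] s(2)[of n] by simp
    show "(Id F (Z \<otimes>\<^sub>o P) \<boxminus> TL Z s) \<cdot> y = Zero F d (Z \<otimes>\<^sub>o P)"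
      using y(2) TL_sub[OF Z Id_in_Hom[OF oP] s(1)] TL_Id[OF Z oP] by simp
  qed
  show "h = Zero F T (SA P)" "\<exists>r\<in>Hom F P P. r \<cdot> (Id F P \<boxminus> s) = Id F P"
    using split_mono[OF triangleD(1)[OF t] inj t] by blast+
qed

text \<open>The telescope of the constant sequence with arrow \<open>f\<close> is the image of
  \<open>f\<close>. As the telescope triangle splits, q is a split epimorphism, so arrows out of the
  telescope may be compared after composing with q.\<close>

lemma idempotents_split:
  assumes f: "f \<in> Hom F c c" "f \<cdot> f = f"
  obtains T t u where "t \<in> Hom F T c" "u \<in> Hom F c T" "t \<cdot> u = f" "u \<cdot> t = Id F T"
proof -
  have oc: "c \<in> Obj F" using Hom_Obj f(1) by blast
  obtain P \<iota> s where P: "is_coproduct F UNIV (\<lambda>_ :: nat. c) P \<iota>" "s \<in> Hom F P P" "\<And>n. s \<cdot> \<iota> n =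
      \<iota> (Suc n) \<cdot> f"
    "Id F P \<boxminus> s \<in> Hom F P P" using ex_shift[where X = "\<lambda>_. c" and k = "\<lambda>_. f", OF f(1)] by blast
  obtain T q h where t: "triangle F P P T (Id F P \<boxminus> s) q h" using TR1_cone[OF P(4)] by blast
  note th = triangleD[OF t] and inc = coproduct_incl[OF P(1) UNIV_I] and oP = coproduct_Obj[OF P(1)]
  have oT: "T \<in> Obj F" using Hom_Obj th by blast
  have step: "q \<cdot> \<iota> (Suc n) \<cdot> f = q \<cdot> \<iota> n" for n using telescope_incl(2)[OF P(1) f(1) P(2,3) t] .
  have uf: "q \<cdot> \<iota> n \<cdot> f = q \<cdot> \<iota> n" for n
  proof -
    have "(q \<cdot> \<iota> (Suc n) \<cdot> f) \<cdot> f = q \<cdot> \<iota> (Suc n) \<cdot> f"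
      using th inc[of "Suc n"] f by (simp add: cat)
    then show ?thesis unfolding step .
  qed
  have u0: "q \<cdot> \<iota> n = q \<cdot> \<iota> 0" for n
    by (induction n) (use step uf in auto)
  \<comment> \<open>The copairing of copies of \<open>f\<close> is invariant under the shift since
    \<open>f\<close> is idempotent; it therefore descends to the inclusion i of the image.\<close>
  obtain w where w: "w \<in> Hom F P c" "\<And>n. w \<cdot> \<iota> n = f"
    using coproduct_copair[OF P(1) oc, where f = "\<lambda>_. f"] f(1) by blast
  have "w \<cdot> s = w"
  proof (rule coproduct_ext[OF P(1) _ w(1)])
    fix n :: nat
    have "(w \<cdot> s) \<cdot> \<iota> n = (w \<cdot> \<iota> (Suc n)) \<cdot> f" using w(1) P(2,3) inc[of n] inc[of "Suc n"] f(1)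
        by (simp add: cat)
    then show "(w \<cdot> s) \<cdot> \<iota> n = w \<cdot> \<iota> n" unfolding w(2) f(2) .
  qed (use w P in \<open>simp add: cat\<close>)
  then have "w \<cdot> (Id F P \<boxminus> s) = Zero F P c"
    using w(1) P(2) oP sub_eq_zero_iff[OF w(1) w(1)] by (simp add: comp_sub cat)
  then obtain i where i: "i \<in> Hom F T c" "i \<cdot> q = w" using exact2[OF t w(1)] by blast
  define u where "u = q \<cdot> \<iota> 0"
  have u: "u \<in> Hom F c T" unfolding u_def using th inc[of 0] by (simp add: cat)
  have iu: "i \<cdot> u = f"
    using Comp_assoc[OF inc[of 0] th(2) i(1)] i(2) w(2)[of 0] unfolding u_def by simp
  have "(u \<cdot> i) \<cdot> q = q"
  proof (rule coproduct_ext[OF P(1) _ th(2)])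
    fix n :: nat
    have "((u \<cdot> i) \<cdot> q) \<cdot> \<iota> n = u \<cdot> (w \<cdot> \<iota> n)" using u i th w(1) inc[of n] by (simp add: cat flip: i(2))
    also have "\<dots> = q \<cdot> \<iota> n" unfolding w(2) u_def uf using u0[of n] ..
    finally show "((u \<cdot> i) \<cdot> q) \<cdot> \<iota> n = q \<cdot> \<iota> n" .
  qed (use u i w th in \<open>simp add: cat\<close>)
  moreover obtain v where v: "v \<in> Hom F T P" "q \<cdot> v = Id F T"
    using split_epi_of_zero[OF t telescope_split(1)[OF P(1) f(1) P(2,3) t]] by blast
  ultimately have "((u \<cdot> i) \<cdot> q) \<cdot> v = Id F T" by simp
  then have "u \<cdot> i = Id F T" using u i(1) th v oT by (simp add: cat)
  then show ?thesis using that i(1) u iu by blast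
qed

end

section \<open>Descending chains\<close>

text \<open>The step is \<open>(1 - e q) (1 - e) = 1 - e (1 + q - q e)\<close>; so q is a polynomial
  in \<open>e\<close> and commutes with it.\<close>

lemma (in ring) one_minus_power:
  assumes e: "e \<in> carrier R"
  shows "\<exists>q\<in>carrier R. e \<otimes> q = q \<otimes> e \<and> (\<one> \<ominus> e) [^] (m :: nat) = \<one> \<ominus> e \<otimes> q"
proof (induction m)
  case 0
  show ?case using e by (intro bexI[of _ \<zero>]) (simp_all add: minus_eq)
next
  case (Suc m)
  then obtain q where q: "q \<in> carrier R" "e \<otimes> q = q \<otimes> e" "(\<one> \<ominus> e) [^] m = \<one> \<ominus> e \<otimes> q" by blast
  let ?q = "\<one> \<oplus> q \<ominus> q \<otimes> e"
  have comm: "e \<otimes> ?q = ?q \<otimes> e"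
    using e q(1) by (simp add: minus_eq l_distr r_distr l_minus r_minus m_assoc q(2)[symmetric])
  have "(\<one> \<ominus> e) [^] Suc m = (\<one> \<ominus> e \<otimes> q) \<otimes> (\<one> \<ominus> e)" using q(3) by simp
  also have "\<dots> = \<one> \<ominus> e \<otimes> ?q"
    using e q(1) by (simp add: minus_eq l_distr r_distr l_minus r_minus minus_add a_ac m_assoc)
  finally show ?case using comm q(1) e by (intro bexI[of _ ?q]) simp_all
qed

lemma (in ring) commuting_power:
  assumes "a \<in> carrier R" "b \<in> carrier R" "a \<otimes> b = b \<otimes> a"
  shows "(a \<otimes> b) [^] (n :: nat) = a [^] n \<otimes> b [^] n" "a [^] n \<otimes> b = b \<otimes> a [^] n"
  by (rule pow_mult_distrib[OF assms(3,1,2)], rule group_commutes_pow[OF assms(3,1,2)])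

text \<open>
  Bass's argument that descending chains of principal left ideals produce idempotents: with
  \<open>x = a x\<^sup>2\<close> and \<open>e = a x\<close>, minimality of \<open>x\<close> makes \<open>e\<^sup>2 - e\<close> nilpotent, and then
  \<open>(e q)\<^sup>m\<close> is idempotent for a suitable polynomial \<open>q\<close> in \<open>e\<close>.
\<close>

lemma (in ring) ex_idempotent:
  assumes x: "x \<in> carrier R" and nil: "\<And>n :: nat. x [^] n \<noteq> \<zero>"
    and min: "\<And>w. w \<in> carrier R \<Longrightarrow> (\<And>n :: nat. (w \<otimes> x) [^] n \<noteq> \<zero>) \<Longrightarrow> \<exists>h\<in>carrier R. h \<otimes> (w \<otimes> x) = x"
  shows "\<exists>a\<in>carrier R. \<exists>k\<in>carrier R. (a \<otimes> x \<otimes> k) \<otimes> (a \<otimes> x \<otimes> k) = a \<otimes> x \<otimes> k \<and> a \<otimes> x \<otimes> k \<noteq> \<zero>"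
proof -
  have "(x \<otimes> x) [^] n \<noteq> \<zero>" for n :: nat
    using nil[of "n + n"] x by (simp add: nat_pow_mult pow_mult_distrib)
  then obtain a where a: "a \<in> carrier R" "a \<otimes> (x \<otimes> x) = x" using min[OF x] by blast
  define e where "e = a \<otimes> x"
  have e: "e \<in> carrier R" "e \<otimes> x = x" using a x by (simp_all add: e_def m_assoc)
  have ex: "e [^] n \<otimes> x = x" for n :: nat
    by (induction n) (use e x in \<open>simp_all add: m_assoc\<close>)
  have enil: "e [^] n \<noteq> \<zero>" for n :: nat
  proof
    assume "e [^] n = \<zero>"
    then have "x = \<zero>" using ex[of n] x by simp
    then show False using nil[of 1] x by simp
  qed
  \<comment> \<open>Chosen so that \<open>?w \<otimes> x\<close> equals \<open>e (e - 1)\<close>. If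
    it were not nilpotent, minimality would recover x from it; but it annihilates x on the right
    because \<open>e \<otimes> x = x\<close>, and then the square of x would vanish.\<close>
  let ?w = "e \<otimes> a \<ominus> a"
  have w: "?w \<in> carrier R" using e a by simp
  have wx: "?w \<otimes> x = e \<otimes> (e \<ominus> \<one>)"
    using e(1) a(1) x by (simp add: minus_eq l_distr r_distr l_minus r_minus m_assoc) (simp add: e_def)
  have "\<exists>m :: nat. (?w \<otimes> x) [^] m = \<zero>"
  proof (rule ccontr)
    assume "\<nexists>m :: nat. (?w \<otimes> x) [^] m = \<zero>"
    then obtain h where h: "h \<in> carrier R" "h \<otimes> (?w \<otimes> x) = x" using min[OF w] by blast
    have "(?w \<otimes> x) \<otimes> x = \<zero>" unfolding wx using e x
      by (simp add: minus_eq r_distr l_distr r_minus l_minus m_assoc r_neg)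
    then have "h \<otimes> ((?w \<otimes> x) \<otimes> x) = \<zero>" using h(1) by simp
    then have "x \<otimes> x = \<zero>" using h w x by (simp add: m_assoc[symmetric])
    then show False using nil[of 2] x by (simp add: numeral_2_eq_2)
  qed
  then obtain m :: nat where m: "(e \<otimes> (e \<ominus> \<one>)) [^] m = \<zero>" unfolding wx by blast
  let ?f = "\<one> \<ominus> e"
  have f: "?f \<in> carrier R" "e \<otimes> ?f = ?f \<otimes> e"
    using e by (simp_all add: minus_eq l_distr r_distr l_minus r_minus)
  have "e \<otimes> (e \<ominus> \<one>) = \<ominus> (e \<otimes> ?f)"
    using e by (simp add: minus_eq r_distr r_minus minus_add a_comm)
  then have "(\<ominus> (e \<otimes> ?f)) [^] m = \<zero>" using m by simp
  moreover have "(\<ominus> y) [^] n = \<zero> \<longleftrightarrow> y [^] n = \<zero>" if y: "y \<in> carrier R" for y and n :: nat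
  proof -
    have "(\<ominus> y) [^] n = y [^] n \<or> (\<ominus> y) [^] n = \<ominus> (y [^] n)"
      by (induction n) (use y in \<open>auto simp: l_minus r_minus\<close>)
    then show ?thesis using y by (metis minus_zero minus_minus nat_pow_closed)
  qed
  ultimately have ef: "(e \<otimes> ?f) [^] m = \<zero>" using e(1) f(1) by blast
  obtain q where q: "q \<in> carrier R" "e \<otimes> q = q \<otimes> e" "?f [^] m = \<one> \<ominus> e \<otimes> q"
    using one_minus_power[OF e(1), of m] by blast
  have "e [^] m \<otimes> (\<one> \<ominus> e \<otimes> q) = \<zero>"
    using commuting_power(1)[OF e(1) f, of m] ef q(3) by simp
  then have "e [^] m \<oplus> \<ominus> (e [^] m \<otimes> (e \<otimes> q)) = \<zero>" using e q(1) by (simp add: minus_eq r_distr r_minus)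
  \<comment> \<open>Expanding the second factor of the vanishing \<open>e^m (1 - e)^m\<close> shows
    that \<open>e^m\<close> absorbs \<open>e q\<close>, and then every power of it.\<close>
  then have emq: "e [^] m \<otimes> (e \<otimes> q) = e [^] m"
    using e q(1) by (metis minus_equality minus_minus m_closed nat_pow_closed a_inv_closed)
  have emqn: "e [^] m \<otimes> (e \<otimes> q) [^] n = e [^] m" for n :: nat
  proof (induction n)
    case (Suc n)
    have "e [^] m \<otimes> (e \<otimes> q) [^] Suc n = (e [^] m \<otimes> (e \<otimes> q) [^] n) \<otimes> (e \<otimes> q)"
      using e q(1) by (simp add: m_assoc)
    then show ?case using Suc emq by simp
  qed (use e in simp)
  \<comment> \<open>Since \<open>p = e^m q^m\<close> and \<open>e^m\<close> absorbs
    \<open>p\<close>, the square of \<open>p\<close> is \<open>p\<close>. It is non-zero because it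
    fixes \<open>e^m\<close>, which is not zero.\<close>
  define p where "p = (e \<otimes> q) [^] m"
  have pe: "p = e [^] m \<otimes> q [^] m" unfolding p_def by (rule commuting_power(1)[OF e(1) q(1,2)])
  have qp: "q [^] m \<otimes> p = p \<otimes> q [^] m"
  proof -
    have "q \<otimes> (e \<otimes> q) = (e \<otimes> q) \<otimes> q" using e(1) q(1) by (simp add: m_assoc q(2))
    then have "q [^] m \<otimes> (e \<otimes> q) = (e \<otimes> q) \<otimes> q [^] m" using commuting_power(2)[OF q(1)] e q(1) by simp
    then have "(e \<otimes> q) [^] m \<otimes> q [^] m = q [^] m \<otimes> (e \<otimes> q) [^] m"
      using commuting_power(2)[of "e \<otimes> q" "q [^] m" m] e q(1) by simp
    then show ?thesis unfolding p_def by simp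
  qed
  have pc: "p \<in> carrier R" using e q(1) by (simp add: p_def)
  have "p \<otimes> p = e [^] m \<otimes> (q [^] m \<otimes> p)" using pe pc e q(1) by (simp add: m_assoc)
  also have "\<dots> = (e [^] m \<otimes> p) \<otimes> q [^] m" unfolding qp using pc e q(1) by (simp add: m_assoc)
  also have "\<dots> = p" using emqn[of m] pe by (simp add: p_def)
  finally have pp: "p \<otimes> p = p" .
  have p0: "p \<noteq> \<zero>"
  proof
    assume "p = \<zero>"
    then have "e [^] m = \<zero>" using emqn[of m] e by (simp add: p_def)
    then show False using enil by blast
  qed
  \<comment> \<open>A positive exponent is needed to pull a factor \<open>e\<close>, and with it x,
    out of \<open>p\<close>.\<close>
  have m0: "m \<noteq> 0"
  proof
    assume "m = 0"
    then have "\<one> = \<zero>" using m by simp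
    then show False using nil[of 0] by simp
  qed
  then obtain m' where m': "m = Suc m'" using not0_implies_Suc by blast
  have "p = (e \<otimes> q) \<otimes> (e \<otimes> q) [^] m'"
    unfolding p_def m' using e q(1) nat_pow_Suc2[of "e \<otimes> q" m'] by simp
  then have "p = a \<otimes> x \<otimes> (q \<otimes> (e \<otimes> q) [^] m')"
    using e q(1) a(1) x by (simp add: m_assoc[symmetric] e_def)
  moreover have "q \<otimes> (e \<otimes> q) [^] m' \<in> carrier R" using e q(1) by simp
  ultimately show ?thesis using pp p0 a(1) by metis
qed

section \<open>Chains of arrows out of a compact object\<close>

definition (in additive_category) End :: "'o \<Rightarrow> 'm ring" where
  "End A = \<lparr>carrier = Hom C A A, mult = Comp C, one = Id C A, zero = Zero C A A, add = Add C\<rparr>"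

lemma (in additive_category) End_simps:
  "carrier (End A) = Hom C A A" "mult (End A) = Comp C" "one (End A) = Id C A"
  "zero (End A) = Zero C A A" "ring.add (End A) = Add C"
  by (simp_all add: End_def)

lemma (in additive_category) ring_End:
  assumes A: "A \<in> Obj C"
  shows "ring (End A)"
proof (rule ringI)
  show "abelian_group (End A)"
    by (rule abelian_groupI; unfold End_simps)
      (use A in \<open>auto intro: add_Hom add_assoc add_comm add_zero zero_Hom neg_Hom add_neg\<close>)
  show "Group.monoid (End A)"
    by (rule monoidI; unfold End_simps)
      (use A in \<open>auto intro: Comp_in_Hom Id_in_Hom Comp_Id Id_Comp Comp_assoc\<close>)
qed (unfold End_simps, auto intro: Comp_Add_left Comp_Add_right)

context hom_faithful_category
begin

primrec comp_seq :: "(nat \<Rightarrow> 'o) \<Rightarrow> (nat \<Rightarrow> 'm) \<Rightarrow> nat \<Rightarrow> 'm" where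
  "comp_seq X k 0 = Id F (X 0)"
| "comp_seq X k (Suc n) = k n \<cdot> comp_seq X k n"

lemma comp_seq_Hom:
  "(\<And>n. k n \<in> Hom F (X n) (X (Suc n))) \<Longrightarrow> comp_seq X k n \<in> Hom F (X 0) (X n)"
  by (induction n) (auto intro: Id_in_Hom Comp_in_Hom dest: Hom_Obj)

text \<open>Let r be a left inverse of \<open>1 - s\<close> and N an index outside the finite
  support of \<open>r \<cdot> \<iota> 0\<close>. In the N-th component, \<open>r (1 - s) = 1\<close>
  gives that the component of \<open>r \<cdot> \<iota> 0\<close> is \<open>(1 + h k_N)\<close>
  composed with the first N arrows, where h comes from \<open>r \<cdot> \<iota> (Suc N)\<close>. It
  is zero by the choice of N, so the N-fold composite equals \<open>- h\<close> after the next
  one.\<close>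

lemma sequence_stabilizes:
  assumes k: "\<And>n. k n \<in> Hom F (X n) (X (Suc n))" and X0: "compact (X 0)"
  shows "\<exists>N>0. \<exists>h\<in>Hom F (X (Suc N)) (X N). h \<cdot> comp_seq X k (Suc N) = comp_seq X k N"
proof -
  obtain P \<iota> s where P: "is_coproduct F UNIV X P \<iota>" "s \<in> Hom F P P" "\<And>n. s \<cdot> \<iota> n = \<iota> (Suc n) \<cdot> k n"
    "Id F P \<boxminus> s \<in> Hom F P P" using ex_shift[where X = X and k = k, OF k] by blast
  obtain T q h where t: "triangle F P P T (Id F P \<boxminus> s) q h" using TR1_cone[OF P(4)] by blast
  obtain r where r: "r \<in> Hom F P P" "r \<cdot> (Id F P \<boxminus> s) = Id F P"
      using telescope_split(2)[OF P(1) k P(2,3) t] by blast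
  note inc = coproduct_incl[OF P(1) UNIV_I] and oX = coproduct_summand[OF P(1) UNIV_I]
    and oP = coproduct_Obj[OF P(1)]
  have rr: "r \<boxminus> r \<cdot> s = Id F P" using r P(2) oP by (simp add: comp_sub cat)
  have a: "r \<cdot> \<iota> n \<boxminus> r \<cdot> \<iota> (Suc n) \<cdot> k n = \<iota> n" for n
  proof -
    have "(r \<boxminus> r \<cdot> s) \<cdot> \<iota> n = r \<cdot> \<iota> n \<boxminus> r \<cdot> (s \<cdot> \<iota> n)" using r(1) P(2) inc[of n] by (simp add: comp_sub cat)
    then show ?thesis unfolding rr P(3) using r(1) inc[of n] inc[of "Suc n"] k[of n] by (simp add: cat)
  qed
  have r0: "r \<cdot> \<iota> 0 \<in> Hom F (X 0) P" using r(1) inc[of 0] by (simp add: cat)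
  obtain J where J: "finite J" "J \<subseteq> UNIV" "supported J \<iota> (r \<cdot> \<iota> 0)"
    using compact_supported[OF X0 small_nat[OF universe_U] P(1) r0] .
  \<comment> \<open>Position 0 is excluded because \<open>ex_minimal\<close> prepends the common
    source to its chain.\<close>
  obtain N where N: "N \<notin> J" "N > 0" using J(1) ex_new_if_finite[of "insert 0 J"] infinite_UNIV_nat by auto
  obtain p where p: "p \<in> Hom F P (X N)" "p \<cdot> \<iota> N = Id F (X N)"
    "\<And>i. i \<in> UNIV \<Longrightarrow> i \<noteq> N \<Longrightarrow> p \<cdot> \<iota> i = Zero F (X i) (X N)" using coproduct_proj[OF P(1) UNIV_I, of N]
      by blast
  note cs = comp_seq_Hom[where X = X and k = k, OF k]
  have pr: "p \<cdot> (r \<cdot> \<iota> n) \<in> Hom F (X n) (X N)" for n using p(1) r(1) inc[of n] by (simp add: cat)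
  have pa: "p \<cdot> (r \<cdot> \<iota> n) \<boxminus> (p \<cdot> (r \<cdot> \<iota> (Suc n))) \<cdot> k n = p \<cdot> \<iota> n" for n
  proof -
    have "p \<cdot> (r \<cdot> \<iota> n \<boxminus> r \<cdot> \<iota> (Suc n) \<cdot> k n) = p \<cdot> (r \<cdot> \<iota> n) \<boxminus> (p \<cdot> (r \<cdot> \<iota> (Suc n))) \<cdot> k n"
      using p(1) r(1) inc[of n] inc[of "Suc n"] k[of n] by (simp add: comp_sub cat)
    then show ?thesis unfolding a by simp
  qed
  \<comment> \<open>Below N the N-th component of \<open>\<iota> n\<close> vanishes, so the relation
    \<open>pa\<close> passes the composite along one arrow at a time.\<close>
  have shift: "p \<cdot> (r \<cdot> \<iota> 0) = (p \<cdot> (r \<cdot> \<iota> n)) \<cdot> comp_seq X k n" if "n \<le> N" for n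
    using that
  proof (induction n)
    case 0
    show ?case using pr[of 0] oX[of 0] by (simp add: cat)
  next
    case (Suc n)
    have "p \<cdot> \<iota> n = Zero F (X n) (X N)" using p(3)[of n] Suc by auto
    then have "p \<cdot> (r \<cdot> \<iota> n) = (p \<cdot> (r \<cdot> \<iota> (Suc n))) \<cdot> k n"
      using pa[of n] sub_eq_zero_iff[OF pr[of n] Comp_in_Hom[OF k[of n] pr[of "Suc n"]]] by simp
    then have "p \<cdot> (r \<cdot> \<iota> 0) = ((p \<cdot> (r \<cdot> \<iota> (Suc n))) \<cdot> k n) \<cdot> comp_seq X k n" using Suc by simp
    also have "\<dots> = (p \<cdot> (r \<cdot> \<iota> (Suc n))) \<cdot> comp_seq X k (Suc n)"
      using Comp_assoc[OF cs[of n] k[of n] pr[of "Suc n"]] by simp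
    finally show ?case .
  qed
  have zero: "p \<cdot> (r \<cdot> \<iota> 0) = Zero F (X 0) (X N)"
  proof -
    have "p \<cdot> (r \<cdot> \<iota> 0) = Zero F P (X N) \<cdot> (r \<cdot> \<iota> 0)"
    proof (rule supported_eq[OF P(1) J(3,2) r0 p(1) zero_Hom[OF oP oX]])
      fix j assume "j \<in> J"
      then have "j \<noteq> N" using N(1) by auto
      then have "p \<cdot> \<iota> j = Zero F (X j) (X N)" by (rule p(3)[OF UNIV_I])
      then show "p \<cdot> \<iota> j = Zero F P (X N) \<cdot> \<iota> j" using inc[of j] oX[of N] by (simp add: zero_comp Hom_def)
    qed
    then show ?thesis using r0 oX[of N] by (simp add: zero_comp Hom_def)
  qed
  let ?h = "p \<cdot> (r \<cdot> \<iota> (Suc N))"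
  note hH = pr[of "Suc N"] and csN = cs[of N] and csS = cs[of "Suc N"]
  have hk: "?h \<cdot> k N \<in> Hom F (X N) (X N)" by (rule Comp_in_Hom[OF k[of N] hH])
  have hcs: "?h \<cdot> comp_seq X k (Suc N) \<in> Hom F (X 0) (X N)" by (rule Comp_in_Hom[OF csS hH])
  have "p \<cdot> (r \<cdot> \<iota> N) = Id F (X N) \<boxplus> ?h \<cdot> k N"
    using pa[of N] p(2) add_sub_cancel[OF pr[of N] hk] by simp
  then have "Zero F (X 0) (X N) = (Id F (X N) \<boxplus> ?h \<cdot> k N) \<cdot> comp_seq X k N"
    using shift[of N] zero by simp
  also have "\<dots> = comp_seq X k N \<boxplus> (?h \<cdot> k N) \<cdot> comp_seq X k N"
    using Comp_Add_left[OF csN Id_in_Hom[OF oX] hk] Id_Comp[OF csN] by simp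
  also have "(?h \<cdot> k N) \<cdot> comp_seq X k N = ?h \<cdot> comp_seq X k (Suc N)"
    using Comp_assoc[OF csN k[of N] hH] by simp
  finally have "?h \<cdot> comp_seq X k (Suc N) \<boxplus> comp_seq X k N = Zero F (X 0) (X N)"
    using add_comm[OF csN hcs] by simp
  then have "comp_seq X k N = neg (?h \<cdot> comp_seq X k (Suc N))" by (rule neg_unique[OF hcs csN])
  also have "\<dots> = neg ?h \<cdot> comp_seq X k (Suc N)" using hH csS by (simp add: neg_comp Hom_def)
  finally show ?thesis using N(2) neg_Hom[OF hH] by metis
qed

text \<open>Minimality is with respect to left divisibility: composing \<open>g\<close> further
  inside \<open>G\<close> loses no information. Without a minimal element, dependent choice gives a
  chain in which each step is strict, contrary to \<open>sequence_stabilizes\<close>.\<close>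

lemma ex_minimal:
  assumes c0: "compact c0" and g0: "g0 \<in> G" and G: "\<And>g. g \<in> G \<Longrightarrow> g \<in> Hom F c0 (Cod F g)"
  shows "\<exists>g\<in>G. \<forall>w. w \<in> Arr F \<longrightarrow> Dom F w = Cod F g \<longrightarrow> w \<cdot> g \<in> G \<longrightarrow>
    (\<exists>h\<in>Hom F (Cod F w) (Cod F g). h \<cdot> (w \<cdot> g) = g)"
proof (rule ccontr)
  assume neg: "\<not> ?thesis"
  let ?Q = "\<lambda>(n :: nat) g g'. \<exists>w. w \<in> Arr F \<and> Dom F w = Cod F g \<and> g' = w \<cdot> g \<and>
    \<not> (\<exists>h\<in>Hom F (Cod F w) (Cod F g). h \<cdot> (w \<cdot> g) = g)"
  have "\<exists>f. \<forall>n. f n \<in> G \<and> ?Q n (f n) (f (Suc n))"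
  proof (rule dependent_nat_choice)
    show "\<exists>g. g \<in> G" using g0 by blast
    show "\<exists>g'. g' \<in> G \<and> ?Q n g g'" if "g \<in> G" for g and n :: nat using neg that by blast
  qed
  then obtain f where f: "\<And>n. f n \<in> G" "\<And>n. ?Q n (f n) (f (Suc n))" by blast
  then obtain w where w: "\<And>n. w n \<in> Arr F" "\<And>n. Dom F (w n) = Cod F (f n)" "\<And>n. f (Suc n) = w n \<cdot> f n"
    "\<And>n. \<not> (\<exists>h\<in>Hom F (Cod F (w n)) (Cod F (f n)). h \<cdot> (w n \<cdot> f n) = f n)" by metis
  have fH: "f n \<in> Hom F c0 (Cod F (f n))" for n using G f(1) by blast
  have codS: "Cod F (f (Suc n)) = Cod F (w n)" for n unfolding w(3) using w(1,2) fH[of n] by (simp add: cat)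
  \<comment> \<open>The sequence starts with the common source and the first member of the chain, so
    the composite at \<open>Suc n\<close> is \<open>f n\<close>.\<close>
  define X where "X n = (case n of 0 \<Rightarrow> c0 | Suc m \<Rightarrow> Cod F (f m))" for n
  define k where "k n = (case n of 0 \<Rightarrow> f 0 | Suc m \<Rightarrow> w m)" for n
  have kH: "k n \<in> Hom F (X n) (X (Suc n))" for n
    using fH[of 0] w(1,2) codS unfolding k_def X_def Hom_def by (cases n) auto
  have cs: "comp_seq X k (Suc n) = f n" for n
  proof (induction n)
    case 0
    show ?case using fH[of 0] compact_Obj[OF c0] by (simp add: k_def X_def cat)
  next
    case (Suc n)
    then show ?case by (simp add: k_def w(3))
  qed
  obtain N h where N: "N > 0" "h \<in> Hom F (X (Suc N)) (X N)" "h \<cdot> comp_seq X k (Suc N) = comp_seq X k N"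
    using sequence_stabilizes[where k = k and X = X, OF kH] c0 unfolding X_def by auto
  then obtain n where n: "N = Suc n" by (cases N) auto
  have "h \<in> Hom F (Cod F (w n)) (Cod F (f n))" using N(2) codS[of n] unfolding n X_def by simp
  moreover have "h \<cdot> (w n \<cdot> f n) = f n" using N(3) unfolding n cs w(3) .
  ultimately show False using w(4) by blast
qed

end

section \<open>Decomposition into compact objects\<close>

context hom_faithful_category
begin

text \<open>A non-zero arrow \<open>u0\<close> from a compact object is factored through a compact c
  as late as possible. Compactness pushes c into a finite part of the coproduct, and minimality
  brings it back by an endomorphism E of c. It factors through \<open>X\<close> and fixes a non-zero
  arrow, so it is not nilpotent; Bass's argument then yields an idempotent of c that factors through
  \<open>X\<close>.\<close>

lemma ex_compact_summand:
  assumes X: "X \<in> Obj F" "\<not> zero_object F X"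
    and I: "small U I" and D: "is_coproduct F I W D \<iota>" and W: "\<And>i. i \<in> I \<Longrightarrow> compact (W i)"
    and \<sigma>: "\<sigma> \<in> Hom F X D" and \<rho>: "\<rho> \<in> Hom F D X" and \<rho>\<sigma>: "\<rho> \<cdot> \<sigma> = Id F X"
  shows "\<exists>T t u. compact T \<and> \<not> zero_object F T \<and> t \<in> Hom F T X \<and> u \<in> Hom F X T \<and> u \<cdot> t = Id F T"
proof -
  obtain c0 u0 where c0: "compact c0" and u0: "u0 \<in> Hom F c0 X" "u0 \<noteq> Zero F c0 X"
    using compacts_detect_zero[OF X(1)] X(2) by blast
  note oc0 = compact_Obj[OF c0]
  \<comment> \<open>The compact stages through which \<open>u0\<close> factors; the identity is one
    of them.\<close>
  let ?G = "{g. g \<in> Hom F c0 (Cod F g) \<and> compact (Cod F g) \<and> (\<exists>v\<in>Hom F (Cod F g) X. v \<cdot> g = u0)}"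
  have "Id F c0 \<in> ?G" using oc0 c0 u0 by (auto simp: cat intro!: exI[of _ u0])
  then obtain g where g: "g \<in> ?G"
    and gmin: "\<And>w. w \<in> Arr F \<Longrightarrow> Dom F w = Cod F g \<Longrightarrow> w \<cdot> g \<in> ?G \<Longrightarrow> \<exists>h\<in>Hom F (Cod F w) (Cod F g).
      h \<cdot> (w \<cdot> g) = g"
    using ex_minimal[OF c0, of "Id F c0" ?G] by blast
  define c where "c = Cod F g"
  have gc: "g \<in> Hom F c0 c" and cc: "compact c" using g unfolding c_def by blast+
  note oc = compact_Obj[OF cc]
  obtain v where v: "v \<in> Hom F c X" "v \<cdot> g = u0" using g unfolding c_def by blast
  have \<sigma>v: "\<sigma> \<cdot> v \<in> Hom F c D" using v(1) \<sigma> by (simp add: cat)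
  obtain J where J: "finite J" "J \<subseteq> I" "supported J \<iota> (\<sigma> \<cdot> v)" using compact_supported[OF cc I D \<sigma>v] .
  obtain D' \<kappa> where D': "is_coproduct F J W D' \<kappa>"
    using ex_coproduct[OF small_finite[OF universe_U J(1)], of W] W compact_Obj J(2) by blast
  have cD': "compact D'" by (rule compact_finite_coproduct[OF J(1) D']) (use W J(2) in blast)
  obtain l p where lp: "l \<in> Hom F D' D" "p \<in> Hom F D D'"
    "\<And>A y. y \<in> Hom F A D \<Longrightarrow> supported J \<iota> y \<Longrightarrow> l \<cdot> (p \<cdot> y) = y"
    by (rule coproduct_finite_part[OF D D' J(2)], rule that; assumption)
  \<comment> \<open>\<open>\<sigma> \<cdot> v\<close> has finite support, so \<open>w\<close> into
    the finite part loses nothing: \<open>\<rho> \<cdot> l\<close> still sends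
    \<open>w \<cdot> g\<close> to \<open>u0\<close>, which is why \<open>w \<cdot> g\<close> stays
    in \<open>?G\<close>.\<close>
  define w where "w = p \<cdot> (\<sigma> \<cdot> v)"
  have w: "w \<in> Hom F c D'" unfolding w_def using lp(2) \<sigma>v by (simp add: cat)
  have "(\<rho> \<cdot> l) \<cdot> (w \<cdot> g) = \<rho> \<cdot> ((l \<cdot> w) \<cdot> g)" using \<rho> lp(1) w gc by (simp add: cat)
  also have "l \<cdot> w = \<sigma> \<cdot> v" unfolding w_def by (rule lp(3)[OF \<sigma>v J(3)])
  also have "\<rho> \<cdot> ((\<sigma> \<cdot> v) \<cdot> g) = (\<rho> \<cdot> \<sigma>) \<cdot> (v \<cdot> g)" using \<rho> \<sigma> v(1) gc by (simp add: cat)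
  also have "\<dots> = u0" unfolding \<rho>\<sigma> v(2) using u0(1) by (simp add: cat)
  finally have "(\<rho> \<cdot> l) \<cdot> (w \<cdot> g) = u0" .
  moreover have "\<rho> \<cdot> l \<in> Hom F D' X" "w \<cdot> g \<in> Hom F c0 D'" using \<rho> lp(1) w gc by (simp_all add: cat)
  ultimately have "w \<cdot> g \<in> ?G" using cD' by (auto simp: Hom_def)
  then obtain h where h: "h \<in> Hom F D' c" "h \<cdot> (w \<cdot> g) = g"
    using gmin[of w] w unfolding c_def by (auto simp: Hom_def)
  define E where "E = h \<cdot> w"
  have E: "E \<in> Hom F c c" unfolding E_def using h(1) w by (simp add: cat)
  have Eg: "E \<cdot> g = g" unfolding E_def using h w gc by (simp add: cat)
  have Ev: "E = (h \<cdot> p \<cdot> \<sigma>) \<cdot> v" unfolding E_def w_def using h(1) lp(2) \<sigma> v(1) by (simp add: cat)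
  have g0: "g \<noteq> Zero F c0 c"
  proof
    assume "g = Zero F c0 c"
    then have "v \<cdot> g = Zero F c0 X" using v(1) oc0 by (simp add: comp_zero Hom_def)
    then show False using v(2) u0(2) by simp
  qed
  interpret R: ring "End c" by (rule ring_End[OF oc])
  have Epow: "(E [^]\<^bsub>End c\<^esub> n) \<in> Hom F c c \<and> (E [^]\<^bsub>End c\<^esub> n) \<cdot> g = g" for n :: nat
  proof (induction n)
    case 0
    then show ?case using gc oc by (simp add: End_simps cat)
  next
    case (Suc n)
    then show ?case using E gc Eg by (auto simp: End_simps cat)
  qed
  \<comment> \<open>Non-nilpotent left multiples of E. Being a left multiple of E means factoring
    through \<open>v\<close>, hence through \<open>X\<close>, and this survives in the
    idempotent.\<close>
  let ?G2 = "{x \<in> Hom F c c. (\<exists>a\<in>Hom F c c. x = a \<cdot> E) \<and> (\<forall>n :: nat. x [^]\<^bsub>End c\<^esub> n \<noteq> Zero F c c)}"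
  have "E [^]\<^bsub>End c\<^esub> n \<noteq> Zero F c c" for n :: nat
  proof
    assume "E [^]\<^bsub>End c\<^esub> n = Zero F c c"
    then have "g = Zero F c c \<cdot> g" using Epow[of n] by simp
    then show False using g0 gc oc by (simp add: zero_comp Hom_def)
  qed
  moreover have "E = Id F c \<cdot> E" using E by (simp add: cat)
  ultimately have "E \<in> ?G2" using E Id_in_Hom[OF oc] by blast
  then obtain x where x: "x \<in> ?G2"
    and xmin: "\<And>w. w \<in> Arr F \<Longrightarrow> Dom F w = Cod F x \<Longrightarrow> w \<cdot> x \<in> ?G2 \<Longrightarrow> \<exists>h\<in>Hom F (Cod F w) (Cod F x).
      h \<cdot> (w \<cdot> x) = x"
    using ex_minimal[OF cc, of E ?G2] by (auto simp: Hom_def)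
  obtain b where b: "b \<in> Hom F c c" "x = b \<cdot> E" using x by blast
  have xH: "x \<in> Hom F c c" using x by blast
  have xmin': "\<exists>h\<in>carrier (End c). h \<otimes>\<^bsub>End c\<^esub> (w \<otimes>\<^bsub>End c\<^esub> x) = x"
    if w: "w \<in> carrier (End c)" "\<And>n :: nat. (w \<otimes>\<^bsub>End c\<^esub> x) [^]\<^bsub>End c\<^esub> n \<noteq> \<zero>\<^bsub>End c\<^esub>" for w
  proof -
    have wH: "w \<in> Hom F c c" using w(1) unfolding End_simps .
    have "w \<cdot> x = (w \<cdot> b) \<cdot> E" "w \<cdot> b \<in> Hom F c c" "w \<cdot> x \<in> Hom F c c" using wH b E xH
        by (simp_all add: cat)
    then have "w \<cdot> x \<in> ?G2" using w(2) unfolding End_simps by blast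
    then show ?thesis unfolding End_simps using xmin[of w] wH xH by (auto simp: Hom_def)
  qed
  have xnil: "x [^]\<^bsub>End c\<^esub> n \<noteq> \<zero>\<^bsub>End c\<^esub>" for n :: nat using x unfolding End_simps by blast
  obtain a k where a: "a \<in> Hom F c c" "k \<in> Hom F c c" "(a \<cdot> x \<cdot> k) \<cdot> (a \<cdot> x \<cdot> k) = a \<cdot> x \<cdot> k"
      "a \<cdot> x \<cdot> k \<noteq> Zero F c c"
    using R.ex_idempotent[OF xH[folded End_simps(1)] xnil xmin'] unfolding End_simps by blast
  define f where "f = a \<cdot> x \<cdot> k"
  \<comment> \<open>The idempotent is \<open>\<alpha> \<cdot> \<beta>\<close> with \<open>X\<close>
    in the middle, so its image T is a retract of \<open>X\<close> as well as of c.\<close>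
  define \<alpha> where "\<alpha> = a \<cdot> b \<cdot> (h \<cdot> p \<cdot> \<sigma>)"
  define \<beta> where "\<beta> = v \<cdot> k"
  have \<alpha>: "\<alpha> \<in> Hom F X c" unfolding \<alpha>_def using a(1) b(1) h(1) lp(2) \<sigma> by (simp add: cat)
  have \<beta>: "\<beta> \<in> Hom F c X" unfolding \<beta>_def using v(1) a(2) by (simp add: cat)
  have f: "f \<in> Hom F c c" "f \<cdot> f = f" unfolding f_def using a xH by (simp_all add: cat)
  have fab: "f = \<alpha> \<cdot> \<beta>"
    unfolding f_def \<alpha>_def \<beta>_def b(2) Ev using a(1,2) b(1) h(1) lp(2) \<sigma> v(1) by (simp add: cat)
  obtain T t u where T: "t \<in> Hom F T c" "u \<in> Hom F c T" "t \<cdot> u = f" "u \<cdot> t = Id F T"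
    using idempotents_split[OF f] .
  have oT: "T \<in> Obj F" using Hom_Obj T(1) by blast
  have "\<not> zero_object F T"
  proof
    assume "zero_object F T"
    then have "t = Zero F T c" using zero_object_zero(2) T(1) by blast
    then have "f = Zero F c c" using T(2,3) oc by (simp add: zero_comp Hom_def)
    then show False using a(4) unfolding f_def by simp
  qed
  moreover have "(u \<cdot> \<alpha>) \<cdot> (\<beta> \<cdot> t) = Id F T"
  proof -
    have "(u \<cdot> \<alpha>) \<cdot> (\<beta> \<cdot> t) = u \<cdot> (\<alpha> \<cdot> \<beta>) \<cdot> t" using T(1,2) \<alpha> \<beta> by (simp add: cat)
    also have "\<dots> = (u \<cdot> t) \<cdot> (u \<cdot> t)" unfolding fab[symmetric] T(3)[symmetric] using T(1,2)
        by (simp add: cat)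
    finally show ?thesis unfolding T(4) using oT by (simp add: cat)
  qed
  moreover have "u \<cdot> \<alpha> \<in> Hom F X T" "\<beta> \<cdot> t \<in> Hom F T X" using T(1,2) \<alpha> \<beta> by (simp_all add: cat)
  ultimately show ?thesis using compact_retract[OF cc T(1,2,4)] by blast
qed

section \<open>Retracts of coproducts of compact objects\<close>

definition sum_of_compacts :: "'o \<Rightarrow> bool" where
  "sum_of_compacts X \<longleftrightarrow> (\<exists>(I :: 'u set) W \<iota>. small U I \<and> (\<forall>i\<in>I. compact (W i)) \<and> is_coproduct F I W X \<iota>)"

lemma sum_of_compactsI:
  assumes I: "small U I" and W: "\<And>i. i \<in> I \<Longrightarrow> compact (W i)" and c: "is_coproduct F I W X \<iota>"
  shows "sum_of_compacts X"
proof -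
  obtain J :: "'u set" and g where g: "bij_betw g J I" "small U J" using small_eqpoll_obtain[OF I] .
  have "compact (W (g j))" if "j \<in> J" for j using W g(1) that by (auto simp: bij_betw_def)
  then show ?thesis unfolding sum_of_compacts_def using g(2) coproduct_reindex[OF c g(1)]
    by (intro exI[of _ J] exI[of _ "\<lambda>j. W (g j)"] exI[of _ "\<lambda>j. \<iota> (g j)"]) blast
qed

text \<open>For finite \<open>J\<close> the arrows \<open>r i\<close> assemble to a left inverse of
  the arrow from the finite coproduct, so \<open>J\<close> spans a direct summand of
  \<open>X\<close>. A family is a set of arrows indexed by itself with sources in \<open>S\<close>,
  which will keep it small; the condition concerns finite subsets, so Zorn's lemma applies.\<close>

definition independent :: "'o set \<Rightarrow> 'o \<Rightarrow> 'm set \<Rightarrow> bool" where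
  "independent S X I \<longleftrightarrow> (\<forall>i\<in>I. i \<in> Hom F (Dom F i) X \<and> Dom F i \<in> S) \<and>
     (\<forall>J\<subseteq>I. finite J \<longrightarrow> (\<exists>r. \<forall>i\<in>J. r i \<in> Hom F X (Dom F i) \<and>
        (\<forall>j\<in>J. r i \<cdot> j = (if j = i then Id F (Dom F i) else Zero F (Dom F j) (Dom F i)))))"

lemma ex_maximal_independent:
  obtains I where "independent S X I" "\<And>I'. independent S X I' \<Longrightarrow> I \<subseteq> I' \<Longrightarrow> I' = I"
proof -
  have "\<exists>M\<in>{I. independent S X I}. \<forall>I\<in>{I. independent S X I}. M \<subseteq> I \<longrightarrow> I = M"
  proof (rule subset_Zorn)
    fix C assume C: "subset.chain {I. independent S X I} C"
    then have ind: "independent S X I" if "I \<in> C" for I using that unfolding subset.chain_def by blast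
    show "\<exists>M\<in>{I. independent S X I}. \<forall>I\<in>C. I \<subseteq> M"
    proof (cases "C = {}")
      case True
      then show ?thesis by (auto simp: independent_def)
    next
      case False
      have "independent S X (\<Union>C)"
        unfolding independent_def
      proof (intro conjI ballI allI impI)
        fix i assume "i \<in> \<Union>C"
        then show "i \<in> Hom F (Dom F i) X" "Dom F i \<in> S" using ind unfolding independent_def by blast+
      next
        fix J assume J: "J \<subseteq> \<Union>C" "finite J"
        then obtain I where I: "I \<in> C" "J \<subseteq> I" using finite_subset_Union_chain[OF J(2,1) False C] by blast
        then show "\<exists>r. \<forall>i\<in>J. r i \<in> Hom F X (Dom F i) \<and>
            (\<forall>j\<in>J. r i \<cdot> j = (if j = i then Id F (Dom F i) else Zero F (Dom F j) (Dom F i)))"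
          using ind[OF I(1)] J(2) unfolding independent_def by blast
      qed
      then show ?thesis by blast
    qed
  qed
  then obtain M where "independent S X M" and M': "\<forall>I\<in>{I. independent S X I}. M \<subseteq> I \<longrightarrow> I = M" by blast
  then show ?thesis using that by blast
qed

text \<open>The coproduct P of a maximal independent family splits off \<open>X\<close> by
  \<open>split_mono\<close>. The complement is a retract of \<open>D\<close>; if it were non-zero,
  it would have a non-zero compact summand, and this would enlarge the family.\<close>

lemma retract_sum_of_compacts:
  assumes D: "sum_of_compacts D" and \<sigma>: "\<sigma> \<in> Hom F X D" and \<rho>: "\<rho> \<in> Hom F D X" and \<rho>\<sigma>: "\<rho> \<cdot> \<sigma> = Id F X"
  shows "sum_of_compacts X"
proof -
  have oX: "X \<in> Obj F" using Hom_Obj \<sigma> by blast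
  obtain K :: "'u set" and W \<kappa> where K: "small U K" "\<forall>i\<in>K. compact (W i)" "is_coproduct F K W D \<kappa>"
    using D unfolding sum_of_compacts_def by blast
  obtain S where S: "S \<subseteq> {X. compact X}" "small U S" "\<And>X. compact X \<Longrightarrow> \<exists>Y\<in>S. isomorphic F X Y"
    using compact_skeleton by blast
  have cS: "compact d" if "d \<in> S" for d using S(1) that by blast
  obtain I where I: "independent S X I" and max: "\<And>I'. independent S X I' \<Longrightarrow> I \<subseteq> I' \<Longrightarrow> I' = I"
    using ex_maximal_independent[of S X] by blast
  have iH: "i \<in> Hom F (Dom F i) X" "Dom F i \<in> S" "compact (Dom F i)" if "i \<in> I" for i
    using I that cS unfolding independent_def by blast+
  have "small U (\<Union>d\<in>S. Hom F d X)"
    by (rule small_UN[OF universe_U S(2)]) (use small_Hom cS compact_Obj oX in blast)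
  moreover have "I \<subseteq> (\<Union>d\<in>S. Hom F d X)" using iH by blast
  ultimately have sI: "small U I" by (rule small_subset[rotated])
  obtain P \<iota> where P: "is_coproduct F I (Dom F) P \<iota>"
    using ex_coproduct[OF sI, of "Dom F"] iH(3) compact_Obj by blast
  note inc = coproduct_incl[OF P] and oP = coproduct_Obj[OF P]
  obtain m where m: "m \<in> Hom F P X" "\<And>i. i \<in> I \<Longrightarrow> m \<cdot> \<iota> i = i"
    using coproduct_copair[OF P oX, where f = "\<lambda>i. i"] iH(1) by blast
  obtain C g h where t: "triangle F P X C m g h" using TR1_cone[OF m(1)] by blast
  note th = triangleD[OF t]
  have oC: "C \<in> Obj F" using Hom_Obj th by blast
  \<comment> \<open>An arrow from a compact object into the tensored coproduct meets finitely many
    members of the family, and these have left inverses on \<open>X\<close>. Tensoring the left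
    inverses detects all its components.\<close>
  have inj: "y = Zero F d (Z \<otimes>\<^sub>o P)"
    if Z: "Z \<in> Obj F" and d: "compact d" and y: "y \<in> Hom F d (Z \<otimes>\<^sub>o P)" and z: "TL Z m \<cdot> y =
      Zero F d (Z \<otimes>\<^sub>o X)" for Z d y
  proof -
    note P' = TL_coproduct[OF Z sI P]
    obtain J where J: "finite J" "J \<subseteq> I" "supported J (\<lambda>i. TL Z (\<iota> i)) y"
        using compact_supported[OF d sI P' y] .
    have "\<exists>r. \<forall>i\<in>J. r i \<in> Hom F X (Dom F i) \<and>
        (\<forall>j\<in>J. r i \<cdot> j = (if j = i then Id F (Dom F i) else Zero F (Dom F j) (Dom F i)))"
      using I J(1,2) unfolding independent_def by blast
    then obtain r where r: "\<And>i. i \<in> J \<Longrightarrow> r i \<in> Hom F X (Dom F i)"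
      "\<And>i j. i \<in> J \<Longrightarrow> j \<in> J \<Longrightarrow> r i \<cdot> j = (if j = i then Id F (Dom F i) else Zero F (Dom F j) (Dom F i))"
      by blast
    show ?thesis
    proof (rule supported_zero[OF P' J(3,2,1) y])
      fix j assume j: "j \<in> J"
      then have jI: "j \<in> I" using J(2) by blast
      obtain p where p: "p \<in> Hom F (Z \<otimes>\<^sub>o P) (Z \<otimes>\<^sub>o Dom F j)" "p \<cdot> TL Z (\<iota> j) = Id F (Z \<otimes>\<^sub>o Dom F j)"
        "\<And>i. i \<in> I \<Longrightarrow> i \<noteq> j \<Longrightarrow> p \<cdot> TL Z (\<iota> i) = Zero F (Z \<otimes>\<^sub>o Dom F i) (Z \<otimes>\<^sub>o Dom F j)"
        using coproduct_proj[OF P' jI] by blast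
      note rj = r(1)[OF j]
      have rm: "r j \<cdot> m \<in> Hom F P (Dom F j)" using rj m(1) by (simp add: cat)
      have "p \<cdot> y = TL Z (r j \<cdot> m) \<cdot> y"
      proof (rule supported_eq[OF P' J(3,2) y p(1) TL_Hom[OF Z rm]])
        fix i assume i: "i \<in> J"
        then have iI: "i \<in> I" using J(2) by blast
        have "TL Z (r j \<cdot> m) \<cdot> TL Z (\<iota> i) = TL Z ((r j \<cdot> m) \<cdot> \<iota> i)"
            using TL_Comp[OF Z inc[OF iI] rm] by simp
        also have "(r j \<cdot> m) \<cdot> \<iota> i = r j \<cdot> i" using Comp_assoc[OF inc[OF iI] m(1) rj] m(2)[OF iI] by simp
        also have "TL Z (r j \<cdot> i) = p \<cdot> TL Z (\<iota> i)"
          unfolding r(2)[OF j i] using p(2) p(3)[OF iI] compact_Obj[OF iH(3)[OF iI]]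
            compact_Obj[OF iH(3)[OF jI]]
          by (auto simp: TL_Id[OF Z] TL_zero[OF Z])
        finally show "p \<cdot> TL Z (\<iota> i) = TL Z (r j \<cdot> m) \<cdot> TL Z (\<iota> i)" ..
      qed
      also have "\<dots> = TL Z (r j) \<cdot> (TL Z m \<cdot> y)"
        unfolding TL_Comp[OF Z m(1) rj] by (rule Comp_assoc[OF y TL_Hom[OF Z m(1)] TL_Hom[OF Z rj]])
      also have "\<dots> = Zero F d (Z \<otimes>\<^sub>o Dom F j)" unfolding z
        using TL_Hom[OF Z rj] compact_Obj[OF d] by (simp add: comp_zero Hom_def)
      finally show "\<exists>p\<in>Hom F (Z \<otimes>\<^sub>o P) (Z \<otimes>\<^sub>o Dom F j). p \<cdot> TL Z (\<iota> j) = Id F (Z \<otimes>\<^sub>o Dom F j) \<and>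
        (\<forall>i\<in>I. i \<noteq> j \<longrightarrow> p \<cdot> TL Z (\<iota> i) = Zero F (Z \<otimes>\<^sub>o Dom F i) (Z \<otimes>\<^sub>o Dom F j)) \<and> p \<cdot> y = Zero F d
          (Z \<otimes>\<^sub>o Dom F j)"
        using p by blast
    qed
  qed
  note h0 = split_mono(1)[OF m(1) inj t]
  obtain r where r: "r \<in> Hom F X P" "r \<cdot> m = Id F P" using split_mono(2)[OF m(1) inj t] by blast
  obtain s where s: "s \<in> Hom F C X" "g \<cdot> s = Id F C" using split_epi_of_zero[OF t h0] by blast
  have gm: "g \<cdot> m = Zero F P C" by (rule triangle_comp[OF t])
  have "zero_object F C"
  proof (rule ccontr)
    assume nz: "\<not> zero_object F C"
    have "(g \<cdot> \<rho>) \<cdot> (\<sigma> \<cdot> s) = g \<cdot> ((\<rho> \<cdot> \<sigma>) \<cdot> s)" using th(2) \<rho> \<sigma> s(1) by (simp add: cat)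
    also have "\<dots> = Id F C" unfolding \<rho>\<sigma> using s th(2) by (simp add: cat)
    finally have "(g \<cdot> \<rho>) \<cdot> (\<sigma> \<cdot> s) = Id F C" .
    moreover have "\<sigma> \<cdot> s \<in> Hom F C D" "g \<cdot> \<rho> \<in> Hom F D C" using th(2) \<rho> \<sigma> s(1) by (simp_all add: cat)
    ultimately obtain T t' u' where T: "compact T" "\<not> zero_object F T" "t' \<in> Hom F T C"
        "u' \<in> Hom F C T" "u' \<cdot> t' = Id F T"
      using ex_compact_summand[OF oC nz K(1,3)] K(2) by blast
    obtain T' w w' where T': "T' \<in> S" "w \<in> Hom F T' T" "w' \<in> Hom F T T'" "w \<cdot> w' = Id F T"
        "w' \<cdot> w = Id F T'"
      using S(3)[OF T(1)] unfolding isomorphic_def isomorphism_def by blast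
    have oT': "T' \<in> Obj F" using Hom_Obj T' by blast
    have mrs: "m \<cdot> (r \<cdot> s) \<in> Hom F C X" using m(1) r(1) s(1) by (simp add: cat)
    \<comment> \<open>The section of g is corrected by its component in P, so that \<open>r\<close>
      annihilates it and the new arrow is orthogonal to the old family.\<close>
    define k where "k = s \<boxminus> m \<cdot> (r \<cdot> s)"
    have k: "k \<in> Hom F C X" unfolding k_def by (rule sub_Hom[OF s(1) mrs])
    have "g \<cdot> k = g \<cdot> s \<boxminus> (g \<cdot> m) \<cdot> (r \<cdot> s)" unfolding k_def using th(2) s(1) m(1) r(1)
        by (simp add: comp_sub cat)
    then have gk: "g \<cdot> k = Id F C" unfolding s(2) gm using r(1) s(1) oC sub_zero[OF Id_in_Hom[OF oC]]
      by (simp add: zero_comp cat)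
    have "r \<cdot> k = r \<cdot> s \<boxminus> (r \<cdot> m) \<cdot> (r \<cdot> s)" unfolding k_def using s(1) m(1) r(1)
        by (simp add: comp_sub cat)
    moreover have rs: "r \<cdot> s \<in> Hom F C P" using r(1) s(1) by (simp add: cat)
    ultimately have rk: "r \<cdot> k = Zero F C P" unfolding r(2) using sub_eq_zero_iff[OF rs rs]
        Id_Comp[OF rs] by simp
    define a where "a = k \<cdot> (t' \<cdot> w)"
    define ra where "ra = w' \<cdot> (u' \<cdot> g)"
    have tw: "t' \<cdot> w \<in> Hom F T' C" and wu: "w' \<cdot> u' \<in> Hom F C T'" using T T' by (simp_all add: cat)
    have a: "a \<in> Hom F T' X" unfolding a_def by (rule Comp_in_Hom[OF tw k])
    have ra: "ra \<in> Hom F X T'" unfolding ra_def using T' T(4) th(2) by (simp add: cat)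
    have Da: "Dom F a = T'" using a by (simp add: Hom_def)
    have "ra \<cdot> a = w' \<cdot> (u' \<cdot> ((g \<cdot> k) \<cdot> (t' \<cdot> w)))" unfolding ra_def a_def using T T' th(2) k
        by (simp add: cat)
    also have "\<dots> = w' \<cdot> ((u' \<cdot> t') \<cdot> w)" unfolding gk using T(3,4) T'(2,3) by (simp add: cat)
    finally have raa: "ra \<cdot> a = Id F T'" unfolding T(5) using T'(2,3,5) by (simp add: cat)
    have rai: "ra \<cdot> i = Zero F (Dom F i) T'" if i: "i \<in> I" for i
    proof -
      have "ra \<cdot> i = (w' \<cdot> u') \<cdot> ((g \<cdot> m) \<cdot> \<iota> i)"
        using m(2)[OF i] T(4) T'(3) th(2) m(1) inc[OF i] iH(1)[OF i] unfolding ra_def by (simp add: cat)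
      then show ?thesis unfolding gm using wu inc[OF i] oC compact_Obj[OF iH(3)[OF i]]
        by (simp add: zero_comp comp_zero Hom_def)
    qed
    have "independent S X (insert a I)"
      unfolding independent_def
    proof (intro conjI ballI allI impI)
      show "i \<in> Hom F (Dom F i) X" "Dom F i \<in> S" if "i \<in> insert a I" for i using that a Da T'(1) iH by auto
      fix J assume J: "J \<subseteq> insert a I" "finite J"
      obtain p where p: "\<And>i. i \<in> I \<Longrightarrow> p i \<in> Hom F P (Dom F i)"
        "\<And>i. i \<in> I \<Longrightarrow> p i \<cdot> \<iota> i = Id F (Dom F i)"
        "\<And>i j. i \<in> I \<Longrightarrow> j \<in> I \<Longrightarrow> j \<noteq> i \<Longrightarrow> p i \<cdot> \<iota> j = Zero F (Dom F j) (Dom F i)"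
        using coproduct_projs[OF P] by blast
      have prj: "(p i \<cdot> r) \<cdot> j = p i \<cdot> \<iota> j" if i: "i \<in> I" and j: "j \<in> I" for i j
      proof -
        have "(p i \<cdot> r) \<cdot> (m \<cdot> \<iota> j) = p i \<cdot> ((r \<cdot> m) \<cdot> \<iota> j)" using p(1)[OF i] r(1) m(1) inc[OF j]
            by (simp add: cat)
        then show ?thesis unfolding m(2)[OF j] r(2) using inc[OF j] by (simp add: cat)
      qed
      have pra: "(p i \<cdot> r) \<cdot> a = Zero F T' (Dom F i)" if i: "i \<in> I" for i
      proof -
        have "(p i \<cdot> r) \<cdot> a = p i \<cdot> ((r \<cdot> k) \<cdot> (t' \<cdot> w))" unfolding a_def
            using p(1)[OF i] r(1) k T(3) T'(2) by (simp add: cat)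
        then show ?thesis unfolding rk using p(1)[OF i] tw oP oT' by (simp add: zero_comp comp_zero Hom_def)
      qed
      let ?r = "\<lambda>i. if i = a then ra else p i \<cdot> r"
      have "?r i \<in> Hom F X (Dom F i) \<and> (\<forall>j\<in>J. ?r i \<cdot> j = (if j = i then Id F (Dom F i) else Zero F
          (Dom F j) (Dom F i)))"
        if i: "i \<in> J" for i
      proof (cases "i = a")
        case True
        then show ?thesis using ra Da raa rai J(1) by auto
      next
        case False
        then have iI: "i \<in> I" using i J(1) by blast
        have "?r i \<in> Hom F X (Dom F i)" using False p(1)[OF iI] r(1) by (simp add: cat)
        moreover have "?r i \<cdot> j = (if j = i then Id F (Dom F i) else Zero F (Dom F j) (Dom F i))"
            if j: "j \<in> J" for j
        proof (cases "j = a")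
          case True
          then show ?thesis using False pra[OF iI] Da by simp
        next
          case j2: False
          then have "j \<in> I" using j J(1) by blast
          then show ?thesis using False prj[OF iI] p(2)[OF iI] p(3)[OF iI] by simp
        qed
        ultimately show ?thesis by blast
      qed
      then show "\<exists>r. \<forall>i\<in>J. r i \<in> Hom F X (Dom F i) \<and>
        (\<forall>j\<in>J. r i \<cdot> j = (if j = i then Id F (Dom F i) else Zero F (Dom F j) (Dom F i)))" by (intro
          exI[of _ ?r]) blast
    qed
    \<comment> \<open>Maximality would put \<open>a\<close> into \<open>I\<close>, where
      \<open>ra\<close> vanishes, although \<open>ra \<cdot> a\<close> is the identity of a non-zero
      object.\<close>
    then have "insert a I = I" using max by blast
    then have "a \<in> I" by blast
    then have "Id F T' = Zero F T' T'" using rai[of a] raa Da by simp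
    then have "zero_object F T'" using zero_object_iff_Id[OF oT'] by blast
    then have "zero_object F T" using T' zero_object_iso[of T' T] isomorphismI[OF T'(2,3,5,4)]
        unfolding isomorphic_def by blast
    then show False using T(2) by blast
  qed
  then have "isomorphic F P X" using iso_of_zero_cone[OF t] unfolding isomorphic_def by blast
  then obtain \<iota>' where "is_coproduct F I (Dom F) X \<iota>'" using coproduct_iso_Obj[OF P] by blast
  then show ?thesis using sum_of_compactsI[OF sI, of "Dom F"] iH(3) by blast
qed

text \<open>Let P be the coproduct of the sources of all arrows to \<open>X\<close> from a compact
  skeleton. By \<open>gen\<close> its arrow to \<open>X\<close> is surjective on compact sources
  after every tensoring, so it splits and \<open>X\<close> is a retract of P. Two terms are allowed
  because a cone contributes one from each side.\<close>

lemma sum_of_compacts_of_generated: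
  assumes X: "X \<in> Obj F"
    and gen: "\<And>Z d y. Z \<in> Obj F \<Longrightarrow> compact d \<Longrightarrow> y \<in> Hom F d (Z \<otimes>\<^sub>o X) \<Longrightarrow>
      \<exists>e e' x x' y1 y2. compact e \<and> compact e' \<and> x \<in> Hom F e X \<and> x' \<in> Hom F e' X \<and>
        y1 \<in> Hom F d (Z \<otimes>\<^sub>o e) \<and> y2 \<in> Hom F d (Z \<otimes>\<^sub>o e') \<and> y = TL Z x \<cdot> y1 \<boxplus> TL Z x' \<cdot> y2"
  shows "sum_of_compacts X"
proof -
  obtain S where S: "S \<subseteq> {X. compact X}" "small U S" "\<And>X. compact X \<Longrightarrow> \<exists>Y\<in>S. isomorphic F X Y"
    using compact_skeleton by blast
  have cS: "compact d" if "d \<in> S" for d using S(1) that by blast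
  let ?I = "\<Union>d\<in>S. Hom F d X"
  have I: "small U ?I" by (rule small_UN[OF universe_U S(2)]) (use small_Hom cS compact_Obj X in blast)
  have iH: "compact (Dom F i)" "i \<in> Hom F (Dom F i) X" if "i \<in> ?I" for i using that cS
      by (auto simp: Hom_def)
  obtain P \<iota> where P: "is_coproduct F ?I (Dom F) P \<iota>"
    using ex_coproduct[OF I, of "Dom F"] iH(1) compact_Obj by blast
  note inc = coproduct_incl[OF P] and oP = coproduct_Obj[OF P]
  obtain q where q: "q \<in> Hom F P X" "\<And>i. i \<in> ?I \<Longrightarrow> q \<cdot> \<iota> i = i"
    using coproduct_copair[OF P X, where f = "\<lambda>i. i"] iH(2) by blast
  \<comment> \<open>An arrow from any compact e is, after passing to the skeleton, one of the arrows
    indexing P.\<close>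
  have fac: "\<exists>y'\<in>Hom F d (Z \<otimes>\<^sub>o P). TL Z q \<cdot> y' = TL Z x \<cdot> y"
    if Z: "Z \<in> Obj F" and e: "compact e" and x: "x \<in> Hom F e X" and y: "y \<in> Hom F d (Z \<otimes>\<^sub>o e)" for Z d e x y
  proof -
    obtain e' u v where e': "e' \<in> S" "u \<in> Hom F e e'" "v \<in> Hom F e' e" "v \<cdot> u = Id F e"
      using S(3)[OF e] unfolding isomorphic_def isomorphism_def by blast
    have xv: "x \<cdot> v \<in> Hom F e' X" using x e'(3) by (simp add: cat)
    then have xvI: "x \<cdot> v \<in> ?I" using e'(1) by blast
    have D: "Dom F (x \<cdot> v) = e'" using xv by (simp add: Hom_def)
    have i: "\<iota> (x \<cdot> v) \<in> Hom F e' P" using inc[OF xvI] D by simp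
    have iu: "\<iota> (x \<cdot> v) \<cdot> u \<in> Hom F e P" using i e'(2) by (simp add: cat)
    have "q \<cdot> (\<iota> (x \<cdot> v) \<cdot> u) = (q \<cdot> \<iota> (x \<cdot> v)) \<cdot> u" using q(1) i e'(2) by (simp add: cat)
    also have "\<dots> = x" unfolding q(2)[OF xvI] using x e' by (simp add: cat)
    finally have "TL Z q \<cdot> TL Z (\<iota> (x \<cdot> v) \<cdot> u) = TL Z x" using TL_Comp[OF Z iu q(1)] by simp
    then have "TL Z q \<cdot> (TL Z (\<iota> (x \<cdot> v) \<cdot> u) \<cdot> y) = TL Z x \<cdot> y"
      using Comp_assoc[OF y TL_Hom[OF Z iu] TL_Hom[OF Z q(1)]] by simp
    then show ?thesis using Comp_in_Hom[OF y TL_Hom[OF Z iu]] by blast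
  qed
  have "\<exists>s\<in>Hom F X P. q \<cdot> s = Id F X"
  proof (rule split_epi[OF q(1)])
    fix Z d y assume Z: "Z \<in> Obj F" and d: "compact d" and y: "y \<in> Hom F d (Z \<otimes>\<^sub>o X)"
    obtain e e' x x' y1 y2 where *: "compact e" "compact e'" "x \<in> Hom F e X" "x' \<in> Hom F e' X"
        "y1 \<in> Hom F d (Z \<otimes>\<^sub>o e)" "y2 \<in> Hom F d (Z \<otimes>\<^sub>o e')" "y = TL Z x \<cdot> y1 \<boxplus> TL Z x' \<cdot> y2"
      using gen[OF Z d y] by blast
    obtain a b where ab: "a \<in> Hom F d (Z \<otimes>\<^sub>o P)" "TL Z q \<cdot> a = TL Z x \<cdot> y1" "b \<in> Hom F d (Z \<otimes>\<^sub>o P)"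
        "TL Z q \<cdot> b = TL Z x' \<cdot> y2"
      using fac[OF Z *(1,3,5)] fac[OF Z *(2,4,6)] by blast
    have "TL Z q \<cdot> (a \<boxplus> b) = y" using Comp_Add_right[OF ab(1,3) TL_Hom[OF Z q(1)]] ab(2,4) *(7) by simp
    then show "\<exists>y'\<in>Hom F d (Z \<otimes>\<^sub>o P). TL Z q \<cdot> y' = y" using add_Hom[OF ab(1,3)] by blast
  qed
  moreover have "sum_of_compacts P" using sum_of_compactsI[OF I iH(1) P] by blast
  ultimately show ?thesis using retract_sum_of_compacts q(1) by blast
qed

lemma sum_of_compacts_finite_part:
  assumes I: "small U I" and W: "\<And>i. i \<in> I \<Longrightarrow> compact (W i)" and c: "is_coproduct F I W Y \<iota>"
    and J: "finite J" "J \<subseteq> I"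
  obtains e l p where "compact e" "l \<in> Hom F e Y" "p \<in> Hom F Y e" "p \<cdot> l = Id F e" "\<And>j. j \<in> J \<Longrightarrow>
      (l \<cdot> p) \<cdot> \<iota> j = \<iota> j"
proof -
  obtain e \<kappa> where e: "is_coproduct F J W e \<kappa>"
    using ex_coproduct[OF small_finite[OF universe_U J(1)], of W] W compact_Obj J(2) by blast
  have ce: "compact e" by (rule compact_finite_coproduct[OF J(1) e]) (use W J(2) in blast)
  obtain l p where lp: "l \<in> Hom F e Y" "p \<in> Hom F Y e" "p \<cdot> l = Id F e"
    "\<And>j. j \<in> J \<Longrightarrow> l \<cdot> \<kappa> j = \<iota> j" "\<And>j. j \<in> J \<Longrightarrow> p \<cdot> \<iota> j = \<kappa> j"
    by (rule coproduct_finite_part[OF c e J(2)]) (rule that; assumption)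
  have "(l \<cdot> p) \<cdot> \<iota> j = \<iota> j" if j: "j \<in> J" for j
  proof -
    have "\<iota> j \<in> Hom F (W j) Y" using coproduct_incl[OF c] j J(2) by blast
    then show ?thesis using Comp_assoc[OF _ lp(2,1)] lp(4)[OF j] lp(5)[OF j] by metis
  qed
  then show ?thesis using that ce lp(1-3) by blast
qed

text \<open>An arrow y into \<open>Z \<otimes> D\<close> is described by its image under
  \<open>h\<close>, which lives on a compact part of \<open>A\<close>, and a remainder from
  \<open>B\<close>, which lives on a compact part of \<open>B\<close>. The first is realized by the
  cone of an arrow between compact parts of \<open>A\<close> and \<open>B\<close>. This gives the
  two terms for \<open>sum_of_compacts_of_generated\<close>.\<close>

lemma sum_of_compacts_cone:
  assumes t: "triangle F A B D f g h" and A: "sum_of_compacts A" and B: "sum_of_compacts B"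
  shows "sum_of_compacts D"
proof (rule sum_of_compacts_of_generated)
  note th = triangleD[OF t]
  have o: "A \<in> Obj F" "B \<in> Obj F" "D \<in> Obj F" using Hom_Obj th by blast+
  show "D \<in> Obj F" by fact
  obtain I :: "'u set" and W \<iota> where I: "small U I" "\<And>i. i \<in> I \<Longrightarrow> compact (W i)" "is_coproduct F I W A \<iota>"
    using A unfolding sum_of_compacts_def by blast
  obtain K :: "'u set" and V \<kappa> where K: "small U K" "\<And>i. i \<in> K \<Longrightarrow> compact (V i)" "is_coproduct F K V B \<kappa>"
    using B unfolding sum_of_compacts_def by blast
  fix Z d y assume Z: "Z \<in> Obj F" and d: "compact d" and y: "y \<in> Hom F d (Z \<otimes>\<^sub>o D)"
  note od = compact_Obj[OF d] and incA = coproduct_incl[OF I(3)] and incB = coproduct_incl[OF K(3)]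
  define z where "z = TL Z h \<cdot> y"
  have z: "z \<in> Hom F d (Z \<otimes>\<^sub>o SA A)" unfolding z_def by (rule Comp_in_Hom[OF y TL_Hom[OF Z th(3)]])
  obtain J where J: "finite J" "J \<subseteq> I" "supported J (\<lambda>i. TL Z (SM (\<iota> i))) z"
    using compact_supported[OF d I(1) TL_coproduct[OF Z I(1) SA_coproduct[OF I(3)]] z] .
  obtain e l p where e: "compact e" "l \<in> Hom F e A" "p \<in> Hom F A e" "p \<cdot> l = Id F e"
    "\<And>j. j \<in> J \<Longrightarrow> (l \<cdot> p) \<cdot> \<iota> j = \<iota> j" using sum_of_compacts_finite_part[OF I J(1,2)] by blast
  note Sl = SM_Hom[OF e(2)] and Sp = SM_Hom[OF e(3)] and oe = compact_Obj[OF e(1)]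
  define z1 where "z1 = TL Z (SM p) \<cdot> z"
  have z1: "z1 \<in> Hom F d (Z \<otimes>\<^sub>o SA e)" unfolding z1_def by (rule Comp_in_Hom[OF z TL_Hom[OF Z Sp]])
  have zz1: "TL Z (SM l) \<cdot> z1 = z"
  proof -
    have lp: "l \<cdot> p \<in> Hom F A A" by (rule Comp_in_Hom[OF e(3,2)])
    have eq: "TL Z (SM l) \<cdot> TL Z (SM p) = TL Z (SM (l \<cdot> p))"
      using TL_Comp[OF Z Sp Sl] SM_Comp[OF e(3,2)] by simp
    have "TL Z (SM (l \<cdot> p)) \<cdot> z = z"
    proof (rule supportedD[OF J(3) z TL_Hom[OF Z SM_Hom[OF lp]]])
      fix j assume j: "j \<in> J"
      then have jI: "j \<in> I" using J(2) by blast
      show "TL Z (SM (l \<cdot> p)) \<cdot> TL Z (SM (\<iota> j)) = TL Z (SM (\<iota> j))"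
        using TL_Comp[OF Z SM_Hom[OF incA[OF jI]] SM_Hom[OF lp]] SM_Comp[OF incA[OF jI] lp]
          e(5)[OF j] by simp
    qed
    then show ?thesis unfolding z1_def using Comp_assoc[OF z TL_Hom[OF Z Sp] TL_Hom[OF Z Sl]] eq by simp
  qed
  have fl: "f \<cdot> l \<in> Hom F e B" by (rule Comp_in_Hom[OF e(2) th(1)])
  obtain L where L: "finite L" "L \<subseteq> K" "supported L \<kappa> (f \<cdot> l)" using compact_supported[OF e(1) K(1,3) fl] .
  obtain e' l' p' where e': "compact e'" "l' \<in> Hom F e' B" "p' \<in> Hom F B e'" "p' \<cdot> l' = Id F e'"
    "\<And>j. j \<in> L \<Longrightarrow> (l' \<cdot> p') \<cdot> \<kappa> j = \<kappa> j" using sum_of_compacts_finite_part[OF K L(1,2)] by blast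
  note Sl' = SM_Hom[OF e'(2)] and Sp' = SM_Hom[OF e'(3)] and oe' = compact_Obj[OF e'(1)]
  \<comment> \<open>\<open>f\<close> carries the compact part e of \<open>A\<close> into a compact
    part e' of \<open>B\<close>; \<open>f1\<close> is this restriction.\<close>
  define f1 where "f1 = p' \<cdot> (f \<cdot> l)"
  have f1: "f1 \<in> Hom F e e'" unfolding f1_def by (rule Comp_in_Hom[OF fl e'(3)])
  have lf1: "l' \<cdot> f1 = f \<cdot> l"
    using supportedD[OF L(3) fl Comp_in_Hom[OF e'(3,2)] e'(5)] Comp_assoc[OF fl e'(3,2)]
      unfolding f1_def by simp
  obtain C1 g1 h1 where t1: "triangle F e e' C1 f1 g1 h1" using TR1_cone[OF f1] by blast
  note th1 = triangleD[OF t1]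
  have cC1: "compact C1" by (rule compact_cone[OF t1 e(1) e'(1)])
  obtain w where w: "w \<in> Hom F C1 D" "w \<cdot> g1 = g \<cdot> l'" "SM l \<cdot> h1 = h \<cdot> w"
    using TR3_morphism[OF t1 t e(2) e'(2) lf1] by blast
  note Sf = SM_Hom[OF th(1)] and Sf1 = SM_Hom[OF f1]
  have Sfz: "TL Z (SM f) \<cdot> z = Zero F d (Z \<otimes>\<^sub>o SA B)"
    unfolding z_def by (rule TL_triangle_comp_Susp[OF Z t y])
  \<comment> \<open>The equation holds after composing with the inclusion of e' into
    \<open>B\<close>, where it is the vanishing of \<open>SM f\<close> on z. The inclusion is split,
    so nothing is lost.\<close>
  have z10: "TL Z (SM f1) \<cdot> z1 = Zero F d (Z \<otimes>\<^sub>o SA e')"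
  proof -
    let ?x = "TL Z (SM f1) \<cdot> z1"
    have x: "?x \<in> Hom F d (Z \<otimes>\<^sub>o SA e')" by (rule Comp_in_Hom[OF z1 TL_Hom[OF Z Sf1]])
    have "TL Z (SM l') \<cdot> ?x = (TL Z (SM l') \<cdot> TL Z (SM f1)) \<cdot> z1"
      by (rule Comp_assoc[symmetric, OF z1 TL_Hom[OF Z Sf1] TL_Hom[OF Z Sl']])
    also have "TL Z (SM l') \<cdot> TL Z (SM f1) = TL Z (SM f) \<cdot> TL Z (SM l)"
      using TL_Comp[OF Z Sf1 Sl'] TL_Comp[OF Z Sl Sf] SM_Comp[OF f1 e'(2)] SM_Comp[OF e(2) th(1)]
        lf1 by simp
    also have "\<dots> \<cdot> z1 = TL Z (SM f) \<cdot> z"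
      using Comp_assoc[OF z1 TL_Hom[OF Z Sl] TL_Hom[OF Z Sf]] zz1 by simp
    finally have "TL Z (SM l') \<cdot> ?x = Zero F d (Z \<otimes>\<^sub>o SA B)" using Sfz by simp
    then have "TL Z (SM p') \<cdot> (TL Z (SM l') \<cdot> ?x) = Zero F d (Z \<otimes>\<^sub>o SA e')"
      using TL_Hom[OF Z Sp'] od by (simp add: comp_zero Hom_def)
    moreover have "TL Z (SM p') \<cdot> (TL Z (SM l') \<cdot> ?x) = ?x"
      using Comp_assoc[OF x TL_Hom[OF Z Sl'] TL_Hom[OF Z Sp']] TL_Comp[OF Z Sl' Sp']
        SM_Comp[OF e'(2,3)] e'(4)
        SM_Id[OF oe'] TL_Id[OF Z SA_Obj[OF oe']] Id_Comp[OF x] by simp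
    ultimately show ?thesis by simp
  qed
  have "TL Z (neg (SM f1)) \<cdot> z1 = Zero F d (Z \<otimes>\<^sub>o SA e')"
    unfolding TL_neg[OF Z Sf1] using z10 z1 TL_Hom[OF Z Sf1] neg_Zero[OF od Tensor_Obj[OF Z SA_Obj[OF oe']]]
    by (simp add: neg_comp Hom_def)
  then obtain y2 where y2: "y2 \<in> Hom F d (Z \<otimes>\<^sub>o C1)" "TL Z h1 \<cdot> y2 = z1"
    using TL_exact[OF Z rotate[OF rotate[OF t1]] z1] by blast
  have wy: "TL Z w \<cdot> y2 \<in> Hom F d (Z \<otimes>\<^sub>o D)" by (rule Comp_in_Hom[OF y2(1) TL_Hom[OF Z w(1)]])
  have hw: "TL Z h \<cdot> (TL Z w \<cdot> y2) = z"
  proof -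
    have "TL Z h \<cdot> (TL Z w \<cdot> y2) = (TL Z h \<cdot> TL Z w) \<cdot> y2"
      by (rule Comp_assoc[symmetric, OF y2(1) TL_Hom[OF Z w(1)] TL_Hom[OF Z th(3)]])
    also have "TL Z h \<cdot> TL Z w = TL Z (SM l) \<cdot> TL Z h1"
      using TL_Comp[OF Z w(1) th(3)] TL_Comp[OF Z th1(3) Sl] w(3) by simp
    also have "\<dots> \<cdot> y2 = z" using Comp_assoc[OF y2(1) TL_Hom[OF Z th1(3)] TL_Hom[OF Z Sl]] y2(2) zz1 by simp
    finally show ?thesis .
  qed
  \<comment> \<open>y and the arrow through the compact cone have the same image under
    \<open>h\<close>, so their difference comes from \<open>B\<close>.\<close>
  have "TL Z h \<cdot> (y \<boxminus> TL Z w \<cdot> y2) = z \<boxminus> z"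
    using TL_Hom[OF Z th(3)] y wy hw by (simp add: comp_sub Hom_def z_def)
  also have "\<dots> = Zero F d (Z \<otimes>\<^sub>o SA A)" using sub_eq_zero_iff[OF z z] by simp
  finally obtain y3 where y3: "y3 \<in> Hom F d (Z \<otimes>\<^sub>o B)" "TL Z g \<cdot> y3 = y \<boxminus> TL Z w \<cdot> y2"
    using TL_exact[OF Z rotate[OF t] sub_Hom[OF y wy]] by blast
  obtain L2 where L2: "finite L2" "L2 \<subseteq> K" "supported L2 (\<lambda>i. TL Z (\<kappa> i)) y3"
    using compact_supported[OF d K(1) TL_coproduct[OF Z K(1,3)] y3(1)] .
  obtain e2 l2 p2 where e2: "compact e2" "l2 \<in> Hom F e2 B" "p2 \<in> Hom F B e2" "p2 \<cdot> l2 = Id F e2"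
    "\<And>j. j \<in> L2 \<Longrightarrow> (l2 \<cdot> p2) \<cdot> \<kappa> j = \<kappa> j" using sum_of_compacts_finite_part[OF K L2(1,2)] by blast
  define y4 where "y4 = TL Z p2 \<cdot> y3"
  have y4: "y4 \<in> Hom F d (Z \<otimes>\<^sub>o e2)" unfolding y4_def by (rule Comp_in_Hom[OF y3(1) TL_Hom[OF Z e2(3)]])
  have lp2: "l2 \<cdot> p2 \<in> Hom F B B" by (rule Comp_in_Hom[OF e2(3,2)])
  have "TL Z (l2 \<cdot> p2) \<cdot> y3 = y3"
  proof (rule supportedD[OF L2(3) y3(1) TL_Hom[OF Z lp2]])
    fix j assume j: "j \<in> L2"
    then have jK: "j \<in> K" using L2(2) by blast
    show "TL Z (l2 \<cdot> p2) \<cdot> TL Z (\<kappa> j) = TL Z (\<kappa> j)" using TL_Comp[OF Z incB[OF jK] lp2] e2(5)[OF j] by simp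
  qed
  then have ly4: "TL Z l2 \<cdot> y4 = y3"
    unfolding y4_def using Comp_assoc[OF y3(1) TL_Hom[OF Z e2(3)] TL_Hom[OF Z e2(2)]]
      TL_Comp[OF Z e2(3,2)] by simp
  have gl: "g \<cdot> l2 \<in> Hom F e2 D" by (rule Comp_in_Hom[OF e2(2) th(2)])
  have "TL Z (g \<cdot> l2) \<cdot> y4 = TL Z g \<cdot> y3"
    using Comp_assoc[OF y4 TL_Hom[OF Z e2(2)] TL_Hom[OF Z th(2)]] TL_Comp[OF Z e2(2) th(2)] ly4 by simp
  then have "TL Z (g \<cdot> l2) \<cdot> y4 \<boxplus> TL Z w \<cdot> y2 = y" using y3(2) add_sub_cancel[OF y wy] by simp
  then show "\<exists>e e' x x' y1 y2. compact e \<and> compact e' \<and> x \<in> Hom F e D \<and> x' \<in> Hom F e' D \<and>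
        y1 \<in> Hom F d (Z \<otimes>\<^sub>o e) \<and> y2 \<in> Hom F d (Z \<otimes>\<^sub>o e') \<and> y = TL Z x \<cdot> y1 \<boxplus> TL Z x' \<cdot> y2"
    using e2(1) cC1 gl w(1) y4 y2(1) by metis
qed

section \<open>The localizing subcategory of coproducts of compact objects\<close>

lemma sum_of_compacts_Obj: "sum_of_compacts X \<Longrightarrow> X \<in> Obj F"
  unfolding sum_of_compacts_def using coproduct_Obj by blast

lemma sum_of_compacts_isomorphic: "isomorphic F A B \<Longrightarrow> sum_of_compacts A \<Longrightarrow> sum_of_compacts B"
  unfolding sum_of_compacts_def using coproduct_iso_Obj by blast

text \<open>For desuspension the compact summands are desuspended one by one; their coproduct has a
  suspension isomorphic to that of \<open>A\<close>, and the suspension reflects isomorphism of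
  objects.\<close>

lemma sum_of_compacts_Susp:
  assumes A: "A \<in> Obj F"
  shows "sum_of_compacts (SA A) \<longleftrightarrow> sum_of_compacts A"
proof
  assume "sum_of_compacts A"
  then obtain I :: "'u set" and W \<iota> where I: "small U I" "\<And>i. i \<in> I \<Longrightarrow> compact (W i)"
      "is_coproduct F I W A \<iota>"
    unfolding sum_of_compacts_def by blast
  then show "sum_of_compacts (SA A)" using sum_of_compactsI[OF I(1) compact_Susp SA_coproduct] by blast
next
  assume "sum_of_compacts (SA A)"
  then obtain I :: "'u set" and W \<iota> where I: "small U I" "\<And>i. i \<in> I \<Longrightarrow> compact (W i)"
      "is_coproduct F I W (SA A) \<iota>"
    unfolding sum_of_compacts_def by blast
  have "\<forall>i\<in>I. \<exists>V. compact V \<and> isomorphic F (SA V) (W i)" using I(2) compact_desuspension by metis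
  then obtain V where V: "\<And>i. i \<in> I \<Longrightarrow> compact (V i)" "\<And>i. i \<in> I \<Longrightarrow> isomorphic F (SA (V i)) (W i)" by metis
  obtain B \<kappa> where B: "is_coproduct F I V B \<kappa>" using ex_coproduct[OF I(1), of V] V(1) compact_Obj by blast
  obtain \<iota>' where "is_coproduct F I (\<lambda>i. SA (V i)) (SA A) \<iota>'"
    using coproduct_iso_summands[OF I(3), of "\<lambda>i. SA (V i)"] V(2) by blast
  then have "isomorphic F (SA B) (SA A)" using coproduct_unique[OF SA_coproduct[OF B]] by blast
  then have "isomorphic F B A" using SA_isomorphic_reflect A coproduct_Obj[OF B] by blast
  then show "sum_of_compacts A" using sum_of_compacts_isomorphic sum_of_compactsI[OF I(1) V(1) B] by blast
qed

lemma sum_of_compacts_coproduct: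
  assumes I: "small U I" and c: "is_coproduct F I X Y \<iota>" and X: "\<And>i. i \<in> I \<Longrightarrow> sum_of_compacts (X i)"
  shows "sum_of_compacts Y"
proof -
  have "\<forall>i\<in>I. \<exists>p. small U (fst p :: 'u set) \<and> (\<forall>j\<in>fst p. compact (fst (snd p) j)) \<and>
      is_coproduct F (fst p) (fst (snd p)) (X i) (snd (snd p))"
    using X unfolding sum_of_compacts_def by fastforce
  then obtain p where p: "\<And>i. i \<in> I \<Longrightarrow> small U (fst (p i) :: 'u set) \<and> (\<forall>j\<in>fst (p i).
      compact (fst (snd (p i)) j)) \<and>
      is_coproduct F (fst (p i)) (fst (snd (p i))) (X i) (snd (snd (p i)))" by metis
  have "is_coproduct F (Sigma I (\<lambda>i. fst (p i))) (\<lambda>q. fst (snd (p (fst q))) (snd q)) Y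
      (\<lambda>q. \<iota> (fst q) \<cdot> snd (snd (p (fst q))) (snd q))"
    using coproduct_Sigma[OF c, where J = "\<lambda>i. fst (p i)" and W = "\<lambda>i. fst (snd (p i))" and \<kappa> =
      "\<lambda>i. snd (snd (p i))"] p
    by blast
  moreover have "small U (Sigma I (\<lambda>i. fst (p i)))"
      using small_Sigma[OF universe_U I, of "\<lambda>i. fst (p i)"] p by blast
  ultimately show ?thesis by (rule sum_of_compactsI[rotated 2]) (use p in auto)
qed

lemma all_sum_of_compacts:
  assumes "X \<in> Obj F"
  shows "sum_of_compacts X"
proof -
  let ?S = "{X. sum_of_compacts X}"
  have "localizing_subcategory U F ?S"
    unfolding localizing_subcategory_def
  proof (intro conjI allI impI ballI)
    show "Z \<in> ?S" if Z: "zero_object F Z" for Z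
    proof -
      obtain Y \<iota> where Y: "is_coproduct F ({} :: 'u set) (\<lambda>_. Z) Y \<iota>"
        using ex_coproduct[of "{} :: 'u set" "\<lambda>_. Z"] small_finite[OF universe_U] by auto
      have oZ: "Z \<in> Obj F" using Z by (simp add: zero_object_def)
      have "Id F Y = Zero F Y Y"
        by (rule coproduct_ext[OF Y]) (use coproduct_Obj[OF Y] in \<open>auto intro: Id_in_Hom zero_Hom\<close>)
      then have "zero_object F Y" using zero_object_iff_Id[OF coproduct_Obj[OF Y]] by blast
      then have "isomorphic F Y Z"
        unfolding isomorphic_def
        by (intro exI[of _ "Zero F Y Z"] isomorphismI[where g = "Zero F Z Y"] zero_Hom
          coproduct_Obj[OF Y] oZ)
          (use zero_object_eq[OF Z] zero_object_eq[of Y] in \<open>meson Comp_in_Hom Id_in_Hom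
            coproduct_Obj[OF Y] oZ zero_Hom\<close>)+
      moreover have "sum_of_compacts Y"
        by (rule sum_of_compactsI[OF small_finite[OF universe_U] _ Y]) auto
      ultimately show ?thesis using sum_of_compacts_isomorphic by blast
    qed
    show "B \<in> ?S" if "isomorphic F A B" "A \<in> ?S" for A B using that sum_of_compacts_isomorphic by blast
    show "SA A \<in> ?S \<longleftrightarrow> A \<in> ?S" if "A \<in> Obj F" for A using sum_of_compacts_Susp[OF that] by simp
    show "D \<in> ?S" if "triangle F A B D f g h" "A \<in> ?S" "B \<in> ?S" for A B D f g h
      using sum_of_compacts_cone that by blast
    show "Y \<in> ?S" if "small U I" "is_coproduct F I X Y \<iota>" "\<forall>i\<in>I. X i \<in> ?S" for I :: "'u set" and X Y \<iota>
      using sum_of_compacts_coproduct[OF that(1,2)] that(3) by blast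
  qed (use sum_of_compacts_Obj in blast)
  moreover have "compact_objects U F \<subseteq> ?S"
  proof
    fix d assume "d \<in> compact_objects U F"
    then have d: "compact d" by (simp add: compact_objects_def)
    have sing: "is_coproduct F {()} (\<lambda>_. d) d (\<lambda>_. Id F d)"
    proof (rule coproductI)
      show "\<exists>h\<in>Hom F d A. \<forall>i\<in>{()}. h \<cdot> Id F d = f i" if "\<And>i. i \<in> {()} \<Longrightarrow> f i \<in> Hom F d A" for A f
        using that[of "()"] by (intro bexI[of _ "f ()"]) (simp_all add: cat)
      show "h = h'" if "h \<in> Hom F d A" "h' \<in> Hom F d A" "\<And>i. i \<in> {()} \<Longrightarrow> h \<cdot> Id F d = h' \<cdot> Id F d" for A h h'
        using that(3)[of "()"] Comp_Id[OF that(1)] Comp_Id[OF that(2)] by simp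
    qed (use compact_Obj[OF d] Id_in_Hom in auto)
    have "sum_of_compacts d" by (rule sum_of_compactsI[OF small_finite[OF universe_U] _ sing])
        (simp_all add: d)
    then show "d \<in> ?S" by simp
  qed
  ultimately have "?S = Obj F" using compact_generates unfolding generates_localizing_def by blast
  then show ?thesis using assms by blast
qed

lemma tt_field: "tt_field U F"
proof (intro tt_field.intro tt_field_axioms.intro)
  show "\<exists>(I :: 'u set) X \<iota>. small U I \<and> (\<forall>i\<in>I. X i \<in> compact_objects U F) \<and> is_coproduct F I X Y \<iota>"
    if "Y \<in> Obj F" for Y
    using all_sum_of_compacts[OF that] unfolding sum_of_compacts_def compact_objects_def by simp
qed (fact big_tt_category_axioms, fact nonzero, fact nonzero_tensor_faithful)

end

section \<open>The case of a tt-field\<close>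

context big_tt_category
begin

lemma tensor_interchange:
  assumes f: "f \<in> Hom F A B" and g: "g \<in> Hom F C D"
  shows "(f \<otimes>\<^sub>a Id F D) \<cdot> (Id F A \<otimes>\<^sub>a g) = f \<otimes>\<^sub>a g" "(Id F B \<otimes>\<^sub>a g) \<cdot> (f \<otimes>\<^sub>a Id F C) = f \<otimes>\<^sub>a g"
proof -
  have o: "A \<in> Obj F" "B \<in> Obj F" "C \<in> Obj F" "D \<in> Obj F" using Hom_Obj f g by blast+
  show "(f \<otimes>\<^sub>a Id F D) \<cdot> (Id F A \<otimes>\<^sub>a g) = f \<otimes>\<^sub>a g"
    using Tensor_Comp[OF Id_in_Hom[OF o(1)] f g Id_in_Hom[OF o(4)]] Comp_Id[OF f] Id_Comp[OF g] by simp
  show "(Id F B \<otimes>\<^sub>a g) \<cdot> (f \<otimes>\<^sub>a Id F C) = f \<otimes>\<^sub>a g"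
    using Tensor_Comp[OF f Id_in_Hom[OF o(2)] Id_in_Hom[OF o(3)] g] Id_Comp[OF f] Comp_Id[OF g] by simp
qed

lemma tensor_Id_comp:
  assumes f: "f \<in> Hom F A B" and g: "g \<in> Hom F B D" and X: "X \<in> Obj F"
  shows "(g \<cdot> f) \<otimes>\<^sub>a Id F X = (g \<otimes>\<^sub>a Id F X) \<cdot> (f \<otimes>\<^sub>a Id F X)"
  using Tensor_Comp[OF f g Id_in_Hom[OF X] Id_in_Hom[OF X]] Comp_Id[OF Id_in_Hom[OF X]] by simp

lemma zero_tensor_Id:
  assumes "A \<in> Obj F" "B \<in> Obj F" "X \<in> Obj F"
  shows "Zero F A B \<otimes>\<^sub>a Id F X = Zero F (A \<otimes>\<^sub>o X) (B \<otimes>\<^sub>o X)"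
  using additive_functor_zero[OF additive_category_axioms additive_category_axioms, of "\<lambda>Y. Y \<otimes>\<^sub>o X"
    "\<lambda>f. f \<otimes>\<^sub>a Id F X"]
    tensor_right_exact[OF assms(3)] assms(1,2) unfolding exact_functor_def by blast

lemma Ihom_contra_functor:
  assumes X: "X \<in> Obj F"
  shows "category_functor (opposite F) F (\<lambda>A. Ihom F A X) (Ihom_contra F X)"
proof -
  have *: "Ihom_contra F X (f \<cdot> g) = Ihom_contra F X g \<cdot> Ihom_contra F X f"
    if f: "f \<in> Hom F B A" and g: "g \<in> Hom F E B" for f g A B E
  proof -
    have o: "A \<in> Obj F" "B \<in> Obj F" "E \<in> Obj F" using Hom_Obj f g by blast+
    note oV = Ihom_Obj[OF o(1) X] and oW = Ihom_Obj[OF o(2) X]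
    note Cf = Ihom_contra_Hom[OF X f] and Cg = Ihom_contra_Hom[OF X g]
    note ev = Eval_Hom[OF o(1) X] Eval_Hom[OF o(2) X] Eval_Hom[OF o(3) X]
    have fg: "f \<cdot> g \<in> Hom F E A" by (rule Comp_in_Hom[OF g f])
    let ?V = "Ihom F A X" and ?W = "Ihom F B X"
    have tH: "Ihom_contra F X f \<otimes>\<^sub>a Id F E \<in> Hom F (?V \<otimes>\<^sub>o E) (?W \<otimes>\<^sub>o E)"
      "Ihom_contra F X g \<otimes>\<^sub>a Id F E \<in> Hom F (?W \<otimes>\<^sub>o E) (Ihom F E X \<otimes>\<^sub>o E)"
      "Ihom_contra F X f \<otimes>\<^sub>a Id F B \<in> Hom F (?V \<otimes>\<^sub>o B) (?W \<otimes>\<^sub>o B)"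
      using Tensor_arr_Hom[OF Cf(1) Id_in_Hom[OF o(3)]] Tensor_arr_Hom[OF Cg(1) Id_in_Hom[OF o(3)]]
        Tensor_arr_Hom[OF Cf(1) Id_in_Hom[OF o(2)]] by blast+
    have "Eval F E X \<cdot> ((Ihom_contra F X g \<cdot> Ihom_contra F X f) \<otimes>\<^sub>a Id F E)
        = (Eval F E X \<cdot> (Ihom_contra F X g \<otimes>\<^sub>a Id F E)) \<cdot> (Ihom_contra F X f \<otimes>\<^sub>a Id F E)"
      unfolding tensor_Id_comp[OF Cf(1) Cg(1) o(3)] by (rule Comp_assoc[symmetric, OF tH(1,2) ev(3)])
    also have "\<dots> = Eval F B X \<cdot> (TL ?W g \<cdot> (Ihom_contra F X f \<otimes>\<^sub>a Id F E))"
      unfolding Cg(2) by (rule Comp_assoc[OF tH(1) TL_Hom[OF oW g] ev(2)])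
    also have "TL ?W g \<cdot> (Ihom_contra F X f \<otimes>\<^sub>a Id F E) = (Ihom_contra F X f \<otimes>\<^sub>a Id F B) \<cdot> TL ?V g"
      using tensor_interchange[OF Cf(1) g] by simp
    also have "Eval F B X \<cdot> \<dots> = (Eval F B X \<cdot> (Ihom_contra F X f \<otimes>\<^sub>a Id F B)) \<cdot> TL ?V g"
      by (rule Comp_assoc[symmetric, OF TL_Hom[OF oV g] tH(3) ev(2)])
    also have "\<dots> = Eval F A X \<cdot> (TL ?V f \<cdot> TL ?V g)"
      unfolding Cf(2) by (rule Comp_assoc[OF TL_Hom[OF oV g] TL_Hom[OF oV f] ev(1)])
    also have "\<dots> = Eval F E X \<cdot> (Ihom_contra F X (f \<cdot> g) \<otimes>\<^sub>a Id F E)"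
      unfolding TL_Comp[OF oV g f, symmetric] Ihom_contra_Hom(2)[OF X fg] ..
    finally show ?thesis
      using transpose_unique[OF Ihom_contra_Hom(1)[OF X fg] Comp_in_Hom[OF Cf(1) Cg(1)] o(3) X] by simp
  qed
  have id: "Ihom_contra F X (Id F A) = Id F (Ihom F A X)" if A: "A \<in> Obj F" for A
  proof -
    note oV = Ihom_Obj[OF A X] and C = Ihom_contra_Hom[OF X Id_in_Hom[OF A]]
    show ?thesis
      by (rule transpose_unique[OF C(1) Id_in_Hom[OF oV] A X]) (rule C(2))
  qed
  show ?thesis
    unfolding category_functor_def category_functor_axioms_def Hom_opposite
    using category_opposite[OF category_axioms] category_axioms Ihom_contra_Hom(1)[OF X]
      Ihom_Obj[OF _ X] * id
    by (simp add: opposite_def)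
qed

text \<open>Every \<open>t\<close> factors through evaluation, and the factor acts on the other
  tensor variable, hence commutes with \<open>d\<close>. So the single equation \<open>z\<close>
  covers all test objects \<open>Z\<close>.\<close>

lemma Ihom_contra_zero_universal:
  assumes X: "X \<in> Obj F" and d: "d \<in> Hom F A B"
    and z: "Eval F B X \<cdot> TL (Ihom F B X) d = Zero F (Ihom F B X \<otimes>\<^sub>o A) X"
    and Z: "Z \<in> Obj F" and t: "t \<in> Hom F (Z \<otimes>\<^sub>o B) X"
  shows "t \<cdot> TL Z d = Zero F (Z \<otimes>\<^sub>o A) X"
proof -
  have o: "A \<in> Obj F" "B \<in> Obj F" using Hom_Obj d by blast+
  note oV = Ihom_Obj[OF o(2) X]
  obtain s where s: "s \<in> Hom F Z (Ihom F B X)" "Eval F B X \<cdot> (s \<otimes>\<^sub>a Id F B) = t"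
    using Eval_universal[OF Z o(2) X t] by blast
  note ev = Eval_Hom[OF o(2) X] and sB = Tensor_arr_Hom[OF s(1) Id_in_Hom[OF o(2)]]
    and sA = Tensor_arr_Hom[OF s(1) Id_in_Hom[OF o(1)]]
  have "t \<cdot> TL Z d = Eval F B X \<cdot> ((s \<otimes>\<^sub>a Id F B) \<cdot> TL Z d)"
    unfolding s(2)[symmetric] by (rule Comp_assoc[OF TL_Hom[OF Z d] sB ev])
  also have "(s \<otimes>\<^sub>a Id F B) \<cdot> TL Z d = TL (Ihom F B X) d \<cdot> (s \<otimes>\<^sub>a Id F A)"
    using tensor_interchange[OF s(1) d] by simp
  also have "Eval F B X \<cdot> \<dots> = (Eval F B X \<cdot> TL (Ihom F B X) d) \<cdot> (s \<otimes>\<^sub>a Id F A)"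
    by (rule Comp_assoc[symmetric, OF sA TL_Hom[OF oV d] ev])
  also have "\<dots> = Zero F (Z \<otimes>\<^sub>o A) X" unfolding z using sA X by (simp add: zero_comp Hom_def)
  finally show ?thesis .
qed

text \<open>
  For rigid \<open>b\<close> the inverse of \<open>hom(b, 1) \<otimes> b \<rightarrow> hom(b, b)\<close> gives a coevaluation
  \<open>1 \<rightarrow> hom(b, 1) \<otimes> b\<close>, and \<open>d\<close> is recovered from \<open>hom(d, 1)\<close> by a triangle identity.
\<close>

lemma rigid_dual_faithful:
  assumes b: "rigid_object F b" and d: "d \<in> Hom F a b"
    and z: "Eval F b (Unit F) \<cdot> TL (Ihom F b (Unit F)) d = Zero F (Ihom F b (Unit F) \<otimes>\<^sub>o a) (Unit F)"
  shows "d = Zero F a b"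
proof -
  have o: "a \<in> Obj F" "b \<in> Obj F" using Hom_Obj d by blast+
  let ?D = "Ihom F b (Unit F)" and ?ev = "Eval F b (Unit F)"
  note oU = Unit_Obj
  note oD = Ihom_Obj[OF o(2) oU]
  note oDb = Tensor_Obj[OF oD o(2)]
  note iD = Id_in_Hom[OF oD] and ib = Id_in_Hom[OF o(2)] and ia = Id_in_Hom[OF o(1)]
  note ev = Eval_Hom[OF o(2) oU]
  note \<alpha>bb = Associator_iso[OF oD o(2) o(2)] and \<alpha>ba = Associator_iso[OF oD o(2) o(1)]
    and \<alpha>ab = Associator_iso[OF oD o(1) o(2)]
  have \<alpha>H: "Associator F ?D b b \<in> Hom F ((?D \<otimes>\<^sub>o b) \<otimes>\<^sub>o b) (?D \<otimes>\<^sub>o (b \<otimes>\<^sub>o b))"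
    "Associator F ?D b a \<in> Hom F ((?D \<otimes>\<^sub>o b) \<otimes>\<^sub>o a) (?D \<otimes>\<^sub>o (b \<otimes>\<^sub>o a))"
    "Associator F ?D a b \<in> Hom F ((?D \<otimes>\<^sub>o a) \<otimes>\<^sub>o b) (?D \<otimes>\<^sub>o (a \<otimes>\<^sub>o b))"
    using \<alpha>bb \<alpha>ba \<alpha>ab unfolding isomorphism_def by blast+
  let ?i = "inverse_arr F (Associator F ?D b b)" and ?j = "inverse_arr F (Associator F ?D a b)"
  note i = inverse_arr[OF \<alpha>bb] and j = inverse_arr[OF \<alpha>ab]
  note s = Symmetry_Hom[OF o(2) o(2)] and s' = Symmetry_Hom[OF o(2) o(1)]
  note evb = Tensor_arr_Hom[OF ev ib]
  obtain lb where lb: "Left_unitor F b \<in> Hom F (Unit F \<otimes>\<^sub>o b) b" using Left_unitor_iso[OF o(2)]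
      by (rule isomorphismE)
  obtain la where la: "Left_unitor F a \<in> Hom F (Unit F \<otimes>\<^sub>o a) a" "la \<in> Hom F a (Unit F \<otimes>\<^sub>o a)"
    "Left_unitor F a \<cdot> la = Id F a" using Left_unitor_iso[OF o(1)] by (rule isomorphismE)
  \<comment> \<open>The arrow whose transpose is the canonical one. The symmetry exchanges the two
    copies of b, so that the last one is paired with the dual.\<close>
  define m where "m = Left_unitor F b \<cdot> (?ev \<otimes>\<^sub>a Id F b) \<cdot> ?i \<cdot> TL ?D (Symmetry F b b) \<cdot> Associator
    F ?D b b"
  have m: "m \<in> Hom F ((?D \<otimes>\<^sub>o b) \<otimes>\<^sub>o b) b"
    unfolding m_def by (rule Comp_in_Hom[OF \<alpha>H(1) Comp_in_Hom[OF TL_Hom[OF oD s] Comp_in_Hom[OF i(1)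
      Comp_in_Hom[OF evb lb]]]])
  define \<theta> where "\<theta> = dual_tensor_to_Ihom F b b"
  have "\<theta> = transpose_arr F (?D \<otimes>\<^sub>o b) b b m" unfolding \<theta>_def dual_tensor_to_Ihom_def Let_def m_def ..
  then have \<theta>: "\<theta> \<in> Hom F (?D \<otimes>\<^sub>o b) (Ihom F b b)" "Eval F b b \<cdot> (\<theta> \<otimes>\<^sub>a Id F b) = m"
    using transpose_ex1[OF oDb o(2) o(2) m] by blast+
  obtain \<theta>' where \<theta>': "\<theta>' \<in> Hom F (Ihom F b b) (?D \<otimes>\<^sub>o b)" "\<theta> \<cdot> \<theta>' = Id F (Ihom F b b)"
    using b o(2) unfolding rigid_object_def isomorphism_def \<theta>_def by blast
  obtain k where k: "k \<in> Hom F (Unit F) (Ihom F b b)" "Eval F b b \<cdot> (k \<otimes>\<^sub>a Id F b) = Left_unitor F b"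
    using Eval_universal[OF oU o(2) o(2) lb] by blast
  \<comment> \<open>The coevaluation: the adjoint of the identity of b, pulled back along the
    invertible canonical arrow. Then \<open>m \<cdot> (\<eta> \<otimes> b)\<close> is the left
    unitor, which is the triangle identity.\<close>
  define \<eta> where "\<eta> = \<theta>' \<cdot> k"
  have \<eta>: "\<eta> \<in> Hom F (Unit F) (?D \<otimes>\<^sub>o b)" unfolding \<eta>_def by (rule Comp_in_Hom[OF k(1) \<theta>'(1)])
  have \<theta>\<eta>: "\<theta> \<cdot> \<eta> = k" unfolding \<eta>_def using Comp_assoc[OF k(1) \<theta>'(1) \<theta>(1)] \<theta>'(2) Id_Comp[OF k(1)] by simp
  have m\<eta>: "m \<cdot> (\<eta> \<otimes>\<^sub>a Id F b) = Left_unitor F b"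
    unfolding \<theta>(2)[symmetric] k(2)[symmetric]
    using Comp_assoc[OF Tensor_arr_Hom[OF \<eta> ib] Tensor_arr_Hom[OF \<theta>(1) ib] Eval_Hom[OF o(2) o(2)]]
      tensor_Id_comp[OF \<eta> \<theta>(1) o(2)] \<theta>\<eta> by simp
  \<comment> \<open>The equations \<open>n1\<close> to \<open>n3\<close> move \<open>d\<close>
    leftwards through the factors of \<open>m\<close> by naturality, until it stands next to the
    evaluation, where \<open>n4\<close> annihilates it.\<close>
  have n1: "Associator F ?D b b \<cdot> TL (?D \<otimes>\<^sub>o b) d = TL ?D (TL b d) \<cdot> Associator F ?D b a"
    using Associator_natural[OF iD ib d] Tensor_Id[OF oD o(2)] by simp
  have n2: "TL ?D (Symmetry F b b) \<cdot> TL ?D (TL b d) = TL ?D (d \<otimes>\<^sub>a Id F b) \<cdot> TL ?D (Symmetry F b a)"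
    using TL_Comp[OF oD TL_Hom[OF o(2) d] s] TL_Comp[OF oD s' Tensor_arr_Hom[OF d ib]]
      Symmetry_natural[OF ib d] by simp
  have n3: "?i \<cdot> TL ?D (d \<otimes>\<^sub>a Id F b) = (TL ?D d \<otimes>\<^sub>a Id F b) \<cdot> ?j"
  proof -
    have dd: "TL ?D (d \<otimes>\<^sub>a Id F b) \<in> Hom F (?D \<otimes>\<^sub>o (a \<otimes>\<^sub>o b)) (?D \<otimes>\<^sub>o (b \<otimes>\<^sub>o b))"
      by (rule TL_Hom[OF oD Tensor_arr_Hom[OF d ib]])
    have d2: "TL ?D d \<otimes>\<^sub>a Id F b \<in> Hom F ((?D \<otimes>\<^sub>o a) \<otimes>\<^sub>o b) ((?D \<otimes>\<^sub>o b) \<otimes>\<^sub>o b)"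
      by (rule Tensor_arr_Hom[OF TL_Hom[OF oD d] ib])
    have "?i \<cdot> TL ?D (d \<otimes>\<^sub>a Id F b) = ?i \<cdot> (TL ?D (d \<otimes>\<^sub>a Id F b) \<cdot> (Associator F ?D a b \<cdot> ?j))"
      unfolding j(3) using dd by (simp add: cat)
    also have "\<dots> = ?i \<cdot> ((TL ?D (d \<otimes>\<^sub>a Id F b) \<cdot> Associator F ?D a b) \<cdot> ?j)"
      using Comp_assoc[OF j(1) \<alpha>H(3) dd] by simp
    also have "TL ?D (d \<otimes>\<^sub>a Id F b) \<cdot> Associator F ?D a b = Associator F ?D b b \<cdot> (TL ?D d \<otimes>\<^sub>a Id F b)"
      using Associator_natural[OF iD d ib] by simp
    also have "?i \<cdot> ((Associator F ?D b b \<cdot> (TL ?D d \<otimes>\<^sub>a Id F b)) \<cdot> ?j)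
        = (?i \<cdot> Associator F ?D b b) \<cdot> ((TL ?D d \<otimes>\<^sub>a Id F b) \<cdot> ?j)"
      using i(1) \<alpha>H(1) d2 j(1) by (simp add: cat)
    also have "\<dots> = (TL ?D d \<otimes>\<^sub>a Id F b) \<cdot> ?j" unfolding i(2) by (rule Id_Comp[OF Comp_in_Hom[OF j(1) d2]])
    finally show ?thesis .
  qed
  have n4: "(?ev \<otimes>\<^sub>a Id F b) \<cdot> (TL ?D d \<otimes>\<^sub>a Id F b) = Zero F ((?D \<otimes>\<^sub>o a) \<otimes>\<^sub>o b) (Unit F \<otimes>\<^sub>o b)"
    using tensor_Id_comp[OF TL_Hom[OF oD d] ev o(2)] z zero_tensor_Id[OF Tensor_Obj[OF oD o(1)] oU
      o(2)] by simp
  have d2: "TL ?D d \<otimes>\<^sub>a Id F b \<in> Hom F ((?D \<otimes>\<^sub>o a) \<otimes>\<^sub>o b) ((?D \<otimes>\<^sub>o b) \<otimes>\<^sub>o b)"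
    by (rule Tensor_arr_Hom[OF TL_Hom[OF oD d] ib])
  let ?r = "TL ?D (Symmetry F b a) \<cdot> Associator F ?D b a"
  have r: "?r \<in> Hom F ((?D \<otimes>\<^sub>o b) \<otimes>\<^sub>o a) (?D \<otimes>\<^sub>o (a \<otimes>\<^sub>o b))"
      by (rule Comp_in_Hom[OF \<alpha>H(2) TL_Hom[OF oD s']])
  have md: "m \<cdot> TL (?D \<otimes>\<^sub>o b) d = Zero F ((?D \<otimes>\<^sub>o b) \<otimes>\<^sub>o a) b"
  proof -
    note Hs = lb evb i(1) TL_Hom[OF oD s] \<alpha>H TL_Hom[OF oDb d] TL_Hom[OF oD TL_Hom[OF o(2) d]]
      TL_Hom[OF oD Tensor_arr_Hom[OF d ib]] TL_Hom[OF oD s'] d2 j(1)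
    let ?L = "Left_unitor F b \<cdot> (?ev \<otimes>\<^sub>a Id F b)"
    have "m \<cdot> TL (?D \<otimes>\<^sub>o b) d = ?L \<cdot> (?i \<cdot> (TL ?D (Symmetry F b b) \<cdot> (Associator F ?D b b \<cdot> TL (?D
        \<otimes>\<^sub>o b) d)))"
      unfolding m_def using Hs by (simp add: cat)
    also have "\<dots> = ?L \<cdot> (?i \<cdot> ((TL ?D (Symmetry F b b) \<cdot> TL ?D (TL b d)) \<cdot> Associator F ?D b a))"
      unfolding n1 using Hs by (simp add: cat)
    also have "\<dots> = ?L \<cdot> ((?i \<cdot> TL ?D (d \<otimes>\<^sub>a Id F b)) \<cdot> ?r)" unfolding n2 using Hs by (simp add: cat)
    also have "\<dots> = Left_unitor F b \<cdot> (((?ev \<otimes>\<^sub>a Id F b) \<cdot> (TL ?D d \<otimes>\<^sub>a Id F b)) \<cdot> (?j \<cdot> ?r))"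
      unfolding n3 using Hs by (simp add: cat)
    also have "\<dots> = Zero F ((?D \<otimes>\<^sub>o b) \<otimes>\<^sub>o a) b"
      unfolding n4 using lb Comp_in_Hom[OF r j(1)] Tensor_Obj[OF oU o(2)] Tensor_Obj[OF oDb o(1)]
      by (simp add: zero_comp comp_zero Hom_def)
    finally show ?thesis .
  qed
  have "d \<cdot> Left_unitor F a = Left_unitor F b \<cdot> TL (Unit F) d" using Left_unitor_natural[OF d] by simp
  also have "\<dots> = m \<cdot> ((\<eta> \<otimes>\<^sub>a Id F b) \<cdot> TL (Unit F) d)"
    unfolding m\<eta>[symmetric] by (rule Comp_assoc[OF TL_Hom[OF oU d] Tensor_arr_Hom[OF \<eta> ib] m])
  also have "(\<eta> \<otimes>\<^sub>a Id F b) \<cdot> TL (Unit F) d = TL (?D \<otimes>\<^sub>o b) d \<cdot> (\<eta> \<otimes>\<^sub>a Id F a)"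
    using tensor_interchange[OF \<eta> d] by simp
  also have "m \<cdot> \<dots> = (m \<cdot> TL (?D \<otimes>\<^sub>o b) d) \<cdot> (\<eta> \<otimes>\<^sub>a Id F a)"
    by (rule Comp_assoc[symmetric, OF Tensor_arr_Hom[OF \<eta> ia] TL_Hom[OF oDb d] m])
  also have "\<dots> = Zero F (Unit F \<otimes>\<^sub>o a) b" unfolding md using Tensor_arr_Hom[OF \<eta> ia] o
      by (simp add: zero_comp Hom_def)
  finally have "(d \<cdot> Left_unitor F a) \<cdot> la = Zero F a b" using la(2) o by (simp add: zero_comp Hom_def)
  then show ?thesis using d la by (simp add: cat)
qed

end

context tt_field
begin

notation add (infixl "\<boxplus>" 60)
notation sub (infixl "\<boxminus>" 60)

lemma Ihom_contra_faithful:
  assumes X: "X \<in> Obj F" and nz: "\<not> zero_object F X"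
  shows "faithful (opposite F) F (\<lambda>A. Ihom F A X) (Ihom_contra F X)"
proof -
  have "f = f'" if f: "f \<in> Hom F A B" "f' \<in> Hom F A B" and eq: "Ihom_contra F X f =
      Ihom_contra F X f'" for f f' A B
  proof -
    have o: "A \<in> Obj F" "B \<in> Obj F" using Hom_Obj f by blast+
    note oV = Ihom_Obj[OF o(2) X] and oU = Unit_Obj
    note oBD = Ihom_Obj[OF o(2) oU]
    let ?BD = "Ihom F B (Unit F)" and ?V = "Ihom F B X"
    define d where "d = f \<boxminus> f'"
    have d: "d \<in> Hom F A B" unfolding d_def by (rule sub_Hom[OF f])
    have "Eval F B X \<cdot> TL ?V f = Eval F B X \<cdot> TL ?V f'"
      using Ihom_contra_Hom(2)[OF X f(1)] Ihom_contra_Hom(2)[OF X f(2)] eq by simp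
    moreover have "Eval F B X \<cdot> TL ?V d = Eval F B X \<cdot> TL ?V f \<boxminus> Eval F B X \<cdot> TL ?V f'"
      unfolding d_def TL_sub[OF oV f] using Eval_Hom[OF o(2) X] TL_Hom[OF oV f(1)] TL_Hom[OF oV f(2)]
      by (simp add: comp_sub Hom_def)
    ultimately have zX: "Eval F B X \<cdot> TL ?V d = Zero F (?V \<otimes>\<^sub>o A) X"
      using sub_eq_zero_iff[OF Ihom_contra_arg[OF X f(1)] Ihom_contra_arg[OF X f(2)]] by simp
    note evB = Eval_Hom[OF o(2) oU] and oXBD = Tensor_Obj[OF X oBD]
    obtain rx where rx: "Right_unitor F X \<in> Hom F (X \<otimes>\<^sub>o Unit F) X" "rx \<in> Hom F X (X \<otimes>\<^sub>o Unit F)"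
      "rx \<cdot> Right_unitor F X = Id F (X \<otimes>\<^sub>o Unit F)" using Right_unitor_iso[OF X] by (rule isomorphismE)
    obtain ia where ia: "Associator F X ?BD A \<in> Hom F ((X \<otimes>\<^sub>o ?BD) \<otimes>\<^sub>o A) (X \<otimes>\<^sub>o (?BD \<otimes>\<^sub>o A))"
      "ia \<in> Hom F (X \<otimes>\<^sub>o (?BD \<otimes>\<^sub>o A)) ((X \<otimes>\<^sub>o ?BD) \<otimes>\<^sub>o A)" "Associator F X ?BD A \<cdot> ia =
        Id F (X \<otimes>\<^sub>o (?BD \<otimes>\<^sub>o A))"
      using Associator_iso[OF X oBD o(1)] by (rule isomorphismE)
    have ib: "Associator F X ?BD B \<in> Hom F ((X \<otimes>\<^sub>o ?BD) \<otimes>\<^sub>o B) (X \<otimes>\<^sub>o (?BD \<otimes>\<^sub>o B))"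
      using Associator_iso[OF X oBD o(2)] by (rule isomorphismE)
    \<comment> \<open>The associator and the right unitor are invertible, so the vanishing of
      \<open>?t\<close> after tensoring with \<open>d\<close> amounts to that of
      \<open>TL X e\<close>, with e the adjoint of \<open>hom(d, 1)\<close>.\<close>
    let ?t = "Right_unitor F X \<cdot> (TL X (Eval F B (Unit F)) \<cdot> Associator F X ?BD B)"
    have TE: "TL X (Eval F B (Unit F)) \<in> Hom F (X \<otimes>\<^sub>o (?BD \<otimes>\<^sub>o B)) (X \<otimes>\<^sub>o Unit F)"
        by (rule TL_Hom[OF X evB])
    have t: "?t \<in> Hom F ((X \<otimes>\<^sub>o ?BD) \<otimes>\<^sub>o B) X" by (rule Comp_in_Hom[OF Comp_in_Hom[OF ib TE] rx(1)])
    define e where "e = Eval F B (Unit F) \<cdot> TL ?BD d"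
    have e: "e \<in> Hom F (?BD \<otimes>\<^sub>o A) (Unit F)" unfolding e_def by (rule Ihom_contra_arg[OF oU d])
    have TXd: "TL X (TL ?BD d) \<in> Hom F (X \<otimes>\<^sub>o (?BD \<otimes>\<^sub>o A)) (X \<otimes>\<^sub>o (?BD \<otimes>\<^sub>o B))"
        by (rule TL_Hom[OF X TL_Hom[OF oBD d]])
    have TXe: "TL X e \<in> Hom F (X \<otimes>\<^sub>o (?BD \<otimes>\<^sub>o A)) (X \<otimes>\<^sub>o Unit F)" by (rule TL_Hom[OF X e])
    have nat: "Associator F X ?BD B \<cdot> TL (X \<otimes>\<^sub>o ?BD) d = TL X (TL ?BD d) \<cdot> Associator F X ?BD A"
      using Associator_natural[OF Id_in_Hom[OF X] Id_in_Hom[OF oBD] d] Tensor_Id[OF X oBD] by simp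
    have "Zero F ((X \<otimes>\<^sub>o ?BD) \<otimes>\<^sub>o A) X = ?t \<cdot> TL (X \<otimes>\<^sub>o ?BD) d"
      using Ihom_contra_zero_universal[OF X d zX oXBD t] by simp
    also have "\<dots> = Right_unitor F X \<cdot> (TL X (Eval F B (Unit F)) \<cdot> (Associator F X ?BD B \<cdot> TL (X \<otimes>\<^sub>o
        ?BD) d))"
      using rx(1) TE ib TL_Hom[OF oXBD d] by (simp add: cat)
    also have "\<dots> = Right_unitor F X \<cdot> (TL X e \<cdot> Associator F X ?BD A)"
      unfolding nat e_def TL_Comp[OF X TL_Hom[OF oBD d] evB] using rx(1) TE TXd ia(1) by (simp add: cat)
    finally have "rx \<cdot> ((Right_unitor F X \<cdot> (TL X e \<cdot> Associator F X ?BD A)) \<cdot> ia) =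
        rx \<cdot> (Zero F ((X \<otimes>\<^sub>o ?BD) \<otimes>\<^sub>o A) X \<cdot> ia)"
      by simp
    moreover have "rx \<cdot> ((Right_unitor F X \<cdot> (TL X e \<cdot> Associator F X ?BD A)) \<cdot> ia)
        = (rx \<cdot> Right_unitor F X) \<cdot> (TL X e \<cdot> (Associator F X ?BD A \<cdot> ia))"
      using rx(1,2) TXe ia(1,2) by (simp add: cat)
    moreover have "\<dots> = TL X e" unfolding rx(3) ia(3) using TXe by (simp add: cat)
    moreover have "rx \<cdot> (Zero F ((X \<otimes>\<^sub>o ?BD) \<otimes>\<^sub>o A) X \<cdot> ia) = Zero F (X \<otimes>\<^sub>o (?BD \<otimes>\<^sub>o A)) (X \<otimes>\<^sub>o Unit F)"
      using rx(2) ia(2) X Hom_Obj(1)[OF ia(2)] by (simp add: zero_comp comp_zero Hom_def)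
    ultimately have "TL X e = TL X (Zero F (?BD \<otimes>\<^sub>o A) (Unit F))"
      using TL_zero[OF X Tensor_Obj[OF oBD o(1)] oU] by simp
    moreover have "inj_on (TL X) (Hom F (?BD \<otimes>\<^sub>o A) (Unit F))"
      using nonzero_tensor_faithful[OF X nz] Tensor_Obj[OF oBD o(1)] oU
        unfolding tensor_faithful_def faithful_def by blast
    ultimately have zU: "Eval F B (Unit F) \<cdot> TL ?BD d = Zero F (?BD \<otimes>\<^sub>o A) (Unit F)"
      using e zero_Hom[OF Tensor_Obj[OF oBD o(1)] oU] unfolding inj_on_def e_def[symmetric] by blast
    \<comment> \<open>\<open>hom(p \<cdot> d, 1)\<close> vanishes together with
      \<open>hom(d, 1)\<close>, and b is rigid, so \<open>rigid_dual_faithful\<close>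
      applies.\<close>
    have pd: "p \<cdot> d = Zero F A b" if b: "compact b" and p: "p \<in> Hom F B b" for b p
    proof (rule rigid_dual_faithful)
      have ob: "b \<in> Obj F" using compact_Obj[OF b] .
      note obD = Ihom_Obj[OF ob oU] and evb = Eval_Hom[OF ob oU]
      let ?bD = "Ihom F b (Unit F)"
      show "rigid_object F b" using compact_iff_rigid[OF ob] b by simp
      show "p \<cdot> d \<in> Hom F A b" by (rule Comp_in_Hom[OF d p])
      have "Eval F b (Unit F) \<cdot> TL ?bD (p \<cdot> d) = (Eval F b (Unit F) \<cdot> TL ?bD p) \<cdot> TL ?bD d"
        unfolding TL_Comp[OF obD d p]
          by (rule Comp_assoc[symmetric, OF TL_Hom[OF obD d] TL_Hom[OF obD p] evb])
      also have "\<dots> = Zero F (?bD \<otimes>\<^sub>o A) (Unit F)"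
        by (rule Ihom_contra_zero_universal[OF oU d zU obD Comp_in_Hom[OF TL_Hom[OF obD p] evb]])
      finally show "Eval F b (Unit F) \<cdot> TL ?bD (p \<cdot> d) = Zero F (?bD \<otimes>\<^sub>o A) (Unit F)" .
    qed
    obtain I :: "'u set" and W \<iota> where I: "small U I" "\<forall>i\<in>I. compact (W i)" "is_coproduct F I W A \<iota>"
      using coproduct_of_compacts[OF o(1)] unfolding compact_objects_def by blast
    obtain K :: "'u set" and V \<kappa> where K: "small U K" "\<forall>i\<in>K. compact (V i)" "is_coproduct F K V B \<kappa>"
      using coproduct_of_compacts[OF o(2)] unfolding compact_objects_def by blast
    \<comment> \<open>Projections of \<open>B\<close> to its summands need not be jointly faithful
      on arbitrary sources. Restricting to a compact summand of \<open>A\<close> gives finite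
      support in \<open>B\<close>, and on such arrows they are.\<close>
    have "d = Zero F A B"
    proof (rule coproduct_ext[OF I(3) d zero_Hom[OF o]])
      fix i assume i: "i \<in> I"
      note ii = coproduct_incl[OF I(3) i] and oW = coproduct_summand[OF I(3) i]
      have di: "d \<cdot> \<iota> i \<in> Hom F (W i) B" by (rule Comp_in_Hom[OF ii d])
      have cW: "compact (W i)" using I(2) i by blast
      obtain J where J: "finite J" "J \<subseteq> K" "supported J \<kappa> (d \<cdot> \<iota> i)"
          using compact_supported[OF cW K(1,3) di] .
      have "d \<cdot> \<iota> i = Zero F (W i) B"
      proof (rule supported_zero[OF K(3) J(3,2,1) di])
        fix j assume j: "j \<in> J"
        then have jK: "j \<in> K" using J(2) by blast
        obtain p where p: "p \<in> Hom F B (V j)" "p \<cdot> \<kappa> j = Id F (V j)"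
          "\<And>i. i \<in> K \<Longrightarrow> i \<noteq> j \<Longrightarrow> p \<cdot> \<kappa> i = Zero F (V i) (V j)" using coproduct_proj[OF K(3) jK] by blast
        have "p \<cdot> (d \<cdot> \<iota> i) = (p \<cdot> d) \<cdot> \<iota> i" by (rule Comp_assoc[symmetric, OF ii d p(1)])
        also have "\<dots> = Zero F (W i) (V j)"
          using pd[of "V j" p] K(2) jK p(1) ii coproduct_summand[OF K(3) jK]
            by (simp add: zero_comp Hom_def)
        finally show "\<exists>p\<in>Hom F B (V j). p \<cdot> \<kappa> j = Id F (V j) \<and>
            (\<forall>i\<in>K. i \<noteq> j \<longrightarrow> p \<cdot> \<kappa> i = Zero F (V i) (V j)) \<and> p \<cdot> (d \<cdot> \<iota> i) = Zero F (W i) (V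
              j)" using p by blast
      qed
      then show "d \<cdot> \<iota> i = Zero F A B \<cdot> \<iota> i" using ii o by (simp add: zero_comp Hom_def)
    qed
    then show "f = f'" using sub_eq_zero_iff[OF f] unfolding d_def by blast
  qed
  then show ?thesis
    unfolding faithful_def Hom_opposite inj_on_def using Ihom_contra_functor[OF X] by blast
qed

end

theorem theorem5p21:
  fixes U :: "'u set" and F :: "('o, 'm) tt_data"
  assumes "big_tt_category U F"
  shows "tt_field U F \<longleftrightarrow>
           nonzero_category F \<and>
           (\<forall>X\<in>Obj F. \<not> zero_object F X \<longrightarrow>
              faithful (opposite F) F (\<lambda>A. Ihom F A X) (Ihom_contra F X))"
proof
  assume "tt_field U F"
  then interpret tt_field U F .
  show "nonzero_category F \<and> (\<forall>X\<in>Obj F. \<not> zero_object F X \<longrightarrow>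
      faithful (opposite F) F (\<lambda>A. Ihom F A X) (Ihom_contra F X))"
    using nonzero Ihom_contra_faithful by blast
next
  assume "nonzero_category F \<and> (\<forall>X\<in>Obj F. \<not> zero_object F X \<longrightarrow>
      faithful (opposite F) F (\<lambda>A. Ihom F A X) (Ihom_contra F X))"
  then have "hom_faithful_category U F"
    using assms unfolding hom_faithful_category_def hom_faithful_category_axioms_def by blast
  then show "tt_field U F" by (rule hom_faithful_category.tt_field)
qed

end
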